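(* Let $(M,J)$ be an almost complex manifold of real dimension four and let $D=\{\rho<0\}$ be a domain in $M$ of finite D'Angelo type, where $\rho$ is a $\mathcal{C}^2$ defining function of $D$, $J$-plurisubharmonic on a neighborhood of $\overline{D}$. Let $q\in\partial D$ be a boundary point of D'Angelo type $2m$ and let $\Lambda\subset D$ be a cone (near $q$) with vertex at $q$ and axis the inward normal axis. Then there exists a constant $C>0$ such that for every $p\in D\cap\Lambda$ and every $v=v_n+v_t\in T_pM$, $$K_{(D,J)}(p,v)\ \ge\ C\left(\frac{|v_t|}{|\rho(p)|^{1/(2m)}}+\frac{|v_n|}{|\rho(p)|}\right),$$ where $v_n$ and $v_t$ are the normal and the tangential parts of $v$ with respect to $q$.
   Context: An almost complex manifold $(M,J)$ is a smooth real manifold with a smooth $(1,1)$-tensor $J$, $J^2=-\mathrm{Id}$. $\Delta\subset\mathbb{C}$ is the unit disc, $J_{st}$ the standard structure. A $J$-holomorphic disc is a map $u:\Delta\to M$ with $J(u)\circ du=du\circ J_{st}$. With $d^c_J\rho(v)=-d\rho(Jv)$, the Levi form is $\mathcal{L}_J\rho(p,v)=d(d^c_J\rho)(p)(v,J(p)v)$, and $\rho$ is $J$-plurisubharmonic if $\mathcal{L}_J\rho\ge0$. A defining function satisfies $d\rho\neq0$ on $\partial D$. D'Angelo type at $p\in\partial D$: $\Delta^1(\partial D,p)=\sup_u\delta_p(\partial D,u)/\delta(u)$ over (nonconstant) $J$-holomorphic discs $u$ with $u(0)=p$, where $\delta_p(\partial D,u)$ is the degree of the first term of the Taylor expansion of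 $\rho\circ u$ at $0$ and $\delta(u)$ is the multiplicity of $u$ at $0$. Finite D'Angelo type means finite type at every boundary point. Kobayashi pseudometric: $K_{(D,J)}(p,v)=\inf\{1/r>0:\ \exists\, u:\Delta\to D\ J\text{-holomorphic},\ u(0)=p,\ d_0u(\partial/\partial x)=rv\}$. Cone, normal and tangential parts: take local coordinates $z=(z_1,z_2)\in\mathbb{C}^2=\mathbb{R}^4$ centered at $q$ with $J(0)=J_{st}$, with complex tangent space $T_0\partial D\cap J(0)T_0\partial D=\{z_2=0\}$ and $\rho=\mathrm{Re}\,z_2+O(\|z\|^2)$. In these coordinates the cone is $\Lambda=\{-\mathrm{Re}\,z_2>k\|z\|\}$ for some $0<k<1$, intersected with a sufficiently small neighborhood of $q$; for $v=(v_1,v_2)\in\mathbb{C}^2\cong T_pM$, the tangential part is $v_t=(v_1,0)$ and the normal part is $v_n=(0,v_2)$. *)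

theory Defs
  imports "HOL-Analysis.Analysis" "HOL-Library.Landau_Symbols"
begin

text \<open>
  The predicate below is meant for open \<open>S\<close> and a finite-dimensional domain, where \<open>f\<close> is of class
  \<open>C^(k+1)\<close> iff it is differentiable with all its directional derivatives of class \<open>C^k\<close>.
\<close>

primrec Ck_on :: "nat \<Rightarrow> ('a::euclidean_space \<Rightarrow> 'b::real_normed_vector) \<Rightarrow> 'a set \<Rightarrow> bool" where
  "Ck_on 0 = (\<lambda>f S. continuous_on S f)"
| "Ck_on (Suc k) = (\<lambda>f S. (\<forall>x\<in>S. f differentiable (at x)) \<and>
      (\<forall>v. Ck_on k (\<lambda>x. frechet_derivative f (at x) v) S))"

definition smooth_on :: "('a::euclidean_space \<Rightarrow> 'b::real_normed_vector) \<Rightarrow> 'a set \<Rightarrow> bool" where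
  "smooth_on f S \<longleftrightarrow> (\<forall>k. Ck_on k f S)"


section \<open>Four-dimensional almost complex manifolds\<close>

text \<open>
  The manifold is the whole type \<open>'a\<close>, required to be Hausdorff and second countable by its
  sort. A chart is a pair of its domain and its coordinate map, whose values outside of the
  domain are irrelevant. The model space \<open>complex \<times> complex\<close> is used as a real vector space.
\<close>

type_synonym 'a chart = "'a set \<times> ('a \<Rightarrow> complex \<times> complex)"

abbreviation chart_dom :: "'a chart \<Rightarrow> 'a set" where
  "chart_dom \<equiv> fst"

abbreviation coord :: "'a chart \<Rightarrow> 'a \<Rightarrow> complex \<times> complex" where
  "coord \<equiv> snd"

definition coord_inv :: "'a chart \<Rightarrow> complex \<times> complex \<Rightarrow> 'a" where
  "coord_inv c = inv_into (chart_dom c) (coord c)"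

definition is_chart :: "('a::topological_space) chart \<Rightarrow> bool" where
  "is_chart c \<longleftrightarrow> open (chart_dom c) \<and> open (coord c ` chart_dom c) \<and>
     homeomorphism (chart_dom c) (coord c ` chart_dom c) (coord c) (coord_inv c)"

definition transition :: "'a chart \<Rightarrow> 'a chart \<Rightarrow> complex \<times> complex \<Rightarrow> complex \<times> complex" where
  "transition c d = coord d \<circ> coord_inv c"

definition compatible :: "'a chart \<Rightarrow> 'a chart \<Rightarrow> bool" where
  "compatible c d \<longleftrightarrow>
     smooth_on (transition c d) (coord c ` (chart_dom c \<inter> chart_dom d)) \<and>
     smooth_on (transition d c) (coord d ` (chart_dom c \<inter> chart_dom d))"

definition smooth_structure :: "('a::{t2_space, second_countable_topology}) chart set \<Rightarrow> bool" where
  "smooth_structure A \<longleftrightarrow>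
     (\<forall>c\<in>A. is_chart c) \<and> (\<Union>c\<in>A. chart_dom c) = UNIV \<and>
     (\<forall>c\<in>A. \<forall>d\<in>A. compatible c d) \<and>
     (\<forall>c. is_chart c \<and> (\<forall>d\<in>A. compatible c d) \<longrightarrow> c \<in> A)"

text \<open>
  A (1,1)-tensor field is given by its components in all charts: \<open>J c x\<close> is the endomorphism of
  the tangent space at \<open>coord_inv c x\<close>, written in the chart \<open>c\<close>. The last condition below is
  the transformation law under changes of coordinates.
\<close>

type_synonym 'a tensor11 = "'a chart \<Rightarrow> complex \<times> complex \<Rightarrow> complex \<times> complex \<Rightarrow> complex \<times> complex"

definition smooth_tensor11 :: "'a chart set \<Rightarrow> 'a tensor11 \<Rightarrow> bool" where
  "smooth_tensor11 A J \<longleftrightarrow>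
     (\<forall>c\<in>A. \<forall>x \<in> coord c ` chart_dom c. linear (J c x)) \<and>
     (\<forall>c\<in>A. \<forall>v. smooth_on (\<lambda>x. J c x v) (coord c ` chart_dom c)) \<and>
     (\<forall>c\<in>A. \<forall>d\<in>A. \<forall>p \<in> chart_dom c \<inter> chart_dom d. \<forall>v.
        frechet_derivative (transition c d) (at (coord c p)) (J c (coord c p) v) =
        J d (coord d p) (frechet_derivative (transition c d) (at (coord c p)) v))"

definition almost_complex_manifold ::
    "('a::{t2_space, second_countable_topology}) chart set \<Rightarrow> 'a tensor11 \<Rightarrow> bool" where
  "almost_complex_manifold A J \<longleftrightarrow> smooth_structure A \<and> smooth_tensor11 A J \<and>
     (\<forall>c\<in>A. \<forall>x \<in> coord c ` chart_dom c. \<forall>v. J c x (J c x v) = - v)"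

definition J_st :: "complex \<times> complex \<Rightarrow> complex \<times> complex" where
  "J_st z = (\<i> * fst z, \<i> * snd z)"


section \<open>Functions on the manifold\<close>

definition in_chart :: "('a \<Rightarrow> real) \<Rightarrow> 'a chart \<Rightarrow> complex \<times> complex \<Rightarrow> real" where
  "in_chart \<rho> c = \<rho> \<circ> coord_inv c"

text \<open>\<open>\<rho>\<close> only matters on the neighborhood \<open>W\<close> of the closure of \<open>D\<close>.\<close>

definition C2_defining_function ::
    "('a::topological_space) chart set \<Rightarrow> 'a set \<Rightarrow> ('a \<Rightarrow> real) \<Rightarrow> 'a set \<Rightarrow> bool" where
  "C2_defining_function A W \<rho> D \<longleftrightarrow>
     D = {p \<in> W. \<rho> p < 0} \<and>
     (\<forall>c\<in>A. Ck_on 2 (in_chart \<rho> c) (coord c ` (chart_dom c \<inter> W))) \<and>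
     (\<forall>c\<in>A. \<forall>p \<in> frontier D \<inter> chart_dom c.
        frechet_derivative (in_chart \<rho> c) (at (coord c p)) \<noteq> (\<lambda>v. 0))"

text \<open>The one-form \<open>d\<^sup>c\<^sub>J \<rho>\<close> in the chart \<open>c\<close>.\<close>

definition dc :: "'a tensor11 \<Rightarrow> ('a \<Rightarrow> real) \<Rightarrow> 'a chart \<Rightarrow>
    complex \<times> complex \<Rightarrow> complex \<times> complex \<Rightarrow> real" where
  "dc J \<rho> c x v = - frechet_derivative (in_chart \<rho> c) (at x) (J c x v)"

text \<open>
  Exterior derivative of a one-form on the model space, evaluated on constant vector fields (for
  which the bracket term vanishes).
\<close>

definition ext_deriv :: "(complex \<times> complex \<Rightarrow> complex \<times> complex \<Rightarrow> real) \<Rightarrow>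
    complex \<times> complex \<Rightarrow> complex \<times> complex \<Rightarrow> complex \<times> complex \<Rightarrow> real" where
  "ext_deriv \<alpha> x v w =
     frechet_derivative (\<lambda>y. \<alpha> y w) (at x) v - frechet_derivative (\<lambda>y. \<alpha> y v) (at x) w"

definition levi_form :: "'a tensor11 \<Rightarrow> ('a \<Rightarrow> real) \<Rightarrow> 'a chart \<Rightarrow>
    complex \<times> complex \<Rightarrow> complex \<times> complex \<Rightarrow> real" where
  "levi_form J \<rho> c x v = ext_deriv (dc J \<rho> c) x v (J c x v)"

definition J_plurisubharmonic_on ::
    "'a chart set \<Rightarrow> 'a tensor11 \<Rightarrow> ('a \<Rightarrow> real) \<Rightarrow> 'a set \<Rightarrow> bool" where
  "J_plurisubharmonic_on A J \<rho> W \<longleftrightarrow>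
     (\<forall>c\<in>A. \<forall>p \<in> chart_dom c \<inter> W. \<forall>v. levi_form J \<rho> c (coord c p) v \<ge> 0)"


section \<open>Pseudoholomorphic discs\<close>

text \<open>
  Discs are taken to be smooth; as \<open>J\<close> is smooth, discs of class \<open>C^1\<close> are smooth by elliptic
  regularity.
\<close>

definition J_holomorphic_disc ::
    "('a::topological_space) chart set \<Rightarrow> 'a tensor11 \<Rightarrow> (complex \<Rightarrow> 'a) \<Rightarrow> bool" where
  "J_holomorphic_disc A J u \<longleftrightarrow>
     continuous_on (ball 0 1) u \<and>
     (\<forall>c\<in>A. smooth_on (coord c \<circ> u) {\<zeta> \<in> ball 0 1. u \<zeta> \<in> chart_dom c}) \<and>
     (\<forall>c\<in>A. \<forall>\<zeta> \<in> ball 0 1. u \<zeta> \<in> chart_dom c \<longrightarrow>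
        (\<forall>h. J c (coord c (u \<zeta>)) (frechet_derivative (coord c \<circ> u) (at \<zeta>) h) =
             frechet_derivative (coord c \<circ> u) (at \<zeta>) (\<i> * h)))"

text \<open>
  \<open>v\<close> is the tangent vector at \<open>p\<close> written in the chart \<open>c\<close>, and \<open>1 :: complex\<close> is the vector
  \<open>\<partial>/\<partial>x\<close>. The infimum is taken in the extended reals.
\<close>

definition kobayashi :: "('a::topological_space) chart set \<Rightarrow> 'a tensor11 \<Rightarrow> 'a set \<Rightarrow>
    'a chart \<Rightarrow> 'a \<Rightarrow> complex \<times> complex \<Rightarrow> ereal" where
  "kobayashi A J D c p v = Inf {ereal (1 / r) | r. 1 / r > 0 \<and>
     (\<exists>u. J_holomorphic_disc A J u \<and> u ` ball 0 1 \<subseteq> D \<and> u 0 = p \<and>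
          frechet_derivative (coord c \<circ> u) (at 0) 1 = r *\<^sub>R v)}"


section \<open>D'Angelo type\<close>

text \<open>
  \<open>k\<close> is the degree of the first term of the Taylor expansion of \<open>f\<close> at 0, that is,
  \<open>f \<zeta> = P \<zeta> + o(\<bar>\<zeta>\<bar>^k)\<close> with a nonzero homogeneous polynomial \<open>P\<close> of degree \<open>k\<close> in \<open>Re \<zeta>\<close> and
  \<open>Im \<zeta>\<close>. The expansion with Peano remainder makes sense for \<open>f = \<rho> \<circ> u\<close> when \<open>\<rho>\<close> is merely of
  class \<open>C^2\<close>, and such a \<open>k\<close> is unique. If there is none, then the vanishing order is \<open>\<infinity>\<close>, as
  \<open>Inf {} = \<infinity>\<close>.
\<close>

definition first_taylor_degree :: "(complex \<Rightarrow> 'b::real_normed_vector) \<Rightarrow> nat \<Rightarrow> bool" where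
  "first_taylor_degree f k \<longleftrightarrow>
     (\<exists>a. (\<exists>j\<le>k. a j \<noteq> 0) \<and>
        (\<lambda>\<zeta>. norm (f \<zeta> - (\<Sum>j\<le>k. (Re \<zeta> ^ j * Im \<zeta> ^ (k - j)) *\<^sub>R a j))) \<in> o[at 0](\<lambda>\<zeta>. norm \<zeta> ^ k))"

definition contact_order :: "('a \<Rightarrow> real) \<Rightarrow> (complex \<Rightarrow> 'a) \<Rightarrow> ereal" where
  "contact_order \<rho> u = Inf {ereal (real k) | k. first_taylor_degree (\<rho> \<circ> u) k}"

text \<open>The multiplicity does not depend on the chart.\<close>

definition disc_multiplicity :: "'a chart set \<Rightarrow> (complex \<Rightarrow> 'a) \<Rightarrow> ereal" where
  "disc_multiplicity A u = Inf {ereal (real k) | k c. c \<in> A \<and> u 0 \<in> chart_dom c \<and>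
     first_taylor_degree (\<lambda>\<zeta>. coord c (u \<zeta>) - coord c (u 0)) k}"

definition dangelo_type ::
    "('a::topological_space) chart set \<Rightarrow> 'a tensor11 \<Rightarrow> ('a \<Rightarrow> real) \<Rightarrow> 'a \<Rightarrow> ereal" where
  "dangelo_type A J \<rho> p = Sup {contact_order \<rho> u / disc_multiplicity A u | u.
     J_holomorphic_disc A J u \<and> u 0 = p \<and> \<not> u constant_on ball 0 1}"

definition finite_dangelo_type ::
    "('a::topological_space) chart set \<Rightarrow> 'a tensor11 \<Rightarrow> ('a \<Rightarrow> real) \<Rightarrow> 'a set \<Rightarrow> bool" where
  "finite_dangelo_type A J \<rho> D \<longleftrightarrow> (\<forall>p \<in> frontier D. dangelo_type A J \<rho> p < \<infinity>)"


section \<open>Coordinates at a boundary point, cones, normal and tangential parts\<close>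

definition adapted_coordinates ::
    "'a chart set \<Rightarrow> 'a tensor11 \<Rightarrow> ('a \<Rightarrow> real) \<Rightarrow> 'a \<Rightarrow> 'a chart \<Rightarrow> bool" where
  "adapted_coordinates A J \<rho> q c \<longleftrightarrow>
     c \<in> A \<and> q \<in> chart_dom c \<and> coord c q = 0 \<and> J c 0 = J_st \<and>
     (let T = {v. frechet_derivative (in_chart \<rho> c) (at 0) v = 0}
      in T \<inter> J c 0 ` T = {z. snd z = 0}) \<and>
     (\<lambda>z. in_chart \<rho> c z - Re (snd z)) \<in> O[at 0](\<lambda>z. (norm z)\<^sup>2)"

definition boundary_cone :: "'a chart \<Rightarrow> real \<Rightarrow> 'a set" where
  "boundary_cone c k = {p \<in> chart_dom c. - Re (snd (coord c p)) > k * norm (coord c p)}"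

definition tangential_part :: "complex \<times> complex \<Rightarrow> complex \<times> complex" where
  "tangential_part v = (fst v, 0)"

definition normal_part :: "complex \<times> complex \<Rightarrow> complex \<times> complex" where
  "normal_part v = (0, snd v)"

end

theory Submission
 imports Defs
begin

text \<open>A non-integrable structure has no holomorphic coordinates in which the defining function
  could be normalised, but a single disc can always be straightened, and this is what the dilations
  need. They multiply by t^(1-k) the part of J that maps the first factor to the second. That part
  vanishes on the axis, so it is O(|w2|) nearby, and the dilation turns |w2| into t^k |w2|. A disc
  in D need not stay near q. In the closed box, the points of the rescaled domain where Phi is large
  keep away from the boundary of the box. Hence the maximum of Phi and a constant continues by that
  constant to the whole unit disc, and discs need not be localised beforehand. For non-integrable J
  the function log |g|^2 fails to be subharmonic. The Laplacian of |g| is about |g_x|^2/|g| or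
  larger and absorbs the part of the error that blows up at the zeros of g; the bounded remainder is
  paid for by Phi. The order k may be smaller than 2m. The estimate with |rho|^(1/k) is the stronger
  one, as |rho| <= 1 near q.\<close>

type_synonym C2 = "complex \<times> complex"
abbreviation "sm \<equiv> smooth_on"
abbreviation "img c \<equiv> coord c ` chart_dom c"
abbreviation "dirs vs \<equiv> set vs \<subseteq> {1, \<i>}"
abbreviation "DD \<equiv> ball (0::complex) 1"
notation scaleR (infixr "*." 75) and inner (infix ".*" 70) and tendsto (infixr "--->" 55)
 and LIMSEQ ("((_)/ ----> (_))" [60, 60] 60)
lemmas mono_l = mult_left_mono
 and mono_r = mult_right_mono
 and cont_sub = continuous_on_subset
 and cont_comp = continuous_on_compose2
 and bb_scaleR = bounded_bilinear_scaleR
 and sq_eq = power2_eq_square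
 and dot_sq = dot_square_norm
 and deriv_comp = has_derivative_compose
 and tri_ineq = norm_triangle_ineq
 and int_cont = integrable_continuous
 and hfd_def = has_field_derivative_def
 and bl_of_real = bounded_linear_of_real
 and bl_fst = bounded_linear_fst
 and bl_snd = bounded_linear_snd
 and deriv_lin = has_derivative_linear

text \<open>
  The finite type condition provides a \<open>J\<close>-holomorphic disc \<open>U\<close> through \<open>q\<close> along which \<open>\<rho>\<close> vanishes to
  some order \<open>k \<le> 2m\<close> with a homogeneous leading part \<open>P\<close> such that \<open>P = Re p\<close> on the unit circle for a
  polynomial \<open>p\<close> with \<open>Re (p 0) > 0\<close>. Take \<open>U\<close> of maximal order of contact: \<open>Re (p 0) \<ge> 0\<close> by
  the maximum principle, and if \<open>Re (p 0) = 0\<close> then \<open>P\<close> is the real part of a monomial, which a change of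
  the \<open>k\<close>-jet of \<open>U\<close> removes. Discs with prescribed jets come from a contraction in a Hoelder space.
  In coordinates that straighten \<open>U\<close>, the dilations by \<open>(t, t^k)\<close> with \<open>t^k\<close> comparable to \<open>\<bar>\<rho>\<bar>\<close> at the given
  point turn \<open>J\<close> into a small perturbation of the standard structure and \<open>D\<close> into almost
  \<open>Re w2 + P w1 < 0\<close>. There \<open>Phi = Re (p w1) + Re w2 + ...\<close> is strictly plurisubharmonic, larger than
  a constant near the center and smaller than it at the sides of a box, so that Sibony's argument
  (the maximum principle for \<open>log \<bar>g\<bar>^2 + \<Lambda> Phi - log \<bar>z\<bar>^2\<close>, \<open>g\<close> being the rescaled disc minus its center)
  bounds the derivatives of the rescaled discs.
\<close>

subsection \<open>Calculus of \<open>C^k\<close> functions\<close>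

text \<open>The direction comes before the function, so that \<open>pd v\<close> acts on functions
  and can be iterated: \<open>pd v (pd w f)\<close> is a mixed second derivative.\<close>

definition pd :: "'a::real_normed_vector => ('a => 'b::real_normed_vector) => 'a => 'b" where "pd v f x = frechet_derivative f (at x) v"

lemma pd_eq: "(f has_derivative f') (at x) ==> pd v f x = f' v" by(simp add: pd_def frechet_derivative_at[symmetric])

lemma hd_pd: "f differentiable (at x) ==> (f has_derivative (%v. pd v f x)) (at x)" unfolding pd_def by(simp add: frechet_derivative_works)

lemma Ck_Suc: "Ck_on (Suc k) f S \<longleftrightarrow> (! x:S. f differentiable (at x)) & (! v. Ck_on k (pd v f) S)" unfolding pd_def[abs_def] by simp

declare Ck_on.simps(2) [simp del]

lemma frechet_cong:
 assumes "open S" "!!x. x : S ==> f x = g x" "x : S" shows "frechet_derivative f (at x) = frechet_derivative g (at x)"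
  and "f differentiable (at x) \<longleftrightarrow> g differentiable (at x)"
proof -
 have *: "(f has_derivative f') (at x) \<longleftrightarrow> (g has_derivative f') (at x)" for f' proof
  show "(g has_derivative f') (at x)" if "(f has_derivative f') (at x)" by(rule has_derivative_transform_within_open[OF that assms(1,3)]) (simp add: assms(2))
  show "(f has_derivative f') (at x)" if "(g has_derivative f') (at x)" by(rule has_derivative_transform_within_open[OF that assms(1,3)]) (simp add: assms(2))
 qed
 show "frechet_derivative f (at x) = frechet_derivative g (at x)" unfolding frechet_derivative_def * ..
 show "f differentiable (at x) \<longleftrightarrow> g differentiable (at x)" unfolding differentiable_def * ..
qed

lemma pd_cong:
 assumes "open S" "!!x. x : S ==> f x = g x" "x : S" shows "pd v f x = pd v g x" unfolding pd_def using frechet_cong(1)[OF assms] by simp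

lemma Ck_cong:
 assumes "open S" "!!x. x : S ==> f x = g x" "Ck_on k f S" shows "Ck_on k g S" using assms(2,3)
proof(induction k arbitrary: f g)
 case 0
 thus ?case by(auto cong: continuous_on_cong)
next
 case (Suc k)
 have "Ck_on k (pd v g) S" for v proof(rule Suc.IH)
  show "!!x. x : S ==> pd v f x = pd v g x" using pd_cong[OF `open S`] Suc.prems(1) by blast
  show "Ck_on k (pd v f) S" using Suc.prems(2) by(simp add: Ck_Suc)
 qed
 moreover have "! x:S. g differentiable (at x)" using frechet_cong(2)[OF `open S`, of f g] Suc.prems by(auto simp: Ck_Suc)
 ultimately show ?case by(simp add: Ck_Suc)
qed

lemma Ck_subset: "Ck_on k f S ==> T <= S ==> Ck_on k f T" by(induction k arbitrary: f) (auto simp: Ck_Suc intro: cont_sub)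

lemma Ck_cont: "Ck_on k f S ==> continuous_on S f"
proof(cases k)
 case (Suc j)
 assume "Ck_on k f S"
 hence "f differentiable_on S" by(intro differentiable_at_imp_differentiable_on) (simp add: Suc Ck_Suc)
 thus ?thesis by(rule differentiable_imp_continuous_on)
qed simp

lemma Ck_SucD: "Ck_on (Suc k) f S ==> Ck_on k f S"
proof(induction k arbitrary: f)
 case 0
 thus ?case using Ck_cont by auto
next
 case (Suc k)
 from Suc.prems have "! v. Ck_on (Suc k) (pd v f) S" "! x:S. f differentiable (at x)" unfolding Ck_Suc[of "Suc k"] by blast+
 thus ?case unfolding Ck_Suc[of k f] using Suc.IH by blast
qed

lemma Ck_mono: "Ck_on k f S ==> j <= k ==> Ck_on j f S" by(induction k) (auto simp: le_Suc_eq dest: Ck_SucD)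

lemma Ck_SucI:
 assumes "open S" "!!x. x : S ==> (f has_derivative f' x) (at x)" "!!v. Ck_on k (%x. f' x v) S" shows "Ck_on (Suc k) f S" unfolding Ck_Suc
proof(intro conjI ballI allI)
 show "f differentiable (at x)" if "x : S" for x using assms(2)[OF that] differentiableI by blast
 show "Ck_on k (pd v f) S" for v by(rule Ck_cong[OF assms(1) _ assms(3)]) (simp add: pd_eq[OF assms(2)])
qed

lemma Ck_deriv: "Ck_on (Suc k) f S ==> x : S ==> (f has_derivative (%v. pd v f x)) (at x)" by(simp add: Ck_Suc hd_pd)

lemma Ck_const [simp]: "Ck_on k (%x. c) S"
proof(induction k arbitrary: c)
 case (Suc k)
 have "pd v (%x::'a. c) = (%x. 0)" for v by(rule ext) (simp add: pd_eq[OF has_derivative_const])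
 thus ?case using Suc by(simp add: Ck_Suc)
qed simp

lemma Ck_bl:
 assumes "bounded_linear L" shows "Ck_on k L S"
proof(cases k)
 case 0
 thus ?thesis using assms by(simp add: linear_continuous_on)
next
 case (Suc j)
 have "pd v L = (%x. L v)" for v by(rule ext) (simp add: pd_eq[OF bounded_linear_imp_has_derivative[OF assms]])
 thus ?thesis using Suc assms by(simp add: Ck_Suc bounded_linear_imp_differentiable)
qed

lemma Ck_add:
 assumes "open S" "Ck_on k f S" "Ck_on k g S" shows "Ck_on k (%x. f x+g x) S" using assms(2,3)
proof(induction k arbitrary: f g)
 case (Suc k)
 show ?case proof(rule Ck_SucI[OF assms(1)])
  show "((%x. f x+g x) has_derivative (%v. pd v f x+pd v g x)) (at x)" if "x : S" for x using Suc.prems that by(intro has_derivative_add Ck_deriv)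
  show "Ck_on k (%x. pd v f x+pd v g x) S" for v using Suc.prems by(intro Suc.IH) (auto simp: Ck_Suc)
 qed
qed (simp add: continuous_on_add)

lemma Ck_bilinear:
 assumes "bounded_bilinear pr" "open S" "Ck_on k f S" "Ck_on k g S" shows "Ck_on k (%x. pr (f x) (g x)) S" using assms(3,4)
proof(induction k arbitrary: f g)
 case 0
 thus ?case using bounded_bilinear.continuous_on[OF assms(1)] by simp
next
 case (Suc k)
 show ?case proof(rule Ck_SucI[OF assms(2)])
  show "((%x. pr (f x) (g x)) has_derivative (%v. pr (f x) (pd v g x)+pr (pd v f x) (g x))) (at x)"
   if "x : S" for x using Suc.prems that by(intro bounded_bilinear.FDERIV[OF assms(1)] Ck_deriv)
  show "Ck_on k (%x. pr (f x) (pd v g x)+pr (pd v f x) (g x)) S" for v using Suc.prems by(intro Ck_add assms(2) Suc.IH) (simp_all add: Ck_SucD, simp_all add: Ck_Suc)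
 qed
qed

lemmas Ck_scaleR = Ck_bilinear[OF bb_scaleR]
lemmas Ck_mult = Ck_bilinear[OF bounded_bilinear_mult]

lemma Ck_lin:
 assumes "bounded_linear L" "open S" "Ck_on k f S" shows "Ck_on k (%x. L (f x)) S" using assms(3)
proof(induction k arbitrary: f)
 case 0
 thus ?case using bounded_linear.continuous_on[OF assms(1)] by simp
next
 case (Suc k)
 show ?case proof(rule Ck_SucI[OF assms(2)])
  show "((%x. L (f x)) has_derivative (%v. L (pd v f x))) (at x)" if "x : S" for x using Suc.prems that by(intro bounded_linear.has_derivative[OF assms(1)] Ck_deriv)
  show "Ck_on k (%x. L (pd v f x)) S" for v using Suc.prems by(intro Suc.IH) (auto simp: Ck_Suc)
 qed
qed

lemma Ck_inner: "open S ==> Ck_on k f S ==> Ck_on k (%x. f x.*i) S" by(rule Ck_lin[OF bounded_linear_inner_left])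

lemma Ck_minus: "open S ==> Ck_on k f S ==> Ck_on k (%x. - f x) S" by(rule Ck_lin[OF bounded_linear_minus[OF bounded_linear_ident]])

lemma Ck_diff: "open S ==> Ck_on k f S ==> Ck_on k g S ==> Ck_on k (%x. f x-g x) S" using Ck_add[of S k f "%x. - g x"] Ck_minus[of S k g] by simp

lemma Ck_sum: "open S ==> (!!i. i : I ==> Ck_on k (f i) S) ==> Ck_on k (%x. SUM i:I. f i x) S" by(induction I rule: infinite_finite_induct) (auto intro: Ck_add)

lemma Ck_power:
 fixes f :: "'a::euclidean_space => 'b::real_normed_algebra_1" shows "open S ==> Ck_on k f S ==> Ck_on k (%x. f x^n) S" by(induction n) (auto intro: Ck_mult)

lemma lin_Basis:
 fixes x :: "'a::euclidean_space"
 assumes "linear L" shows "L x = (SUM i:Basis. (x.*i)*.L i)"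
proof -
 have "L x = L (SUM i:Basis. (x.*i)*.i)" by(simp add: euclidean_representation)
 also have "... = (SUM i:Basis. (x.*i)*.L i)" by(simp add: linear_sum[OF assms] linear_scale[OF assms])
 finally show ?thesis .
qed

lemma pd_Basis:
 fixes f :: "'a::euclidean_space => 'b::real_normed_vector"
 assumes "f differentiable (at x)" shows "pd v f x = (SUM i:Basis. (v.*i)*.pd i f x)" using lin_Basis[OF deriv_lin[OF hd_pd[OF assms]]] .

text \<open>The derivative of the outer function is expanded in the standard basis. This writes the
  derivative of the composition as a finite sum of products, and the induction hypothesis applies to
  the partial derivatives \<open>pd i f\<close>.\<close>

lemma Ck_compose:
 fixes f :: "'b::euclidean_space => 'c::real_normed_vector" and g :: "'a::euclidean_space => 'b"
 assumes "open S" "open T" "Ck_on k f T" "Ck_on k g S" "!!x. x : S ==> g x : T" shows "Ck_on k (%x. f (g x)) S" using assms(3,4)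
proof(induction k arbitrary: f)
 case 0
 thus ?case using assms(5) by(auto intro: cont_comp)
next
 case (Suc k)
 show ?case proof(rule Ck_SucI[OF assms(1)])
  show "((%x. f (g x)) has_derivative (%v. SUM i:Basis. (pd v g x.*i)*.pd i f (g x))) (at x)"
   if "x : S" for x proof -
   have f: "(f has_derivative (%v. pd v f (g x))) (at (g x))" by(rule Ck_deriv[OF Suc.prems(1) assms(5)[OF that]])
   have "f differentiable (at (g x))" by(rule differentiableI[OF f])
   hence eq: "pd (pd v g x) f (g x) = (SUM i:Basis. (pd v g x.*i)*.pd i f (g x))" for v by(rule pd_Basis)
   have "((%x. f (g x)) has_derivative (%v. pd (pd v g x) f (g x))) (at x)" by(rule deriv_comp[OF Ck_deriv[OF Suc.prems(2) that] f])
   thus ?thesis unfolding eq .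
  qed
  show "Ck_on k (%x. SUM i:Basis. (pd v g x.*i)*.pd i f (g x)) S" for v proof(intro Ck_sum Ck_scaleR assms(1))
   fix i :: 'b
   show "Ck_on k (%x. pd v g x.*i) S" using Suc.prems(2) assms(1) by(intro Ck_inner) (simp_all add: Ck_Suc)
   show "Ck_on k (%x. pd i f (g x)) S" proof(rule Suc.IH[OF _ Ck_SucD[OF Suc.prems(2)]])
    show "Ck_on k (pd i f) T" using Suc.prems(1) by(simp add: Ck_Suc)
   qed
  qed
 qed
qed

lemma Ck_inverse:
 fixes f :: "'a::euclidean_space => real"
 assumes "open S" "Ck_on k f S" "!!x. x : S ==> f x ~= 0" shows "Ck_on k (%x. inverse (f x)) S" using assms(2)
proof(induction k)
 case 0
 thus ?case using assms(3) by(auto intro: continuous_on_inverse)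
next
 case (Suc k)
 show ?case proof(rule Ck_SucI[OF assms(1)])
  show "((%x. inverse (f x)) has_derivative (%v. - (inverse (f x)*pd v f x*inverse (f x)))) (at x)" if "x : S" for x
   using Suc.prems that assms(3) by(intro Deriv.has_derivative_inverse Ck_deriv)
  show "Ck_on k (%x. - (inverse (f x)*pd v f x*inverse (f x))) S" for v using Suc assms(1) Ck_SucD[OF Suc.prems] by(intro Ck_minus Ck_mult Suc.IH) (auto simp: Ck_Suc)
 qed
qed

lemma Ck_Pair:
 assumes "open S" "Ck_on k f S" "Ck_on k g S" shows "Ck_on k (%x. (f x, g x)) S"
proof -
 have "bounded_linear (%x::'b. (x, 0::'c))" "bounded_linear (%x::'c. (0::'b, x))" by(intro bounded_linear_Pair bounded_linear_ident bounded_linear_zero)+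
 from Ck_lin[OF this(1) assms(1,2)] Ck_lin[OF this(2) assms(1,3)]
 have "Ck_on k (%x. (f x, 0)+(0, g x)) S" by(rule Ck_add[OF assms(1)])
 thus ?thesis by simp
qed

lemma Ck_local:
 assumes "!!x. x : S ==> ? T. open T & x : T & Ck_on k f T" shows "Ck_on k f S" using assms
proof(induction k arbitrary: f)
 case 0
 have "isCont f x" if "x : S" for x using 0[OF that] continuous_on_eq_continuous_at by auto
 thus ?case by(simp add: continuous_at_imp_continuous_on)
next
 case (Suc k)
 have "Ck_on k (pd v f) S" for v using Suc.prems by(intro Suc.IH) (meson Ck_Suc)
 moreover have "f differentiable (at x)" if "x : S" for x using Suc.prems[OF that] by(auto simp: Ck_Suc)
 ultimately show ?case by(simp add: Ck_Suc)
qed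

text \<open>Both mixed derivatives are the limit of the same second difference quotient.\<close>

lemma pd_symmetric_real:
 fixes f :: "'a::euclidean_space => real"
 assumes "open S" "x : S" "Ck_on 2 f S" shows "pd v (pd w f) x = pd w (pd v f) x"
proof -
 have C2: "Ck_on (Suc (Suc 0)) f S" using assms(3) by(simp add: numeral_2_eq_2)
 hence C1: "Ck_on (Suc 0) (pd u f) S" for u using Ck_Suc by blast
 have C0: "continuous_on S (pd u' (pd u f))" for u u' using C1 by(auto simp: Ck_Suc)
 obtain r where r: "r > 0" "cball x r <= S" using assms open_contains_cball by metis
 \<comment> \<open>Steps of length up to r/n along both directions stay within distance r of x; the
   + 1 keeps \<open>n\<close> positive if both directions vanish.\<close>
 define n where "n = norm v+norm w+1"
 have n: "n > 0" unfolding n_def by(intro add_nonneg_pos add_nonneg_nonneg) auto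
 have mem: "x+s*.u+t*.u' : S" if "abs s <= r/n" "abs t <= r/n" "{u, u'} = {v, w}" for s t u u' proof -
  have "norm (s*.u+t*.u') <= abs s*norm u+abs t*norm u'" by(metis norm_scaleR tri_ineq)
  also have "... <= (r/n)*norm u+(r/n)*norm u'" using that by(intro add_mono mono_r) auto
  also have "... = (r/n)*(norm v+norm w)" using that(3) by(auto simp: doubleton_eq_iff algebra_simps)
  also have "... <= (r/n)*n" using r n by(intro mono_l) (auto simp: n_def)
  also have "... = r" using n by simp
  finally have "dist x (x+s*.u+t*.u') <= r" by(metis add.assoc add_diff_cancel_left' dist_commute dist_norm)
  thus ?thesis using r by auto
 qed
 have line: "((%s. g (y+s*.u)) has_real_derivative pd u g (y+s*.u)) (at s)"
  if "Ck_on (Suc 0) g S" "y+s*.u : S" for g :: "'a => real" and y u s proof -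
  have "((%s. y+s*.u) has_derivative (%h. h*.u)) (at s)" by(auto intro!: derivative_eq_intros)
  from deriv_comp[OF this Ck_deriv[OF that]]
  have "((%s. g (y+s*.u)) has_derivative (%h. pd (h*.u) g (y+s*.u))) (at s)" .
  moreover have "pd (h*.u) g (y+s*.u) = pd u g (y+s*.u)*h" for h using linear_scale[OF deriv_lin[OF Ck_deriv[OF that]]] by simp
  ultimately show ?thesis by(simp add: hfd_def)
 qed
 \<comment> \<open>Two applications of the mean value theorem, along \<open>u\<close> and then along
   \<open>u'\<close>. The condition {u, u'} = {v, w} lets one argument serve both orders of
   differentiation.\<close>
 have key: "? s t. 0 < s & s < h & 0 < t & t < h &
   f (x+h*.u+h*.u')-f (x+h*.u)-f (x+h*.u')+f x
    = h*h*pd u' (pd u f) (x+s*.u+t*.u')"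
  if h: "0 < h" "h <= r/n" and uu: "{u, u'} = {v, w}" for h u u' proof -
  define fi where "fi = (%s. f (x+h*.u'+s*.u)-f (x+s*.u))"
  have "? s. 0 < s & s < h & fi h-fi 0 = (h-0)*(pd u f (x+h*.u'+s*.u)-pd u f (x+s*.u))" unfolding fi_def proof(intro MVT2 DERIV_diff)
   fix s assume "0 <= s" "s <= h"
   thus "((%s. f (x+h*.u'+s*.u)) has_real_derivative pd u f (x+h*.u'+s*.u)) (at s)" using mem[of s h u u'] h uu by(intro line Ck_SucD[OF C2]) (auto simp: algebra_simps)
   show "((%s. f (x+s*.u)) has_real_derivative pd u f (x+s*.u)) (at s)" using mem[of s 0 u u'] h uu `0 <= s` `s <= h` by(intro line Ck_SucD[OF C2]) auto
  qed (use h in auto)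
  then obtain s where s: "0 < s" "s < h" "fi h-fi 0 = h*(pd u f (x+h*.u'+s*.u)-pd u f (x+s*.u))" by auto
  have "? t. 0 < t & t < h & pd u f (x+s*.u+h*.u')-pd u f (x+s*.u+0*.u')
    = (h-0)*pd u' (pd u f) (x+s*.u+t*.u')" proof(intro MVT2)
   fix t assume "0 <= t" "t <= h"
   thus "((%t. pd u f (x+s*.u+t*.u')) has_real_derivative
    pd u' (pd u f) (x+s*.u+t*.u')) (at t)" using mem[of s t u u'] h uu s by(intro line C1) auto
  qed (use h in auto)
  then obtain t where t: "0 < t" "t < h" "pd u f (x+s*.u+h*.u')-pd u f (x+s*.u)
    = h*pd u' (pd u f) (x+s*.u+t*.u')" by auto
  have "f (x+h*.u+h*.u')-f (x+h*.u)-f (x+h*.u')+f x = fi h-fi 0" by(simp add: fi_def algebra_simps)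
  also have "... = h*h*pd u' (pd u f) (x+s*.u+t*.u')" using s(3) t(3) by(simp add: algebra_simps)
  finally show ?thesis using s t by blast
 qed
 define q where "q = (%h. (f (x+h*.v+h*.w)-f (x+h*.v)-f (x+h*.w)+f x)/(h*h))"
 have lim: "(q ---> pd u' (pd u f) x) (at_right 0)" if uu: "{u, u'} = {v, w}" for u u' proof(rule tendstoI)
  fix e :: real assume "e > 0"
  have "isCont (pd u' (pd u f)) x" using C0 assms by(simp add: continuous_on_eq_continuous_at)
  then obtain d where d: "d > 0" "!!y. dist y x < d ==> dist (pd u' (pd u f) y) (pd u' (pd u f) x) < e" using `e > 0` by(metis continuous_at_eps_delta)
  define h0 where "h0 = min (r/n) (d/n)"
  have "h0 > 0" using r d n by(simp add: h0_def)
  moreover have "dist (q h) (pd u' (pd u f) x) < e" if h: "0 < h" "h < h0" for h proof -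
   obtain s t where st: "0 < s" "s < h" "0 < t" "t < h" "f (x+h*.u+h*.u')-f (x+h*.u)-f (x+h*.u')+f x
    = h*h*pd u' (pd u f) (x+s*.u+t*.u')" using key[of h u u'] h uu by(auto simp: h0_def)
   have "q h = (f (x+h*.u+h*.u')-f (x+h*.u)-f (x+h*.u')+f x)/(h*h)" using uu unfolding q_def doubleton_eq_iff by(auto simp: algebra_simps)
   hence "q h = pd u' (pd u f) (x+s*.u+t*.u')" using st(5) h by simp
   moreover have "dist (x+s*.u+t*.u') x < d" proof -
    have "norm (s*.u+t*.u') <= s*norm u+t*norm u'" using st by(metis abs_of_pos norm_scaleR tri_ineq)
    also have "... <= h*norm u+h*norm u'" using st by(intro add_mono mono_r) auto
    also have "... = h*(norm v+norm w)" using uu by(auto simp: doubleton_eq_iff algebra_simps)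
    also have "... < h*n" using h by(simp add: n_def)
    also have "... < d" using h n by(simp add: h0_def pos_less_divide_eq)
    finally show ?thesis by(simp add: dist_norm add.assoc)
   qed
   ultimately show ?thesis using d by simp
  qed
  ultimately show "eventually (%h. dist (q h) (pd u' (pd u f) x) < e) (at_right 0)" unfolding eventually_at_right_field by blast
 qed
 have "pd v (pd w f) x = pd w (pd v f) x" by(rule tendsto_unique[OF _ lim lim]) (auto simp: insert_commute)
 thus ?thesis .
qed

lemma pd_lin:
 assumes "bounded_linear L" "f differentiable (at x)" shows "pd v (%y. L (f y)) x = L (pd v f x)"
 by(rule pd_eq[OF bounded_linear.has_derivative[OF assms(1) hd_pd[OF assms(2)]]])

lemma pd_symmetric:
 fixes f :: "'a::euclidean_space => 'b::euclidean_space"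
 assumes "open S" "x : S" "Ck_on 2 f S" shows "pd v (pd w f) x = pd w (pd v f) x"
proof(rule euclidean_eqI)
 fix i :: 'b assume "i : Basis"
 have C: "Ck_on (Suc (Suc 0)) f S" using assms by(simp add: numeral_2_eq_2)
 have L: "bounded_linear (%y::'b. y.*i)" by(rule bounded_linear_inner_left)
 have 1: "pd u (%y. f y.*i) y = pd u f y.*i" if "y : S" for u y using C that by(intro pd_lin[OF L]) (auto simp: Ck_Suc)
 have 2: "pd u' (pd u (%y. f y.*i)) x = pd u' (pd u f) x.*i" for u u' proof -
  have "pd u' (pd u (%y. f y.*i)) x = pd u' (%y. pd u f y.*i) x" by(rule pd_cong[OF assms(1) 1 assms(2)])
  also have "... = pd u' (pd u f) x.*i" using C assms(2) by(intro pd_lin[OF L]) (auto simp: Ck_Suc)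
  finally show ?thesis .
 qed
 have "Ck_on 2 (%y. f y.*i) S" by(rule Ck_lin[OF L assms(1,3)])
 from pd_symmetric_real[OF assms(1,2) this] show "pd v (pd w f) x.*i = pd w (pd v f) x.*i" by(simp add: 2)
qed

section \<open>Smooth functions\<close>

lemma sm_Suc: "sm f S \<longleftrightarrow> (! x:S. f differentiable (at x)) & (! v. sm (pd v f) S)"
proof
 assume "sm f S"
 hence "Ck_on (Suc k) f S" for k by(simp add: smooth_on_def)
 thus "(! x:S. f differentiable (at x)) & (! v. sm (pd v f) S)" by(auto simp: Ck_Suc smooth_on_def)
next
 assume *: "(! x:S. f differentiable (at x)) & (! v. sm (pd v f) S)"
 hence "Ck_on (Suc k) f S" for k by(auto simp: Ck_Suc smooth_on_def)
 thus "sm f S" unfolding smooth_on_def using Ck_SucD by blast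
qed

lemma sm_pd: "sm f S ==> sm (pd v f) S" using sm_Suc by blast

lemma sm_dif: "sm f S ==> x : S ==> f differentiable (at x)" using sm_Suc by blast

lemma sm_deriv: "sm f S ==> x : S ==> (f has_derivative (%v. pd v f x)) (at x)" by(simp add: sm_dif hd_pd)

lemma sm_Ck: "sm f S ==> Ck_on k f S" by(simp add: smooth_on_def)

lemma sm_cont: "sm f S ==> continuous_on S f" using Ck_cont sm_Ck by blast

lemma sm_subset: "sm f S ==> T <= S ==> sm f T" by(auto simp: smooth_on_def intro: Ck_subset)

lemma sm_cong: "open S ==> (!!x. x : S ==> f x = g x) ==> sm f S ==> sm g S" unfolding smooth_on_def using Ck_cong by blast

lemma sm_const [simp]: "sm (%x. c) S" by(simp add: smooth_on_def)

lemma sm_bl: "bounded_linear L ==> sm L S" by(simp add: smooth_on_def Ck_bl)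

lemma sm_add: "open S ==> sm f S ==> sm g S ==> sm (%x. f x+g x) S" by(simp add: smooth_on_def Ck_add)

lemma sm_diff: "open S ==> sm f S ==> sm g S ==> sm (%x. f x-g x) S" by(simp add: smooth_on_def Ck_diff)

lemma sm_scaleR: "open S ==> sm f S ==> sm g S ==> sm (%x. f x*.g x) S" by(simp add: smooth_on_def Ck_scaleR)

lemma sm_mult:
 fixes f g :: "'a::euclidean_space => 'b::real_normed_algebra" shows "open S ==> sm f S ==> sm g S ==> sm (%x. f x*g x) S" by(simp add: smooth_on_def Ck_mult)

lemma sm_power:
 fixes f :: "'a::euclidean_space => 'b::real_normed_algebra_1" shows "open S ==> sm f S ==> sm (%x. f x^n) S" by(simp add: smooth_on_def Ck_power)

lemma sm_lin: "bounded_linear L ==> open S ==> sm f S ==> sm (%x. L (f x)) S" by(simp add: smooth_on_def Ck_lin)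

lemma sm_sum: "open S ==> (!!i. i : I ==> sm (f i) S) ==> sm (%x. SUM i:I. f i x) S" by(simp add: smooth_on_def Ck_sum)

lemma sm_Pair: "open S ==> sm f S ==> sm g S ==> sm (%x. (f x, g x)) S" by(simp add: smooth_on_def Ck_Pair)

lemma sm_comp:
 fixes f :: "'b::euclidean_space => 'c::real_normed_vector" and g :: "'a::euclidean_space => 'b"
 shows "open S ==> open T ==> sm f T ==> sm g S ==> (!!x. x : S ==> g x : T)
  ==> sm (%x. f (g x)) S" by(simp add: smooth_on_def Ck_compose)

lemma sm_inverse:
 fixes f :: "'a::euclidean_space => real" shows "open S ==> sm f S ==> (!!x. x : S ==> f x ~= 0) ==> sm (%x. inverse (f x)) S" by(simp add: smooth_on_def Ck_inverse)

lemma pd_symmetric_smooth: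
 fixes f :: "'a::euclidean_space => 'b::euclidean_space"
 assumes "open S" "x : S" "sm f S" shows "pd v (pd w f) x = pd w (pd v f) x" using pd_symmetric[OF assms(1,2) sm_Ck[OF assms(3)]] .

subsection \<open>A right inverse of the Cauchy--Riemann operator\<close>

text \<open>Complex scalar multiplication on C^2, used as a bounded bilinear map over the reals so
  that all the rules above apply to it.\<close>

definition cmul :: "complex => C2 => C2" where "cmul a z = (a*fst z, a * snd z)"

lemma norm_cmul: "norm (cmul a z) = norm a*norm z"
proof -
 have "norm (cmul a z) = sqrt ((norm a)^2*((norm (fst z))^2+(norm (snd z))^2))" by(simp add: cmul_def norm_prod_def norm_mult power_mult_distrib algebra_simps)
 also have "... = norm a*norm z" by(simp add: real_sqrt_mult norm_prod_def)
 finally show ?thesis .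
qed

lemma bb_cmul: "bounded_bilinear cmul"
proof
 show "? K. ! a b. norm (cmul a b) <= norm a*norm b*K" by(rule exI[of _ 1]) (simp add: norm_cmul)
qed (auto simp: cmul_def algebra_simps)

lemma bl_cmul: "bounded_linear (cmul a)" by(rule bounded_bilinear.bounded_linear_right[OF bb_cmul])

lemma J_st_cmul: "J_st = cmul \<i>" by(rule ext) (simp add: J_st_def cmul_def)

lemma cmul_cmul [simp]: "cmul a (cmul b z) = cmul (a*b) z" by(simp add: cmul_def)

lemma cmul_1 [simp]: "cmul 1 z = z" and cmul_minus1: "cmul (- 1) z = - z" and cmul_0 [simp]: "cmul 0 z = 0" and cmul_0_right [simp]: "cmul a 0 = 0"
 by(simp_all add: cmul_def prod_eq_iff)

lemma cmul_add_right: "cmul a (y+z) = cmul a y+cmul a z" and cmul_diff_right: "cmul a (y-z) = cmul a y-cmul a z" and cmul_minus_right: "cmul a (- z) = - cmul a z"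
 and cmul_scaleR_right: "cmul a (r*.z) = r*.cmul a z" and cmul_of_real: "cmul (of_real r) z = r*.z"
 by(simp_all add: cmul_def prod_eq_iff algebra_simps scaleR_conv_of_real)

lemma continuous_on_cmul [continuous_intros]: "continuous_on S f ==> continuous_on S g ==> continuous_on S (%x. cmul (f x) (g x))"
 by(rule bounded_bilinear.continuous_on[OF bb_cmul])

lemmas Ck_cmul = Ck_bilinear[OF bb_cmul]

text \<open>Leibniz's rule. The derivatives are packaged as bounded operators, whose joint
  continuity is checked direction by direction.\<close>

lemma param_integral_deriv:
 fixes f :: "'a::euclidean_space => 't::euclidean_space => 'c::euclidean_space"
 assumes der: "!!x t. t : cbox a b ==> ((%x. f x t) has_derivative f' x t) (at x)" and cont: "!!x. continuous_on (cbox a b) (f x)"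
  and cont': "!!v. continuous_on (UNIV \<times> cbox a b) (%(x, t). f' x t v)"
 shows "((%x. integral (cbox a b) (f x)) has_derivative (%v. integral (cbox a b) (%t. f' x t v))) (at x)"
proof -
 define F where "F = (%x t. if t : cbox a b then Blinfun (f' x t) else 0)"
 have F: "blinfun_apply (F x t) = f' x t" if "t : cbox a b" for x t
  unfolding F_def using that has_derivative_bounded_linear[OF der[OF that]] by(simp add: bounded_linear_Blinfun_apply)
 have contF: "continuous_on (UNIV \<times> cbox a b) (%(x, t). F x t)" unfolding split_beta proof(rule continuous_on_blinfun_componentwise)
  fix i :: 'a assume "i : Basis"
  show "continuous_on (UNIV \<times> cbox a b) (%p. blinfun_apply (F (fst p) (snd p)) i)" proof(rule continuous_on_eq)
   show "continuous_on (UNIV \<times> cbox a b) (%p. f' (fst p) (snd p) i)" using cont'[of i] by(simp add: split_beta)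
  qed (use F in auto)
 qed
 have "((%x. integral (cbox a b) (f x)) has_derivative integral (cbox a b) (F x)) (at x within UNIV)" proof(rule leibniz_rule[OF _ _ contF])
  show "((%x. f x t) has_derivative blinfun_apply (F x t)) (at x within UNIV)" if "t : cbox a b" for x t using der[OF that] F[OF that] by simp
  show "f x integrable_on cbox a b" for x by(rule int_cont[OF cont])
 qed auto
 moreover have "blinfun_apply (integral (cbox a b) (F x)) v = integral (cbox a b) (%t. f' x t v)" for v proof -
  have "continuous_on (cbox a b) (%t. case (x, t) of (x, t) => F x t)" by(rule cont_comp[OF contF]) (auto intro!: continuous_intros)
  hence "continuous_on (cbox a b) (F x)" by simp
  hence "F x integrable_on cbox a b" by(rule int_cont)
  hence "blinfun_apply (integral (cbox a b) (F x)) v = integral (cbox a b) (%t. blinfun_apply (F x t) v)" by(rule blinfun_apply_integral)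
  also have "... = integral (cbox a b) (%t. f' x t v)" by(intro integral_cong) (simp add: F)
  finally show ?thesis .
 qed
 hence "blinfun_apply (integral (cbox a b) (F x)) = (%v. integral (cbox a b) (%t. f' x t v))" by(rule ext)
 ultimately show ?thesis by simp
qed

text \<open>The kernels below vanish for |z| >= 2. The square contains the disc of radius 3, and the
  spare width 1 allows it to be shifted by vectors of norm below 1 without losing any part of their
  support.\<close>

abbreviation bx :: "complex set" where "bx == cbox (Complex (-3) (-3)) (Complex 3 3)"

lemma in_bx: "norm z <= 3 ==> z : bx" using abs_Re_le_cmod[of z] abs_Im_le_cmod[of z] by(auto simp: in_cbox_complex_iff)

lemma bx_norm: "z : bx ==> norm z <= 6" using cmod_le[of z] by(auto simp: in_cbox_complex_iff)

text \<open>The integral of f (x + t) over the square does not depend on \<open>x\<close> as long as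
  |x| < 1, because the support stays inside. Differentiation under the integral sign at x = 0 gives
  the claim.\<close>

lemma integral_pd_zero:
 fixes f :: "complex => 'b::euclidean_space"
 assumes "Ck_on (Suc 0) f UNIV" "!!z. norm z > 2 ==> f z = 0" shows "integral bx (pd v f) = 0"
proof -
 let ?I = "%x. integral bx (%t. f (x+t))"
 have cf: "continuous_on UNIV f" using Ck_cont[OF assms(1)] .
 have cf': "continuous_on UNIV (pd v f)" for v using assms(1) by(simp add: Ck_Suc)
 have 1: "(?I has_derivative (%v. integral bx (%t. pd v f (0+t)))) (at 0)" proof(rule param_integral_deriv)
  show "((%x. f (x+t)) has_derivative (%v. pd v f (x+t))) (at x)" for x t proof -
   have "((%x. x+t) has_derivative (%h. h)) (at x)" by(auto intro!: derivative_eq_intros)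
   from deriv_comp[OF this Ck_deriv[OF assms(1) UNIV_I]] show ?thesis .
  qed
  show "continuous_on bx (%t. f (x+t))" for x by(rule cont_comp[OF cf]) (auto intro!: continuous_intros)
  show "continuous_on (UNIV \<times> bx) (%(x, t). pd v f (x+t))" for v unfolding split_beta by(rule cont_comp[OF cf']) (auto intro!: continuous_intros)
 qed
 have 2: "?I x = integral bx f" if "x : DD" for x proof -
  have "f integrable_on bx" by(rule int_cont) (rule cont_sub[OF cf], simp)
  hence i: "(f has_integral integral bx f) bx" by(rule integrable_integral)
  have out: "f z = 0" if "z ~: bx" for z using in_bx[of z] assms(2)[of z] that by force
  let ?B = "cbox (Complex (-3) (-3)+x) (Complex 3 3+x)"
  have out': "f z = 0" if "z ~: ?B" for z proof(rule ccontr)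
   assume "f z ~= 0"
   hence "norm z <= 2" using assms(2)[of z] by force
   hence "norm (z-x) <= 3" using `x : DD` norm_triangle_ineq4[of z x] by simp
   from in_bx[OF this] that show False by(auto simp: in_cbox_complex_iff algebra_simps)
  qed
  have "(f has_integral integral bx f) UNIV" by(rule has_integral_on_superset[OF i]) (use out in auto)
  moreover have "f integrable_on ?B" by(rule int_cont) (rule cont_sub[OF cf], simp)
  hence j: "(f has_integral integral ?B f) ?B" by(rule integrable_integral)
  hence "(f has_integral integral ?B f) UNIV" by(rule has_integral_on_superset) (use out' in auto)
  ultimately have "integral ?B f = integral bx f" by(rule has_integral_unique[rotated])
  with j have "((f o ((+) x)) has_integral integral bx f) bx" by(simp add: has_integral_shift_cbox_iff)
  thus ?thesis by(simp add: o_def integral_unique)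
 qed
 have "((%x. integral bx f) has_derivative (%v. integral bx (%t. pd v f (0+t)))) (at 0)" by(rule has_derivative_transform_within_open[OF 1, of "DD"]) (auto simp: 2)
 hence "(%v. integral bx (%t. pd v f (0+t))) = (%v. 0)" by(rule has_derivative_unique[OF _ has_derivative_const])
 thus ?thesis by(simp add: fun_eq_iff)
qed

text \<open>Truncated powers are of class C^(n-1) and, up to factors, closed under differentiation;
  they serve as cut-offs with explicit derivatives.\<close>

definition cutpow :: "nat => real => real" where "cutpow n x = (max 0 x)^n"

lemma DERIV_cutpow:
 assumes "n >= 1" shows "(cutpow (Suc n) has_real_derivative real (Suc n)*cutpow n x) (at x)"
proof -
 consider "x > 0" | "x < 0" | "x = 0" by linarith
 thus ?thesis proof cases
  case 1
  have "((%x. x^Suc n) has_real_derivative real (Suc n)*x^n) (at x)" by(auto intro!: derivative_eq_intros simp del: power_Suc)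
  hence "((%x. x^Suc n) has_real_derivative real (Suc n)*cutpow n x) (at x)" using 1 by(simp add: cutpow_def max_def)
  thus ?thesis by(rule has_field_derivative_transform_within_open[of _ _ _ "{0<..}"]) (use 1 in \<open>auto simp: cutpow_def max_def\<close>)
 next
  case 2
  have "((%x. 0) has_real_derivative real (Suc n)*cutpow n x) (at x)" using 2 assms by(simp add: cutpow_def max_def power_0_left)
  thus ?thesis by(rule has_field_derivative_transform_within_open[of _ _ _ "{..<0}"]) (use 2 in \<open>auto simp: cutpow_def max_def\<close>)
 next
  case 3
  have "((%h. cutpow (Suc n) h/h) ---> 0) (at 0)" proof(rule tendsto_rabs_zero_cancel, rule real_tendsto_sandwich)
   show "\<forall>\<^sub>F h in at 0. 0 <= abs (cutpow (Suc n) h/h)" by simp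
   show "\<forall>\<^sub>F h in at 0. abs (cutpow (Suc n) h/h) <= abs h^n" by(rule eventuallyI) (auto simp: cutpow_def max_def abs_mult power_abs)
   show "((%h. abs h^n) ---> 0) (at (0::real))" using assms by(intro tendsto_eq_intros) auto
  qed auto
  thus ?thesis using 3 assms by(simp add: has_field_derivative_iff cutpow_def power_0_left)
 qed
qed

lemma Ck_cutpow: "j < n ==> Ck_on j (cutpow n) UNIV"
proof(induction j arbitrary: n)
 case 0
 show ?case unfolding cutpow_def[abs_def] by(auto intro!: continuous_intros)
next
 case (Suc j)
 then obtain p where p: "n = Suc p" "p >= 1" "j < p" by(cases n) auto
 show ?case proof(rule Ck_SucI)
  show "(cutpow n has_derivative (%v. real n*cutpow p x * v)) (at x)" for x using DERIV_cutpow[OF p(2), of x] p(1) by(simp add: hfd_def)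
  have "Ck_on j (%x. v * real n*cutpow p x) UNIV" for v using Suc.IH[OF p(3)] by(intro Ck_mult Ck_const) auto
  thus "Ck_on j (%x. real n*cutpow p x * v) UNIV" for v by(simp add: mult_ac)
 qed auto
qed

text \<open>A radial C^2 density on the annulus 1 <= |z| <= 2. Since it vanishes near 0, the kernel
  built from it has no singularity.\<close>

definition omg :: "complex => real" where "omg z = cutpow 3 ((z.*z-1)*(4-z.*z))"

lemma Ck_normsq: "Ck_on k (%z::'a::euclidean_space. z.*z) S"
proof -
 have "Ck_on k (%z::'a. z.*z) UNIV" by(rule Ck_bilinear[OF bounded_bilinear_inner]) (auto intro: Ck_bl bounded_linear_ident)
 thus ?thesis by(rule Ck_subset) simp
qed

lemma Ck_omg: "Ck_on 2 omg UNIV" unfolding omg_def[abs_def] by(rule Ck_compose[OF _ _ Ck_cutpow[of 2 3]]) (auto intro!: Ck_mult Ck_diff Ck_normsq Ck_const)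

lemma omg_nonneg: "omg z >= 0" by(simp add: omg_def cutpow_def)

lemma omg_zero: "norm z <= 1 | 2 <= norm z ==> omg z = 0"
proof -
 assume "norm z <= 1 | 2 <= norm z"
 moreover have "2^2 <= (norm z)^2" if "2 <= norm z" using that by(intro power_mono) auto
 moreover have "(norm z)^2 <= 1" if "norm z <= 1" using that by(simp add: power_le_one)
 ultimately have "(z.*z-1)*(4-z.*z) <= 0" by(auto simp: dot_sq mult_le_0_iff)
 thus ?thesis by(simp add: omg_def cutpow_def max_def)
qed

lemma pd_omg_radial: "pd (\<i>*z) omg z = 0"
proof -
 let ?q = "%z::complex. (z.*z-1)*(4-z.*z)"
 have "((%z. ?q z) has_derivative (%v. (z.*z-1)*(- (2*(z.*v)))+(2*(z.*v))*(4-z.*z))) (at z)" by(auto intro!: derivative_eq_intros simp: inner_commute)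
 from deriv_comp[OF this, of "cutpow 3" "%v. 3*cutpow 2 (?q z) * v"]
 have "(omg has_derivative (%v. 3*cutpow 2 (?q z)*((z.*z-1)*(- (2*(z.*v)))+(2*(z.*v))*(4-z.*z)))) (at z)" using DERIV_cutpow[of 2 "?q z"] unfolding omg_def[abs_def]
  by(simp add: hfd_def numeral_3_eq_3 numeral_2_eq_2)
 hence "pd (\<i>*z) omg z = 3*cutpow 2 (?q z)*((z.*z-1)*(- (2*(z.*(\<i>*z))))+(2*(z.*(\<i>*z)))*(4-z.*z))" by(rule pd_eq)
 also have "z.*(\<i>*z) = 0" by(simp add: inner_complex_def)
 finally show ?thesis by simp
qed

definition c0 :: real where "c0 = integral bx omg"

lemma c0_pos: "c0 > 0"
proof -
 have co: "continuous_on bx omg" using Ck_cont[OF Ck_omg] cont_sub by blast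
 have nn: "integral bx omg >= 0" by(rule integral_nonneg[OF int_cont[OF co]]) (simp add: omg_nonneg)
 have "integral bx omg ~= 0" proof
  assume "integral bx omg = 0"
  hence hi: "(omg has_integral 0) bx" using integrable_integral[OF int_cont[OF co]] by simp
  have "omg (Complex (3/2) 0) = 0" by(rule has_integral_0_cbox_imp_0[OF co _ hi])
    (auto simp: omg_nonneg in_cbox_complex_iff in_box_complex_iff box_ne_empty Basis_complex_def)
  thus False by(simp add: omg_def cutpow_def inner_complex_def)
 qed
 with nn show ?thesis by(simp add: c0_def)
qed

definition conv :: "(complex => complex) => (complex => C2) => real => complex => C2" where "conv ka g r z = integral bx (%et. cmul (ka et) (g (z-of_real r*et)))"

definition kk :: "complex => complex" where "kk z = cnj z * of_real (omg z)"

text \<open>Put zeta = r eta and carry out the integral over \<open>r\<close>: for |zeta| <= 1 the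
  kernel becomes c0/(2 pi zeta), where \<open>c0\<close> is the mass of \<open>omg\<close>. So this
  is a Cauchy transform, split over the scales \<open>r\<close> into convolutions with one fixed C^2
  kernel of compact support. The singularity of 1/zeta reappears only as r tends to 0.\<close>

definition TT :: "(complex => C2) => complex => C2" where "TT g z = integral {0..1} (%r. conv kk g r z)"

lemma Ck_kk: "Ck_on 2 kk UNIV" unfolding kk_def[abs_def] by(intro Ck_mult Ck_lin[OF bl_of_real] Ck_omg Ck_bl bounded_linear_cnj) auto

lemma kk_zero: "norm z >= 2 ==> kk z = 0" by(simp add: kk_def omg_zero)

lemma kk_cont: "continuous_on S kk" using Ck_cont[OF Ck_kk] cont_sub by blast

section \<open>Convolutions at a fixed scale and their derivatives\<close>

lemma conv_cont:
 fixes g :: "complex => C2"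
 assumes "continuous_on UNIV ka" "continuous_on UNIV g" shows "continuous_on S (%et. cmul (ka et) (g (z-of_real r*et)))"
proof(intro continuous_intros)
 show "continuous_on S ka" using assms(1) cont_sub by blast
 show "continuous_on S (%et. g (z-of_real r*et))" by(rule cont_comp[OF assms(2)]) (intro continuous_intros, auto)
qed

lemma continuous_conv:
 assumes "continuous_on UNIV ka" "continuous_on UNIV g" shows "continuous_on S (%(r, z). conv ka g r z)"
proof -
 have "continuous_on UNIV (%p. integral bx (%et. cmul (ka et) (g (snd p-of_real (fst p)*et))))" proof(rule integral_continuous_on_param)
  show "continuous_on (UNIV \<times> bx) (%(p, et). cmul (ka et) (g (snd p-of_real (fst p)*et)))" unfolding split_beta proof(intro continuous_on_cmul)
   show "continuous_on (UNIV \<times> bx) (%x. ka (snd x))" by(rule cont_comp[OF assms(1)]) (auto intro!: continuous_intros)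
   show "continuous_on (UNIV \<times> bx) (%x. g (snd (fst x)-of_real (fst (fst x)) * snd x))" by(rule cont_comp[OF assms(2)]) (auto intro!: continuous_intros)
  qed
 qed
 thus ?thesis unfolding conv_def split_beta by(rule cont_sub) simp
qed

lemma continuous_conv_r:
 assumes "continuous_on UNIV ka" "continuous_on UNIV g" shows "continuous_on S (%r. conv ka g r z)"
proof -
 have "continuous_on S (%r. case (r, z) of (r, z) => conv ka g r z)" by(rule cont_comp[OF continuous_conv[OF assms, of UNIV]]) (auto intro!: continuous_intros)
 thus ?thesis by simp
qed

lemma has_derivative_shift:
 assumes "Ck_on (Suc 0) g UNIV" shows "((%z. g (z-w)) has_derivative (%v. pd v g (z-w))) (at z)"
proof -
 have "((%z. z-w) has_derivative (%h. h)) (at z)" by(auto intro!: derivative_eq_intros)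
 from deriv_comp[OF this Ck_deriv[OF assms UNIV_I]] show ?thesis .
qed

lemma continuous_pd: "Ck_on (Suc 0) g S ==> continuous_on S (pd v g)" by(simp add: Ck_Suc)

lemma conv_has_derivative:
 assumes "continuous_on UNIV ka" "Ck_on (Suc 0) g UNIV" shows "(conv ka g r has_derivative (%v. conv ka (pd v g) r z)) (at z)" unfolding conv_def[abs_def]
proof(rule param_integral_deriv)
 show "((%z. cmul (ka et) (g (z-of_real r*et))) has_derivative (%v. cmul (ka et) (pd v g (z-of_real r*et)))) (at z)" for z et
  by(rule bounded_linear.has_derivative[OF bl_cmul has_derivative_shift[OF assms(2)]])
 show "continuous_on bx (%et. cmul (ka et) (g (z-of_real r*et)))" for z by(rule conv_cont[OF assms(1) Ck_cont[OF assms(2)]])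
 show "continuous_on (UNIV \<times> bx) (%(z, et). cmul (ka et) (pd v g (z-of_real r*et)))" for v unfolding split_beta proof(intro continuous_on_cmul)
  show "continuous_on (UNIV \<times> bx) (%x. ka (snd x))" by(rule cont_comp[OF assms(1)]) (auto intro!: continuous_intros)
  show "continuous_on (UNIV \<times> bx) (%x. pd v g (fst x-of_real r * snd x))" by(rule cont_comp[OF continuous_pd[OF assms(2)]]) (auto intro!: continuous_intros)
 qed
qed

lemma TT_has_derivative:
 assumes "Ck_on (Suc 0) g UNIV" shows "(TT g has_derivative (%v. TT (pd v g) z)) (at z)"
proof -
 have "((%z. integral (cbox 0 1) (%r. conv kk g r z)) has_derivative (%v. integral (cbox 0 1) (%r. conv kk (pd v g) r z))) (at z)" proof(rule param_integral_deriv)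
  show "((%z. conv kk g r z) has_derivative (%v. conv kk (pd v g) r z)) (at z)" for z r using conv_has_derivative[OF kk_cont assms] .
  show "continuous_on (cbox 0 1) (%r. conv kk g r z)" for z by(rule continuous_conv_r[OF kk_cont Ck_cont[OF assms]])
  show "continuous_on (UNIV \<times> cbox 0 1) (%(z, r). conv kk (pd v g) r z)" for v proof -
   have "continuous_on (UNIV \<times> cbox 0 1) (%p. case (snd p, fst p) of (r, z) => conv kk (pd v g) r z)"
    by(rule cont_comp[OF continuous_conv[OF kk_cont continuous_pd[OF assms], of UNIV]]) (auto intro!: continuous_intros)
   thus ?thesis by(simp add: split_beta)
  qed
 qed
 thus ?thesis unfolding TT_def[abs_def] by simp
qed

lemma pd_TT: "sm g UNIV ==> pd v (TT g) = TT (pd v g)" by(rule ext) (rule pd_eq[OF TT_has_derivative[OF sm_Ck]])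

lemma sm_TT:
 assumes "sm g UNIV" shows "sm (TT g) UNIV"
proof -
 have "Ck_on k (TT g) UNIV" if "sm g UNIV" for k g using that proof(induction k arbitrary: g)
  case 0
  have "TT g differentiable_on UNIV" using TT_has_derivative[OF sm_Ck[OF 0]] by(auto simp: differentiable_on_def differentiable_def)
  thus ?case by(simp add: differentiable_imp_continuous_on)
 next
  case (Suc k)
  show ?case by(rule Ck_SucI[OF _ TT_has_derivative[OF sm_Ck[OF Suc.prems]]]) (auto intro: Suc.IH sm_pd Suc.prems)
 qed
 thus ?thesis using assms by(simp add: smooth_on_def)
qed

lemma has_derivative_rescale:
 fixes g :: "complex => 'b::real_normed_vector"
 assumes "Ck_on (Suc 0) g UNIV" shows "((%et. g (z-of_real r*et)) has_derivative (%v. - (r*.pd v g (z-of_real r*et)))) (at et)"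
proof -
 have "((%et. z-of_real r*et) has_derivative (%v. - (r*.v))) (at et)" by(auto intro!: derivative_eq_intros simp: scaleR_conv_of_real)
 from deriv_comp[OF this Ck_deriv[OF assms UNIV_I]]
 have "((%et. g (z-of_real r*et)) has_derivative (%v. pd (- (r*.v)) g (z-of_real r*et))) (at et)" .
 moreover have "pd (- (r*.v)) g y = - (r*.pd v g y)" for v y proof -
  have l: "linear (%v. pd v g y)" by(rule deriv_lin[OF Ck_deriv[OF assms UNIV_I]])
  show ?thesis using linear_neg[OF l, of "r*.v"] linear_scale[OF l, of r v] by simp
 qed
 ultimately show ?thesis by simp
qed

lemma Ck_rescale:
 fixes g :: "complex => 'b::real_normed_vector" shows "Ck_on k g UNIV ==> Ck_on k (%et. g (z-of_real r*et)) UNIV"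
proof -
 assume g: "Ck_on k g UNIV"
 have "Ck_on k (%et. z-of_real r*et) UNIV" by(intro Ck_diff Ck_const Ck_bl[OF bounded_linear_mult_right]) auto
 from Ck_compose[OF open_UNIV open_UNIV g this] show ?thesis by simp
qed

text \<open>Integration by parts in \<open>et\<close>. Subtracting a constant \<open>c\<close> from
  \<open>g\<close> does not affect its derivative; the choice c = g z brings in the Hoelder
  increment of \<open>g\<close>.\<close>

lemma conv_by_parts:
 assumes "Ck_on (Suc 0) ka UNIV" "!!z. norm z >= 2 ==> ka z = 0" "Ck_on (Suc 0) g UNIV"
 shows "r*.conv ka (pd v g) r z = integral bx (%et. cmul (pd v ka et) (g (z-of_real r*et)-c))"
proof -
 let ?f = "%et. cmul (ka et) (g (z-of_real r*et)-c)"
 have der: "(?f has_derivative (%v. cmul (ka et) (- (r*.pd v g (z-of_real r*et)))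
   + cmul (pd v ka et) (g (z-of_real r*et)-c))) (at et)" for et proof(rule bounded_bilinear.FDERIV[OF bb_cmul Ck_deriv[OF assms(1)]])
  show "((%et. g (z-of_real r*et)-c) has_derivative (%v. - (r*.pd v g (z-of_real r*et)))) (at et)"
   using has_derivative_diff[OF has_derivative_rescale[OF assms(3)] has_derivative_const[of c]] by simp
 qed simp
 have "integral bx (pd v ?f) = 0" by(rule integral_pd_zero) (auto intro!: Ck_cmul Ck_diff Ck_const assms Ck_rescale simp: assms(2))
 also have "pd v ?f = (%et. - (r*.cmul (ka et) (pd v g (z-of_real r*et)))
   + cmul (pd v ka et) (g (z-of_real r*et)-c))" by(rule ext) (simp add: pd_eq[OF der] cmul_minus_right cmul_scaleR_right)
 also have "integral bx ... = - (r*.conv ka (pd v g) r z)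
   + integral bx (%et. cmul (pd v ka et) (g (z-of_real r*et)-c))" proof -
  have i1: "(%et. cmul (ka et) (pd v g (z-of_real r*et))) integrable_on bx" by(rule int_cont[OF conv_cont[OF Ck_cont[OF assms(1)] continuous_pd[OF assms(3)]]])
  have "continuous_on UNIV (%z. g z-c)" using Ck_cont[OF assms(3)] by(intro continuous_intros)
  hence i2: "(%et. cmul (pd v ka et) (g (z-of_real r*et)-c)) integrable_on bx" using int_cont[OF conv_cont[OF continuous_pd[OF assms(1)]], of "%z. g z-c"] by simp
  show ?thesis unfolding conv_def using i1 i2 by(subst integral_add) (auto intro!: integrable_neg integrable_cmul)
 qed
 finally show ?thesis by simp
qed

lemma measure_bx: "measure lborel bx = 36" by(subst content_cbox_if) (auto simp: Basis_complex_def box_ne_empty in_cbox_complex_iff)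

lemma conv_pd_bound:
 assumes "Ck_on (Suc 0) ka UNIV" "!!z. norm z >= 2 ==> ka z = 0" "Ck_on (Suc 0) g UNIV" and M: "!!et. et : bx ==> norm (pd v ka et) <= M"
  and B: "!!z w. norm (g z-g w) <= B * sqrt (norm (z-w))" and r: "r > 0" shows "norm (conv ka (pd v g) r z) <= 108*M*B/sqrt r"
proof -
 have "0 : bx" by(rule in_bx) simp
 from M[OF this] have M0: "M >= 0" using norm_ge_zero order_trans by blast
 have B0: "B >= 0" using B[of 1 0] norm_ge_zero[of "g 1-g 0"] by(simp del: norm_ge_zero)
 have cont: "continuous_on UNIV (%w. g w-g z)" using Ck_cont[OF assms(3)] by(intro continuous_intros)
 have "((%et. cmul (pd v ka et) (g (z-of_real r*et)-g z)) has_integral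
   integral bx (%et. cmul (pd v ka et) (g (z-of_real r*et)-g z))) bx" using int_cont[OF conv_cont[OF continuous_pd[OF assms(1)] cont]] by(simp add: integrable_integral)
 hence "norm (integral bx (%et. cmul (pd v ka et) (g (z-of_real r*et)-g z)))
   <= (M*(B*(3 * sqrt r)))*measure lborel bx" proof(rule has_integral_bound[rotated])
  fix et assume e: "et : bx"
  have "norm (g (z-of_real r*et)-g z) <= B * sqrt (norm (z-of_real r*et-z))" by(rule B)
  \<comment> \<open>On \<open>bx\<close> the norm of \<open>et\<close> is at most 6; 9 is taken for
    the sake of its square root. The final factor 108 is 3 times the area 36 of
    \<open>bx\<close>.\<close>
  also have "... <= B * sqrt (9*r)" using B0 r bx_norm[OF e] by(intro mono_l) (auto simp: norm_mult)
  also have "sqrt (9*r) = 3 * sqrt r" by(simp add: real_sqrt_mult)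
  finally show "norm (cmul (pd v ka et) (g (z-of_real r*et)-g z)) <= M*(B*(3 * sqrt r))" unfolding norm_cmul using M[OF e] M0 by(intro mult_mono) auto
 qed (use M0 B0 r in auto)
 hence "norm (r*.conv ka (pd v g) r z) <= 108*M*B * sqrt r" using conv_by_parts[OF assms(1-3), of r v z "g z"] by(simp add: measure_bx)
 hence "r*norm (conv ka (pd v g) r z) <= 108*M*B * sqrt r" using r by simp
 hence "norm (conv ka (pd v g) r z) <= 108*M*B * sqrt r/r" using r by(simp add: pos_le_divide_eq mult.commute)
 also have "... = 108*M*B/sqrt r" using r by(simp add: field_simps)
 finally show ?thesis .
qed

text \<open>The majorant \<open>b\<close> may be singular at the end points, as 1/sqrt r is at 0;
  only its primitive has to be continuous there. At 0 and 1 it is replaced by the norm of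
  \<open>f\<close>.\<close>

lemma integral_bound_interior:
 fixes f :: "real => 'b::banach"
 assumes "continuous_on {0..1} f" "continuous_on {0..1} F" and "!!r. 0 < r ==> r < 1 ==> (F has_real_derivative b r) (at r)"
  and "!!r. 0 < r ==> r < 1 ==> norm (f r) <= b r" shows "norm (integral {0..1} f) <= F 1-F 0"
proof -
 have "(b has_integral (F 1-F 0)) {0..1}" by(rule fundamental_theorem_of_calculus_interior)
    (use assms in \<open>auto simp: has_real_derivative_iff_has_vector_derivative\<close>)
 hence hi: "((%r. if r : {0, 1} then norm (f r) else b r) has_integral (F 1-F 0)) {0..1}" by(rule has_integral_spike_finite[of "{0, 1}", rotated 2]) auto
 have "norm (integral {0..1} f) <= integral {0..1} (%r. if r : {0, 1} then norm (f r) else b r)" by(rule integral_norm_bound_integral)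
    (use assms hi in \<open>auto intro: integrable_continuous_interval\<close>)
 also have "... = F 1-F 0" using hi by(rule integral_unique)
 finally show ?thesis .
qed

text \<open>The Hoelder norm of exponent 1/2, with one bound for the supremum and the seminorm. This
  exponent turns the integrals over the scales into square roots and an arctangent.\<close>

definition Hb :: "(complex => 'b::real_normed_vector) => real => bool" where
 "Hb f B \<longleftrightarrow> (! z. norm (f z) <= B) & (! z w. norm (f z-f w) <= B * sqrt (norm (z-w)))"

lemma HbD: "Hb f B ==> norm (f z) <= B" "Hb f B ==> norm (f z-f w) <= B * sqrt (norm (z-w))" by(auto simp: Hb_def)

lemma Hb_nonneg: "Hb f B ==> B >= 0" unfolding Hb_def using norm_ge_zero order_trans by blast

lemma pd_linear_bound:
 fixes f :: "complex => 'b::real_normed_vector"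
 assumes "f differentiable (at z)" shows "norm (pd w f z) <= (norm (pd 1 f z)+norm (pd \<i> f z))*norm w"
proof -
 have "pd w f z = Re w*.pd 1 f z+Im w*.pd \<i> f z" using pd_Basis[OF assms, of w] by(simp add: Basis_complex_def)
 hence "norm (pd w f z) <= abs (Re w)*norm (pd 1 f z)+abs (Im w)*norm (pd \<i> f z)" by(metis norm_scaleR tri_ineq)
 also have "... <= norm w*norm (pd 1 f z)+norm w*norm (pd \<i> f z)" using abs_Re_le_cmod abs_Im_le_cmod by(intro add_mono mono_r) auto
 finally show ?thesis by(simp add: algebra_simps)
qed

text \<open>The Cauchy transform gains one derivative in Hoelder spaces. The piece of scale r of a
  derivative is bounded by K/sqrt r and its partial derivatives by K/(r sqrt r). Over a distance d
  it therefore changes by at most the minimum of 2K/sqrt r and 2Kd/(r sqrt r), which is at most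
  4Kd/(sqrt r (r + d)). The primitive 8K sqrt d arctan (sqrt (r/d)) of the latter gives a total of
  order sqrt d.\<close>

lemma TT_Hb: "EX C>0. ! g B. sm g UNIV --> Hb g B -->
   Hb (TT g) (C*B) & (! v:{1, \<i>}. Hb (pd v (TT g)) (C*B))"
proof -
 have kk1: "Ck_on (Suc 0) (pd v kk) UNIV" for v using Ck_kk unfolding numeral_2_eq_2 Ck_Suc[of "Suc 0"] by blast
 have "bounded (f ` bx)" if "continuous_on UNIV f" for f :: "complex => complex" by(intro compact_imp_bounded compact_continuous_image cont_sub[OF that]) auto
 from this[OF kk_cont] this[OF Ck_cont[OF kk1]] this[OF continuous_pd[OF kk1]]
 have "bounded (kk ` bx)" "bounded (pd v kk ` bx)" "bounded (pd w (pd v kk) ` bx)" for v w by blast+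
 hence ex0: "EX M>0. ! et:bx. norm (kk et) <= M" and ex1: "EX M>0. ! et:bx. norm (pd v kk et) <= M" and ex2: "EX M>0. ! et:bx. norm (pd w (pd v kk) et) <= M" for v w
  unfolding bounded_pos by auto
 obtain m0 where m0: "m0 > 0" "!!et. et : bx ==> norm (kk et) <= m0" using ex0 by blast
 obtain m1 where m1: "m1 > 0" "!!et. et : bx ==> norm (pd 1 kk et) <= m1" using ex1[of 1] by blast
 obtain m2 where m2: "m2 > 0" "!!et. et : bx ==> norm (pd \<i> kk et) <= m2" using ex1[of \<i>] by blast
 obtain m3 where m3: "m3 > 0" "!!et. et : bx ==> norm (pd 1 (pd 1 kk) et) <= m3" using ex2[of 1 1] by blast
 obtain m4 where m4: "m4 > 0" "!!et. et : bx ==> norm (pd 1 (pd \<i> kk) et) <= m4" using ex2[of 1 \<i>] by blast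
 obtain m5 where m5: "m5 > 0" "!!et. et : bx ==> norm (pd \<i> (pd 1 kk) et) <= m5" using ex2[of \<i> 1] by blast
 obtain m6 where m6: "m6 > 0" "!!et. et : bx ==> norm (pd \<i> (pd \<i> kk) et) <= m6" using ex2[of \<i> \<i>] by blast
 define M where "M = m0+m1+m2+m3+m4+m5+m6"
 have M: "M > 0" "m0 <= M" "m1 <= M" "m2 <= M" "m3 <= M" "m4 <= M" "m5 <= M" "m6 <= M" using m0(1) m1(1) m2(1) m3(1) m4(1) m5(1) m6(1) unfolding M_def by linarith+
 have Mkk: "norm (kk et) <= M" if "et : bx" for et using m0(2)[OF that] M by linarith
 have M1: "norm (pd v kk et) <= M" if "et : bx" "v : {1, \<i>}" for et v using m1(2)[OF that(1)] m2(2)[OF that(1)] M that(2) by auto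
 have M2: "norm (pd w (pd v kk) et) <= M" if "et : bx" "v : {1, \<i>}" "w : {1, \<i>}" for et v w
  using m3(2)[OF that(1)] m4(2)[OF that(1)] m5(2)[OF that(1)] m6(2)[OF that(1)] M that(2,3) by auto
 \<comment> \<open>Dominates the constants of the three estimates below: 36 M for
   \<open>TT g\<close> itself, 216 M for the supremum of its derivatives and 432 M pi for their
   increments.\<close>
 define C where "C = 108*M*8*pi"
 have C: "C >= 36*M" "C >= 2*(108*M)" "C >= 4*(108*M)*pi" "C > 0" unfolding C_def using M(1) pi_ge_two by(auto simp: field_simps intro: order_trans[of _ "2*1"])
 have "Hb (TT g) (C*B) & (! v:{1, \<i>}. Hb (pd v (TT g)) (C*B))" if g: "sm g UNIV" and H: "Hb g B" for g B proof -
  have B0: "B >= 0" using Hb_nonneg[OF H] .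
  have cg: "continuous_on UNIV g" using sm_cont[OF g] .
  have gk: "Ck_on k g UNIV" for k using sm_Ck[OF g] .
  have conv_lip: "norm (integral bx (%et. cmul (kk et) (h et))) <= 36*M*b"
   if "continuous_on UNIV h" "!!et. norm (h et) <= b" for h b proof -
   have b: "b >= 0" using that(2) norm_ge_zero order_trans by blast
   have "((%et. cmul (kk et) (h et)) has_integral integral bx (%et. cmul (kk et) (h et))) bx"
    by(intro integrable_integral int_cont continuous_intros kk_cont cont_sub[OF that(1)]) auto
   hence "norm (integral bx (%et. cmul (kk et) (h et))) <= (M*b)*measure lborel bx" proof(rule has_integral_bound[rotated])
    fix et assume "et : bx"
    thus "norm (cmul (kk et) (h et)) <= M*b" unfolding norm_cmul using Mkk[of et] M that(2)[of et] by(intro mult_mono) auto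
   qed (use M b in auto)
   thus ?thesis by(simp add: measure_bx)
  qed
  have shiftc: "continuous_on UNIV (%et. g (z-of_real r*et))" for z r by(rule cont_comp[OF cg]) (intro continuous_intros, auto)
  have ci: "(%r. conv kk g r z) integrable_on {0..1}" for z by(rule integrable_continuous_interval[OF continuous_conv_r[OF kk_cont cg]])
  have unit: "norm (integral {0..1} f) <= b" if "continuous_on {0..1} f" "!!r. norm (f r) <= b"
   for f :: "real => C2" and b using integral_bound_interior[OF that(1), of "%r. b*r" "%r. b"] that(2) by(auto intro!: continuous_intros derivative_eq_intros)
  have H0: "Hb (TT g) (C*B)" unfolding Hb_def proof(intro conjI allI)
   fix z w
   have "norm (TT g z) <= 36*M*B" unfolding TT_def proof(rule unit[OF continuous_conv_r[OF kk_cont cg]])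
    show "norm (conv kk g r z) <= 36*M*B" for r unfolding conv_def by(rule conv_lip[OF shiftc]) (rule HbD(1)[OF H])
   qed
   also have "... <= C*B" using C(1) B0 by(rule mono_r)
   finally show "norm (TT g z) <= C*B" .
   have "norm (TT g z-TT g w) = norm (integral {0..1} (%r. conv kk g r z-conv kk g r w))" unfolding TT_def by(simp add: integral_diff[OF ci ci])
   also have "... <= 36*M*(B * sqrt (norm (z-w)))" proof(rule unit)
    show "continuous_on {0..1} (%r. conv kk g r z-conv kk g r w)" by(intro continuous_intros continuous_conv_r[OF kk_cont cg])
    fix r
    have "conv kk g r z-conv kk g r w =
    integral bx (%et. cmul (kk et) (g (z-of_real r*et)-g (w-of_real r*et)))" unfolding conv_def cmul_diff_right by(rule integral_diff[symmetric])
    (rule int_cont[OF conv_cont[OF kk_cont cg]])+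
    also have "norm ... <= 36*M*(B * sqrt (norm (z-w)))" proof(rule conv_lip)
    show "continuous_on UNIV (%et. g (z-of_real r*et)-g (w-of_real r*et))" by(intro continuous_intros shiftc)
    show "norm (g (z-of_real r*et)-g (w-of_real r*et)) <= B * sqrt (norm (z-w))" for et using HbD(2)[OF H, of "z-of_real r*et" "w-of_real r*et"] by simp
    qed
    finally show "norm (conv kk g r z-conv kk g r w) <= 36*M*(B * sqrt (norm (z-w)))" .
   qed
   also have "... = (36*M*B) * sqrt (norm (z-w))" by simp
   also have "... <= (C*B) * sqrt (norm (z-w))" using C(1) B0 by(intro mono_r) auto
   finally show "norm (TT g z-TT g w) <= C*B * sqrt (norm (z-w))" .
  qed
  have kk1: "Ck_on (Suc 0) kk UNIV" "Ck_on (Suc 0) (pd v kk) UNIV" for v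
   using Ck_kk Ck_SucD unfolding numeral_2_eq_2 Ck_Suc[of "Suc 0"] by(auto intro: Ck_SucD[OF Ck_kk[unfolded numeral_2_eq_2]])
  have pdkk0: "pd v kk z = 0" if "norm z > 2" for v z proof -
   have "pd v kk z = pd v (%z. 0) z" by(rule pd_cong[of "- cball 0 2"]) (use that in \<open>auto intro: kk_zero\<close>)
   also have "... = 0" by(rule pd_eq) (rule has_derivative_const)
   finally show ?thesis .
  qed
  \<comment> \<open>The kernel estimates ask for vanishing on the closed set |z| >= 2. On the circle
    |z| = 2 it follows by continuity along the outward ray.\<close>
  have pdkk2: "pd v kk z = 0" if "norm z >= 2" for v z proof(cases "norm z > 2")
   case False
   hence nz: "norm z = 2" using that by simp
   have lim: "((%t. pd v kk ((1+t)*.z)) ---> pd v kk z) (at_right (0::real))" proof -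
    have "isCont (pd v kk) ((1+0)*.z)" using continuous_pd[OF kk1(1), of v] by(simp add: continuous_on_eq_continuous_at)
    moreover have "((%t. (1+t)*.z) ---> (1+0)*.z) (at_right (0::real))" by(intro tendsto_intros)
    ultimately show ?thesis using isCont_tendsto_compose by fastforce
   qed
   have "eventually (%t. pd v kk ((1+t)*.z) = 0) (at_right (0::real))" unfolding eventually_at_right_field by(rule exI[of _ 1]) (use nz pdkk0 in auto)
   hence "((%t. pd v kk ((1+t)*.z)) ---> 0) (at_right (0::real))" by(rule tendsto_eventually)
   from tendsto_unique[OF _ lim this] show ?thesis by simp
  qed (rule pdkk0)
  have H1: "Hb (pd v (TT g)) (C*B)" if v: "v : {1, \<i>}" for v proof -
   let ?psi = "%r z. conv kk (pd v g) r z"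
   have pc: "continuous_on {0..1} (%r. ?psi r z)" for z by(rule continuous_conv_r[OF kk_cont continuous_pd[OF gk]])
   have pi': "(%r. ?psi r z) integrable_on {0..1}" for z by(rule integrable_continuous_interval[OF pc])
   have b1: "norm (?psi r z) <= 108*M*B/sqrt r" if "r > 0" for r z proof(rule conv_pd_bound[OF kk1(1) kk_zero gk _ _ that])
    show "norm (pd v kk et) <= M" if "et : bx" for et using M1[OF that v] .
   qed (use HbD(2)[OF H] in auto)
   have b2: "norm (pd w (?psi r) z) <= 108*M*B/(r * sqrt r)" if "r > 0" "w : {1, \<i>}" for r z w proof -
    have "pd w (?psi r) z = conv kk (pd w (pd v g)) r z" by(rule pd_eq[OF conv_has_derivative[OF kk_cont]]) (rule sm_Ck[OF sm_pd[OF g]])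
    also have "pd w (pd v g) = pd v (pd w g)" by(rule ext) (rule pd_symmetric_smooth[OF open_UNIV UNIV_I g])
    finally have 1: "pd w (?psi r) z = conv kk (pd v (pd w g)) r z" .
    \<comment> \<open>Of the two derivatives one is moved to the kernel at the cost of 1/r; the
      other one is estimated through the Hoelder increments of \<open>g\<close>.\<close>
    have "r*.conv kk (pd v (pd w g)) r z = conv (pd v kk) (pd w g) r z" using conv_by_parts[OF kk1(1) kk_zero sm_Ck[OF sm_pd[OF g]], of r v w z 0] by(simp add: conv_def)
    hence 2: "r*norm (pd w (?psi r) z) = norm (conv (pd v kk) (pd w g) r z)" unfolding 1 using `r > 0` by(metis abs_of_pos norm_scaleR)
    have "norm (conv (pd v kk) (pd w g) r z) <= 108*M*B/sqrt r" proof(rule conv_pd_bound[OF kk1(2) pdkk2 gk _ _ `r > 0`])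
    show "norm (pd w (pd v kk) et) <= M" if "et : bx" for et using M2[OF that v `w : _`] .
    qed (use HbD(2)[OF H] in auto)
    hence "r*norm (pd w (?psi r) z) <= 108*M*B/sqrt r" using 2 by simp
    hence "norm (pd w (?psi r) z) <= (108*M*B/sqrt r)/r" using `r > 0` by(subst pos_le_divide_eq) (auto simp: mult.commute)
    thus ?thesis by(simp add: mult.commute)
   qed
   have b3: "norm (?psi r z-?psi r w) <= 2*(108*M*B/(r * sqrt r))*norm (z-w)" if r: "r > 0" for r z w
   proof(rule differentiable_bound[of UNIV "?psi r" "%z h. pd h (?psi r) z"])
    have dif: "?psi r differentiable (at z)" for z using conv_has_derivative[OF kk_cont sm_Ck[OF sm_pd[OF g]]] differentiableI by blast
    show "(?psi r has_derivative (%h. pd h (?psi r) z)) (at z within UNIV)" for z using hd_pd[OF dif] by simp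
    show "onorm (%h. pd h (?psi r) z) <= 2*(108*M*B/(r * sqrt r))" for z proof(rule onorm_le)
    fix h
    have "norm (pd h (?psi r) z) <= (norm (pd 1 (?psi r) z)+norm (pd \<i> (?psi r) z))*norm h" by(rule pd_linear_bound[OF dif])
    also have "... <= (2*(108*M*B/(r * sqrt r)))*norm h" unfolding mult_2 by(intro mono_r add_mono b2[OF r]) auto
    finally show "norm (pd h (?psi r) z) <= 2*(108*M*B/(r * sqrt r))*norm h" .
    qed
   qed auto
   let ?K = "108*M*B"
   have K0: "?K >= 0" using M(1) B0 by simp
   have eq: "pd v (TT g) z = integral {0..1} (%r. ?psi r z)" for z unfolding pd_TT[OF g] TT_def ..
   show ?thesis unfolding Hb_def proof(intro conjI allI)
    fix z w
    have "norm (integral {0..1} (%r. ?psi r z)) <= 2*?K * sqrt 1-2*?K * sqrt 0" proof(rule integral_bound_interior[OF pc _ _ b1])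
    show "continuous_on {0..1} (%r. 2*?K * sqrt r)" by(intro continuous_intros)
    show "((%r. 2*?K * sqrt r) has_real_derivative ?K/sqrt r) (at r)" if "0 < r" for r using that by(auto intro!: derivative_eq_intros simp: field_simps)
    qed auto
    also have "... = (2*(108*M))*B" by simp
    also have "... <= C*B" using C(2) B0 by(rule mono_r)
    finally show "norm (pd v (TT g) z) <= C*B" by(simp add: eq)
    show "norm (pd v (TT g) z-pd v (TT g) w) <= C*B * sqrt (norm (z-w))" proof(cases "z = w")
    case False
    define d where "d = norm (z-w)"
    have d: "d > 0" using False by(simp add: d_def)
    have "norm (pd v (TT g) z-pd v (TT g) w) = norm (integral {0..1} (%r. ?psi r z-?psi r w))" unfolding eq by(simp add: integral_diff[OF pi' pi'])
    also have "... <= 4*?K*(2 * sqrt d*arctan (sqrt (1/d)))-4*?K*(2 * sqrt d*arctan (sqrt (0/d)))" proof(rule integral_bound_interior)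
    show "continuous_on {0..1} (%r. ?psi r z-?psi r w)" by(intro continuous_intros pc)
    show "continuous_on {0..1} (%r. 4*?K*(2 * sqrt d*arctan (sqrt (r/d))))" using d by(intro continuous_intros) auto
    fix r :: real assume r: "0 < r" "r < 1"
    have "((%r. sqrt r/sqrt d) has_real_derivative inverse (sqrt r)/2/sqrt d) (at r)" by(rule DERIV_cdivide) (rule DERIV_real_sqrt, use r in auto)
    from DERIV_cmult[OF DERIV_chain2[OF DERIV_arctan this], of "2 * sqrt d"]
    have der: "((%r. 2 * sqrt d*arctan (sqrt (r/d))) has_real_derivative
    2 * sqrt d*(inverse (1+(sqrt r/sqrt d)^2)*(inverse (sqrt r)/2/sqrt d))) (at r)" unfolding real_sqrt_divide .
    have e1: "2*a*(b*(c/2/a)) = b*c" if "a ~= 0" for a b c :: real using that by simp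
    have e2: "(sqrt r/sqrt d)^2 = r/d" using r d by(simp add: power_divide)
    have e3: "1+r/d = (r+d)/d" using d by(simp add: field_simps)
    have "2 * sqrt d*(inverse (1+(sqrt r/sqrt d)^2)*(inverse (sqrt r)/2/sqrt d))
    = inverse ((r+d)/d)*inverse (sqrt r)" unfolding e2 e3 by(rule e1) (use d in simp)
    also have "... = d/(sqrt r*(r+d))" by(simp add: divide_inverse)
    finally have "((%r. 2 * sqrt d*arctan (sqrt (r/d))) has_real_derivative d/(sqrt r*(r+d))) (at r)" using der by simp
    thus "((%r. 4*?K*(2 * sqrt d*arctan (sqrt (r/d)))) has_real_derivative
    4*?K*(d/(sqrt r*(r+d)))) (at r)" by(rule DERIV_cmult)
    show "norm (?psi r z-?psi r w) <= 4*?K*(d/(sqrt r*(r+d)))" proof(cases "r <= d")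
    case True
    have "norm (?psi r z-?psi r w) <= ?K/sqrt r+?K/sqrt r" using b1[OF r(1), of z] b1[OF r(1), of w] norm_triangle_ineq4[of "?psi r z" "?psi r w"] by linarith
    also have "... = 4*?K*(1/(2 * sqrt r))" using r by(simp add: field_simps)
    also have "... <= 4*?K*(d/(sqrt r*(r+d)))" proof(rule mono_l)
    have "(1/sqrt r)*(1/2) <= (1/sqrt r)*(d/(r+d))" using True r d by(intro mono_l) (auto simp: pos_le_divide_eq)
    thus "1/(2 * sqrt r) <= d/(sqrt r*(r+d))" by(simp add: mult.commute)
    qed (use K0 in simp)
    finally show ?thesis .
    next
    case False
    have "norm (?psi r z-?psi r w) <= 2*(?K/(r * sqrt r))*d" using b3[OF r(1), of z w] by(simp add: d_def)
    also have "... = 4*?K*(d/(2*r * sqrt r))" using r by(simp add: field_simps)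
    also have "... <= 4*?K*(d/(sqrt r*(r+d)))" proof(rule mono_l)
    have "(d/sqrt r)*(1/(2*r)) <= (d/sqrt r)*(1/(r+d))" using False r d by(intro mono_l) (auto intro!: divide_left_mono)
    thus "d/(2*r * sqrt r) <= d/(sqrt r*(r+d))" by(simp add: mult.commute)
    qed (use K0 in simp)
    finally show ?thesis .
    qed
    qed
    also have "... <= 4*?K*(2 * sqrt d*(pi/2))" proof -
    have "4*?K*(2 * sqrt d*arctan (sqrt (1/d))) <= 4*?K*(2 * sqrt d*(pi/2))" using K0 d arctan_ubound[of "sqrt (1/d)"] by(intro mono_l) auto
    thus ?thesis by simp
    qed
    also have "... = (4*(108*M)*pi)*B * sqrt d" by simp
    also have "... <= C*B * sqrt d" using C(3) B0 d by(intro mono_r) auto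
    finally show ?thesis by(simp add: d_def)
    qed simp
   qed
  qed
  show ?thesis using H0 H1 by blast
 qed
 thus ?thesis using C(4) by blast
qed

text \<open>The rotation field i eta is divergence free and annihilates the radial weight, so a
  rotational derivative integrates to 0 against it. The identity is assembled from the integrals of
  two partial derivatives, each of which vanishes.\<close>

lemma integral_omg_rotation:
 assumes "Ck_on (Suc 0) g UNIV" "r > 0" shows "integral bx (%et. omg et*.pd (\<i>*et) g (z-of_real r*et)) = (0 :: C2)"
proof -
 let ?h = "%et. g (z-of_real r*et)"
 have h: "(?h has_derivative (%v. - (r*.pd v g (z-of_real r*et)))) (at et)" for et by(rule has_derivative_rescale[OF assms(1)])
 have o1: "Ck_on (Suc 0) omg UNIV" using Ck_mono[OF Ck_omg] by simp
 have o: "(omg has_derivative (%v. pd v omg et)) (at et)" for et by(rule Ck_deriv[OF o1 UNIV_I])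
 have C1: "Ck_on (Suc 0) (%et. (et.*a * omg et)*.?h et) UNIV" for a by(rule Ck_scaleR[OF open_UNIV Ck_mult[OF open_UNIV Ck_bl[OF bounded_linear_inner_left] o1]
    Ck_rescale[OF assms(1)]])
 have zero: "integral bx (pd v (%et. (et.*a * omg et)*.?h et)) = 0" for v a by(rule integral_pd_zero[OF C1]) (simp add: omg_zero)
 have eq: "pd v (%et. (et.*a * omg et)*.?h et) et = - (r*(et.*a) * omg et)*.pd v g (z-of_real r*et)
   + ((v.*a) * omg et+(et.*a)*pd v omg et)*.?h et" for v a et proof(rule pd_eq)
  have "((%et. et.*a * omg et) has_derivative (%v. et.*a*pd v omg et+(v.*a) * omg et)) (at et)" by(rule has_derivative_mult[OF _ o]) (auto intro!: derivative_eq_intros)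
  from has_derivative_scaleR[OF this h]
  show "((%et. (et.*a * omg et)*.?h et) has_derivative (%v. - (r*(et.*a) * omg et)*.pd v g (z-of_real r*et)
   + ((v.*a) * omg et+(et.*a)*pd v omg et)*.?h et)) (at et)" by(rule has_derivative_eq_rhs) (simp add: fun_eq_iff algebra_simps)
 qed
 have int: "pd v (%et. (et.*a * omg et)*.?h et) integrable_on bx" for v a by(rule int_cont[OF cont_sub[OF continuous_pd[OF C1]]]) simp
 have rad: "pd \<i> omg et*Re et-pd 1 omg et*Im et = 0" for et proof -
  have "pd (\<i>*et) omg et = (SUM i:Basis. ((\<i>*et).*i)*.pd i omg et)" by(rule pd_Basis) (rule differentiableI[OF o])
  thus ?thesis by(simp add: pd_omg_radial Basis_complex_def algebra_simps)
 qed
 have lin: "pd (\<i>*et) g y = Re et*.pd \<i> g y-Im et*.pd 1 g y" for et y using pd_Basis[OF differentiableI[OF Ck_deriv[OF assms(1) UNIV_I]], of "\<i>*et" y]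
  by(simp add: Basis_complex_def)
 have "0 = integral bx (%et. pd \<i> (%et. (et.*1 * omg et)*.?h et) et-pd 1 (%et. (et.*\<i> * omg et)*.?h et) et)" unfolding integral_diff[OF int int] zero by simp
 also have "... = integral bx (%et. (- r)*.(omg et*.pd (\<i>*et) g (z-of_real r*et)))" proof(rule integral_cong)
  fix et
  have "pd \<i> (%et. (et.*1 * omg et)*.?h et) et-pd 1 (%et. (et.*\<i> * omg et)*.?h et) et
   = (- r)*.(omg et*.pd (\<i>*et) g (z-of_real r*et))
    + (pd \<i> omg et*Re et-pd 1 omg et*Im et)*.?h et" unfolding eq lin by(simp add: algebra_simps)
  thus "pd \<i> (%et. (et.*1 * omg et)*.?h et) et-pd 1 (%et. (et.*\<i> * omg et)*.?h et) et
   = (- r)*.(omg et*.pd (\<i>*et) g (z-of_real r*et))" by(simp add: rad)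
 qed
 also have "... = (- r)*.integral bx (%et. omg et*.pd (\<i>*et) g (z-of_real r*et))" by(rule integral_cmul)
 finally show ?thesis using assms(2) by simp
qed

text \<open>The product cnj eta (g_x + i g_y) is the derivative of \<open>g\<close> along eta plus i
  times its derivative along i eta, and the latter integrates to 0 by rotation invariance. The
  former is minus the r-derivative of the weighted integral of g (z - r eta), so the integral over
  the scales telescopes. At r = 0 it yields c0 g z, and at r = 1 all points of nonzero weight lie
  outside the support of \<open>g\<close>.\<close>

lemma TT_dbar:
 assumes "sm g UNIV" and supp: "!!xi. norm xi >= 1/2 ==> g xi = 0" and z: "norm z < 1/2" shows "pd 1 (TT g) z+cmul \<i> (pd \<i> (TT g) z) = c0*.g z"
proof -
 have gk: "Ck_on k g UNIV" for k by(rule sm_Ck[OF assms(1)])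
 have lin: "pd w g y = Re w*.pd 1 g y+Im w*.pd \<i> g y" for w y using pd_Basis[OF sm_dif[OF assms(1) UNIV_I], of w y] by(simp add: Basis_complex_def)
 let ?A = "%r. integral bx (%et. omg et*.g (z-of_real r*et))"
 let ?D = "%r. integral bx (%et. omg et*.pd et g (z-of_real r*et))"
 have comg: "continuous_on S omg" for S using Ck_cont[OF Ck_omg] cont_sub by blast
 have cg: "continuous_on UNIV g" "continuous_on UNIV (pd v g)" for v using sm_cont sm_pd assms(1) by blast+
 have cS: "continuous_on S (%x. pd v g (fi x))" if "continuous_on S fi" for S :: "'x::topological_space set" and fi v by(rule cont_comp[OF cg(2) that]) auto
 have cS2: "continuous_on S (%x. pd (w x) g (fi x))" if "continuous_on S w" "continuous_on S fi"
  for S :: "'x::topological_space set" and fi w proof -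
  have "(%x. pd (w x) g (fi x)) = (%x. Re (w x)*.pd 1 g (fi x)+Im (w x)*.pd \<i> g (fi x))" by(rule ext) (rule lin)
  thus ?thesis by(simp only:) (intro continuous_intros that cS)
 qed
 have dA: "(?A has_derivative (%s. integral bx (%et. omg et*.pd (- (s*.et)) g (z-of_real r*et)))) (at r)" for r proof(rule param_integral_deriv)
  fix r et
  have "((%r. z-of_real r*et) has_derivative (%s. - (s*.et))) (at r)" by(auto intro!: derivative_eq_intros simp: scaleR_conv_of_real)
  from deriv_comp[OF this Ck_deriv[OF gk UNIV_I]]
  have "((%r. g (z-of_real r*et)) has_derivative (%s. pd (- (s*.et)) g (z-of_real r*et))) (at r)" .
  thus "((%r. omg et*.g (z-of_real r*et)) has_derivative (%s. omg et*.pd (- (s*.et)) g (z-of_real r*et))) (at r)" by(rule has_derivative_scaleR_right)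
 next
  show "continuous_on bx (%et. omg et*.g (z-of_real r*et))" for r :: real by(intro continuous_intros comg cont_comp[OF cg(1)]) auto
  show "continuous_on (UNIV \<times> bx) (%(r, et). omg et*.pd (- (s*.et)) g (z-of_real r*et))" for s unfolding split_beta
   by(intro continuous_intros cS2 cont_comp[OF comg]) auto
 qed
 have dA': "(?A has_vector_derivative-?D r) (at r within {0..1})" for r proof -
  have "integral bx (%et. omg et*.pd (- (s*.et)) g (z-of_real r*et)) = s*.(- ?D r)" for s proof -
   have "omg et*.pd (- (s*.et)) g y = (- s)*.(omg et*.pd et g y)" for et y unfolding lin[of "- (s*.et)"] lin[of et] by(simp add: algebra_simps)
   hence "integral bx (%et. omg et*.pd (- (s*.et)) g (z-of_real r*et))
    = integral bx (%et. (- s)*.(omg et*.pd et g (z-of_real r*et)))" by simp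
   also have "... = (- s)*.?D r" by(rule integral_cmul)
   finally show ?thesis by simp
  qed
  thus ?thesis using dA[of r] unfolding has_vector_derivative_def by(simp add: has_derivative_at_withinI)
 qed
 have hi: "((%r. - ?D r) has_integral (?A 1-?A 0)) {0..1}" by(rule fundamental_theorem_of_calculus[OF _ dA']) simp
 have A0: "?A 0 = c0*.g z" proof -
  have "?A 0 = integral bx (%et. omg et*.g z)" by simp
  also have "... = integral bx omg*.g z" using has_integral_scaleR_left[OF integrable_integral[OF int_cont[OF comg]]] by(rule integral_unique)
  finally show ?thesis by(simp add: c0_def)
 qed
 have A1: "?A 1 = 0" proof -
  have "omg et*.g (z-of_real 1*et) = 0" for et proof(cases "norm et <= 1")
   case False
   hence "norm (z-et) >= 1/2" using z norm_triangle_ineq3[of z et] by linarith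
   thus ?thesis using supp by simp
  qed (simp add: omg_zero)
  hence "(%et. omg et*.g (z-of_real 1*et)) = (%et. 0)" by(rule ext)
  thus ?thesis by(simp only: integral_0)
 qed
 have ci: "(%r. conv kk (pd v g) r z) integrable_on {0..1}" for v by(rule integrable_continuous_interval[OF continuous_conv_r[OF kk_cont cg(2)]])
 have ci2: "(%r. cmul \<i> (conv kk (pd v g) r z)) integrable_on {0..1}" for v using integrable_linear[OF ci bl_cmul] by(simp add: o_def)
 have "pd 1 (TT g) z+cmul \<i> (pd \<i> (TT g) z)
   = integral {0..1} (%r. conv kk (pd 1 g) r z)+cmul \<i> (integral {0..1} (%r. conv kk (pd \<i> g) r z))" by(simp add: pd_TT[OF assms(1)] TT_def)
 also have "... = integral {0..1} (%r. conv kk (pd 1 g) r z+cmul \<i> (conv kk (pd \<i> g) r z))"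
  using integral_linear[OF ci bl_cmul, of \<i>] by(simp add: o_def integral_add[OF ci ci2])
 also have "... = integral {0..1} ?D" proof(rule integral_spike)
  show "negligible {0::real}" by simp
  fix r :: real assume r: "r : {0..1} - {0}"
  hence "r > 0" by simp
  have i1: "(%et. omg et*.pd et g (z-of_real r*et)) integrable_on bx" "(%et. omg et*.pd (\<i>*et) g (z-of_real r*et)) integrable_on bx"
   by(intro int_cont continuous_intros comg cS2)+
  hence i2: "(%et. cmul \<i> (omg et*.pd (\<i>*et) g (z-of_real r*et))) integrable_on bx" using integrable_linear[OF i1(2) bl_cmul] by(simp add: o_def)
  have j: "(%et. cmul (kk et) (pd v g (z-of_real r*et))) integrable_on bx" for v by(rule int_cont[OF conv_cont[OF kk_cont cg(2)]])
  have j2: "(%et. cmul \<i> (cmul (kk et) (pd v g (z-of_real r*et)))) integrable_on bx" for v using integrable_linear[OF j bl_cmul] by(simp add: o_def)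
  have "conv kk (pd 1 g) r z+cmul \<i> (conv kk (pd \<i> g) r z)
    = integral bx (%et. cmul (kk et) (pd 1 g (z-of_real r*et))+cmul \<i> (cmul (kk et) (pd \<i> g (z-of_real r*et))))"
   unfolding conv_def using integral_linear[OF j bl_cmul, of \<i>] by(simp only: o_def integral_add[OF j j2])
  also have "... = integral bx (%et. omg et*.pd et g (z-of_real r*et)+cmul \<i> (omg et*.pd (\<i>*et) g (z-of_real r*et)))" proof(rule integral_cong)
   fix et
   have "cmul (kk et) a+cmul \<i> (cmul (kk et) b) = omg et*.(Re et*.a+Im et*.b)
    + cmul \<i> (omg et*.(Re (\<i>*et)*.a+Im (\<i>*et)*.b))" for a b by(simp add: cmul_def kk_def prod_eq_iff complex_eq_iff algebra_simps)
   thus "cmul (kk et) (pd 1 g (z-of_real r*et))+cmul \<i> (cmul (kk et) (pd \<i> g (z-of_real r*et)))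
    = omg et*.pd et g (z-of_real r*et)+cmul \<i> (omg et*.pd (\<i>*et) g (z-of_real r*et))" unfolding lin[of et] lin[of "\<i>*et"] .
  qed
  also have "... = ?D r+cmul \<i> (integral bx (%et. omg et*.pd (\<i>*et) g (z-of_real r*et)))" using integral_linear[OF i1(2) bl_cmul, of \<i>]
   by(simp only: o_def integral_add[OF i1(1) i2])
  also have "integral bx (%et. omg et*.pd (\<i>*et) g (z-of_real r*et)) = 0" by(rule integral_omg_rotation[OF gk `r > 0`])
  finally show "?D r = conv kk (pd 1 g) r z+cmul \<i> (conv kk (pd \<i> g) r z)" by simp
 qed
 also have "... = c0*.g z" using has_integral_neg[OF hi] A0 A1 by(simp add: integral_unique)
 finally show ?thesis .
qed

subsection \<open>Hoelder norms of higher order\<close>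

text \<open>A bound in the Hoelder space C^(n,1/2): partial derivatives in \<open>x\<close> and
  \<open>y\<close> up to order \<open>n\<close> share the bound \<open>B\<close>.\<close>

primrec HbN :: "nat => (complex => 'b::real_normed_vector) => real => bool" where "HbN 0 f B = Hb f B"
| "HbN (Suc n) f B = (Hb f B & HbN n (pd 1 f) B & HbN n (pd \<i> f) B)"

lemma HbN_Hb: "HbN n f B ==> Hb f B" by(cases n) auto

lemma HbN_nonneg: "HbN n f B ==> B >= 0" using HbN_Hb Hb_nonneg by blast

lemma HbN_pd: "HbN (Suc n) f B ==> v : {1, \<i>} ==> HbN n (pd v f) B" by auto

lemma HbN_SucI: "Hb f B ==> (!!v. v : {1, \<i>} ==> HbN n (pd v f) B) ==> HbN (Suc n) f B" by simp

declare HbN.simps(2) [simp del]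

lemma HbN_SucD: "HbN (Suc n) f B ==> HbN n f B"
proof(induction n arbitrary: f)
 case (Suc n)
 show ?case by(rule HbN_SucI[OF HbN_Hb[OF Suc.prems]]) (rule Suc.IH[OF HbN_pd[OF Suc.prems]])
qed (simp add: HbN.simps)

lemma HbN_le: "HbN n f B ==> m <= n ==> HbN m f B" by(induction n) (auto simp: le_Suc_eq dest: HbN_SucD)

lemma Hb_mono: "Hb f B ==> B <= C ==> Hb f C" unfolding Hb_def by(meson mono_r order_trans real_sqrt_ge_zero norm_ge_zero)

lemma HbN_mono: "HbN n f B ==> B <= C ==> HbN n f C" by(induction n arbitrary: f) (auto intro: Hb_mono simp: HbN.simps(2))

lemma Hb_add:
 assumes "Hb f B" "Hb g C" shows "Hb (%z. f z+g z) (B+C)" unfolding Hb_def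
proof(intro conjI allI)
 fix z w
 show "norm (f z+g z) <= B+C" using HbD(1)[OF assms(1), of z] HbD(1)[OF assms(2), of z] tri_ineq[of "f z" "g z"] by linarith
 have "norm (f z+g z-(f w+g w)) <= norm (f z-f w)+norm (g z-g w)" by(rule norm_diff_triangle_ineq)
 thus "norm (f z+g z-(f w+g w)) <= (B+C) * sqrt (norm (z-w))" using HbD(2)[OF assms(1), of z w] HbD(2)[OF assms(2), of z w] by(simp add: algebra_simps)
qed

lemma pd_add: "f differentiable (at x) ==> g differentiable (at x) ==> pd v (%z. f z+g z) x = pd v f x+pd v g x" by(rule pd_eq) (intro has_derivative_add hd_pd)

lemma pd_minus: "f differentiable (at x) ==> pd v (%z. - f z) x = - pd v f x" by(rule pd_eq) (intro has_derivative_minus hd_pd)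

lemma pd_diff: "f differentiable (at x) ==> g differentiable (at x) ==> pd v (%z. f z-g z) x = pd v f x-pd v g x" by(rule pd_eq) (intro has_derivative_diff hd_pd)

lemma pd_bilinear:
 assumes "bounded_bilinear pr" "f differentiable (at x)" "g differentiable (at x)" shows "pd v (%z. pr (f z) (g z)) x = pr (f x) (pd v g x)+pr (pd v f x) (g x)"
 by(rule pd_eq) (intro bounded_bilinear.FDERIV[OF assms(1)] hd_pd assms)

lemma pd_sum: "(!!i. i : I ==> f i differentiable (at x)) ==> pd v (%z. SUM i:I. f i z) x = (SUM i:I. pd v (f i) x)" by(rule pd_eq) (intro has_derivative_sum hd_pd)

lemma HbN_add:
 assumes "sm f UNIV" "sm g UNIV" "HbN n f B" "HbN n g C" shows "HbN n (%z. f z+g z) (B+C)" using assms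
proof(induction n arbitrary: f g)
 case (Suc n)
 have eq: "pd v (%z. f z+g z) = (%z. pd v f z+pd v g z)" for v by(rule ext) (intro pd_add sm_dif[OF Suc.prems(1)] sm_dif[OF Suc.prems(2)] UNIV_I)
 show ?case by(rule HbN_SucI[OF Hb_add[OF HbN_Hb HbN_Hb, OF Suc.prems(3,4)]], unfold eq,
    rule Suc.IH[OF sm_pd sm_pd HbN_pd HbN_pd, OF Suc.prems(1,2,3) _ Suc.prems(4)])
qed (simp add: Hb_add)

lemma Hb_linear:
 assumes "bounded_linear L" "!!x. norm (L x) <= K*norm x" "Hb f B" "K >= 0" shows "Hb (%z. L (f z)) (K*B)" unfolding Hb_def
proof(intro conjI allI)
 fix z w
 show "norm (L (f z)) <= K*B" using assms(2)[of "f z"] mono_l[OF HbD(1)[OF assms(3), of z] assms(4)] by linarith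
 have "norm (L (f z)-L (f w)) <= K*norm (f z-f w)" using assms(2)[of "f z-f w"] by(simp add: linear_diff[OF bounded_linear.linear[OF assms(1)]])
 also have "... <= K*(B * sqrt (norm (z-w)))" by(intro mono_l HbD(2) assms)
 finally show "norm (L (f z)-L (f w)) <= K*B * sqrt (norm (z-w))" by simp
qed

lemma HbN_linear:
 assumes "bounded_linear L" "!!x. norm (L x) <= K*norm x" "K >= 0" "sm f UNIV" "HbN n f B" shows "HbN n (%z. L (f z)) (K*B)" using assms(4,5)
proof(induction n arbitrary: f)
 case (Suc n)
 have eq: "pd v (%z. L (f z)) = (%z. L (pd v f z))" for v by(rule ext) (intro pd_lin assms sm_dif[OF Suc.prems(1)] UNIV_I)
 show ?case by(rule HbN_SucI[OF Hb_linear[OF assms(1,2) HbN_Hb[OF Suc.prems(2)] assms(3)]], unfold eq,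
    rule Suc.IH[OF sm_pd[OF Suc.prems(1)] HbN_pd[OF Suc.prems(2)]])
qed (simp add: Hb_linear assms)

lemma HbN_minus: "sm f UNIV ==> HbN n f B ==> HbN n (%z. - f z) B" using HbN_linear[OF bounded_linear_minus[OF bounded_linear_ident], of 1 f n B] by simp

lemma sm_minus: "open S ==> sm f S ==> sm (%x. - f x) S" by(simp add: smooth_on_def Ck_minus)

lemma HbN_diff: "sm f UNIV ==> sm g UNIV ==> HbN n f B ==> HbN n g C ==> HbN n (%z. f z-g z) (B+C)" using HbN_add[of f "%z. - g z" n B C] by(simp add: HbN_minus sm_minus)

lemma Hb_bilinear:
 assumes "bounded_bilinear pr" "!!x y. norm (pr x y) <= norm x*norm y" "Hb f B" "Hb g C" shows "Hb (%z. pr (f z) (g z)) (2*(B*C))" unfolding Hb_def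
proof(intro conjI allI)
 fix z w
 have B: "B >= 0" and C: "C >= 0" using Hb_nonneg assms(3,4) by auto
 have "norm (pr (f z) (g z)) <= B*C" using assms(2)[of "f z" "g z"] mult_mono[OF HbD(1)[OF assms(3)] HbD(1)[OF assms(4)] B norm_ge_zero, of z z] by linarith
 moreover have "B*C >= 0" using B C by simp
 ultimately show "norm (pr (f z) (g z)) <= 2*(B*C)" by linarith
 have "pr (f z) (g z)-pr (f w) (g w) = pr (f z-f w) (g z)+pr (f w) (g z-g w)"
  by(simp add: bounded_bilinear.diff_left[OF assms(1)] bounded_bilinear.diff_right[OF assms(1)])
 hence "norm (pr (f z) (g z)-pr (f w) (g w)) <= norm (f z-f w)*norm (g z)+norm (f w)*norm (g z-g w)"
  using assms(2) by(metis (no_types, opaque_lifting) add_mono norm_triangle_le)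
 also have "... <= (B * sqrt (norm (z-w)))*C+B*(C * sqrt (norm (z-w)))" using B C by(intro add_mono mult_mono HbD[OF assms(3)] HbD[OF assms(4)]) auto
 finally show "norm (pr (f z) (g z)-pr (f w) (g w)) <= 2*(B*C) * sqrt (norm (z-w))" by(simp add: algebra_simps)
qed

lemma sm_bilinear: "bounded_bilinear pr ==> open S ==> sm f S ==> sm g S ==> sm (%x. pr (f x) (g x)) S" by(simp add: smooth_on_def Ck_bilinear)

lemma HbN_bilinear:
 assumes "bounded_bilinear pr" "!!x y. norm (pr x y) <= norm x*norm y" and "sm f UNIV" "sm g UNIV" "HbN n f B" "HbN n g C"
 shows "HbN n (%z. pr (f z) (g z)) (2^Suc n*(B*C))" using assms(3-)
proof(induction n arbitrary: f g)
 case 0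
 thus ?case using Hb_bilinear[OF assms(1,2)] by simp
next
 case (Suc n)
 have B: "B >= 0" and C: "C >= 0" using HbN_nonneg Suc.prems by auto
 have eq: "pd v (%z. pr (f z) (g z)) = (%z. pr (f z) (pd v g z)+pr (pd v f z) (g z))" for v
  by(rule ext) (intro pd_bilinear[OF assms(1)] sm_dif[OF Suc.prems(1)] sm_dif[OF Suc.prems(2)] UNIV_I)
 show ?case proof(rule HbN_SucI)
  have "(2::real)^Suc 0 <= 2^Suc (Suc n)" by(rule power_increasing) auto
  hence "(2::real)*(B*C) <= 2^Suc (Suc n)*(B*C)" using B C by(intro mono_r) auto
  thus "Hb (%z. pr (f z) (g z)) (2^Suc (Suc n)*(B*C))" using Hb_mono[OF Hb_bilinear[OF assms(1,2) HbN_Hb HbN_Hb, OF Suc.prems(3,4)]] by blast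
  fix v :: complex assume v: "v : {1, \<i>}"
  have "HbN n (%z. pr (f z) (pd v g z)+pr (pd v f z) (g z)) (2^Suc n*(B*C)+2^Suc n*(B*C))"
   by(intro HbN_add Suc.IH sm_bilinear[OF assms(1)] open_UNIV sm_pd Suc.prems HbN_SucD[OF Suc.prems(3)]
    HbN_SucD[OF Suc.prems(4)] HbN_pd[OF Suc.prems(3) v] HbN_pd[OF Suc.prems(4) v])
  moreover have "2^Suc n*(B*C)+2^Suc n*(B*C) = 2^Suc (Suc n)*(B*C)" by simp
  ultimately show "HbN n (pd v (%z. pr (f z) (g z))) (2^Suc (Suc n)*(B*C))" unfolding eq by(simp only:)
 qed
qed

lemma HbN_sum:
 fixes f :: "'i => complex => 'b::real_normed_vector"
 assumes "finite I" "!!i. i : I ==> sm (f i) UNIV" "!!i. i : I ==> HbN n (f i) B" shows "HbN n (%z. SUM i:I. f i z) (real (card I)*B)" using assms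
proof(induction I rule: finite_induct)
 case empty
 have "HbN n (%z::complex. 0::'b) 0" proof(induction n)
  case (Suc n)
  have "pd v (%z::complex. 0::'b) = (%z. 0)" for v by(rule ext) (rule pd_eq[OF has_derivative_const])
  thus ?case using Suc by(simp add: Hb_def HbN.simps(2))
 qed (simp add: Hb_def)
 thus ?case by simp
next
 case (insert i I)
 have "HbN n (%z. f i z+(SUM i:I. f i z)) (B+real (card I)*B)" using insert by(intro HbN_add sm_sum) auto
 thus ?case using insert by(simp add: algebra_simps)
qed

text \<open>\<open>TT\<close> commutes with differentiation, so that one constant serves all orders
  \<open>n\<close>. The convergence of the iteration below in every order rests on this
  uniformity.\<close>

lemma TT_HbN: "EX C>0. ! n g B. sm g UNIV --> HbN n g B -->
   HbN n (TT g) (C*B) & (! v:{1, \<i>}. HbN n (pd v (TT g)) (C*B))"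
proof -
 obtain C where C: "C > 0" and H: "!!g B. sm g UNIV ==> Hb g B ==>
   Hb (TT g) (C*B) & (! v:{1, \<i>}. Hb (pd v (TT g)) (C*B))" using TT_Hb by blast
 have 1: "HbN n (TT g) (C*B)" if "sm g UNIV" "HbN n g B" for n g B using that proof(induction n arbitrary: g)
  case 0 thus ?case using H by simp
 next
  case (Suc n)
  show ?case by(rule HbN_SucI) (use H[OF Suc.prems(1) HbN_Hb[OF Suc.prems(2)]] in
    \<open>auto simp: pd_TT[OF Suc.prems(1)] intro!: Suc.IH sm_pd Suc.prems HbN_pd[OF Suc.prems(2)]\<close>)
 qed
 have 2: "HbN n (pd v (TT g)) (C*B)" if "sm g UNIV" "HbN n g B" "v : {1, \<i>}" for n g B v using that(1,2) proof(induction n arbitrary: g)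
  case 0 thus ?case using H[OF 0(1), of B] that(3) by auto
 next
  case (Suc n)
  have eq: "pd w (pd v (TT g)) = pd v (TT (pd w g))" for w proof -
   have "pd w (pd v (TT g)) = pd v (pd w (TT g))" by(rule ext) (rule pd_symmetric_smooth[OF open_UNIV UNIV_I sm_TT[OF Suc.prems(1)]])
   thus ?thesis by(simp add: pd_TT[OF Suc.prems(1)])
  qed
  show ?case by(rule HbN_SucI) (use H[OF Suc.prems(1) HbN_Hb[OF Suc.prems(2)]] that(3) in
    \<open>auto simp: eq intro!: Suc.IH sm_pd Suc.prems HbN_pd[OF Suc.prems(2)]\<close>)
 qed
 show ?thesis using C 1 2 by blast
qed

section \<open>Composition with functions whose derivatives are bounded\<close>

primrec Qb :: "nat => ('e::euclidean_space => 'f::real_normed_vector) => real => 'e set => bool" where "Qb 0 Q M S = (! x:S. norm (Q x) <= M)"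
| "Qb (Suc n) Q M S = ((! x:S. norm (Q x) <= M) & (! i:Basis. Qb n (pd i Q) M S))"

lemma Qb_norm: "Qb n Q M S ==> x : S ==> norm (Q x) <= M" by(cases n) auto

lemma Qb_pd: "Qb (Suc n) Q M S ==> i : Basis ==> Qb n (pd i Q) M S" by simp

declare Qb.simps(2) [simp del]

lemma Qb_SucI: "(!!x. x : S ==> norm (Q x) <= M) ==> (!!i. i : Basis ==> Qb n (pd i Q) M S) ==> Qb (Suc n) Q M S" by(simp add: Qb.simps(2))

lemma Qb_SucD: "Qb (Suc n) Q M S ==> Qb n Q M S"
proof(induction n arbitrary: Q)
 case (Suc n)
 show ?case proof(rule Qb_SucI)
  show "norm (Q x) <= M" if "x : S" for x by(rule Qb_norm[OF Suc.prems that])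
  show "Qb n (pd i Q) M S" if "i : Basis" for i by(rule Suc.IH[OF Qb_pd[OF Suc.prems that]])
 qed
qed (simp add: Qb.simps)

lemma Qb_pd_bound:
 fixes Q :: "'e::euclidean_space => 'f::real_normed_vector"
 assumes "Qb (Suc n) Q M S" "x : S" "Q differentiable (at x)" shows "norm (pd h Q x) <= real (DIM('e))*M*norm h"
proof -
 have "norm (pd h Q x) <= (SUM i:Basis. norm ((h.*i)*.pd i Q x))" unfolding pd_Basis[OF assms(3), of h] by(rule norm_sum)
 also have "... <= (SUM i:(Basis::'e set). norm h*M)" using Qb_norm[OF Qb_pd[OF assms(1)] assms(2)] by(intro sum_mono) (simp add: Basis_le_norm mult_mono)
 finally show ?thesis by(simp add: mult_ac)
qed

lemma Qb_lipschitz: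
 fixes Q :: "'e::euclidean_space => 'f::real_normed_vector"
 assumes "Qb (Suc n) Q M S" "convex S" "!!x. x : S ==> Q differentiable (at x)" "x : S" "y : S" shows "norm (Q x-Q y) <= real (DIM('e))*M*norm (x-y)"
proof(rule differentiable_bound[OF assms(2) _ _ assms(4,5)])
 show "(Q has_derivative (%h. pd h Q x)) (at x within S)" if "x : S" for x using hd_pd[OF assms(3)[OF that]] has_derivative_at_withinI by blast
 show "onorm (%h. pd h Q x) <= real (DIM('e))*M" if "x : S" for x by(rule onorm_le) (rule Qb_pd_bound[OF assms(1) that assms(3)[OF that]])
qed

lemma pd_compose:
 fixes Q :: "'e::euclidean_space => 'f::real_normed_vector"
 assumes "u differentiable (at z)" "Q differentiable (at (u z))" shows "pd v (%z. Q (u z)) z = (SUM i:Basis. (pd v u z.*i)*.pd i Q (u z))"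
proof -
 have "pd v (%z. Q (u z)) z = pd (pd v u z) Q (u z)" by(rule pd_eq[OF deriv_comp[OF hd_pd hd_pd]]) (use assms in auto)
 also have "... = (SUM i:Basis. (pd v u z.*i)*.pd i Q (u z))" by(rule pd_Basis[OF assms(2)])
 finally show ?thesis .
qed

lemma HbN_inner: "i : Basis ==> sm f UNIV ==> HbN n f B ==> HbN n (%z. f z.*i) B" using HbN_linear[OF bounded_linear_inner_left, of i 1 f n B] by(simp add: Basis_le_norm)

lemma sm_inner: "open S ==> sm f S ==> sm (%x. f x.*i) S" by(simp add: smooth_on_def Ck_inner)

lemma HbN_compose:
 fixes dummy :: "'e::euclidean_space \<times> 'f::real_normed_vector" and B :: real
 assumes "B >= 0" shows "EX K>0. ! S (Q :: 'e => 'f) M u. open S --> convex S --> sm Q S --> Qb (Suc n) Q M S -->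
   sm u UNIV --> (! z. u z : S) --> HbN n u B --> HbN n (%z. Q (u z)) (K*M)"
proof(induction n)
 case 0
 show ?case proof(intro exI[of _ "1+real (DIM('e))*B"] conjI allI impI)
  show "1+real (DIM('e))*B > 0" using assms by(simp add: add_pos_nonneg)
  fix S and Q :: "'e => 'f" and M and u :: "complex => 'e"
  assume a: "open S" "convex S" "sm Q S" "Qb (Suc 0) Q M S" "sm u UNIV" "! z. u z : S" "HbN 0 u B"
  have M: "M >= 0" using Qb_norm[OF a(4), of "u 0"] a(6) norm_ge_zero order_trans by blast
  show "HbN 0 (%z. Q (u z)) ((1+real (DIM('e))*B)*M)" unfolding HbN.simps Hb_def proof(intro conjI allI)
   fix z w
   have "norm (Q (u z)) <= M" using Qb_norm[OF a(4)] a(6) by blast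
   moreover have "real (DIM('e))*B*M >= 0" using assms M by simp
   ultimately show "norm (Q (u z)) <= (1+real (DIM('e))*B)*M" by(simp add: algebra_simps)
   have "norm (Q (u z)-Q (u w)) <= real (DIM('e))*M*norm (u z-u w)" using a(6) by(intro Qb_lipschitz[OF a(4,2)] sm_dif[OF a(3)]) auto
   also have "... <= real (DIM('e))*M*(B * sqrt (norm (z-w)))" using a(7) M by(intro mono_l HbD(2)) auto
   also have "... <= (1+real (DIM('e))*B)*M * sqrt (norm (z-w))" using M by(simp add: algebra_simps)
   finally show "norm (Q (u z)-Q (u w)) <= (1+real (DIM('e))*B)*M * sqrt (norm (z-w))" .
  qed
 qed
next
 case (Suc n)
 then obtain K where K: "K > 0" and IH: "!!S (Q :: 'e => 'f) M u. open S ==> convex S ==> sm Q S ==>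
   Qb (Suc n) Q M S ==> sm u UNIV ==> (!!z. u z : S) ==> HbN n u B ==> HbN n (%z. Q (u z)) (K*M)" by blast
 define K' where "K' = K+real (DIM('e))*2^Suc n*B*K"
 show ?case proof(intro exI[of _ K'] conjI allI impI)
  show "K' > 0" using assms K by(simp add: K'_def add_pos_nonneg)
  fix S and Q :: "'e => 'f" and M and u :: "complex => 'e"
  assume a: "open S" "convex S" "sm Q S" "Qb (Suc (Suc n)) Q M S" "sm u UNIV" "! z. u z : S" "HbN (Suc n) u B"
  have M: "M >= 0" using Qb_norm[OF a(4), of "u 0"] a(6) norm_ge_zero order_trans by blast
  have u: "!!z. u z : S" using a(6) by blast
  have eq: "pd v (%z. Q (u z)) = (%z. SUM i:Basis. (pd v u z.*i)*.pd i Q (u z))" for v by(rule ext) (intro pd_compose sm_dif[OF a(5)] sm_dif[OF a(3)] UNIV_I u)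
  have sm: "sm (%z. pd i Q (u z)) UNIV" for i by(rule sm_comp[OF open_UNIV a(1) sm_pd[OF a(3)] a(5) u])
  show "HbN (Suc n) (%z. Q (u z)) (K'*M)" proof(rule HbN_SucI)
   have "HbN n (%z. Q (u z)) (K*M)" by(rule IH[OF a(1-3) Qb_SucD[OF a(4)] a(5) u HbN_SucD[OF a(7)]])
   thus "Hb (%z. Q (u z)) (K'*M)" using assms K M by(intro Hb_mono[OF HbN_Hb]) (auto simp: K'_def intro!: mono_r)
   fix v :: complex assume v: "v : {1, \<i>}"
   have "HbN n (%z. SUM i:(Basis::'e set). (pd v u z.*i)*.pd i Q (u z)) (real (card (Basis::'e set))*(2^Suc n*(B*(K*M))))" proof(rule HbN_sum)
    fix i :: 'e assume i: "i : Basis"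
    show "sm (%z. (pd v u z.*i)*.pd i Q (u z)) UNIV" by(intro sm_scaleR sm_inner sm_pd a(5) sm open_UNIV)
    have "HbN n (%z. pd i Q (u z)) (K*M)" by(rule IH[OF a(1,2) sm_pd[OF a(3)] Qb_pd[OF a(4) i] a(5) u HbN_SucD[OF a(7)]])
    thus "HbN n (%z. (pd v u z.*i)*.pd i Q (u z)) (2^Suc n*(B*(K*M)))" by(intro HbN_bilinear[OF bb_scaleR] sm_inner sm_pd a(5) sm open_UNIV
    HbN_inner[OF i] HbN_pd[OF a(7) v]) auto
   qed auto
   thus "HbN n (pd v (%z. Q (u z))) (K'*M)" unfolding eq using K M by(elim HbN_mono) (auto simp: K'_def algebra_simps)
  qed
 qed
qed

text \<open>Lipschitz dependence on the inner function, at the price of one more derivative of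
  \<open>Q\<close> than for the composition itself: the seminorm involves a second difference of
  \<open>Q\<close>, between \<open>z\<close> and \<open>w\<close> and between \<open>u\<close> and
  \<open>u'\<close>.\<close>

lemma HbN_compose_diff:
 fixes dummy :: "'e::euclidean_space \<times> 'f::real_normed_vector" and B :: real
 assumes "B >= 0" shows "EX K>0. ! S (Q :: 'e => 'f) M u u' D. open S --> convex S --> sm Q S --> Qb (Suc (Suc n)) Q M S -->
   sm u UNIV --> (! z. u z : S) --> HbN n u B --> sm u' UNIV --> (! z. u' z : S) --> HbN n u' B -->
   HbN n (%z. u z-u' z) D --> HbN n (%z. Q (u z)-Q (u' z)) (K*M*D)"
proof(induction n)
 case 0
 define d where "d = real (DIM('e))"
 have d: "d >= 0" by(simp add: d_def)
 show ?case proof(intro exI[of _ "1+d+d*d*B"] conjI allI impI)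
  show "1+d+d*d*B > 0" using assms d by(intro add_pos_nonneg) auto
  fix S and Q :: "'e => 'f" and M and u u' :: "complex => 'e" and D
  assume a: "open S" "convex S" "sm Q S" "Qb (Suc (Suc 0)) Q M S" "sm u UNIV" "! z. u z : S" "HbN 0 u B"
   "sm u' UNIV" "! z. u' z : S" "HbN 0 u' B" "HbN 0 (%z. u z-u' z) D"
  have M: "M >= 0" using Qb_norm[OF a(4), of "u 0"] a(6) norm_ge_zero order_trans by blast
  have D: "D >= 0" using HbN_nonneg[OF a(11)] .
  have dif: "Q differentiable (at x)" "pd i Q differentiable (at x)" if "x : S" for x i using sm_dif[OF a(3) that] sm_dif[OF sm_pd[OF a(3)] that] .
  have Dn: "norm (u z-u' z) <= D" "norm ((u z-u' z)-(u w-u' w)) <= D * sqrt (norm (z-w))" for z w using HbD[of "%z. u z-u' z" D] a(11) by auto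
  have Bn: "norm (u z-u w) <= B * sqrt (norm (z-w))" "norm (u' z-u' w) <= B * sqrt (norm (z-w))" for z w using HbD[of u B] HbD[of u' B] a(7,10) by auto
  show "HbN 0 (%z. Q (u z)-Q (u' z)) ((1+d+d*d*B)*M*D)" unfolding HbN.simps Hb_def proof(intro conjI allI)
   fix z w
   have "norm (Q (u z)-Q (u' z)) <= d*M*norm (u z-u' z)" unfolding d_def using a(6,9) by(intro Qb_lipschitz[OF a(4,2)] dif) auto
   also have "... <= d*M*D" using d M Dn(1) by(intro mono_l) auto
   also have "... <= (1+d+d*d*B)*M*D" using assms d M D by(intro mono_r) auto
   finally show "norm (Q (u z)-Q (u' z)) <= (1+d+d*d*B)*M*D" .
   \<comment> \<open>The segment from u' z to u z lies in the convex set \<open>S\<close>. Moving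
     along it at \<open>z\<close> and at \<open>w\<close> simultaneously reduces the second
     difference to increments of the derivative of \<open>Q\<close> and of u - u'.\<close>
   let ?c = "%z s. u' z+s*.(u z-u' z)"
   have c: "?c z s : S" if "s : {0..1}" for z s proof -
    have "(1-s)*.u' z+s*.u z : S" using convexD_alt[OF a(2), of "u' z" "u z" s] a(6,9) that by auto
    thus ?thesis by(simp add: algebra_simps)
   qed
   let ?R = "((d+d*d*B)*M*D) * sqrt (norm (z-w))"
   let ?f = "%s. Q (?c z s)-Q (?c w s)"
   have der: "((%s. Q (?c z s)) has_derivative (%h. h*.pd (u z-u' z) Q (?c z s))) (at s within {0..1})"
    if "s : {0..1}" for s z proof -
    have 1: "((%s. ?c z s) has_derivative (%h. h*.(u z-u' z))) (at s within {0..1})" by(auto intro!: derivative_eq_intros)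
    have hd: "(Q has_derivative (%v. pd v Q (?c z s))) (at (?c z s))" by(rule hd_pd[OF dif(1)[OF c[OF that]]])
    from deriv_comp[OF 1 hd] linear_scale[OF deriv_lin[OF hd]]
    show ?thesis by simp
   qed
   have "norm (?f 1-?f 0) <= ?R*norm (1-0 :: real)" proof(rule differentiable_bound[of "{0..1}"])
    fix s :: real assume s: "s : {0..1}"
    let ?h = "pd (u z-u' z) Q (?c z s)-pd (u w-u' w) Q (?c w s)"
    show "(?f has_derivative (%h. h*.pd (u z-u' z) Q (?c z s)-h*.pd (u w-u' w) Q (?c w s))) (at s within {0..1})" by(intro has_derivative_diff der s)
    have lin: "linear (%v. pd v Q (?c z s))" by(rule deriv_lin[OF hd_pd[OF dif(1)[OF c[OF s]]]])
    have "?h = pd ((u z-u' z)-(u w-u' w)) Q (?c z s)+(pd (u w-u' w) Q (?c z s)-pd (u w-u' w) Q (?c w s))" using linear_diff[OF lin, of "u z-u' z" "u w-u' w"] by simp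
    hence "norm ?h <= norm (pd ((u z-u' z)-(u w-u' w)) Q (?c z s))+norm (pd (u w-u' w) Q (?c z s)-pd (u w-u' w) Q (?c w s))" using tri_ineq by metis
    also have "... <= d*M*(D * sqrt (norm (z-w)))+d*d*B*M*D * sqrt (norm (z-w))" proof(rule add_mono)
    have "norm (pd ((u z-u' z)-(u w-u' w)) Q (?c z s)) <= d*M*norm ((u z-u' z)-(u w-u' w))" unfolding d_def by(rule Qb_pd_bound[OF a(4) c[OF s] dif(1)[OF c[OF s]]])
    also have "... <= d*M*(D * sqrt (norm (z-w)))" using d M Dn(2) by(intro mono_l) auto
    finally show "norm (pd ((u z-u' z)-(u w-u' w)) Q (?c z s)) <= d*M*(D * sqrt (norm (z-w)))" .
    let ?v = "u w-u' w"
    have cc: "norm (?c z s-?c w s) <= B * sqrt (norm (z-w))" proof -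
    have "?c z s-?c w s = (1-s)*.(u' z-u' w)+s*.(u z-u w)" by(simp add: algebra_simps)
    hence "norm (?c z s-?c w s) <= norm ((1-s)*.(u' z-u' w))+norm (s*.(u z-u w))" using tri_ineq by metis
    also have "... = (1-s)*norm (u' z-u' w)+s*norm (u z-u w)" using s by simp
    also have "... <= (1-s)*(B * sqrt (norm (z-w)))+s*(B * sqrt (norm (z-w)))" using s Bn by(intro add_mono mono_l) auto
    finally show ?thesis by(simp add: algebra_simps)
    qed
    have eq: "pd ?v Q (?c z s)-pd ?v Q (?c w s) = (SUM i:Basis. (?v.*i)*.(pd i Q (?c z s)-pd i Q (?c w s)))"
    unfolding pd_Basis[OF dif(1)[OF c[OF s]], of ?v] by(simp add: sum_subtractf scaleR_diff_right)
    have "norm (pd ?v Q (?c z s)-pd ?v Q (?c w s)) <= (SUM i:(Basis::'e set). norm ((?v.*i)*.(pd i Q (?c z s)-pd i Q (?c w s))))" unfolding eq by(rule norm_sum)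
    also have "... <= (SUM i:(Basis::'e set). D*(d*M*(B * sqrt (norm (z-w)))))" proof(rule sum_mono)
    fix i :: 'e assume i: "i : Basis"
    have l: "norm (pd i Q x-pd i Q y) <= d*M*norm (x-y)" if "x : S" "y : S" for x y unfolding d_def by(rule Qb_lipschitz[OF Qb_pd[OF a(4) i] a(2) _ that]) (rule dif(2))
    have "norm (pd i Q (?c z s)-pd i Q (?c w s)) <= d*M*norm (?c z s-?c w s)" by(rule l) (rule c[OF s])+
    also have "... <= d*M*(B * sqrt (norm (z-w)))" using d M cc by(intro mono_l) auto
    finally have "norm (pd i Q (?c z s)-pd i Q (?c w s)) <= d*M*(B * sqrt (norm (z-w)))" .
    moreover have "abs (?v.*i) <= D" by(rule order_trans[OF Basis_le_norm[OF i] Dn(1)])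
    ultimately show "norm ((?v.*i)*.(pd i Q (?c z s)-pd i Q (?c w s))) <= D*(d*M*(B * sqrt (norm (z-w))))" unfolding norm_scaleR using D by(intro mult_mono) auto
    qed
    also have "... = d*d*B*M*D * sqrt (norm (z-w))" by(simp add: d_def mult_ac)
    finally show "norm (pd ?v Q (?c z s)-pd ?v Q (?c w s)) <= d*d*B*M*D * sqrt (norm (z-w))" .
    qed
    also have "... = ?R" by(simp add: algebra_simps)
    finally have hb: "norm ?h <= ?R" .
    show "onorm (%h. h*.pd (u z-u' z) Q (?c z s)-h*.pd (u w-u' w) Q (?c w s)) <= ?R" proof(rule onorm_le)
    fix h :: real
    have "norm (h*.pd (u z-u' z) Q (?c z s)-h*.pd (u w-u' w) Q (?c w s)) = abs h*norm ?h" by(metis norm_scaleR scaleR_diff_right)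
    also have "... <= abs h*?R" using hb by(intro mono_l) auto
    finally show "norm (h*.pd (u z-u' z) Q (?c z s)-h*.pd (u w-u' w) Q (?c w s)) <= ?R*norm h" by(simp add: mult.commute)
    qed
   qed auto
   hence "norm ((Q (u z)-Q (u w))-(Q (u' z)-Q (u' w))) <= ?R" by simp
   also have "(Q (u z)-Q (u w))-(Q (u' z)-Q (u' w)) = (Q (u z)-Q (u' z))-(Q (u w)-Q (u' w))" by(simp add: algebra_simps)
   also have "?R <= (1+d+d*d*B)*M*D * sqrt (norm (z-w))" using M D by(intro mono_r) auto
   finally show "norm (Q (u z)-Q (u' z)-(Q (u w)-Q (u' w))) <= (1+d+d*d*B)*M*D * sqrt (norm (z-w))" .
  qed
 qed
next
 case (Suc n)
 then obtain K where K: "K > 0" and IH: "!!S (Q :: 'e => 'f) M u u' D. open S ==> convex S ==> sm Q S ==> Qb (Suc (Suc n)) Q M S ==>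
   sm u UNIV ==> (!!z. u z : S) ==> HbN n u B ==> sm u' UNIV ==> (!!z. u' z : S) ==> HbN n u' B ==>
   HbN n (%z. u z-u' z) D ==> HbN n (%z. Q (u z)-Q (u' z)) (K*M*D)" by blast
 obtain K1 where K1: "K1 > 0" and C: "!!S (Q :: 'e => 'f) M u. open S ==> convex S ==> sm Q S ==>
   Qb (Suc n) Q M S ==> sm u UNIV ==> (!!z. u z : S) ==> HbN n u B ==> HbN n (%z. Q (u z)) (K1*M)" using HbN_compose[OF assms, where ?'e='e and ?'f='f, of n] by blast
 define K' where "K' = K+real (DIM('e))*(2^Suc n*(K1+B*K))"
 show ?case proof(intro exI[of _ K'] conjI allI impI)
  show "K' > 0" using assms K K1 by(simp add: K'_def add_pos_nonneg)
  fix S and Q :: "'e => 'f" and M and u u' :: "complex => 'e" and D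
  assume a: "open S" "convex S" "sm Q S" "Qb (Suc (Suc (Suc n))) Q M S" "sm u UNIV" "! z. u z : S" "HbN (Suc n) u B"
   "sm u' UNIV" "! z. u' z : S" "HbN (Suc n) u' B" "HbN (Suc n) (%z. u z-u' z) D"
  have M: "M >= 0" using Qb_norm[OF a(4), of "u 0"] a(6) norm_ge_zero order_trans by blast
  have D: "D >= 0" using HbN_nonneg[OF a(11)] .
  have u: "!!z. u z : S" "!!z. u' z : S" using a(6,9) by blast+
  have sm: "sm (%z. pd i Q (u z)) UNIV" "sm (%z. pd i Q (u' z)) UNIV" for i by(intro sm_comp[OF open_UNIV a(1) sm_pd[OF a(3)]] a u)+
  have smQ: "sm (%z. Q (u z)) UNIV" "sm (%z. Q (u' z)) UNIV" by(intro sm_comp[OF open_UNIV a(1) a(3)] a u)+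
  have pdd: "pd v (%z. u z-u' z) = (%z. pd v u z-pd v u' z)" for v by(rule ext) (intro pd_diff sm_dif[OF a(5)] sm_dif[OF a(8)] UNIV_I)
  have eq: "pd v (%z. Q (u z)-Q (u' z)) = (%z. SUM i:Basis. (pd v (%z. u z-u' z) z.*i)*.pd i Q (u z)
    + (pd v u' z.*i)*.(pd i Q (u z)-pd i Q (u' z)))" for v proof(rule ext)
   fix z
   have "pd v (%z. Q (u z)-Q (u' z)) z = pd v (%z. Q (u z)) z-pd v (%z. Q (u' z)) z" by(intro pd_diff sm_dif[OF smQ(1)] sm_dif[OF smQ(2)] UNIV_I)
   also have "... = (SUM i:Basis. (pd v u z.*i)*.pd i Q (u z))-(SUM i:Basis. (pd v u' z.*i)*.pd i Q (u' z))"
    by(intro arg_cong2[where f=minus] pd_compose sm_dif[OF a(5)] sm_dif[OF a(8)]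
    sm_dif[OF a(3)] UNIV_I u)
   finally show "pd v (%z. Q (u z)-Q (u' z)) z = (SUM i:Basis. (pd v (%z. u z-u' z) z.*i)*.pd i Q (u z)
    + (pd v u' z.*i)*.(pd i Q (u z)-pd i Q (u' z)))" unfolding pdd by(simp add: sum_subtractf[symmetric] inner_diff_left algebra_simps)
  qed
  have smd: "sm (%z. u z-u' z) UNIV" by(intro sm_diff a open_UNIV)
  show "HbN (Suc n) (%z. Q (u z)-Q (u' z)) (K'*M*D)" proof(rule HbN_SucI)
   have "HbN n (%z. Q (u z)-Q (u' z)) (K*M*D)" by(rule IH[OF a(1-3) Qb_SucD[OF a(4)] a(5) u(1) HbN_SucD[OF a(7)] a(8) u(2) HbN_SucD[OF a(10)] HbN_SucD[OF a(11)]])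
   thus "Hb (%z. Q (u z)-Q (u' z)) (K'*M*D)" using assms K K1 M D by(intro Hb_mono[OF HbN_Hb]) (auto simp: K'_def intro!: mono_r)
   fix v :: complex assume v: "v : {1, \<i>}"
   have "HbN n (%z. SUM i:(Basis::'e set). (pd v (%z. u z-u' z) z.*i)*.pd i Q (u z)
    + (pd v u' z.*i)*.(pd i Q (u z)-pd i Q (u' z))) (real (card (Basis::'e set))*(2^Suc n*(D*(K1*M))+2^Suc n*(B*(K*M*D))))" proof(rule HbN_sum)
    fix i :: 'e assume i: "i : Basis"
    have s1: "sm (%z. (pd v (%z. u z-u' z) z.*i)*.pd i Q (u z)) UNIV" by(intro sm_scaleR sm_inner sm_pd smd sm open_UNIV)
    have s2: "sm (%z. (pd v u' z.*i)*.(pd i Q (u z)-pd i Q (u' z))) UNIV" by(intro sm_scaleR sm_inner sm_diff sm_pd a(8) sm open_UNIV)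
    show "sm (%z. (pd v (%z. u z-u' z) z.*i)*.pd i Q (u z)
    + (pd v u' z.*i)*.(pd i Q (u z)-pd i Q (u' z))) UNIV" by(rule sm_add[OF open_UNIV s1 s2])
    have h1: "HbN n (%z. pd i Q (u z)) (K1*M)" by(rule C[OF a(1,2) sm_pd[OF a(3)] Qb_SucD[OF Qb_pd[OF a(4) i]] a(5) u(1) HbN_SucD[OF a(7)]])
    have h2: "HbN n (%z. pd i Q (u z)-pd i Q (u' z)) (K*M*D)" by(rule IH[OF a(1,2) sm_pd[OF a(3)] Qb_pd[OF a(4) i] a(5) u(1) HbN_SucD[OF a(7)] a(8) u(2)
    HbN_SucD[OF a(10)] HbN_SucD[OF a(11)]])
    show "HbN n (%z. (pd v (%z. u z-u' z) z.*i)*.pd i Q (u z)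
    + (pd v u' z.*i)*.(pd i Q (u z)-pd i Q (u' z))) (2^Suc n*(D*(K1*M))+2^Suc n*(B*(K*M*D)))" proof(rule HbN_add[OF s1 s2])
    show "HbN n (%z. (pd v (%z. u z-u' z) z.*i)*.pd i Q (u z)) (2^Suc n*(D*(K1*M)))" by(intro HbN_bilinear[OF bb_scaleR] sm_inner sm_pd smd sm open_UNIV
    HbN_inner[OF i] HbN_pd[OF a(11) v] h1) auto
    show "HbN n (%z. (pd v u' z.*i)*.(pd i Q (u z)-pd i Q (u' z))) (2^Suc n*(B*(K*M*D)))" by(intro HbN_bilinear[OF bb_scaleR] sm_inner sm_diff sm_pd a(8) sm open_UNIV
    HbN_inner[OF i] HbN_pd[OF a(10) v] h2) auto
    qed
   qed auto
   thus "HbN n (pd v (%z. Q (u z)-Q (u' z))) (K'*M*D)" unfolding eq using K M D by(elim HbN_mono) (auto simp: K'_def algebra_simps)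
  qed
 qed
qed

subsection \<open>A smooth bump function\<close>

text \<open>The powers in the denominator make the family of these functions closed under
  differentiation up to linear combinations, so their smoothness takes a single induction.\<close>

definition flat_exp :: "nat => real => real" where "flat_exp n x = (if x > 0 then exp (- (1/x))/x^n else 0)"

lemma flat_exp_tendsto: "((%h. flat_exp n h/h) ---> 0) (at 0)"
proof -
 have 1: "((%h. flat_exp n h/h) ---> 0) (at_right 0)" proof -
  have "((%x::real. x^Suc n/exp x) ---> 0) at_top" by(rule tendsto_power_div_exp_0)
  from filterlim_compose[OF this filterlim_inverse_at_top_right]
  have "((%h::real. inverse h^Suc n/exp (inverse h)) ---> 0) (at_right 0)" .
  thus ?thesis by(rule Lim_transform_eventually) (auto simp: eventually_at_right_field flat_exp_def exp_minus field_simps intro!: exI[of _ 1])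
 qed
 have 2: "((%h. flat_exp n h/h) ---> 0) (at_left 0)" by(rule tendsto_eventually) (auto simp: eventually_at_left_field flat_exp_def intro!: exI[of _ "-1"])
 show ?thesis using 1 2 by(simp add: filterlim_split_at)
qed

lemma DERIV_flat_exp: "(flat_exp n has_real_derivative flat_exp (Suc (Suc n)) x-real n*flat_exp (Suc n) x) (at x)"
proof -
 consider "x > 0" | "x < 0" | "x = 0" by linarith
 thus ?thesis proof cases
  case 1
  have "((%x. exp (- (1/x))*inverse x^n) has_real_derivative
    exp (- (1/x))*(inverse x^2)*inverse x^n+exp (- (1/x))*(real n*inverse x^(n-1)*(- (inverse x^2)))) (at x)"
   using 1 by(auto intro!: derivative_eq_intros simp: sq_eq divide_inverse)
  also have "exp (- (1/x))*(inverse x^2)*inverse x^n+exp (- (1/x))*(real n*inverse x^(n-1)*(- (inverse x^2)))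
    = flat_exp (Suc (Suc n)) x-real n*flat_exp (Suc n) x" using 1 by(cases n) (auto simp: flat_exp_def sq_eq divide_inverse power_inverse algebra_simps)
  finally show ?thesis by(rule has_field_derivative_transform_within_open[of _ _ _ "{0<..}"])
    (use 1 in \<open>auto simp: flat_exp_def divide_inverse power_inverse\<close>)
 next
  case 2
  have "((%x. 0) has_real_derivative flat_exp (Suc (Suc n)) x-real n*flat_exp (Suc n) x) (at x)" using 2 by(simp add: flat_exp_def)
  thus ?thesis by(rule has_field_derivative_transform_within_open[of _ _ _ "{..<0}"]) (use 2 in \<open>auto simp: flat_exp_def\<close>)
 next
  case 3
  thus ?thesis using flat_exp_tendsto[of n] by(simp add: has_field_derivative_iff flat_exp_def)
 qed
qed

lemma smooth_flat_exp: "sm (flat_exp n) UNIV"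
proof -
 have "Ck_on k (flat_exp n) UNIV" for k n proof(induction k arbitrary: n)
  case 0
  have "isCont (flat_exp n) x" for x using DERIV_isCont[OF DERIV_flat_exp] .
  thus ?case by(simp add: continuous_at_imp_continuous_on)
 next
  case (Suc k)
  show ?case proof(rule Ck_SucI)
   show "(flat_exp n has_derivative (%v. (flat_exp (Suc (Suc n)) x-real n*flat_exp (Suc n) x) * v)) (at x)" for x using DERIV_flat_exp[of n x] by(simp add: hfd_def)
   show "Ck_on k (%x. (flat_exp (Suc (Suc n)) x-real n*flat_exp (Suc n) x) * v) UNIV" for v by(intro Ck_mult Ck_diff Ck_const Suc.IH open_UNIV)
  qed simp
 qed
 thus ?thesis by(simp add: smooth_on_def)
qed

text \<open>Equal to 1 for |z| <= 1/8 and to 0 for |z| >= 1/2: the constants 1/64 and 1/4 are the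
  squares of these radii. The two terms of the denominator never vanish together.\<close>

definition chi :: "complex => real" where "chi z = flat_exp 0 (1/4-z.*z)*inverse (flat_exp 0 (1/4-z.*z)+flat_exp 0 (z.*z-1/64))"

lemma flat_exp_nonneg: "flat_exp 0 x >= 0" and flat_exp_pos: "x > 0 ==> flat_exp 0 x > 0" and flat_exp_zero: "x <= 0 ==> flat_exp 0 x = 0" by(simp_all add: flat_exp_def)

lemma smooth_chi: "sm chi UNIV"
proof -
 have n: "sm (%z::complex. z.*z) UNIV" by(simp add: smooth_on_def Ck_normsq)
 have 1: "sm (%z::complex. flat_exp 0 (1/4-z.*z)) UNIV" by(rule sm_comp[OF open_UNIV open_UNIV smooth_flat_exp]) (auto intro!: sm_diff n)
 have 2: "sm (%z::complex. flat_exp 0 (z.*z-1/64)) UNIV" by(rule sm_comp[OF open_UNIV open_UNIV smooth_flat_exp]) (auto intro!: sm_diff n)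
 have "flat_exp 0 (1/4-z.*z)+flat_exp 0 (z.*z-1/64) ~= 0" for z :: complex proof(cases "z.*z < 1/4")
  case True
  thus ?thesis using flat_exp_pos[of "1/4-z.*z"] flat_exp_nonneg[of "z.*z-1/64"] by linarith
 next
  case False
  thus ?thesis using flat_exp_pos[of "z.*z-1/64"] flat_exp_nonneg[of "1/4-z.*z"] by linarith
 qed
 thus ?thesis unfolding chi_def[abs_def] by(intro sm_mult sm_inverse sm_add 1 2 open_UNIV) auto
qed

lemma chi_one: "norm z <= 1/8 ==> chi z = 1"
proof -
 assume "norm z <= 1/8"
 hence "(norm z)^2 <= (1/8)^2" by(intro power_mono) auto
 hence "z.*z <= 1/64" by(simp add: dot_sq sq_eq)
 thus ?thesis using flat_exp_pos[of "1/4-z.*z"] by(simp add: chi_def flat_exp_zero)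
qed

lemma chi_zero: "norm z >= 1/2 ==> chi z = 0"
proof -
 assume "norm z >= 1/2"
 hence "(1/2)^2 <= (norm z)^2" by(intro power_mono) auto
 hence "1/4-z.*z <= 0" by(simp add: dot_sq sq_eq)
 thus ?thesis by(simp add: chi_def flat_exp_zero)
qed

lemma pd_vanish:
 assumes "!!z. z ~: cball 0 R ==> f z = 0" "z ~: cball (0::complex) R" shows "pd v f z = 0"
proof -
 have "pd v f z = pd v (%z. 0) z" by(rule pd_cong[of "- cball 0 R"]) (use assms in auto)
 also have "... = 0" by(rule pd_eq) (rule has_derivative_const)
 finally show ?thesis .
qed

text \<open>Increments over distances up to 1 are controlled by the gradient, larger ones by the
  supremum.\<close>

lemma smooth_compact_Hb:
 fixes f :: "complex => 'b::real_normed_vector"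
 assumes "sm f UNIV" "!!z. z ~: cball 0 R ==> f z = 0" shows "EX B>0. Hb f B"
proof -
 have bd: "EX M>0. ! z. norm (k z) <= M" if "continuous_on UNIV k" "!!z. z ~: cball 0 R ==> k z = 0"
  for k :: "complex => 'b" proof -
  have "bounded (k ` cball 0 R)" by(intro compact_imp_bounded compact_continuous_image cont_sub[OF that(1)]) auto
  then obtain M where M: "M > 0" "! z:cball 0 R. norm (k z) <= M" unfolding bounded_pos by auto
  have "norm (k z) <= M" for z using M that(2)[of z] by(cases "z : cball 0 R") auto
  thus ?thesis using M by blast
 qed
 have pv: "pd v f z = 0" if "z ~: cball 0 R" for v z by(rule pd_vanish[OF _ that]) (rule assms(2))
 obtain M where M: "M > 0" "!!z. norm (f z) <= M" using bd[OF sm_cont[OF assms(1)] assms(2)] by blast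
 obtain M1 where M1: "M1 > 0" "!!z. norm (pd 1 f z) <= M1" using bd[OF sm_cont[OF sm_pd[OF assms(1)]] pv] by blast
 obtain M2 where M2: "M2 > 0" "!!z. norm (pd \<i> f z) <= M2" using bd[OF sm_cont[OF sm_pd[OF assms(1)]] pv] by blast
 have lip: "norm (f z-f w) <= (M1+M2)*norm (z-w)" for z w proof(rule differentiable_bound[of UNIV f "%z h. pd h f z"])
  show "(f has_derivative (%h. pd h f z)) (at z within UNIV)" for z using sm_deriv[OF assms(1)] by simp
  show "onorm (%h. pd h f z) <= M1+M2" for z proof(rule onorm_le)
   fix h
   show "norm (pd h f z) <= (M1+M2)*norm h" using pd_linear_bound[OF sm_dif[OF assms(1) UNIV_I], of h z]
    mono_r[OF add_mono[OF M1(2)[of z] M2(2)[of z]] norm_ge_zero[of h]] by linarith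
  qed
 qed auto
 have "Hb f (2*M+M1+M2)" unfolding Hb_def proof(intro conjI allI)
  fix z w
  show "norm (f z) <= 2*M+M1+M2" using M(1) M(2)[of z] M1(1) M2(1) by linarith
  show "norm (f z-f w) <= (2*M+M1+M2) * sqrt (norm (z-w))" proof(cases "norm (z-w) <= 1")
   case True
   hence "norm (z-w)*norm (z-w) <= norm (z-w)*1" by(intro mono_l) auto
   hence "norm (z-w) <= sqrt (norm (z-w))" by(simp add: real_le_rsqrt sq_eq)
   hence "(M1+M2)*norm (z-w) <= (2*M+M1+M2) * sqrt (norm (z-w))" using M(1) M1(1) M2(1) by(intro mult_mono) auto
   thus ?thesis using lip[of z w] by linarith
  next
   case False
   hence "1 <= sqrt (norm (z-w))" by simp
   hence "(2*M+M1+M2)*1 <= (2*M+M1+M2) * sqrt (norm (z-w))" using M(1) M1(1) M2(1) by(intro mono_l) auto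
   moreover have "norm (f z-f w) <= (2*M+M1+M2)*1" using M(2)[of z] M(2)[of w] norm_triangle_ineq4[of "f z" "f w"] M1(1) M2(1) by simp
   ultimately show ?thesis by(rule order_trans[rotated])
  qed
 qed
 thus ?thesis using M(1) M1(1) M2(1) by(intro exI[of _ "2*M+M1+M2"]) auto
qed

lemma smooth_compact_HbN:
 fixes f :: "complex => 'b::real_normed_vector"
 assumes "sm f UNIV" "!!z. z ~: cball 0 R ==> f z = 0" shows "EX B>0. HbN n f B" using assms
proof(induction n arbitrary: f)
 case 0
 thus ?case using smooth_compact_Hb by auto
next
 case (Suc n)
 have pv: "pd v f z = 0" if "z ~: cball 0 R" for v z by(rule pd_vanish[OF _ that]) (rule Suc.prems(2))
 obtain B where B: "B > 0" "Hb f B" using smooth_compact_Hb[OF Suc.prems] by blast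
 obtain B1 where B1: "B1 > 0" "HbN n (pd 1 f) B1" using Suc.IH[OF sm_pd[OF Suc.prems(1)] pv] by blast
 obtain B2 where B2: "B2 > 0" "HbN n (pd \<i> f) B2" using Suc.IH[OF sm_pd[OF Suc.prems(1)] pv] by blast
 have "HbN (Suc n) f (B+B1+B2)" using B B1 B2 by(intro HbN_SucI) (auto elim!: Hb_mono HbN_mono)
 thus ?case using B B1 B2 by(intro exI[of _ "B+B1+B2"]) auto
qed

section \<open>Iterated partial derivatives\<close>

primrec pds :: "'a::real_normed_vector list => ('a => 'b::real_normed_vector) => 'a => 'b" where "pds [] f = f"
| "pds (v # vs) f = pds vs (pd v f)"

lemma sm_pds: "sm f S ==> sm (pds vs f) S" by(induction vs arbitrary: f) (auto intro: sm_pd)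

lemma pds_append: "pds (vs @ ws) f = pds ws (pds vs f)" by(induction vs arbitrary: f) auto

lemma HbN_pds: "HbN n f B ==> dirs vs ==> length vs <= n ==> HbN (n-length vs) (pds vs f) B"
proof(induction vs arbitrary: f n)
 case (Cons v vs)
 then obtain m where m: "n = Suc m" by(cases n) auto
 have "HbN m (pd v f) B" using Cons.prems m by(intro HbN_pd) auto
 from Cons.IH[OF this] Cons.prems m show ?case by simp
qed simp

lemma HbN_from_pds:
 assumes "HbN n f B" "!!vs. dirs vs ==> length vs = Suc n ==> Hb (pds vs f) B" shows "HbN (Suc n) f B" using assms
proof(induction n arbitrary: f)
 case 0
 have "Hb (pd v f) B" if "v : {1, \<i>}" for v using 0(2)[of "[v]"] that by auto
 thus ?case using 0 by(intro HbN_SucI) auto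
next
 case (Suc n)
 show ?case proof(rule HbN_SucI[OF HbN_Hb[OF Suc.prems(1)]])
  fix v :: complex assume v: "v : {1, \<i>}"
  show "HbN (Suc n) (pd v f) B" proof(rule Suc.IH[OF HbN_pd[OF Suc.prems(1) v]])
   fix vs :: "complex list" assume "dirs vs" "length vs = Suc n"
   thus "Hb (pds vs (pd v f)) B" using Suc.prems(2)[of "v # vs"] v by auto
  qed
 qed
qed

lemma pds_replicate: "(pd v ^^ j) f = pds (replicate j v) f"
proof(induction j arbitrary: f)
 case (Suc j)
 have "(pd v ^^ Suc j) f = (pd v ^^ j) (pd v f)" by(simp add: funpow_swap1)
 thus ?case using Suc by simp
qed simp

lemma pds_TT: "sm g UNIV ==> pds vs (TT g) = TT (pds vs g)" by(induction vs arbitrary: g) (auto simp: pd_TT sm_pd)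

lemma pd_scaleR_c: "f differentiable (at x) ==> pd v (%z. c*.f z) x = c*.pd v f x" by(rule pd_lin[OF bounded_linear_scaleR_right])

lemma pds_add: "sm f UNIV ==> sm g UNIV ==> pds vs (%z. f z+g z) = (%z. pds vs f z+pds vs g z)"
proof(induction vs arbitrary: f g)
 case (Cons v vs)
 have "pd v (%z. f z+g z) = (%z. pd v f z+pd v g z)" by(rule ext) (intro pd_add sm_dif[OF Cons.prems(1)] sm_dif[OF Cons.prems(2)] UNIV_I)
 thus ?case using Cons.IH[OF sm_pd sm_pd, OF Cons.prems] by simp
qed simp

lemma pds_linear:
 assumes "bounded_linear L" shows "sm f UNIV ==> pds vs (%z. L (f z)) = (%z. L (pds vs f z))"
proof(induction vs arbitrary: f)
 case (Cons v vs)
 have "pd v (%z. L (f z)) = (%z. L (pd v f z))" by(rule ext) (intro pd_lin assms sm_dif[OF Cons.prems] UNIV_I)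
 thus ?case using Cons.IH[OF sm_pd[OF Cons.prems]] by simp
qed simp

lemma pds_minus: "sm f UNIV ==> pds vs (%z. - f z) = (%z. - pds vs f z)" by(rule pds_linear[OF bounded_linear_minus[OF bounded_linear_ident]])

lemma pds_diff: "sm f UNIV ==> sm g UNIV ==> pds vs (%z. f z-g z) = (%z. pds vs f z-pds vs g z)" using pds_add[of f "%z. - g z" vs] by(simp add: sm_minus pds_minus)

lemma pds_sum:
 fixes f :: "'i => 'a::euclidean_space => 'b::real_normed_vector"
 shows "finite I ==> (!!i. i : I ==> sm (f i) UNIV) ==> pds vs (%z. SUM i:I. f i z) = (%z. SUM i:I. pds vs (f i) z)"
proof(induction I rule: finite_induct)
 case empty
 have "pds vs (%z::'a. 0::'b) = (%z. 0)" proof(induction vs)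
  case (Cons v vs)
  have "pd v (%z::'a. 0::'b) = (%z. 0)" by(rule ext) (rule pd_eq[OF has_derivative_const])
  thus ?case using Cons by simp
 qed simp
 thus ?case by simp
next
 case (insert i I)
 thus ?case by(simp add: pds_add sm_sum)
qed

lemma TT_diff:
 assumes "continuous_on UNIV f" "continuous_on UNIV g" shows "TT (%z. f z-g z) z = TT f z-TT g z"
proof -
 have "conv kk (%z. f z-g z) r z = conv kk f r z-conv kk g r z" for r unfolding conv_def cmul_diff_right by(rule integral_diff)
    (rule int_cont[OF conv_cont[OF kk_cont assms(1)]],
    rule int_cont[OF conv_cont[OF kk_cont assms(2)]])
 moreover have "integral {0..1} (%r. conv kk f r z-conv kk g r z)
   = integral {0..1} (%r. conv kk f r z)-integral {0..1} (%r. conv kk g r z)" by(rule integral_diff)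
    (rule integrable_continuous_interval[OF continuous_conv_r[OF kk_cont assms(1)]],
    rule integrable_continuous_interval[OF continuous_conv_r[OF kk_cont assms(2)]])
 ultimately show ?thesis unfolding TT_def by simp
qed

subsection \<open>The fixed point equation for discs with prescribed jets\<close>

definition SS :: "(complex => C2) => complex => C2" where "SS g z = (1/c0)*.TT g z"

definition ee :: "nat => complex => complex" where "ee j z = of_real (chi z)*z^j"

text \<open>Taylor coefficients in the real direction only. For solutions of the disc equation
  through the origin they determine the full jet there, by the argument of
  \<open>disc_jet_difference\<close>.\<close>

definition jet :: "(complex => C2) => nat => C2" where "jet f j = (1/fact j)*.(pd 1 ^^ j) f 0"

text \<open>The subtracted polynomial removes the pure x-jet of order \<open>N\<close> at 0. Where
  \<open>chi\<close> is 1 it is holomorphic, so it does not change the Cauchy-Riemann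
  derivative.\<close>

definition LU :: "nat => (complex => C2) => complex => C2" where "LU N d z = SS d z-(SUM j<=N. cmul (ee j z) (jet (SS d) j))"

text \<open>Maps with prescribed pure x-jet \<open>h\<close>, written in terms of their
  Cauchy-Riemann derivative: if \<open>g\<close> is supported in the disc of radius 1/2, then u =
  \<open>UU N h g\<close> satisfies u_x + i u_y = g near 0.\<close>

definition UU :: "nat => (nat => C2) => (complex => C2) => complex => C2" where "UU N h g z = (SUM j<=N. cmul (ee j z) (h j))+LU N g z"

lemma bl_cmul_left: "bounded_linear (%a. cmul a z)" by(rule bounded_bilinear.bounded_linear_left[OF bb_cmul])

lemma smooth_SS: "sm g UNIV ==> sm (SS g) UNIV" unfolding SS_def[abs_def] by(rule sm_lin[OF bounded_linear_scaleR_right open_UNIV sm_TT])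

lemma pds_SS: "sm g UNIV ==> pds vs (SS g) = SS (pds vs g)" unfolding SS_def[abs_def] using pds_linear[OF bounded_linear_scaleR_right sm_TT] pds_TT by(metis (no_types))

lemma smooth_ee: "sm (ee j) UNIV" unfolding ee_def[abs_def] by(intro sm_mult sm_power open_UNIV sm_lin[OF bl_of_real] smooth_chi) (rule sm_bl[OF bounded_linear_ident])

lemma ee_zero: "norm z >= 1/2 ==> ee j z = 0" by(simp add: ee_def chi_zero)

lemma ee_bound: "EX E>0. ! j<=N. HbN n (ee j) E"
proof(induction N)
 case 0
 obtain E where "E > 0" "HbN n (ee 0) E" using smooth_compact_HbN[OF smooth_ee, of "1/2"] ee_zero by(metis linorder_not_less mem_cball_0 order_less_imp_le)
 thus ?case by auto
next
 case (Suc N)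
 then obtain E where E: "E > 0" "! j<=N. HbN n (ee j) E" by blast
 obtain E' where "E' > 0" "HbN n (ee (Suc N)) E'" using smooth_compact_HbN[OF smooth_ee, of "1/2"] ee_zero by(metis linorder_not_less mem_cball_0 order_less_imp_le)
 with E show ?case by(intro exI[of _ "E+E'"]) (auto simp: le_Suc_eq elim!: HbN_mono)
qed

lemma HbN_poly: "EX K>0. ! h H. (! j<=N. norm (h j) <= H) --> HbN n (%z. SUM j<=N. cmul (ee j z) (h j)) (K*H)"
proof -
 obtain E where E: "E > 0" "! j<=N. HbN n (ee j) E" using ee_bound by blast
 show ?thesis proof(intro exI[of _ "real (Suc N)*E"] conjI allI impI)
  show "real (Suc N)*E > 0" using E by simp
  fix h :: "nat => C2" and H assume h: "! j<=N. norm (h j) <= H"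
  have "HbN n (%z. SUM j<=N. cmul (ee j z) (h j)) (real (card {..N})*(H*E))" proof(rule HbN_sum)
   fix j assume j: "j : {..N}"
   show "sm (%z. cmul (ee j z) (h j)) UNIV" by(rule sm_lin[OF bl_cmul_left open_UNIV smooth_ee])
   have "HbN n (%z. cmul (ee j z) (h j)) (norm (h j)*E)" by(rule HbN_linear[OF bl_cmul_left _ _ smooth_ee]) (use E j in \<open>auto simp: norm_cmul mult.commute\<close>)
   thus "HbN n (%z. cmul (ee j z) (h j)) (H*E)" by(rule HbN_mono) (use h j E in \<open>auto intro: mono_r\<close>)
  qed simp
  thus "HbN n (%z. SUM j<=N. cmul (ee j z) (h j)) (real (Suc N)*E*H)" by(simp add: mult_ac)
 qed
qed

lemma smooth_poly: "sm (%z. SUM j<=N. cmul (ee j z) (h j)) UNIV" by(intro sm_sum open_UNIV sm_lin[OF bl_cmul_left open_UNIV smooth_ee])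

lemma smooth_LU: "sm g UNIV ==> sm (LU N g) UNIV" unfolding LU_def[abs_def] by(intro sm_diff smooth_SS smooth_poly open_UNIV)

lemma smooth_UU: "sm g UNIV ==> sm (UU N h g) UNIV" unfolding UU_def[abs_def] by(intro sm_add smooth_LU smooth_poly open_UNIV)

lemma SS_HbN: "EX C>0. ! n g B. sm g UNIV --> HbN n g B -->
   HbN n (SS g) (C*B) & (! v:{1, \<i>}. HbN n (pd v (SS g)) (C*B))"
proof -
 obtain C where C: "C > 0" "!!n g B. sm g UNIV ==> HbN n g B ==>
   HbN n (TT g) (C*B) & (! v:{1, \<i>}. HbN n (pd v (TT g)) (C*B))" using TT_HbN by blast
 show ?thesis proof(intro exI[of _ "C/c0"] conjI allI impI ballI)
  show "C/c0 > 0" using C c0_pos by simp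
  fix n and g :: "complex => C2" and B assume g: "sm g UNIV" "HbN n g B"
  have L: "HbN n (%z. (1/c0)*.f z) (C/c0*B)" if "sm f UNIV" "HbN n f (C*B)" for f :: "complex => C2"
   using HbN_linear[OF bounded_linear_scaleR_right, of "1/c0" "1/c0" f n "C*B"] that c0_pos by simp
  show "HbN n (SS g) (C/c0*B)" unfolding SS_def[abs_def] using C(2)[OF g] by(intro L sm_TT g) auto
  fix v :: complex assume v: "v : {1, \<i>}"
  have "pd v (SS g) = (%z. (1/c0)*.pd v (TT g) z)" unfolding SS_def[abs_def] by(rule ext) (intro pd_scaleR_c sm_dif[OF sm_TT[OF g(1)] UNIV_I])
  thus "HbN n (pd v (SS g)) (C/c0*B)" using L[OF sm_pd[OF sm_TT[OF g(1)], of v]] C(2)[OF g] v by auto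
 qed
qed

lemma jet_bound: "HbN n f B ==> j <= n ==> norm (jet f j) <= B"
proof -
 assume a: "HbN n f B" "j <= n"
 have "HbN (n-j) (pds (replicate j 1) f) B" using HbN_pds[OF a(1), of "replicate j 1"] a(2) by(auto simp: set_replicate_conv_if)
 from HbD(1)[OF HbN_Hb[OF this]] have "norm ((pd 1 ^^ j) f 0) <= B" by(simp add: pds_replicate)
 moreover have "norm (jet f j) <= norm ((pd 1 ^^ j) f 0)" proof -
  have "(1/fact j)*norm ((pd 1 ^^ j) f 0) <= 1*norm ((pd 1 ^^ j) f 0)" by(intro mono_r) auto
  thus ?thesis by(simp add: jet_def)
 qed
 ultimately show ?thesis by linarith
qed

text \<open>One derivative is gained. The subtracted polynomial contains derivatives of
  \<open>SS d\<close> up to order \<open>N\<close>, which the norm of order \<open>n\<close>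
  controls because N <= n.\<close>

lemma LU_HbN:
 assumes "N <= n" shows "EX K>0. ! d D. sm d UNIV --> HbN n d D --> HbN (Suc n) (LU N d) (K*D)"
proof -
 obtain C where C: "C > 0" "!!n g B. sm g UNIV ==> HbN n g B ==>
   HbN n (SS g) (C*B) & (! v:{1, \<i>}. HbN n (pd v (SS g)) (C*B))" using SS_HbN by blast
 obtain E where E: "E > 0" "!!h H. (! j<=N. norm (h j) <= H) ==> HbN (Suc n) (%z. SUM j<=N. cmul (ee j z) (h j)) (E*H)" using HbN_poly[of N "Suc n"] by blast
 show ?thesis proof(intro exI[of _ "C+E*C"] conjI allI impI)
  show "C+E*C > 0" using C E by(simp add: add_pos_pos)
  fix d :: "complex => C2" and D assume d: "sm d UNIV" "HbN n d D"
  have 1: "HbN (Suc n) (SS d) (C*D)" using C(2)[OF d] by(intro HbN_SucI) (auto dest: HbN_Hb)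
  have 2: "HbN (Suc n) (%z. SUM j<=N. cmul (ee j z) (jet (SS d) j)) (E*(C*D))" proof(rule E(2), intro allI impI)
   fix j assume "j <= N"
   thus "norm (jet (SS d) j) <= C*D" using C(2)[OF d] assms by(intro jet_bound[of n]) auto
  qed
  have "HbN (Suc n) (LU N d) (C*D+E*(C*D))" unfolding LU_def[abs_def] by(rule HbN_diff[OF smooth_SS[OF d(1)] smooth_poly 1 2])
  thus "HbN (Suc n) (LU N d) ((C+E*C)*D)" by(simp add: algebra_simps)
 qed
qed

lemma pds_pd_commute:
 fixes f :: "'a::euclidean_space => 'b::euclidean_space" shows "sm f UNIV ==> pds vs (pd v f) = pd v (pds vs f)"
proof(induction vs arbitrary: f)
 case (Cons w vs)
 have "pd w (pd v f) = pd v (pd w f)" by(rule ext) (rule pd_symmetric_smooth[OF open_UNIV UNIV_I Cons.prems])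
 thus ?case using Cons.IH[OF sm_pd[OF Cons.prems]] by simp
qed simp

text \<open>At the top order the norm \<open>X\<close> is multiplied only by the constant of the
  Cauchy transform, which depends neither on \<open>N\<close> nor on \<open>n\<close>. The
  polynomial correction enters the lower order term alone.\<close>

lemma LU_top: "EX C>0. ! N n. EX K>0. ! d D X vs. sm d UNIV --> HbN N d D --> dirs vs --> length vs <= n -->
   Hb (pds vs d) X --> Hb (pds vs (pd 1 (LU N d))) (C*X+K*D)"
proof -
 obtain C where C: "C > 0" "!!n g B. sm g UNIV ==> HbN n g B ==>
   HbN n (SS g) (C*B) & (! v:{1, \<i>}. HbN n (pd v (SS g)) (C*B))" using SS_HbN by blast
 have "EX K>0. ! d D X vs. sm d UNIV --> HbN N d D --> dirs vs --> length vs <= n -->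
   Hb (pds vs d) X --> Hb (pds vs (pd 1 (LU N d))) (C*X+K*D)" for N n proof -
  obtain E where E: "E > 0" "!!h H. (! j<=N. norm (h j) <= H) ==> HbN (Suc n) (%z. SUM j<=N. cmul (ee j z) (h j)) (E*H)" using HbN_poly[of N "Suc n"] by blast
  show ?thesis proof(intro exI[of _ "E*C"] conjI allI impI)
   show "E*C > 0" using C E by simp
   fix d :: "complex => C2" and D X and vs :: "complex list"
   assume d: "sm d UNIV" "HbN N d D" and vs: "dirs vs" "length vs <= n" and X: "Hb (pds vs d) X"
   let ?P = "%z. SUM j<=N. cmul (ee j z) (jet (SS d) j)"
   have P: "HbN (Suc n) ?P (E*(C*D))" proof(rule E(2), intro allI impI)
    fix j assume "j <= N"
    thus "norm (jet (SS d) j) <= C*D" using C(2)[OF d] by(intro jet_bound[of N]) auto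
   qed
   have "HbN (Suc n-length (1 # vs)) (pds (1 # vs) ?P) (E*(C*D))" by(rule HbN_pds[OF P]) (use vs in auto)
   hence h2: "Hb (pds vs (pd 1 ?P)) (E*(C*D))" by(auto dest: HbN_Hb)
   have "pds vs (pd 1 (SS d)) = pd 1 (SS (pds vs d))" by(simp add: pds_pd_commute smooth_SS d pds_SS)
   hence h1: "Hb (pds vs (pd 1 (SS d))) (C*X)" using C(2)[OF sm_pds[OF d(1)], of 0 vs X] X by auto
   have "pds vs (pd 1 (LU N d)) = (%z. pds vs (pd 1 (SS d)) z-pds vs (pd 1 ?P) z)"
    using pds_diff[OF smooth_SS[OF d(1)] smooth_poly[where N=N and h="jet (SS d)"], of "1 # vs"] by(simp add: LU_def[abs_def])
   moreover have "Hb (%z. pds vs (pd 1 (SS d)) z-pds vs (pd 1 ?P) z) (C*X+E*(C*D))" using HbN_diff[of _ _ 0, OF _ _ h1[folded HbN.simps(1)] h2[folded HbN.simps(1)]]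
    by(simp add: sm_pds sm_pd smooth_SS d smooth_poly)
   ultimately show "Hb (pds vs (pd 1 (LU N d))) (C*X+E*C*D)" by(simp add: mult_ac)
  qed
 qed
 thus ?thesis using C(1) by blast
qed

lemma SS_diff:
 assumes "sm f UNIV" "sm g UNIV" shows "SS (%z. f z-g z) = (%z. SS f z-SS g z)" by(rule ext) (simp add: SS_def TT_diff sm_cont assms scaleR_diff_right)

lemma LU_diff:
 assumes "sm f UNIV" "sm g UNIV" shows "LU N (%z. f z-g z) = (%z. LU N f z-LU N g z)"
proof -
 have j: "jet (%z. SS f z-SS g z) j = jet (SS f) j-jet (SS g) j" for j unfolding jet_def pds_replicate pds_diff[OF smooth_SS[OF assms(1)] smooth_SS[OF assms(2)]]
  by(simp add: scaleR_diff_right)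
 show ?thesis unfolding LU_def[abs_def] SS_diff[OF assms] j by(rule ext) (simp add: cmul_diff_right sum_subtractf)
qed

lemma UU_diff:
 assumes "sm f UNIV" "sm g UNIV" shows "(%z. UU N h f z-UU N h g z) = LU N (%z. f z-g z)" unfolding LU_diff[OF assms] UU_def by simp

text \<open>The term of the Leibniz formula in which all n + 1 derivatives fall on \<open>y\<close>
  is subtracted; the others involve at most \<open>n\<close> derivatives of
  \<open>y\<close>.\<close>

lemma bilinear_commutator:
 assumes pr: "bounded_bilinear pr" "!!x y. norm (pr x y) <= norm x*norm y" shows "sm y UNIV ==> sm bz UNIV ==> HbN n y Y ==> HbN (Suc n) bz B ==>
  dirs vs ==> length vs = Suc n ==>
  Hb (%z. pds vs (%z. pr (y z) (bz z)) z-pr (pds vs y z) (bz z)) (2^(n+2)*(Y*B))"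
proof(induction n arbitrary: y bz vs)
 case 0
 then obtain v where vs: "vs = [v]" and v: "v : {1, \<i>}" by(cases vs) auto
 have "pds vs (%z. pr (y z) (bz z)) z-pr (pds vs y z) (bz z) = pr (y z) (pd v bz z)" for z
  unfolding vs using pd_bilinear[OF pr(1) sm_dif[OF 0(1) UNIV_I] sm_dif[OF 0(2) UNIV_I], of v z] by simp
 moreover have "Hb (%z. pr (y z) (pd v bz z)) (2*(Y*B))" using 0 v by(intro Hb_bilinear[OF pr]) (auto simp: HbN.simps)
 hence "Hb (%z. pr (y z) (pd v bz z)) (2^(0+2)*(Y*B))" by(rule Hb_mono) (use HbN_nonneg[OF 0(3)] HbN_nonneg[OF 0(4)] in simp)
 ultimately show ?case by simp
next
 case (Suc n)
 then obtain v ws where vs: "vs = v # ws" and v: "v : {1, \<i>}" and ws: "set ws <= {1, \<i>}" "length ws = Suc n" by(cases vs) auto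
 have eq: "pd v (%z. pr (y z) (bz z)) = (%z. pr (y z) (pd v bz z)+pr (pd v y z) (bz z))"
  by(rule ext) (intro pd_bilinear[OF pr(1)] sm_dif[OF Suc.prems(1)] sm_dif[OF Suc.prems(2)] UNIV_I)
 have s1: "sm (%z. pr (y z) (pd v bz z)) UNIV" and s2: "sm (%z. pr (pd v y z) (bz z)) UNIV" by(intro sm_bilinear[OF pr(1)] open_UNIV sm_pd Suc.prems)+
 have "HbN (Suc n) (%z. pr (y z) (pd v bz z)) (2^Suc (Suc n)*(Y*B))"
  by(rule HbN_bilinear[OF pr Suc.prems(1) sm_pd[OF Suc.prems(2)] Suc.prems(3) HbN_pd[OF Suc.prems(4) v]])
 from HbN_pds[OF this ws(1)] ws(2) have 1: "HbN 0 (pds ws (%z. pr (y z) (pd v bz z))) (2^Suc (Suc n)*(Y*B))" by simp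
 have "Hb (%z. pds ws (%z. pr (pd v y z) (bz z)) z-pr (pds ws (pd v y) z) (bz z)) (2^(n+2)*(Y*B))"
  by(rule Suc.IH[OF sm_pd[OF Suc.prems(1)] Suc.prems(2) HbN_pd[OF Suc.prems(3) v] HbN_SucD[OF Suc.prems(4)] ws])
 hence 2: "HbN 0 (%z. pds ws (%z. pr (pd v y z) (bz z)) z-pr (pds ws (pd v y) z) (bz z)) (2^(n+2)*(Y*B))" by simp
 have "HbN 0 (%z. pds ws (%z. pr (y z) (pd v bz z)) z + (pds ws (%z. pr (pd v y z) (bz z)) z-pr (pds ws (pd v y) z) (bz z))) (2^Suc (Suc n)*(Y*B)+2^(n+2)*(Y*B))"
  by(rule HbN_add[OF _ _ 1 2]) (intro sm_diff sm_pds s1 s2 open_UNIV sm_bilinear[OF pr(1)] sm_pd Suc.prems)+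
 moreover have "(%z. pds vs (%z. pr (y z) (bz z)) z-pr (pds vs y z) (bz z)) = (%z. pds ws (%z. pr (y z) (pd v bz z)) z +
   (pds ws (%z. pr (pd v y z) (bz z)) z-pr (pds ws (pd v y) z) (bz z)))" unfolding vs by(rule ext) (simp add: eq pds_add[OF s1 s2])
 moreover have "2^Suc (Suc n)*(Y*B)+2^(n+2)*(Y*B) = 2^(Suc n+2)*(Y*B)" by simp
 ultimately show ?case by(simp only: HbN.simps(1))
qed

section \<open>The nonlinear operator and its estimates\<close>

definition bt :: "nat => (nat => C2) => (C2 => C2) => (complex => C2) => complex => C2" where "bt N h q g z = chi z*.q (UU N h g z)"

definition yy :: "nat => (nat => C2) => C2 => (complex => C2) => complex => real" where "yy N h i g z = pd 1 (UU N h g) z.*i"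

text \<open>\<open>chi\<close> times the linear map with columns Q_i (u), applied to u_x and
  expanded in the basis. A fixed point g therefore gives u_x + i u_y = Q (u) u_x near 0, where
  \<open>chi\<close> is 1, and the cut-off confines g to the disc of radius 1/2.\<close>

definition FF where "FF N h Q g z = (SUM i:(Basis::C2 set). yy N h i g z*.bt N h (Q i) g z)"

lemma smooth_yy: "sm g UNIV ==> sm (yy N h i g) UNIV" unfolding yy_def[abs_def] by(intro sm_inner sm_pd smooth_UU open_UNIV)

lemma smooth_bt:
 assumes "sm g UNIV" "open S" "sm q S" "!!z. UU N h g z : S" shows "sm (bt N h q g) UNIV" unfolding bt_def[abs_def]
 by(intro sm_scaleR open_UNIV smooth_chi sm_comp[OF open_UNIV assms(2,3) smooth_UU[OF assms(1)]] assms(4))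

lemma smooth_FF:
 assumes "sm g UNIV" "open S" "!!i. i : Basis ==> sm (Q i) S" "!!z. UU N h g z : S" shows "sm (FF N h Q g) UNIV" unfolding FF_def[abs_def]
 by(intro sm_sum sm_scaleR smooth_yy smooth_bt[OF assms(1,2)] open_UNIV assms)

lemma FF_zero: "norm z >= 1/2 ==> FF N h Q g z = 0" by(simp add: FF_def bt_def chi_zero)

lemma UU_HbN:
 assumes "N <= n" shows "EX K>0. ! h H g B. (! j<=N. norm (h j) <= H) --> sm g UNIV --> HbN n g B --> HbN (Suc n) (UU N h g) (K*(H+B))"
proof -
 obtain K where K: "K > 0" "!!d D. sm d UNIV ==> HbN n d D ==> HbN (Suc n) (LU N d) (K*D)" using LU_HbN[OF assms] by blast
 obtain E where E: "E > 0" "!!h H. (! j<=N. norm (h j) <= H) ==> HbN (Suc n) (%z. SUM j<=N. cmul (ee j z) (h j)) (E*H)" using HbN_poly[of N "Suc n"] by blast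
 show ?thesis proof(intro exI[of _ "K+E"] conjI allI impI)
  show "K+E > 0" using K E by simp
  fix h :: "nat => C2" and H and g :: "complex => C2" and B
  assume a: "! j<=N. norm (h j) <= H" "sm g UNIV" "HbN n g B"
  have "0 <= norm (h 0)" by simp
  also have "... <= H" using a(1) by blast
  finally have H: "H >= 0" .
  have "HbN (Suc n) (UU N h g) (E*H+K*B)" unfolding UU_def[abs_def] by(rule HbN_add[OF smooth_poly smooth_LU[OF a(2)] E(2)[OF a(1)] K(2)[OF a(2,3)]])
  thus "HbN (Suc n) (UU N h g) ((K+E)*(H+B))" by(rule HbN_mono) (use K(1) E(1) H HbN_nonneg[OF a(3)] in \<open>simp add: algebra_simps\<close>)
 qed
qed

text \<open>Differences of the coefficients along two maps are estimated in order n + 1, and such a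
  difference costs two further derivatives of \<open>Q\<close>, hence n + 3.\<close>

definition goodQ :: "nat => (C2 => C2 => C2) => real => C2 set => bool" where
 "goodQ n Q M S \<longleftrightarrow> open S & convex S & (! i:Basis. sm (Q i) S & Qb (n+3) (Q i) M S)"

text \<open>Since \<open>UU\<close> gains a derivative over \<open>g\<close>, the coefficient
  factors are controlled in order n + 1 and the factor u_x in order \<open>n\<close>.\<close>

definition "BYb N n B H K \<longleftrightarrow> (! Q S M h g g' D. goodQ n Q M S --> (! j<=N. norm (h j) <= H) -->
  sm g UNIV --> sm g' UNIV --> (! z. UU N h g z : S) --> (! z. UU N h g' z : S) -->
  HbN n g B --> HbN n g' B --> HbN n (%z. g z-g' z) D --> (! i:Basis. HbN (Suc n) (bt N h (Q i) g) (K*M) & HbN (Suc n) (bt N h (Q i) g') (K*M) &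
    HbN (Suc n) (%z. bt N h (Q i) g z-bt N h (Q i) g' z) (K*M*D) &
    HbN n (yy N h i g) K & HbN n (yy N h i g') K & HbN n (%z. yy N h i g z-yy N h i g' z) (K*D)))"
definition "FFb N n B H K \<longleftrightarrow> (! Q S M h g g' D. goodQ n Q M S --> (! j<=N. norm (h j) <= H) -->
  sm g UNIV --> sm g' UNIV --> (! z. UU N h g z : S) --> (! z. UU N h g' z : S) -->
  HbN n g B --> HbN n g' B --> HbN n (%z. g z-g' z) D -->
  HbN n (FF N h Q g) (K*M) & HbN n (%z. FF N h Q g z-FF N h Q g' z) (K*M*D))"
text \<open>A tame estimate in order n + 1: the top order norm \<open>X\<close> of the difference is
  multiplied by \<open>C\<close> and by the bound \<open>ka\<close> of order zero for the
  coefficients, while \<open>K\<close> multiplies only the norm \<open>D\<close> of lower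
  order.\<close>

definition "topb N n B h Q S ka C K \<longleftrightarrow> (! g g' D X B' vs. sm g UNIV --> sm g' UNIV --> (! z. UU N h g z : S) --> (! z. UU N h g' z : S) -->
  HbN n g B --> HbN n g' B --> HbN n (%z. g z-g' z) D --> (! i:Basis. Hb (bt N h (Q i) g) ka) -->
  dirs vs --> length vs = Suc n --> Hb (pds vs (%z. g z-g' z)) X --> Hb (pds vs g') B' -->
  Hb (pds vs (%z. FF N h Q g z-FF N h Q g' z)) (C*ka*X+K*(1+B')*D))"

lemma BY_estimate:
 assumes "N <= n" "B >= 0" "H >= 0" shows "EX K>0. BYb N n B H K"
proof -
 obtain K1 where K1: "K1 > 0" "!!h H g B. (! j<=N. norm (h j) <= H) ==> sm g UNIV ==> HbN n g B ==> HbN (Suc n) (UU N h g) (K1*(H+B))" using UU_HbN[OF assms(1)] by blast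
 obtain K2 where K2: "K2 > 0" "!!d D. sm d UNIV ==> HbN n d D ==> HbN (Suc n) (LU N d) (K2*D)" using LU_HbN[OF assms(1)] by blast
 define R where "R = K1*(H+B)"
 have R: "R >= 0" using assms K1 by(simp add: R_def)
 obtain K3 where K3: "K3 > 0" "!!S (Q :: C2 => C2) M u. open S ==> convex S ==> sm Q S ==>
   Qb (Suc (Suc n)) Q M S ==> sm u UNIV ==> (! z. u z : S) ==> HbN (Suc n) u R ==> HbN (Suc n) (%z. Q (u z)) (K3*M)"
  using HbN_compose[OF R, where ?'e="C2" and ?'f="C2", of "Suc n"] by blast
 obtain K4 where K4: "K4 > 0" "!!S (Q :: C2 => C2) M u u' D. open S ==> convex S ==> sm Q S ==>
   Qb (Suc (Suc (Suc n))) Q M S ==> sm u UNIV ==> (! z. u z : S) ==> HbN (Suc n) u R ==> sm u' UNIV ==>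
   (! z. u' z : S) ==> HbN (Suc n) u' R ==> HbN (Suc n) (%z. u z-u' z) D ==> HbN (Suc n) (%z. Q (u z)-Q (u' z)) (K4*M*D)"
  using HbN_compose_diff[OF R, where ?'e="C2" and ?'f="C2", of "Suc n"] by blast
 obtain X where X: "X > 0" "HbN (Suc n) chi X"
  using smooth_compact_HbN[OF smooth_chi, of "1/2" "Suc n"] chi_zero by(metis linorder_not_less mem_cball_0 order_less_imp_le)
 define E where "E = 2^Suc (Suc n)*X"
 have E: "E > 0" using X by(simp add: E_def)
 define K where "K = R+K2+E*K3+E*K4*K2"
 have Kp: "R <= K" "K2 <= K" "E*K3 <= K" "E*K4*K2 <= K" "K > 0" using R K2(1) K3(1) K4(1) E unfolding K_def by(auto simp: add_pos_nonneg add_nonneg_pos)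
 show ?thesis unfolding BYb_def proof(intro exI[of _ K] conjI allI impI ballI)
  show "K > 0" by fact
  fix Q S M and h :: "nat => C2" and g g' :: "complex => C2" and D and i :: C2
  assume Q: "goodQ n Q M S" and h: "! j<=N. norm (h j) <= H" and g: "sm g UNIV" and g': "sm g' UNIV"
   and S: "! z. UU N h g z : S" "! z. UU N h g' z : S" and B: "HbN n g B" "HbN n g' B" and D: "HbN n (%z. g z-g' z) D" and i: "i : Basis"
  have D0: "D >= 0" using HbN_nonneg[OF D] .
  have q: "open S" "convex S" "sm (Q i) S" "Qb (Suc (Suc (Suc n))) (Q i) M S" using Q i by(auto simp: goodQ_def eval_nat_numeral)
  have M: "M >= 0" using Qb_norm[OF q(4)] S(1) norm_ge_zero order_trans by blast
  have U: "HbN (Suc n) (UU N h g) R" "HbN (Suc n) (UU N h g') R" unfolding R_def by(intro K1(2) h g g' B)+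
  have smd: "sm (%z. g z-g' z) UNIV" by(intro sm_diff g g' open_UNIV)
  have dU: "HbN (Suc n) (%z. UU N h g z-UU N h g' z) (K2*D)" unfolding UU_diff[OF g g'] by(rule K2(2)[OF smd D])
  have smq: "sm (%z. Q i (UU N h f z)) UNIV" if "sm f UNIV" "! z. UU N h f z : S" for f using that by(intro sm_comp[OF open_UNIV q(1,3) smooth_UU]) auto
  have c1: "HbN (Suc n) (bt N h (Q i) f) (K*M)" if f: "sm f UNIV" "! z. UU N h f z : S" "HbN (Suc n) (UU N h f) R" for f proof -
   have "HbN (Suc n) (%z. Q i (UU N h f z)) (K3*M)" by(rule K3(2)[OF q(1-3) Qb_SucD[OF q(4)] smooth_UU[OF f(1)] f(2,3)])
   hence "HbN (Suc n) (bt N h (Q i) f) (2^Suc (Suc n)*(X*(K3*M)))" unfolding bt_def[abs_def] by(intro HbN_bilinear[OF bb_scaleR] smooth_chi smq f X(2)) auto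
   moreover have "2^Suc (Suc n)*(X*(K3*M)) = (E*K3)*M" by(simp add: E_def mult_ac)
   moreover have "(E*K3)*M <= K*M" using Kp M by(intro mono_r) auto
   ultimately show ?thesis by(metis HbN_mono)
  qed
  show "HbN (Suc n) (bt N h (Q i) g) (K*M)" "HbN (Suc n) (bt N h (Q i) g') (K*M)" by(rule c1; (rule g g' S U))+
  have "HbN (Suc n) (%z. Q i (UU N h g z)-Q i (UU N h g' z)) (K4*M*(K2*D))" by(rule K4(2)[OF q smooth_UU[OF g] S(1) U(1) smooth_UU[OF g'] S(2) U(2) dU])
  hence "HbN (Suc n) (%z. chi z*.(Q i (UU N h g z)-Q i (UU N h g' z))) (2^Suc (Suc n)*(X*(K4*M*(K2*D))))"
   by(intro HbN_bilinear[OF bb_scaleR] smooth_chi sm_diff smq g g' S open_UNIV X(2)) auto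
  moreover have "2^Suc (Suc n)*(X*(K4*M*(K2*D))) = (E*K4*K2)*(M*D)" by(simp add: E_def mult_ac)
  moreover have "(E*K4*K2)*(M*D) <= K*(M*D)" using Kp M D0 by(intro mono_r) auto
  ultimately have "HbN (Suc n) (%z. chi z*.(Q i (UU N h g z)-Q i (UU N h g' z))) (K*(M*D))" by(metis HbN_mono)
  thus "HbN (Suc n) (%z. bt N h (Q i) g z-bt N h (Q i) g' z) (K*M*D)" by(simp add: bt_def scaleR_diff_right mult_ac)
  have c2: "HbN n (yy N h i f) K" if f: "sm f UNIV" "HbN (Suc n) (UU N h f) R" for f unfolding yy_def[abs_def]
   by(rule HbN_mono[OF HbN_inner[OF i sm_pd[OF smooth_UU[OF f(1)]] HbN_pd[OF f(2)]] Kp(1)]) simp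
  show "HbN n (yy N h i g) K" "HbN n (yy N h i g') K" by(rule c2; (rule g g' U))+
  have pdU: "pd 1 (%z. UU N h g z-UU N h g' z) z = pd 1 (UU N h g) z-pd 1 (UU N h g') z" for z by(intro pd_diff sm_dif[OF smooth_UU] UNIV_I g g')
  have "HbN n (%z. pd 1 (%z. UU N h g z-UU N h g' z) z.*i) (K2*D)" by(rule HbN_inner[OF i sm_pd HbN_pd[OF dU]]) (auto intro!: sm_diff smooth_UU g g')
  hence "HbN n (%z. pd 1 (%z. UU N h g z-UU N h g' z) z.*i) (K*D)" by(rule HbN_mono) (use Kp D0 in \<open>auto intro: mono_r\<close>)
  thus "HbN n (%z. yy N h i g z-yy N h i g' z) (K*D)" by(simp add: yy_def pdU inner_diff_left)
 qed
qed

lemma card_Basis_C2: "card (Basis :: C2 set) = 4" by simp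

lemma FF_diff_eq: "FF N h Q g z-FF N h Q g' z = (SUM i:Basis. (yy N h i g z-yy N h i g' z)*.bt N h (Q i) g z
   + yy N h i g' z*.(bt N h (Q i) g z-bt N h (Q i) g' z))" unfolding FF_def by(simp add: sum_subtractf[symmetric] algebra_simps)

lemma FF_estimate:
 assumes "N <= n" "B >= 0" "H >= 0" shows "EX K>0. FFb N n B H K"
proof -
 obtain K where K: "K > 0" and BYK: "BYb N n B H K" using BY_estimate[OF assms] by blast
 note BY = BYK[unfolded BYb_def, rule_format (no_asm)]
 define K' where "K' = 8*(2^Suc n*(K*K))"
 show ?thesis unfolding FFb_def proof(intro exI[of _ K'] conjI allI impI)
  show "K' > 0" using K by(simp add: K'_def)
  fix Q S M and h :: "nat => C2" and g g' :: "complex => C2" and D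
  assume a: "goodQ n Q M S" "! j<=N. norm (h j) <= H" "sm g UNIV" "sm g' UNIV"
   "! z. UU N h g z : S" "! z. UU N h g' z : S" "HbN n g B" "HbN n g' B" "HbN n (%z. g z-g' z) D"
  have q: "open S" "sm (Q i) S" if "i : Basis" for i using a(1) that by(auto simp: goodQ_def)
  have "SOME_Basis": "(1, 0) : (Basis :: C2 set)" by(simp add: Basis_prod_def Basis_complex_def)
  have M: "M >= 0" using a(1) Qb_norm[of "n+3" "Q (1, 0)" M S "UU N h g 0"] a(5) SOME_Basis norm_ge_zero order_trans unfolding goodQ_def by blast
  note byf = BY[OF a]
  have sy: "sm (yy N h i g) UNIV" "sm (yy N h i g') UNIV" for i by(intro smooth_yy a)+
  have sb: "sm (bt N h (Q i) g) UNIV" "sm (bt N h (Q i) g') UNIV" if "i : Basis" for i using a(5,6) by(intro smooth_bt[OF _ q[OF that]] a; blast)+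
  have "HbN n (FF N h Q g) (real (card (Basis :: C2 set))*(2^Suc n*(K*(K*M))))" unfolding FF_def[abs_def] proof(rule HbN_sum)
   fix i :: C2 assume i: "i : Basis"
   show "sm (%z. yy N h i g z*.bt N h (Q i) g z) UNIV" by(intro sm_scaleR open_UNIV sy sb i)
   show "HbN n (%z. yy N h i g z*.bt N h (Q i) g z) (2^Suc n*(K*(K*M)))" using byf[rule_format, OF i] by(intro HbN_bilinear[OF bb_scaleR] sy sb i) (auto dest: HbN_SucD)
  qed simp
  thus "HbN n (FF N h Q g) (K'*M)" by(rule HbN_mono) (use K M in \<open>simp add: K'_def\<close>)
  have "HbN n (%z. SUM i:Basis. (yy N h i g z-yy N h i g' z)*.bt N h (Q i) g z
   + yy N h i g' z*.(bt N h (Q i) g z-bt N h (Q i) g' z)) (real (card (Basis :: C2 set))*(2^Suc n*((K*D)*(K*M))+2^Suc n*(K*(K*M*D))))" proof(rule HbN_sum)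
   fix i :: C2 assume i: "i : Basis"
   have s1: "sm (%z. (yy N h i g z-yy N h i g' z)*.bt N h (Q i) g z) UNIV" by(intro sm_scaleR sm_diff open_UNIV sy sb i)
   have s2: "sm (%z. yy N h i g' z*.(bt N h (Q i) g z-bt N h (Q i) g' z)) UNIV" by(intro sm_scaleR sm_diff open_UNIV sy sb i)
   show "sm (%z. (yy N h i g z-yy N h i g' z)*.bt N h (Q i) g z
    + yy N h i g' z*.(bt N h (Q i) g z-bt N h (Q i) g' z)) UNIV" by(rule sm_add[OF open_UNIV s1 s2])
   show "HbN n (%z. (yy N h i g z-yy N h i g' z)*.bt N h (Q i) g z
    + yy N h i g' z*.(bt N h (Q i) g z-bt N h (Q i) g' z)) (2^Suc n*((K*D)*(K*M))+2^Suc n*(K*(K*M*D)))" using byf[rule_format, OF i]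
    by(intro HbN_add[OF s1 s2] HbN_bilinear[OF bb_scaleR] sm_diff open_UNIV sy sb i) (auto dest: HbN_SucD)
  qed simp
  thus "HbN n (%z. FF N h Q g z-FF N h Q g' z) (K'*M*D)" unfolding FF_diff_eq by(rule HbN_mono) (simp add: K'_def algebra_simps)
 qed
qed

lemma Hb_diff: "Hb f B ==> Hb g C ==> Hb (%z. f z-g z) (B+C)" using Hb_add[of f B "%z. - g z" C] by(simp add: Hb_def norm_minus_commute)

lemma Hb_sum:
 fixes f :: "'i => complex => 'b::real_normed_vector"
 assumes "finite I" "!!i. i : I ==> Hb (f i) B" shows "Hb (%z. SUM i:I. f i z) (real (card I)*B)" using assms
proof(induction I rule: finite_induct)
 case (insert i I)
 have "Hb (%z. f i z+(SUM i:I. f i z)) (B+real (card I)*B)" using insert by(intro Hb_add) auto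
 thus ?case using insert by(simp add: algebra_simps)
qed (simp add: Hb_def)

text \<open>The constant \<open>C\<close> is independent of the order. The only term with n + 1
  derivatives on the difference of the unknowns comes from u_x, to which \<open>LU_top\<close>
  applies; the remaining terms are commutators or contain a difference of coefficients.\<close>

lemma FF_top: "EX C>0. ! N n B H Q S M ka h. N <= n --> B >= 0 --> H >= 0 --> ka >= 0 --> M >= 0 --> goodQ n Q M S --> (! j<=N. norm (h j) <= H) -->
  (EX K>0. topb N n B h Q S ka C K)"
proof -
 obtain C where C: "C > 0" and LT: "!!N n. EX K>0. ! d D X vs. sm d UNIV --> HbN N d D --> dirs vs --> length vs <= n -->
   Hb (pds vs d) X --> Hb (pds vs (pd 1 (LU N d))) (C*X+K*D)" using LU_top by blast
 show ?thesis proof(rule exI[of _ "8*C"], intro conjI allI impI)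
  show "8*C > 0" using C by simp
  fix N n :: nat and B H :: real and Q S and M ka :: real and h :: "nat => C2"
  assume nn: "N <= n" and B0: "B >= 0" and H0: "H >= 0" and k0: "ka >= 0" and M: "M >= 0" and gQ: "goodQ n Q M S" and h: "! j<=N. norm (h j) <= H"
  obtain K2 where K2: "K2 > 0" "!!d D X vs. sm d UNIV ==> HbN N d D ==> dirs vs ==> length vs <= Suc n ==>
    Hb (pds vs d) X ==> Hb (pds vs (pd 1 (LU N d))) (C*X+K2*D)" using LT[of N "Suc n"] by blast
  obtain E where E: "E > 0" "!!h H. (! j<=N. norm (h j) <= H) ==> HbN (Suc (Suc n)) (%z. SUM j<=N. cmul (ee j z) (h j)) (E*H)" using HbN_poly[of N "Suc (Suc n)"] by blast
  obtain K where K: "K > 0" and BYK: "BYb N n B H K" using BY_estimate[OF nn B0 H0] by blast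
  note BY = BYK[unfolded BYb_def, rule_format (no_asm)]
  define p where "p = (2::real)^(n+2)"
  have p: "p > 0" by(simp add: p_def)
  define L where "L = 4*(2*p*(K*(K*M))+2*(K2*ka)+2*((E*H+K2*B+C)*(K*M)))+1"
  have L: "L > 0" unfolding L_def using p K M K2(1) k0 E(1) H0 B0 C by(intro add_nonneg_pos) auto
  show "EX K>0. topb N n B h Q S ka (8*C) K" unfolding topb_def proof(intro exI[of _ L] conjI allI impI)
   show "L > 0" by fact
   fix g g' :: "complex => C2" and D X B' and vs :: "complex list"
   assume g: "sm g UNIV" "sm g' UNIV" and S: "! z. UU N h g z : S" "! z. UU N h g' z : S"
    and B: "HbN n g B" "HbN n g' B" and D: "HbN n (%z. g z-g' z) D" and kap: "! i:Basis. Hb (bt N h (Q i) g) ka"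
    and vs: "dirs vs" "length vs = Suc n" and X: "Hb (pds vs (%z. g z-g' z)) X" and B': "Hb (pds vs g') B'"
   have D0: "D >= 0" using HbN_nonneg[OF D] .
   have B'0: "B' >= 0" using Hb_nonneg[OF B'] .
   note byf = BY[OF gQ h g S B D]
   have q: "open S" "sm (Q i) S" if "i : Basis" for i using gQ that by(auto simp: goodQ_def)
   have sy: "sm (yy N h i g) UNIV" "sm (yy N h i g') UNIV" for i by(intro smooth_yy g)+
   have sb: "sm (bt N h (Q i) g) UNIV" "sm (bt N h (Q i) g') UNIV" if "i : Basis" for i using S by(intro smooth_bt[OF _ q[OF that]] g; blast)+
   have smd: "sm (%z. g z-g' z) UNIV" by(intro sm_diff g open_UNIV)
   have vs': "length vs <= Suc n" using vs by simp
   have top1: "Hb (pds vs (%z. yy N h i g z-yy N h i g' z)) (C*X+K2*D)" if i: "i : Basis" for i proof -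
    have "(%z. yy N h i g z-yy N h i g' z) = (%z. pd 1 (LU N (%z. g z-g' z)) z.*i)" proof(rule ext)
    fix z
    have "pd 1 (%z. UU N h g z-UU N h g' z) z = pd 1 (UU N h g) z-pd 1 (UU N h g') z" by(intro pd_diff sm_dif[OF smooth_UU] UNIV_I g)
    thus "yy N h i g z-yy N h i g' z = pd 1 (LU N (%z. g z-g' z)) z.*i" unfolding UU_diff[OF g] by(simp add: yy_def inner_diff_left)
    qed
    hence "pds vs (%z. yy N h i g z-yy N h i g' z) = (%z. pds vs (pd 1 (LU N (%z. g z-g' z))) z.*i)"
    using pds_linear[OF bounded_linear_inner_left sm_pd[OF smooth_LU[OF smd]]] by simp
    moreover have "HbN 0 (pds vs (pd 1 (LU N (%z. g z-g' z)))) (C*X+K2*D)" using K2(2)[OF smd HbN_le[OF D nn] vs(1) vs' X] by simp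
    ultimately show ?thesis using HbN_inner[OF i sm_pds[OF sm_pd[OF smooth_LU[OF smd]]], of 0] by simp
   qed
   have top2: "Hb (pds vs (yy N h i g')) (E*H+(C*B'+K2*B))" if i: "i : Basis" for i proof -
    let ?P = "%z. SUM j<=N. cmul (ee j z) (h j)"
    have "yy N h i g' = (%z. (pd 1 ?P z+pd 1 (LU N g') z).*i)" proof(rule ext)
    fix z
    have "pd 1 (UU N h g') z = pd 1 ?P z+pd 1 (LU N g') z" unfolding UU_def[abs_def] by(rule pd_add) (intro sm_dif[OF smooth_poly] sm_dif[OF smooth_LU] UNIV_I g)+
    thus "yy N h i g' z = (pd 1 ?P z+pd 1 (LU N g') z).*i" by(simp add: yy_def)
    qed
    hence "pds vs (yy N h i g') = (%z. pds vs (%z. pd 1 ?P z+pd 1 (LU N g') z) z.*i)"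
    using pds_linear[OF bounded_linear_inner_left sm_add[OF open_UNIV sm_pd sm_pd, OF smooth_poly smooth_LU[OF g(2)]]] by simp
    also have "pds vs (%z. pd 1 ?P z+pd 1 (LU N g') z) = (%z. pds vs (pd 1 ?P) z+pds vs (pd 1 (LU N g')) z)"
    by(rule pds_add[OF sm_pd sm_pd, OF smooth_poly smooth_LU[OF g(2)]])
    finally have eq: "pds vs (yy N h i g') = (%z. (pds vs (pd 1 ?P) z+pds vs (pd 1 (LU N g')) z).*i)" .
    have "HbN (Suc (Suc n)-length (1 # vs)) (pds (1 # vs) ?P) (E*H)" by(rule HbN_pds[OF E(2)[OF h]]) (use vs in auto)
    hence "Hb (pds vs (pd 1 ?P)) (E*H)" by(auto dest: HbN_Hb)
    from Hb_add[OF this K2(2)[OF g(2) HbN_le[OF B(2) nn] vs(1) vs' B']]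
    have "HbN 0 (%z. pds vs (pd 1 ?P) z+pds vs (pd 1 (LU N g')) z) (E*H+(C*B'+K2*B))" by simp
    thus ?thesis unfolding eq using HbN_inner[OF i sm_add[OF open_UNIV sm_pds sm_pds, OF sm_pd sm_pd, OF smooth_poly smooth_LU[OF g(2)]], of 0] by simp
   qed
   let ?T1 = "%i z. (yy N h i g z-yy N h i g' z)*.bt N h (Q i) g z"
   let ?T2 = "%i z. yy N h i g' z*.(bt N h (Q i) g z-bt N h (Q i) g' z)"
   have s1: "sm (?T1 i) UNIV" and s2: "sm (?T2 i) UNIV" if "i : Basis" for i by(intro sm_scaleR sm_diff open_UNIV sy sb that)+
   \<comment> \<open>The commutator costs norms of lower order only; in the principal term the
     coefficients enter through \<open>ka\<close>.\<close>
   have e1: "Hb (pds vs (?T1 i)) (p*(K*D*(K*M))+2*((C*X+K2*D)*ka))" if i: "i : Basis" for i proof -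
    have c: "Hb (%z. pds vs (?T1 i) z-pds vs (%z. yy N h i g z-yy N h i g' z) z*.bt N h (Q i) g z) (p*(K*D*(K*M)))" unfolding p_def using byf[rule_format, OF i]
    by(intro bilinear_commutator[OF bb_scaleR _ _ _ _ _ vs] sm_diff open_UNIV sy sb i) auto
    have "Hb (%z. pds vs (%z. yy N h i g z-yy N h i g' z) z*.bt N h (Q i) g z) (2*((C*X+K2*D)*ka))"
    by(rule Hb_bilinear[OF bb_scaleR _ top1[OF i] kap[rule_format, OF i]]) simp
    from Hb_add[OF c this] show ?thesis by simp
   qed
   have e2: "Hb (pds vs (?T2 i)) (p*(K*(K*M*D))+2*((E*H+(C*B'+K2*B))*(K*M*D)))" if i: "i : Basis" for i proof -
    have c: "Hb (%z. pds vs (?T2 i) z-pds vs (yy N h i g') z*.(bt N h (Q i) g z-bt N h (Q i) g' z)) (p*(K*(K*M*D)))" unfolding p_def using byf[rule_format, OF i]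
    by(intro bilinear_commutator[OF bb_scaleR _ _ _ _ _ vs] sm_diff open_UNIV sy sb i) auto
    have "Hb (%z. pds vs (yy N h i g') z*.(bt N h (Q i) g z-bt N h (Q i) g' z)) (2*((E*H+(C*B'+K2*B))*(K*M*D)))"
    using byf[rule_format, OF i] by(intro Hb_bilinear[OF bb_scaleR _ top2[OF i]]) (auto dest: HbN_Hb)
    from Hb_add[OF c this] show ?thesis by simp
   qed
   have eq: "pds vs (%z. FF N h Q g z-FF N h Q g' z) = (%z. SUM i:Basis. (pds vs (?T1 i) z+pds vs (?T2 i) z))" proof -
    have "pds vs (%z. SUM i:Basis. ?T1 i z+?T2 i z) = (%z. SUM i:Basis. pds vs (%z. ?T1 i z+?T2 i z) z)" by(intro pds_sum finite_Basis sm_add open_UNIV s1 s2)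
    also have "... = (%z. SUM i:Basis. (pds vs (?T1 i) z+pds vs (?T2 i) z))" by(rule ext) (simp add: pds_add[OF s1 s2])
    finally show ?thesis by(simp only: FF_diff_eq)
   qed
   have "Hb (%z. SUM i:(Basis::C2 set). (pds vs (?T1 i) z+pds vs (?T2 i) z)) (real (card (Basis::C2 set)) *
    ((p*(K*D*(K*M))+2*((C*X+K2*D)*ka))+(p*(K*(K*M*D))+2*((E*H+(C*B'+K2*B))*(K*M*D)))))" by(rule Hb_sum[OF finite_Basis Hb_add[OF e1 e2]])
   thus "Hb (pds vs (%z. FF N h Q g z-FF N h Q g' z)) (8*C*ka*X+L*(1+B')*D)" unfolding eq proof(rule Hb_mono)
    have "4*((p*(K*D*(K*M))+2*((C*X+K2*D)*ka))+(p*(K*(K*M*D))+2*((E*H+(C*B'+K2*B))*(K*M*D))))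
    = 8*C*ka*X+4*(2*p*(K*(K*M))+2*(K2*ka)+2*((E*H+K2*B+C*B')*(K*M)))*D" by(simp add: algebra_simps)
    also have "... <= 8*C*ka*X+L*(1+B')*D" proof(intro add_left_mono mono_r D0)
    have 1: "E*H+K2*B+C*B' <= (E*H+K2*B+C)*(1+B')" using E(1) H0 K2(1) B0 C B'0 by(simp add: algebra_simps)
    have "4*(2*p*(K*(K*M))+2*(K2*ka)+2*((E*H+K2*B+C*B')*(K*M)))
    <= 4*((2*p*(K*(K*M))+2*(K2*ka))*(1+B')+2*(((E*H+K2*B+C)*(1+B'))*(K*M)))" proof(intro mono_l add_mono mono_r 1)
    have "0 <= (2*p*(K*(K*M))+2*(K2*ka))*B'" using p K M K2(1) k0 B'0 by(intro mult_nonneg_nonneg) auto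
    thus "2*p*(K*(K*M))+2*(K2*ka) <= (2*p*(K*(K*M))+2*(K2*ka))*(1+B')" by(simp add: algebra_simps)
    qed (use K M in auto)
    also have "... = (L-1)*(1+B')" by(simp add: L_def algebra_simps)
    also have "... <= L*(1+B')" using B'0 by(intro mono_r) auto
    finally show "4*(2*p*(K*(K*M))+2*(K2*ka)+2*((E*H+K2*B+C*B')*(K*M))) <= L*(1+B')" .
    qed
    finally show "real (card (Basis::C2 set)) * ((p*(K*D*(K*M))+2*((C*X+K2*D)*ka))+(p*(K*(K*M*D))+2*((E*H+(C*B'+K2*B))*(K*M*D)))) <= 8*C*ka*X+L*(1+B')*D" by simp
   qed
  qed
 qed
qed

section \<open>Convergence of the iteration in all orders\<close>

lemma summable_half_recursion:
 fixes a c :: "nat => real"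
 assumes rec: "!!k. a (Suc k) = a k/2+c k" and a0: "a 0 >= 0" and c: "!!k. c k >= 0" "summable c" shows "summable a"
proof(rule summableI_nonneg_bounded)
 show nn: "0 <= a k" for k proof(induction k)
  case (Suc k) thus ?case using rec[of k] c(1)[of k] by simp
 qed (rule a0)
 fix n
 show "sum a {..<n} <= 2*(a 0+suminf c)" proof -
  have "sum a {..<Suc n} = a 0+(SUM k<n. a (Suc k))" by(rule sum.lessThan_Suc_shift)
  also have "(SUM k<n. a (Suc k)) = sum a {..<n}/2+sum c {..<n}" by(simp add: rec sum.distrib sum_divide_distrib)
  finally have "sum a {..<n} + a n = a 0+(sum a {..<n}/2+sum c {..<n})" by simp
  moreover have "sum c {..<n} <= suminf c" by(rule sum_le_suminf[OF c(2)]) (use c in auto)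
  moreover have "s <= 2*(p+r)" if "s+x = p+(s/2+q)" "q <= r" "0 <= x" for s x p q r :: real using that by(simp add: field_simps)
  ultimately show ?thesis using nn[of n] by blast
 qed
qed

text \<open>Every partial derivative converges uniformly with summable increments, so limits and
  derivatives may be exchanged one order at a time.\<close>

lemma smooth_limit:
 fixes f :: "nat => complex => 'b::euclidean_space"
 assumes sm: "!!k. sm (f k) UNIV" and bd: "!!vs. dirs vs ==> ? a. summable a & (! k z. norm (pds vs (f (Suc k)) z-pds vs (f k) z) <= a k)"
 shows "? g. sm g UNIV & (! vs z. dirs vs --> (%k. pds vs (f k) z) ----> pds vs g z)"
proof -
 define F where "F = (%vs z. lim (%k. pds vs (f k) z))"
 have conv: "(%k. pds vs (f k) z) ----> F vs z" and unif: "!!e. e > 0 ==> \<forall>\<^sub>F k in sequentially. ! z. norm (pds vs (f k) z-F vs z) <= e"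
  if vs: "dirs vs" for vs z proof -
  obtain a where a: "summable a" "!!k z. norm (pds vs (f (Suc k)) z-pds vs (f k) z) <= a k" using bd[OF vs] by blast
  have a0: "a k >= 0" for k using a(2)[of k 0] norm_ge_zero order_trans by blast
  have cv: "(%k. pds vs (f k) z) ----> F vs z" for z proof -
   have "summable (%k. pds vs (f (Suc k)) z-pds vs (f k) z)" by(rule summable_comparison_test[OF _ a(1)]) (use a(2) in auto)
   hence "(%n. SUM k<n. pds vs (f (Suc k)) z-pds vs (f k) z) ----> suminf (%k. pds vs (f (Suc k)) z-pds vs (f k) z)" by(rule summable_LIMSEQ)
   hence "(%n. (SUM k<n. pds vs (f (Suc k)) z-pds vs (f k) z)+pds vs (f 0) z) ----> suminf (%k. pds vs (f (Suc k)) z-pds vs (f k) z)+pds vs (f 0) z"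
    by(intro tendsto_intros)
   moreover have "(SUM k<n. pds vs (f (Suc k)) z-pds vs (f k) z)+pds vs (f 0) z = pds vs (f n) z" for n using sum_lessThan_telescope[of "%k. pds vs (f k) z" n] by simp
   ultimately have "convergent (%n. pds vs (f n) z)" by(auto simp: convergent_def)
   thus ?thesis unfolding F_def by(simp add: convergent_LIMSEQ_iff)
  qed
  show "(%k. pds vs (f k) z) ----> F vs z" by(rule cv)
  have diff: "norm (pds vs (f (k+m)) z-pds vs (f k) z) <= sum a {..<k+m} - sum a {..<k}" for k m z proof(induction m)
   case (Suc m)
   have "norm (pds vs (f (k+Suc m)) z-pds vs (f k) z)
    <= norm (pds vs (f (Suc (k+m))) z-pds vs (f (k+m)) z)+norm (pds vs (f (k+m)) z-pds vs (f k) z)"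
    using tri_ineq[of "pds vs (f (Suc (k+m))) z-pds vs (f (k+m)) z" "pds vs (f (k+m)) z-pds vs (f k) z"] by simp
   thus ?case using Suc a(2)[of "k+m" z] by simp
  qed simp
  have tail: "norm (pds vs (f k) z-F vs z) <= suminf a-sum a {..<k}" for k z proof -
   have "(%m. norm (pds vs (f (m+k)) z-pds vs (f k) z)) ----> norm (F vs z-pds vs (f k) z)" by(intro tendsto_intros LIMSEQ_ignore_initial_segment cv)
   moreover have "? N. ALL m>=N. norm (pds vs (f (m+k)) z-pds vs (f k) z) <= suminf a-sum a {..<k}" proof(intro exI allI impI)
    fix m
    show "norm (pds vs (f (m+k)) z-pds vs (f k) z) <= suminf a-sum a {..<k}" using diff[of k m z] sum_le_suminf[OF a(1), of "{..<k+m}"] a0 by(simp add: add.commute)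
   qed
   ultimately have "norm (F vs z-pds vs (f k) z) <= suminf a-sum a {..<k}" by(rule LIMSEQ_le_const2)
   thus ?thesis by(simp add: norm_minus_commute)
  qed
  fix e :: real assume "e > 0"
  have "(%k. suminf a-sum a {..<k}) ----> suminf a-suminf a" by(intro tendsto_intros summable_LIMSEQ a)
  hence "(%k. suminf a-sum a {..<k}) ----> 0" by simp
  from order_tendstoD(2)[OF this `e > 0`]
  show "\<forall>\<^sub>F k in sequentially. ! z. norm (pds vs (f k) z-F vs z) <= e"
   by eventually_elim (use tail order_trans less_imp_le in \<open>metis (no_types)\<close>)
 qed
 have lin: "pd h (pds vs (f k)) z = Re h*.pds (vs @ [1]) (f k) z+Im h*.pds (vs @ [\<i>]) (f k) z" for h vs k z
  using pd_Basis[OF sm_dif[OF sm_pds[OF sm] UNIV_I], of h vs k z] by(simp add: Basis_complex_def pds_append)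
 have der: "(F vs has_derivative (%h. Re h*.F (vs @ [1]) z+Im h*.F (vs @ [\<i>]) z)) (at z)"
  if vs: "dirs vs" for vs z proof -
  let ?g' = "%z h. Re h*.F (vs @ [1]) z+Im h*.F (vs @ [\<i>]) z"
  have "? g. ! x:UNIV. (%n. pds vs (f n) x) ----> g x & (g has_derivative ?g' x) (at x within UNIV)"
  proof(rule has_derivative_sequence[OF convex_UNIV _ _ UNIV_I conv[OF vs]])
   show "(pds vs (f n) has_derivative (%h. pd h (pds vs (f n)) x)) (at x within UNIV)" for n x using sm_deriv[OF sm_pds[OF sm]] by simp
   fix e :: real assume e: "e > 0"
   have v1: "set (vs @ [1]) <= {1, \<i>}" "set (vs @ [\<i>]) <= {1, \<i>}" using vs by auto
   have ev: "\<forall>\<^sub>F n in sequentially. (! z. norm (pds (vs @ [1]) (f n) z-F (vs @ [1]) z) <= e/2) &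
    (! z. norm (pds (vs @ [\<i>]) (f n) z-F (vs @ [\<i>]) z) <= e/2)" using e by(intro eventually_conj unif v1) auto
   show "\<forall>\<^sub>F n in sequentially. ! x:UNIV. ! h. norm (pd h (pds vs (f n)) x-?g' x h) <= e*norm h" proof(rule eventually_mono[OF ev], intro ballI allI)
    fix n x h
    assume "(! z. norm (pds (vs @ [1]) (f n) z-F (vs @ [1]) z) <= e/2) & (! z. norm (pds (vs @ [\<i>]) (f n) z-F (vs @ [\<i>]) z) <= e/2)"
    hence a: "! z. norm (pds (vs @ [1]) (f n) z-F (vs @ [1]) z) <= e/2" "! z. norm (pds (vs @ [\<i>]) (f n) z-F (vs @ [\<i>]) z) <= e/2" by blast+
    have "pd h (pds vs (f n)) x-?g' x h = Re h*.(pds (vs @ [1]) (f n) x-F (vs @ [1]) x)+Im h*.(pds (vs @ [\<i>]) (f n) x-F (vs @ [\<i>]) x)"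
    unfolding lin by(simp add: algebra_simps)
    hence "norm (pd h (pds vs (f n)) x-?g' x h) <= abs (Re h)*norm (pds (vs @ [1]) (f n) x-F (vs @ [1]) x)+abs (Im h)*norm (pds (vs @ [\<i>]) (f n) x-F (vs @ [\<i>]) x)"
    by(metis norm_scaleR tri_ineq)
    also have "... <= norm h*(e/2)+norm h*(e/2)" using a abs_Re_le_cmod[of h] abs_Im_le_cmod[of h] e by(intro add_mono mult_mono) auto
    finally show "norm (pd h (pds vs (f n)) x-?g' x h) <= e*norm h" by(simp add: mult.commute)
   qed
  qed
  then obtain g where g: "!!x. (%n. pds vs (f n) x) ----> g x" "!!x. (g has_derivative ?g' x) (at x)" by auto
  have "g = F vs" using LIMSEQ_unique[OF g(1) conv[OF vs]] by(rule ext)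
  with g(2)[of z] show ?thesis by simp
 qed
 have Ck: "Ck_on k (F vs) UNIV" if "dirs vs" for k vs using that proof(induction k arbitrary: vs)
  case 0
  have "isCont (F vs) z" for z using has_derivative_continuous[OF der[OF 0]] .
  thus ?case by(simp add: continuous_at_imp_continuous_on)
 next
  case (Suc k)
  show ?case by(rule Ck_SucI[OF open_UNIV der[OF Suc.prems]]) (use Suc.prems in \<open>auto intro!: Ck_add Ck_scaleR Ck_const Suc.IH\<close>)
 qed
 have eq: "pds vs (F ws) = F (ws @ vs)" if "dirs vs" "set ws <= {1, \<i>}" for vs ws using that proof(induction vs arbitrary: ws)
  case (Cons v vs)
  have "pd v (F ws) = F (ws @ [v])" using Cons.prems by(auto intro!: ext simp: pd_eq[OF der])
  thus ?case using Cons.IH[of "ws @ [v]"] Cons.prems by simp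
 qed simp
 show ?thesis proof(intro exI[of _ "F []"] conjI allI impI)
  show "sm (F []) UNIV" unfolding smooth_on_def using Ck by simp
  fix vs z assume "dirs vs"
  thus "(%k. pds vs (f k) z) ----> pds vs (F []) z" using conv eq[of vs "[]"] by simp
 qed
qed

lemma Hb_limit:
 assumes "!!z. (%m. f m z) ----> f' z" "!!m. m >= m0 ==> Hb (f m) B" shows "Hb f' B" unfolding Hb_def
proof(intro conjI allI)
 fix z w
 have "(%m. norm (f m z)) ----> norm (f' z)" by(intro tendsto_intros assms)
 thus "norm (f' z) <= B" by(rule LIMSEQ_le_const2) (use assms(2) HbD(1) in blast)
 have "(%m. norm (f m z-f m w)) ----> norm (f' z-f' w)" by(intro tendsto_intros assms)
 thus "norm (f' z-f' w) <= B * sqrt (norm (z-w))" by(rule LIMSEQ_le_const2) (use assms(2) HbD(2) in blast)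
qed

lemma HbN_iff_pds: "HbN n f B \<longleftrightarrow> (! vs. dirs vs & length vs <= n --> Hb (pds vs f) B)"
proof
 assume "HbN n f B"
 thus "! vs. dirs vs & length vs <= n --> Hb (pds vs f) B" using HbN_pds HbN_Hb by blast
next
 assume *: "! vs. dirs vs & length vs <= n --> Hb (pds vs f) B"
 have "HbN m f B" if "m <= n" for m using that proof(induction m)
  case 0
  show ?case using *[rule_format, of "[]"] by simp
 next
  case (Suc m)
  thus ?case using * by(intro HbN_from_pds) auto
 qed
 thus "HbN n f B" by simp
qed

lemma HbN_zero: "HbN n (%z. 0 :: C2) 0"
proof -
 have "HbN n (%z::complex. SUM i:({}::nat set). (0::C2)) (real (card ({}::nat set))*0)" by(rule HbN_sum) auto
 thus ?thesis by simp
qed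

text \<open>Smallness \<open>mu\<close> is required of finitely many derivatives of the
  coefficients; the higher ones may be large. The iteration contracts in the fixed order
  \<open>N\<close>, and convergence in the higher orders follows by induction from the tame
  estimate, whose factor \<open>C * ka\<close> stays below 1/2 whatever the order. Hence the limit
  is smooth.\<close>

theorem disc_fixed_point:
 assumes "H >= 0" shows "EX mu>0. EX R>0. ! Q h. goodQ N Q mu (ball 0 R) --> (! n. EX M>=0. goodQ n Q M (ball 0 R)) --> (! j<=N. norm (h j) <= H) -->
  (? g. sm g UNIV & (! z. norm z >= 1/2 --> g z = 0) & (! z. UU N h g z : ball 0 R) & (! z. g z = FF N h Q g z))"
proof -
 obtain KU where KU: "KU > 0" "!!h H g B. (! j<=N. norm (h j) <= H) ==> sm g UNIV ==> HbN N g B ==> HbN (Suc N) (UU N h g) (KU*(H+B))" using UU_HbN[of N N] by blast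
 obtain KF where KF: "KF > 0" "FFb N N 1 H KF" using FF_estimate[OF order_refl zero_le_one assms, of N] by blast
 note KFD = KF(2)[unfolded FFb_def, rule_format (no_asm)]
 obtain KB where KB: "KB > 0" "BYb N N 1 H KB" using BY_estimate[OF order_refl zero_le_one assms, of N] by blast
 obtain C where C: "C > 0" and top: "! N n B H Q S M ka h. N <= n --> B >= 0 --> H >= 0 --> ka >= 0 --> M >= 0 --> goodQ n Q M S --> (! j<=N. norm (h j) <= H) -->
  (EX K>0. topb N n B h Q S ka C K)" using FF_top by(elim exE conjE) (rule that)
 \<comment> \<open>Makes the contraction factor \<open>KF * mu\<close> in order \<open>N\<close> and
   the top order factor \<open>C * (KB * mu)\<close> at most 1/2.\<close>
 define mu where "mu = 1/(2*(KF+C*KB))"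
 define R where "R = KU*(H+1)+1"
 have mu: "mu > 0" "KF*mu <= 1/2" "C*(KB*mu) <= 1/2" proof -
  have 1: "KF > 0" "C*KB > 0" using KF(1) C KB(1) by auto
  thus "mu > 0" "KF*mu <= 1/2" unfolding mu_def by(auto simp: divide_le_eq)
  have "C*KB/(2*(KF+C*KB)) <= 1/2" using 1 by(simp add: divide_le_eq)
  thus "C*(KB*mu) <= 1/2" by(simp add: mu_def)
 qed
 have R: "R > 0" using KU(1) assms unfolding R_def by(intro add_nonneg_pos) auto
 show ?thesis proof(rule exI[of _ mu], intro conjI, rule mu, rule exI[of _ R], intro conjI, rule R, intro allI impI)
  fix Q and h :: "nat => C2"
  assume gQ: "goodQ N Q mu (ball 0 R)" and gQn: "! n. EX M>=0. goodQ n Q M (ball 0 R)" and h: "! j<=N. norm (h j) <= H"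
  let ?S = "ball 0 R :: C2 set"
  let ?F = "FF N h Q"
  have q: "sm (Q i) ?S" if "i : Basis" for i using gQ that by(auto simp: goodQ_def)
  have US: "! z. UU N h g z : ?S" if "sm g UNIV" "HbN N g 1" for g proof
   fix z
   have "norm (UU N h g z) <= KU*(H+1)" using HbD(1)[OF HbN_Hb[OF KU(2)[OF h that]]] .
   thus "UU N h g z : ?S" by(simp add: R_def)
  qed
  have smF: "sm (?F g) UNIV" if "sm g UNIV" "HbN N g 1" for g using US[OF that] q by(intro smooth_FF[OF that(1), of ?S]) auto
  have Fmap: "HbN N (?F g) 1" if "sm g UNIV" "HbN N g 1" for g proof -
   have "HbN N (%z. g z-g z) 2" using HbN_diff[OF that(1,1,2,2)] by simp
   from KFD[OF gQ h that(1,1) US[OF that] US[OF that] that(2,2) this]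
   have "HbN N (?F g) (KF*mu)" by blast
   thus ?thesis by(rule HbN_mono) (use mu in simp)
  qed
  have Fcontr: "HbN N (%z. ?F g z-?F g' z) (D/2)"
   if "sm g UNIV" "HbN N g 1" "sm g' UNIV" "HbN N g' 1" "HbN N (%z. g z-g' z) D" for g g' D proof -
   have "HbN N (%z. ?F g z-?F g' z) (KF*mu*D)" using KFD[OF gQ h that(1,3) US[OF that(1,2)] US[OF that(3,4)] that(2,4,5)] by blast
   thus ?thesis by(rule HbN_mono) (use mono_r[OF mu(2) HbN_nonneg[OF that(5)]] in simp)
  qed
  define gs where "gs = (%k. (?F ^^ k) (%z. 0))"
  have gs0: "gs 0 = (%z. 0)" and gsS: "gs (Suc k) = ?F (gs k)" for k by(simp_all add: gs_def)
  have inv: "sm (gs k) UNIV & HbN N (gs k) 1" for k proof(induction k)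
   case 0
   show ?case using HbN_zero[of N] by(auto simp: gs0 elim: HbN_mono)
  next
   case (Suc k)
   thus ?case by(simp add: gsS smF Fmap)
  qed
  hence sm: "sm (gs k) UNIV" and inv1: "HbN N (gs k) 1" for k by auto
  have smd: "sm (%z. gs k z-gs l z) UNIV" for k l by(intro sm_diff sm open_UNIV)
  note US' = US[OF sm inv1]
  have d: "HbN N (%z. gs (Suc k) z-gs k z) ((1/2)^k)" for k proof(induction k)
   case 0
   show ?case using inv1[of 1] by(simp add: gs0)
  next
   case (Suc k)
   show ?case using Fcontr[OF sm inv1 sm inv1 Suc] by(simp add: gsS)
  qed
  have P: "? a. summable a & (! k. HbN n (%z. gs (Suc k) z-gs k z) (a k))" if "N <= n" for n using that proof(induction n rule: dec_induct)
   case base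
   show ?case using d by(intro exI[of _ "%k. (1/2)^k"]) (auto intro: summable_geometric)
  next
   case (step n)
   then obtain a where a: "summable a" "!!k. HbN n (%z. gs (Suc k) z-gs k z) (a k)" by blast
   have a0: "a k >= 0" for k using HbN_nonneg[OF a(2)] .
   define B where "B = suminf a"
   have B0: "B >= 0" unfolding B_def by(rule suminf_nonneg[OF a(1) a0])
   have Bn: "HbN n (gs k) B" for k proof -
    have "HbN n (gs k) (sum a {..<k})" proof(induction k)
    case 0
    show ?case using HbN_zero[of n] by(simp add: gs0)
    next
    case (Suc k)
    from HbN_add[OF sm[of k] smd[of "Suc k" k] Suc a(2)[of k]] show ?case by simp
    qed
    thus ?thesis by(rule HbN_mono) (use sum_le_suminf[OF a(1), of "{..<k}"] a0 in \<open>auto simp: B_def\<close>)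
   qed
   obtain M where M: "M >= 0" "goodQ n Q M ?S" using gQn by blast
   \<comment> \<open>Bounds the coefficients along all iterates, since these stay in the unit ball
     of order \<open>N\<close>; it does not depend on the order \<open>n\<close> of the
     induction.\<close>
   define ka where "ka = KB*mu"
   have kap: "ka >= 0" "C*ka <= 1/2" using KB(1) mu by(auto simp: ka_def)
   have bk: "! i:Basis. Hb (bt N h (Q i) (gs k)) ka" for k proof -
    have "HbN N (%z. gs k z-gs k z) 2" using HbN_diff[OF sm sm inv1 inv1, of k k] by simp
    from KB(2)[unfolded BYb_def, rule_format (no_asm), OF gQ h sm sm US' US' inv1 inv1 this] show ?thesis unfolding ka_def by(blast intro: HbN_Hb)
   qed
   obtain K where K: "K > 0" and topK: "topb N n B h Q ?S ka C K" using top[rule_format (no_asm), OF step(1) B0 assms kap(1) M h] by(elim exE conjE) (rule that)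
   note est = topK[unfolded topb_def, rule_format (no_asm)]
   obtain T0 where T0: "T0 > 0" "HbN (Suc n) (gs 1) T0" using smooth_compact_HbN[OF sm[of 1], of "1/2" "Suc n"] FF_zero[of _ N h Q "gs 0"] gsS[of 0]
    by(metis One_nat_def linorder_not_less mem_cball_0 order_less_imp_le)
   \<comment> \<open>Solves B' = B'/2 + K B + T0, so that the top order bound passes from each
     iterate to the next.\<close>
   define B' where "B' = 2*(K*B+T0)"
   have B'0: "B' >= 0" using K B0 T0 by(simp add: B'_def)
   have zero0: "Hb (pds vs (gs 0)) 0" for vs using pds_sum[of "{} :: nat set" "%i (z::complex). 0 :: C2" vs] by(simp add: gs0 Hb_def)
   have topB: "Hb (pds vs (gs k)) B'" if vs: "dirs vs" "length vs = Suc n" for vs k proof(induction k)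
    case 0
    show ?case using Hb_mono[OF zero0 B'0] .
   next
    case (Suc k)
    have z: "(%z. gs k z-gs 0 z) = gs k" by(simp add: gs0)
    have "Hb (pds vs (%z. ?F (gs k) z-?F (gs 0) z)) (C*ka*B'+K*(1+0)*B)" by(rule est[OF sm sm US' US' Bn Bn _ bk vs _ zero0]) (simp_all add: z Bn Suc)
    moreover have "Hb (pds vs (gs 1)) T0" using T0(2) vs by(simp add: HbN_iff_pds)
    ultimately have "Hb (%z. pds vs (%z. ?F (gs k) z-?F (gs 0) z) z+pds vs (gs 1) z) (C*ka*B'+K*(1+0)*B+T0)" by(rule Hb_add)
    moreover have "(%z. pds vs (%z. ?F (gs k) z-?F (gs 0) z) z+pds vs (gs 1) z) = pds vs (gs (Suc k))"
    using pds_diff[OF sm[of "Suc k"] sm[of "Suc 0"], of vs] by(simp add: gsS[symmetric] One_nat_def)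
    ultimately have top: "Hb (pds vs (gs (Suc k))) (C*ka*B'+K*(1+0)*B+T0)" by(simp only:)
    have "C*ka*B' <= 1/2*B'" using kap(2) B'0 by(rule mono_r)
    moreover have "1/2*B' = K*(1+0)*B+T0" by(simp add: B'_def)
    ultimately have "C*ka*B'+K*(1+0)*B+T0 <= B'" by linarith
    with top show ?case by(rule Hb_mono)
   qed
   \<comment> \<open>Majorant of the top order increments: each is at most half of its predecessor
     plus a multiple of an increment of lower order, and the latter are summable already.\<close>
   define a' where "a' = rec_nat (2*B') (%k x. x/2+K*(1+B')*a k)"
   have a'0: "a' 0 = 2*B'" and a'S: "a' (Suc k) = a' k/2+K*(1+B')*a k" for k by(simp_all add: a'_def)
   have a's: "summable a'" proof(rule summable_half_recursion[where c="%k. K*(1+B')*a k"])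
    show "a' (Suc k) = a' k/2+K*(1+B')*a k" for k by(rule a'S)
   qed (use a'0 B'0 K a0 a(1) in \<open>auto intro: summable_mult\<close>)
   have a'B: "Hb (pds vs (%z. gs (Suc k) z-gs k z)) (a' k)" if vs: "dirs vs" "length vs = Suc n" for vs k proof(induction k)
    case 0
    have "Hb (%z. pds vs (gs (Suc 0)) z-pds vs (gs 0) z) (B'+B')" by(rule Hb_diff[OF topB[OF vs] topB[OF vs]])
    thus ?case by(simp add: a'0 pds_diff[OF sm sm])
   next
    case (Suc k)
    have X0: "a' k >= 0" using Hb_nonneg[OF Suc] .
    have "Hb (pds vs (%z. ?F (gs (Suc k)) z-?F (gs k) z)) (C*ka*a' k+K*(1+B')*a k)" by(rule est[OF sm sm US' US' Bn Bn a(2) bk vs Suc topB[OF vs]])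
    hence "Hb (pds vs (%z. gs (Suc (Suc k)) z-gs (Suc k) z)) (C*ka*a' k+K*(1+B')*a k)" by(simp only: gsS[symmetric])
    thus ?case by(rule Hb_mono) (use mono_r[OF kap(2) X0] in \<open>simp add: a'S\<close>)
   qed
   have a'nn: "a' k >= 0" for k using Hb_nonneg[OF a'B[of "replicate (Suc n) 1" k]] by(auto simp: set_replicate_conv_if)
   show ?case proof(intro exI[of _ "%k. a k+a' k"] conjI allI)
    show "summable (%k. a k+a' k)" by(intro summable_add a a's)
    fix k
    show "HbN (Suc n) (%z. gs (Suc k) z-gs k z) (a k+a' k)" proof(rule HbN_from_pds)
    show "HbN n (%z. gs (Suc k) z-gs k z) (a k+a' k)" by(rule HbN_mono[OF a(2)]) (use a'nn in simp)
    show "Hb (pds vs (%z. gs (Suc k) z-gs k z)) (a k+a' k)" if "dirs vs" "length vs = Suc n" for vs by(rule Hb_mono[OF a'B[OF that]]) (use a0 in simp)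
    qed
   qed
  qed
  have "? g. sm g UNIV & (! vs z. dirs vs --> (%k. pds vs (gs k) z) ----> pds vs g z)" proof(rule smooth_limit[OF sm])
   fix vs :: "complex list" assume vs: "dirs vs"
   obtain a where a: "summable a" "!!k. HbN (N+length vs) (%z. gs (Suc k) z-gs k z) (a k)" using P[of "N+length vs"] by auto
   have "norm (pds vs (gs (Suc k)) z-pds vs (gs k) z) <= a k" for k z proof -
    have "Hb (pds vs (%z. gs (Suc k) z-gs k z)) (a k)" using a(2)[of k] vs by(simp add: HbN_iff_pds)
    from HbD(1)[OF this, of z] show ?thesis by(simp add: pds_diff[OF sm sm])
   qed
   with a(1) show "? a. summable a & (! k z. norm (pds vs (gs (Suc k)) z-pds vs (gs k) z) <= a k)" by blast
  qed
  then obtain g where g: "sm g UNIV" "!!vs z. dirs vs ==> (%k. pds vs (gs k) z) ----> pds vs g z" by blast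
  have g1: "HbN N g 1" unfolding HbN_iff_pds proof(intro allI impI, elim conjE)
   fix vs :: "complex list" assume vs: "dirs vs" "length vs <= N"
   show "Hb (pds vs g) 1" by(rule Hb_limit[OF g(2)[OF vs(1)], of 0]) (use inv1 vs in \<open>auto simp: HbN_iff_pds\<close>)
  qed
  have tail: "HbN N (%z. g z-gs k z) (2*(1/2)^k)" for k proof -
   have dm: "HbN N (%z. gs (k+m) z-gs k z) (2*(1/2)^k*(1-(1/2)^m))" for m proof(induction m)
    case 0
    show ?case using HbN_zero[of N] by simp
   next
    case (Suc m)
    from HbN_add[OF smd[of "k+m" k] smd[of "Suc (k+m)" "k+m"] Suc d[of "k+m"]]
    have "HbN N (%z. gs (k+Suc m) z-gs k z) (2*(1/2)^k*(1-(1/2)^m)+(1/2)^(k+m))" by simp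
    thus ?case by(rule HbN_mono) (simp add: power_add field_simps)
   qed
   show ?thesis unfolding HbN_iff_pds proof(intro allI impI, elim conjE)
    fix vs :: "complex list" assume vs: "dirs vs" "length vs <= N"
    show "Hb (pds vs (%z. g z-gs k z)) (2*(1/2)^k)" proof(rule Hb_limit[of "%m z. pds vs (gs (m+k)) z-pds vs (gs k) z" _ 0])
    show "(%m. pds vs (gs (m+k)) z-pds vs (gs k) z) ----> pds vs (%z. g z-gs k z) z" for z
    unfolding pds_diff[OF g(1) sm] by(intro tendsto_intros LIMSEQ_ignore_initial_segment g(2) vs)
    fix m
    have "Hb (pds vs (%z. gs (k+m) z-gs k z)) (2*(1/2)^k*(1-(1/2)^m))" using dm[of m] vs by(simp add: HbN_iff_pds)
    hence "Hb (%z. pds vs (gs (m+k)) z-pds vs (gs k) z) (2*(1/2)^k*(1-(1/2)^m))" by(simp add: pds_diff[OF sm sm] add.commute)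
    thus "Hb (%z. pds vs (gs (m+k)) z-pds vs (gs k) z) (2*(1/2)^k)" by(rule Hb_mono) (simp add: field_simps)
    qed
   qed
  qed
  have lim0: "(%k. gs k z) ----> g z" for z using g(2)[of "[]"] by simp
  show "? g. sm g UNIV & (! z. norm z >= 1/2 --> g z = 0) & (! z. UU N h g z : ?S) & (! z. g z = ?F g z)" proof(intro exI[of _ g] conjI allI impI)
   show "sm g UNIV" by fact
   show "UU N h g z : ?S" for z using US[OF g(1) g1] by blast
   show eq: "g z = ?F g z" for z proof(rule LIMSEQ_unique)
    show "(%k. gs (Suc k) z) ----> g z" using lim0 by(rule LIMSEQ_Suc)
    have "norm (gs (Suc k) z-?F g z) <= (1/2)^k" for k proof -
    have "HbN N (%z. ?F g z-?F (gs k) z) ((2*(1/2)^k)/2)" by(rule Fcontr[OF g(1) g1 sm inv1 tail])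
    from HbD(1)[OF HbN_Hb[OF this], of z] show ?thesis by(simp add: gsS norm_minus_commute)
    qed
    hence ev: "\<forall>\<^sub>F k in sequentially. norm (gs (Suc k) z-?F g z) <= (1/2)^k" by(intro always_eventually allI)
    have "(%k. (1/2 :: real)^k) ----> 0" by(rule LIMSEQ_realpow_zero) auto
    from Lim_null_comparison[OF ev this] have "(%k. gs (Suc k) z-?F g z) ----> 0" .
    thus "(%k. gs (Suc k) z) ----> ?F g z" by(simp add: LIM_zero_iff)
   qed
   show "g z = 0" if "norm z >= 1/2" for z using eq[of z] FF_zero[OF that] by simp
  qed
 qed
qed

section \<open>Dilation of the coefficients and existence of discs\<close>

lemma Qb_cong:
 assumes "open S" shows "(!!x. x : S ==> f x = g x) ==> Qb n f M S ==> Qb n g M S"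
proof(induction n arbitrary: f g)
 case (Suc n)
 show ?case proof(rule Qb_SucI)
  show "norm (g x) <= M" if "x : S" for x using Qb_norm[OF Suc.prems(2) that] Suc.prems(1)[OF that] by simp
  fix i :: 'a assume "i : Basis"
  show "Qb n (pd i g) M S" by(rule Suc.IH[OF _ Qb_pd[OF Suc.prems(2) `i : Basis`]]) (rule pd_cong[OF assms Suc.prems(1)])
 qed
qed simp

lemma Qb_mono: "Qb n f M S ==> M <= M' ==> Qb n f M' S"
proof(induction n arbitrary: f)
 case (Suc n)
 show ?case by(rule Qb_SucI) (use Qb_norm[OF Suc.prems(1)] Suc.prems(2) Suc.IH[OF Qb_pd[OF Suc.prems(1)]] order_trans in blast)+
qed (auto intro: order_trans)

lemma Qb_scaleR:
 assumes "open S" "c >= 0" shows "sm f S ==> Qb n f M S ==> Qb n (%x. c*.f x) (c*M) S"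
proof(induction n arbitrary: f)
 case 0
 thus ?case using assms by(auto intro: mono_l)
next
 case (Suc n)
 show ?case proof(rule Qb_SucI)
  show "norm (c*.f x) <= c*M" if "x : S" for x using Qb_norm[OF Suc.prems(2) that] assms by(auto intro: mono_l)
  fix i :: 'a assume i: "i : Basis"
  have "Qb n (%x. c*.pd i f x) (c*M) S" by(rule Suc.IH[OF sm_pd[OF Suc.prems(1)] Qb_pd[OF Suc.prems(2) i]])
  thus "Qb n (pd i (%x. c*.f x)) (c*M) S" by(rule Qb_cong[OF assms(1), rotated]) (simp add: pd_scaleR_c sm_dif[OF Suc.prems(1)])
 qed
qed

lemma pd_rescaled:
 assumes "Q differentiable (at (ep*.x))" shows "pd v (%x. Q (ep*.x)) x = ep*.pd v Q (ep*.x)"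
proof -
 have h: "(Q has_derivative (%v. pd v Q (ep*.x))) (at (ep*.x))" by(rule hd_pd[OF assms])
 have "((%x. ep*.x) has_derivative (%v. ep*.v)) (at x)" by(auto intro!: derivative_eq_intros)
 from deriv_comp[OF this h]
 have "((%x. Q (ep*.x)) has_derivative (%v. pd (ep*.v) Q (ep*.x))) (at x)" .
 from pd_eq[OF this] show ?thesis by(simp add: linear_scale[OF deriv_lin[OF h]])
qed

lemma smooth_rescaled:
 fixes Q :: "'a::euclidean_space => 'b::real_normed_vector"
 assumes "sm Q T" "open T" "open S" "!!x. x : S ==> ep*.x : T" shows "sm (%x. Q (ep*.x)) S"
 by(rule sm_comp[OF assms(3,2,1) sm_bl[OF bounded_linear_scaleR_right] assms(4)])

lemma Qb_rescaled:
 fixes Q :: "'a::euclidean_space => 'b::real_normed_vector"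
 assumes "r0 > 0" shows "sm Q (ball 0 r0) ==> EX M>0. ! ep rh. 0 < ep & ep <= 1 & 0 < rh & ep*rh <= r0/2 --> Qb n (%x. Q (ep*.x)) M (ball 0 rh)"
proof(induction n arbitrary: Q)
 have in_r: "norm (ep*.x) <= r0/2" if "0 < ep" "ep*rh <= r0/2" "x : ball 0 rh" for ep rh and x :: 'a proof -
  have "ep*norm x <= ep*rh" using that by(intro mono_l) auto
  moreover have "norm (ep*.x) = ep*norm x" using that(1) by simp
  ultimately show ?thesis using that(2) by linarith
 qed
 have bd: "EX M>0. ! x:cball 0 (r0/2). norm (Q x) <= M" if "sm Q (ball 0 r0)" for Q :: "'a => 'b" proof -
  have "continuous_on (cball 0 (r0/2)) Q" by(rule cont_sub[OF sm_cont[OF that]]) (use assms in auto)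
  hence "bounded (Q ` cball 0 (r0/2))" by(intro compact_imp_bounded compact_continuous_image) auto
  thus ?thesis unfolding bounded_pos by auto
 qed
 {
  case 0
  from bd[OF 0] obtain M where M: "M > 0" "! x:cball 0 (r0/2). norm (Q x) <= M" by blast
  show ?case proof(rule exI[of _ M], intro conjI M(1) allI impI)
   fix ep rh assume a: "0 < ep & ep <= 1 & 0 < rh & ep*rh <= r0/2"
   show "Qb 0 (%x. Q (ep*.x)) M (ball 0 rh)" using in_r[of ep rh] a M(2) by(simp del: norm_scaleR)
  qed
 next
  case (Suc n)
  from bd[OF Suc.prems] obtain M where M: "M > 0" "! x:cball 0 (r0/2). norm (Q x) <= M" by blast
  have "! i. EX M>0. ! ep rh. 0 < ep & ep <= 1 & 0 < rh & ep*rh <= r0/2 --> Qb n (%x. pd i Q (ep*.x)) M (ball 0 rh)" using Suc.IH[OF sm_pd[OF Suc.prems]] by blast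
  from choice[OF this] obtain m where m: "!!i. m i > 0"
   "!!i ep rh. 0 < ep ==> ep <= 1 ==> 0 < rh ==> ep*rh <= r0/2 ==> Qb n (%x. pd i Q (ep*.x)) (m i) (ball 0 rh)" by blast
  define M' where "M' = M+sum m Basis"
  have sm0: "sum m Basis >= 0" by(intro sum_nonneg) (use m(1) less_imp_le in blast)
  have mM: "m i <= M'" if "i : Basis" for i proof -
  have "m i <= sum m Basis" by(rule member_le_sum[OF that]) (use m(1) less_imp_le in auto)
  thus ?thesis using M(1) by(simp add: M'_def)
 qed
  show ?case proof(rule exI[of _ M'], intro conjI allI impI)
   show "M' > 0" using M(1) sm0 by(simp add: M'_def)
   fix ep rh assume a: "0 < ep & ep <= 1 & 0 < rh & ep*rh <= r0/2"
   have inb: "ep*.x : ball 0 r0" if "x : ball 0 rh" for x :: 'a using in_r[of ep rh x] a that assms by(simp del: norm_scaleR)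
   show "Qb (Suc n) (%x. Q (ep*.x)) M' (ball 0 rh)" proof(rule Qb_SucI)
    show "norm (Q (ep*.x)) <= M'" if "x : ball 0 rh" for x using M(2)[rule_format, of "ep*.x"] in_r[of ep rh x] a that sm0 by(simp add: M'_def del: norm_scaleR)
    fix i :: 'a assume i: "i : Basis"
    have "Qb n (%x. pd i Q (ep*.x)) M' (ball 0 rh)" by(rule Qb_mono[OF m(2) mM[OF i]]) (use a in auto)
    hence "Qb n (%x. ep*.pd i Q (ep*.x)) (ep*M') (ball 0 rh)" using a by(intro Qb_scaleR smooth_rescaled[OF sm_pd[OF Suc.prems]] inb) auto
    hence "Qb n (%x. ep*.pd i Q (ep*.x)) M' (ball 0 rh)" by(rule Qb_mono) (use a M(1) sm0 in \<open>auto simp: M'_def intro: mult_left_le_one_le\<close>)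
    thus "Qb n (pd i (%x. Q (ep*.x))) M' (ball 0 rh)" by(rule Qb_cong[OF open_ball, rotated]) (simp add: pd_rescaled sm_dif[OF Suc.prems inb])
   qed
  qed
 }
qed

text \<open>As \<open>Q\<close> vanishes at 0, the values Q (ep x) are O(ep) by the mean value
  theorem, and derivatives carry a factor \<open>ep\<close> by the chain rule. Dilation thus makes
  the coefficients small in any fixed norm.\<close>

lemma Qb_rescaled_small:
 fixes Q :: "'a::euclidean_space => 'b::real_normed_vector"
 assumes "r0 > 0" "sm Q (ball 0 r0)" "Q 0 = 0" "rh > 0" shows "EX M>0. ! ep. 0 < ep & ep <= 1 & ep*rh <= r0/2 --> Qb (Suc n) (%x. Q (ep*.x)) (ep*M) (ball 0 rh)"
proof -
 obtain M0 where M0: "M0 > 0" "!!ep rh. 0 < ep ==> ep <= 1 ==> 0 < rh ==> ep*rh <= r0/2 ==> Qb (Suc n) (%x. Q (ep*.x)) M0 (ball 0 rh)"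
  using Qb_rescaled[OF assms(1,2), of "Suc n"] by blast
 have "! i. EX M>0. ! ep rh. 0 < ep & ep <= 1 & 0 < rh & ep*rh <= r0/2 --> Qb n (%x. pd i Q (ep*.x)) M (ball 0 rh)"
  using Qb_rescaled[OF assms(1) sm_pd[OF assms(2)]] by blast
 from choice[OF this] obtain m where m: "!!i. m i > 0"
  "!!i ep rh. 0 < ep ==> ep <= 1 ==> 0 < rh ==> ep*rh <= r0/2 ==> Qb n (%x. pd i Q (ep*.x)) (m i) (ball 0 rh)" by blast
 have "Qb (Suc n) (%x. Q (1*.x)) M0 (ball 0 (r0/2))" by(rule M0(2)) (use assms in auto)
 hence QM0: "Qb (Suc n) Q M0 (ball 0 (r0/2))" by simp
 have sub: "ball 0 (r0/2) <= ball (0::'a) r0" using assms by auto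
 have lip: "norm (Q x) <= real (DIM('a))*M0*norm x" if "x : ball 0 (r0/2)" for x using Qb_lipschitz[OF QM0 convex_ball _ that, of 0] sm_dif[OF assms(2)] sub assms by auto
 define M where "M = real (DIM('a))*M0*rh+sum m Basis"
 have sm0: "sum m Basis >= 0" by(intro sum_nonneg) (use m(1) less_imp_le in blast)
 have mM: "m i <= M" if "i : Basis" for i proof -
  have "m i <= sum m Basis" by(rule member_le_sum[OF that]) (use m(1) less_imp_le in auto)
  moreover have "0 <= real DIM('a)*M0*rh" using M0(1) assms(4) by(intro mult_nonneg_nonneg) auto
  ultimately show ?thesis by(simp add: M_def)
 qed
 have Mp: "M > 0" using M0(1) assms(4) sm0 by(simp add: M_def add_pos_nonneg)
 show ?thesis proof(rule exI[of _ M], intro conjI allI impI)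
  show "M > 0" by fact
  fix ep assume a: "0 < ep & ep <= 1 & ep*rh <= r0/2"
  have inb: "ep*.x : ball 0 (r0/2)" if "x : ball 0 rh" for x :: 'a proof -
   have "ep*norm x < ep*rh" using that a by simp
   moreover have "norm (ep*.x) = ep*norm x" using a by simp
   ultimately have "norm (ep*.x) < r0/2" using a by linarith
   thus ?thesis by(simp del: norm_scaleR)
  qed
  hence inb': "ep*.x : ball 0 r0" if "x : ball 0 rh" for x :: 'a using sub that by blast
  show "Qb (Suc n) (%x. Q (ep*.x)) (ep*M) (ball 0 rh)" proof(rule Qb_SucI)
   fix x :: 'a assume x: "x : ball 0 rh"
   have "norm (Q (ep*.x)) <= real (DIM('a))*M0*norm (ep*.x)" by(rule lip[OF inb[OF x]])
   also have "... <= real (DIM('a))*M0*(ep*rh)" using M0(1) a x by(intro mono_l) auto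
   also have "... <= ep*M" using a sm0 by(simp add: M_def algebra_simps)
   finally show "norm (Q (ep*.x)) <= ep*M" .
  next
   fix i :: 'a assume i: "i : Basis"
   have "Qb n (%x. pd i Q (ep*.x)) M (ball 0 rh)" by(rule Qb_mono[OF m(2) mM[OF i]]) (use a assms in auto)
   hence "Qb n (%x. ep*.pd i Q (ep*.x)) (ep*M) (ball 0 rh)" using a by(intro Qb_scaleR smooth_rescaled[OF sm_pd[OF assms(2)]] inb') auto
   thus "Qb n (pd i (%x. Q (ep*.x))) (ep*M) (ball 0 rh)" by(rule Qb_cong[OF open_ball, rotated]) (simp add: pd_rescaled sm_dif[OF assms(2) inb'])
  qed
 qed
qed

lemma pds_cong:
 assumes "open S" shows "(!!x. x : S ==> f x = g x) ==> x : S ==> pds vs f x = pds vs g x"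
proof(induction vs arbitrary: f g)
 case (Cons v vs)
 show ?case using Cons.IH[OF pd_cong[OF assms Cons.prems(1)] Cons.prems(2)] by simp
qed simp

lemma pd_power: "pd v (%z::complex. z^j) = (%z. of_nat j*z^(j-1) * v)"
proof(rule ext, rule pd_eq)
 fix z :: complex
 have "((%z. z^j) has_field_derivative of_nat j*z^(j-1)) (at z)" by(auto intro!: derivative_eq_intros)
 thus "((%z. z^j) has_derivative (%v. of_nat j*z^(j-1) * v)) (at z)" by(simp add: hfd_def)
qed

lemma smooth_power: "sm (%z::complex. z^j) S"
proof -
 have "sm (%z::complex. z^j) UNIV" by(rule sm_power[OF open_UNIV sm_bl[OF bounded_linear_ident]])
 thus ?thesis by(rule sm_subset) simp
qed

lemma pds_power: "pds (replicate i 1) (%z::complex. z^j) 0 = (if i = j then fact j else 0)"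
proof(induction i arbitrary: j)
 case 0
 show ?case by(cases j) auto
next
 case (Suc i)
 have "pds (replicate (Suc i) 1) (%z::complex. z^j) 0 = pds (replicate i 1) (%z. of_nat j*z^(j-1)) 0" by(simp add: pd_power)
 also have "... = of_nat j*pds (replicate i 1) (%z. z^(j-1)) 0" using pds_linear[OF bounded_linear_mult_right smooth_power] by metis
 also have "... = (if Suc i = j then fact j else 0)" unfolding Suc by(cases j) auto
 finally show ?case .
qed

lemma UU_eq: "UU N h g z = (SUM j<=N. cmul (ee j z) (h j-jet (SS g) j))+SS g z" unfolding UU_def LU_def by(simp add: cmul_diff_right sum_subtractf)

lemma UU_near_0: "norm z < 1/8 ==> UU N h g z = (SUM j<=N. cmul (z^j) (h j-jet (SS g) j))+SS g z" by(simp add: UU_eq ee_def chi_one)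

lemma jet_UU:
 assumes g: "sm g UNIV" and j: "j <= N" shows "(pd 1 ^^ j) (UU N h g) 0 = fact j*.h j"
proof -
 let ?vs = "replicate j (1::complex)"
 let ?c = "%j. h j-jet (SS g) j"
 have sm: "sm (%z. cmul (z^i) (?c i)) UNIV" for i by(rule sm_lin[OF bl_cmul_left open_UNIV smooth_power])
 have "pds ?vs (UU N h g) 0 = pds ?vs (%z. (SUM i<=N. cmul (z^i) (?c i))+SS g z) 0" by(rule pds_cong[of "ball 0 (1/8)"]) (auto simp: UU_near_0)
 also have "... = pds ?vs (%z. SUM i<=N. cmul (z^i) (?c i)) 0+pds ?vs (SS g) 0" by(subst pds_add[OF sm_sum[OF open_UNIV sm] smooth_SS[OF g]]) simp
 also have "pds ?vs (%z. SUM i<=N. cmul (z^i) (?c i)) 0 = (SUM i<=N. pds ?vs (%z. cmul (z^i) (?c i)) 0)" by(subst pds_sum[OF _ sm]) auto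
 also have "... = (SUM i<=N. cmul (if j = i then fact i else 0) (?c i))" by(intro sum.cong refl) (simp add: pds_linear[OF bl_cmul_left smooth_power] pds_power)
 also have "... = (SUM i<=N. if i = j then cmul (fact j) (?c j) else 0)" by(intro sum.cong refl) auto
 also have "... = cmul (fact j) (?c j)" using j by simp
 also have "cmul (fact j) (?c j) = fact j*.?c j" using cmul_of_real[of "fact j"] by simp
 also have "fact j*.?c j+pds ?vs (SS g) 0 = fact j*.h j" by(simp add: jet_def pds_replicate scaleR_diff_right)
 finally show ?thesis by(simp add: pds_replicate)
qed

lemma UU_dbar:
 assumes g: "sm g UNIV" and supp: "!!z. norm z >= 1/2 ==> g z = 0" and z: "norm z < 1/8" shows "pd 1 (UU N h g) z+cmul \<i> (pd \<i> (UU N h g) z) = g z"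
proof -
 let ?P = "%z. SUM j<=N. cmul (z^j) (h j-jet (SS g) j)"
 have sm: "sm (%z. cmul (z^i) (h i-jet (SS g) i)) UNIV" for i by(rule sm_lin[OF bl_cmul_left open_UNIV smooth_power])
 have smP: "sm ?P UNIV" by(rule sm_sum[OF open_UNIV sm])
 have 1: "pd v (UU N h g) z = pd v ?P z+pd v (SS g) z" for v proof -
  have "pd v (UU N h g) z = pd v (%z. ?P z+SS g z) z" by(rule pd_cong[of "ball 0 (1/8)"]) (use z in \<open>auto simp: UU_near_0\<close>)
  also have "... = pd v ?P z+pd v (SS g) z" by(rule pd_add[OF sm_dif[OF smP UNIV_I] sm_dif[OF smooth_SS[OF g] UNIV_I]])
  finally show ?thesis .
 qed
 have P: "pd v ?P z = cmul v (pd 1 ?P z)" for v proof -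
  have 2: "pd v ?P z = (SUM j<=N. cmul (of_nat j*z^(j-1) * v) (h j-jet (SS g) j))" for v by(subst pd_sum[OF sm_dif[OF sm UNIV_I]])
    (simp add: pd_lin[OF bl_cmul_left sm_dif[OF smooth_power UNIV_I]] pd_power)
  show ?thesis unfolding 2 linear_sum[OF bounded_linear.linear[OF bl_cmul]] by(simp add: mult_ac)
 qed
 have S: "pd v (SS g) z = (1/c0)*.pd v (TT g) z" for v unfolding SS_def[abs_def] by(rule pd_scaleR_c[OF sm_dif[OF sm_TT[OF g] UNIV_I]])
 have "pd 1 (UU N h g) z+cmul \<i> (pd \<i> (UU N h g) z)
   = (pd 1 ?P z+cmul \<i> (pd \<i> ?P z))+(1/c0)*.(pd 1 (TT g) z+cmul \<i> (pd \<i> (TT g) z))" unfolding 1 S by(simp add: cmul_add_right cmul_scaleR_right algebra_simps)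
 also have "pd 1 ?P z+cmul \<i> (pd \<i> ?P z) = 0" unfolding P[of \<i>] by(simp add: cmul_minus1)
 also have "pd 1 (TT g) z+cmul \<i> (pd \<i> (TT g) z) = c0*.g z" by(rule TT_dbar[OF g supp]) (use z in auto)
 finally show ?thesis using c0_pos by simp
qed

text \<open>After a dilation by a small \<open>ep\<close> the coefficients meet the smallness
  condition of the fixed point theorem. The solution is restricted to the disc of radius 1/8, where
  the cut-off is 1, and reparametrised by the unit disc. This scales the prescribed jet by powers of
  \<open>t\<close>.\<close>

theorem local_discs:
 fixes b :: "C2 => C2 => C2" and h :: "nat => C2"
 assumes r0: "r0 > 0" and sm: "!!i. i : Basis ==> sm (%z. b z i) (ball 0 r0)" and lin: "!!z. z : ball 0 r0 ==> linear (b z)" and b0: "!!i. i : Basis ==> b 0 i = 0"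
 shows "EX t>0. t <= 1 & (? u. sm u UNIV & u 0 = 0 & (! j. 1 <= j & j <= N --> (pd 1 ^^ j) u 0 = t^j*.(fact j*.h j)) &
   (! z:DD. u z : ball 0 r0 & pd 1 u z+cmul \<i> (pd \<i> u z) = b (u z) (pd 1 u z)))"
proof -
 define H where "H = (SUM j<=N. norm (h j))"
 have H0: "H >= 0" by(simp add: H_def sum_nonneg)
 have Hh: "norm (h j) <= H" if "j <= N" for j unfolding H_def using that by(intro member_le_sum) auto
 obtain mu R where mu: "mu > 0" and R: "R > 0" and fp: "!!Q h. goodQ N Q mu (ball 0 R) ==> (! n. EX M>=0. goodQ n Q M (ball 0 R)) ==> (! j<=N. norm (h j) <= H) ==>
  (? g. sm g UNIV & (! z. norm z >= 1/2 --> g z = 0) & (! z. UU N h g z : ball 0 R) & (! z. g z = FF N h Q g z))" using disc_fixed_point[OF H0, of N] by blast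
 have "! i:Basis. EX M>0. ! ep. 0 < ep & ep <= 1 & ep*R <= r0/2 --> Qb (Suc (N+2)) (%x. b (ep*.x) i) (ep*M) (ball 0 R)" using Qb_rescaled_small[OF r0 sm b0 R] by blast
 from bchoice[OF this] obtain m where m: "!!i. i : Basis ==> m i > 0"
  "!!i ep. i : Basis ==> 0 < ep ==> ep <= 1 ==> ep*R <= r0/2 ==> Qb (N+3) (%x. b (ep*.x) i) (ep*m i) (ball 0 R)" by(auto simp: eval_nat_numeral)
 define M where "M = 1+sum m Basis"
 have sm0: "sum m Basis >= 0" by(intro sum_nonneg) (use m(1) less_imp_le in blast)
 have mM: "m i <= M" if "i : Basis" for i proof -
  have "m i <= sum m Basis" by(rule member_le_sum[OF that]) (use m(1) less_imp_le in auto)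
  thus ?thesis using that by(simp add: M_def)
 qed
 define ep where "ep = min 1 (min (r0/2/R) (mu/M))"
 have M1: "M > 0" using sm0 by(simp add: M_def)
 have e: "0 < ep" "ep <= 1" "ep*R <= r0/2" "ep*M <= mu" proof -
  show "0 < ep" "ep <= 1" using r0 R mu M1 by(auto simp: ep_def)
  have "ep <= r0/2/R" "ep <= mu/M" by(auto simp: ep_def)
  thus "ep*R <= r0/2" "ep*M <= mu" using R M1 by(simp_all add: pos_le_divide_eq)
 qed
 define Q where "Q = (%i x. b (ep*.x) i)"
 have inb: "ep*.x : ball 0 r0" if "x : ball 0 R" for x :: C2 proof -
  have "ep*norm x < ep*R" using that e(1) by simp
  moreover have "norm (ep*.x) = ep*norm x" using e by simp
  ultimately have "norm (ep*.x) < r0" using e(3) r0 by linarith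
  thus ?thesis by(simp del: norm_scaleR)
 qed
 have smQ: "sm (Q i) (ball 0 R)" if "i : Basis" for i unfolding Q_def by(rule smooth_rescaled[OF sm[OF that] open_ball open_ball inb])
 have gQ: "goodQ N Q mu (ball 0 R)" unfolding goodQ_def proof(intro conjI ballI)
  fix i :: C2 assume i: "i : Basis"
  show "sm (Q i) (ball 0 R)" by(rule smQ[OF i])
  have "ep*m i <= mu" using mono_l[OF mM[OF i], of ep] e by linarith
  thus "Qb (N+3) (Q i) mu (ball 0 R)" unfolding Q_def using m(2)[OF i e(1-3)] Qb_mono by blast
 qed auto
 have gQn: "! n. EX M>=0. goodQ n Q M (ball 0 R)" proof
  fix n
  have "! i:Basis. EX M>0. Qb (n+3) (Q i) M (ball 0 R)" proof
   fix i :: C2 assume i: "i : Basis"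
   from Qb_rescaled[OF r0 sm[OF i], of "n+3"] e R show "EX M>0. Qb (n+3) (Q i) M (ball 0 R)" unfolding Q_def by blast
  qed
  from bchoice[OF this] obtain m where m: "!!i. i : Basis ==> m i > 0" "!!i. i : Basis ==> Qb (n+3) (Q i) (m i) (ball 0 R)" by blast
  have "goodQ n Q (sum m Basis) (ball 0 R)" unfolding goodQ_def proof(intro conjI ballI)
   fix i :: C2 assume i: "i : Basis"
   show "sm (Q i) (ball 0 R)" by(rule smQ[OF i])
   have "m i <= sum m Basis" using m(1) less_imp_le by(intro member_le_sum[OF i]) auto
   thus "Qb (n+3) (Q i) (sum m Basis) (ball 0 R)" using m(2)[OF i] Qb_mono by blast
  qed auto
  moreover have "sum m Basis >= 0" by(intro sum_nonneg) (use m(1) less_imp_le in blast)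
  ultimately show "EX M>=0. goodQ n Q M (ball 0 R)" by blast
 qed
 \<comment> \<open>The power ep^(j-1) complements the outer factor \<open>ep\<close> of
   \<open>u\<close>, so that the j-th derivative of \<open>u\<close> carries exactly t^j with t =
   ep/8. The value at 0 is prescribed as 0.\<close>
 define h' where "h' = (%j. if j = 0 then 0 else ep^(j-1)*.h j)"
 have h': "! j<=N. norm (h' j) <= H" proof(intro allI impI)
  fix j assume j: "j <= N"
  show "norm (h' j) <= H" proof(cases "j = 0")
   case False
   have "ep^(j-1)*norm (h j) <= 1*norm (h j)" using e by(intro mono_r power_le_one) auto
   thus ?thesis using Hh[OF j] False e by(simp add: h'_def)
  qed (simp add: h'_def H0)
 qed
 obtain g where g: "sm g UNIV" "!!z. norm z >= 1/2 ==> g z = 0" "!!z. UU N h' g z : ball 0 R" "!!z. g z = FF N h' Q g z" using fp[OF gQ gQn h'] by blast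
 let ?U = "UU N h' g"
 have smU: "sm ?U UNIV" by(rule smooth_UU[OF g(1)])
 have eqU: "pd 1 ?U z+cmul \<i> (pd \<i> ?U z) = b (ep*.?U z) (pd 1 ?U z)" if "norm z < 1/8" for z proof -
  have "pd 1 ?U z+cmul \<i> (pd \<i> ?U z) = g z" by(rule UU_dbar[OF g(1,2) that])
  also have "... = (SUM i:Basis. (pd 1 ?U z.*i)*.b (ep*.?U z) i)" using g(4)[of z] that by(simp add: FF_def yy_def bt_def chi_one Q_def)
  also have "... = b (ep*.?U z) (pd 1 ?U z)" by(rule lin_Basis[symmetric, OF lin[OF inb[OF g(3)]]])
  finally show ?thesis .
 qed
 define t where "t = ep/8"
 define u where "u = (%z. ep*.?U ((1/8)*.z))"
 have smr: "sm (%z. ?U ((1/8)*.z)) UNIV" by(rule smooth_rescaled[OF smU]) auto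
 have pdu: "pd v u z = t*.pd v ?U ((1/8)*.z)" for v z unfolding u_def t_def by(simp add: pd_scaleR_c sm_dif[OF smr] pd_rescaled sm_dif[OF smU])
 have jr: "(pd 1 ^^ j) (%z. f ((1/8)*.z)) 0 = (1/8)^j*.(pd 1 ^^ j) f 0" if "sm f UNIV" for f :: "complex => C2" and j unfolding pds_replicate using that
 proof(induction j arbitrary: f)
  case (Suc j)
  have "pd 1 (%z. f ((1/8)*.z)) = (%z. (1/8)*.pd 1 f ((1/8)*.z))" by(rule ext) (rule pd_rescaled[OF sm_dif[OF Suc.prems UNIV_I]])
  moreover have "sm (%z. pd 1 f ((1/8)*.z)) UNIV" by(rule smooth_rescaled[OF sm_pd[OF Suc.prems]]) auto
  ultimately show ?case using Suc.IH[OF sm_pd[OF Suc.prems]] pds_linear[OF bounded_linear_scaleR_right, of "%z. pd 1 f ((1/8)*.z)" "replicate j 1" "1/8"] by simp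
 qed simp
 show ?thesis proof(rule exI[of _ t], intro conjI)
  show "t > 0" "t <= 1" using e by(auto simp: t_def)
  show "? u. sm u UNIV & u 0 = 0 & (! j. 1 <= j & j <= N --> (pd 1 ^^ j) u 0 = t^j*.(fact j*.h j)) &
   (! z:DD. u z : ball 0 r0 & pd 1 u z+cmul \<i> (pd \<i> u z) = b (u z) (pd 1 u z))" proof(rule exI[of _ u], intro conjI ballI allI impI)
   show "sm u UNIV" unfolding u_def by(rule sm_lin[OF bounded_linear_scaleR_right open_UNIV smr])
   show "u 0 = 0" using jet_UU[OF g(1), of 0 N h'] by(simp add: u_def h'_def)
   fix j assume j: "1 <= j & j <= N"
   have "(pd 1 ^^ j) u 0 = ep*.(pd 1 ^^ j) (%z. ?U ((1/8)*.z)) 0" unfolding u_def pds_replicate pds_linear[OF bounded_linear_scaleR_right smr] by simp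
   also have "... = ep*.((1/8)^j*.(fact j*.(ep^(j-1)*.h j)))" unfolding jr[OF smU] jet_UU[OF g(1) conjunct2[OF j]] using j by(simp add: h'_def)
   also have "... = t^j*.(fact j*.h j)" using j by(cases j) (auto simp: t_def power_divide)
   finally show "(pd 1 ^^ j) u 0 = t^j*.(fact j*.h j)" .
  next
   fix z :: complex assume z: "z : DD"
   show "u z : ball 0 r0" unfolding u_def by(rule inb[OF g(3)])
   have uz: "u z = ep*.?U ((1/8)*.z)" by(simp add: u_def)
   have z8: "norm ((1/8)*.z) < 1/8" using z by simp
   have "pd 1 u z+cmul \<i> (pd \<i> u z) = t*.b (u z) (pd 1 ?U ((1/8)*.z))" unfolding pdu cmul_scaleR_right uz using eqU[OF z8] by(simp add: scaleR_add_right[symmetric])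
   also have "... = b (u z) (pd 1 u z)" unfolding pdu uz by(simp add: linear_scale[OF lin[OF inb[OF g(3)]]])
   finally show "pd 1 u z+cmul \<i> (pd \<i> u z) = b (u z) (pd 1 u z)" .
  qed
 qed
qed

subsection \<open>Flat functions\<close>

definition flat :: "nat => (complex => 'b::real_normed_vector) => bool" where "flat j f \<longleftrightarrow> (! vs. length vs < j --> pds vs f 0 = 0)"

lemma flat_0 [simp]: "flat 0 f" by(simp add: flat_def)

lemma flat_Suc: "flat (Suc j) f \<longleftrightarrow> f 0 = 0 & (! v. flat j (pd v f))"
proof
 assume a: "flat (Suc j) f"
 show "f 0 = 0 & (! v. flat j (pd v f))" proof(intro conjI allI)
  show "f 0 = 0" using a[unfolded flat_def, rule_format, of "[]"] by simp
  show "flat j (pd v f)" for v unfolding flat_def using a[unfolded flat_def, rule_format, of "v # _"] by simp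
 qed
next
 assume a: "f 0 = 0 & (! v. flat j (pd v f))"
 show "flat (Suc j) f" unfolding flat_def proof(intro allI impI)
  fix vs :: "complex list" assume "length vs < Suc j"
  thus "pds vs f 0 = 0" using a by(cases vs) (auto simp: flat_def)
 qed
qed

lemma flat_mono: "flat j f ==> i <= j ==> flat i f" by(auto simp: flat_def)

lemma flat_cong:
 assumes "open S" "0 : S" "!!x. x : S ==> f x = g x" "flat j f" shows "flat j g" unfolding flat_def using pds_cong[OF assms(1), of f g 0] assms by(simp add: flat_def)

lemma flat_add:
 assumes S: "open S" "0 : S" shows "sm f S ==> sm g S ==> flat j f ==> flat j g ==> flat j (%z. f z+g z)"
proof(induction j arbitrary: f g)
 case (Suc j)
 have "flat j (pd v (%z. f z+g z))" for v proof(rule flat_cong[OF S])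
  show "flat j (%z. pd v f z+pd v g z)" using Suc.prems by(intro Suc.IH sm_pd) (auto simp: flat_Suc)
  show "pd v f x+pd v g x = pd v (%z. f z+g z) x" if "x : S" for x by(rule pd_add[symmetric]) (intro sm_dif[OF Suc.prems(1)] sm_dif[OF Suc.prems(2)] that)+
 qed
 thus ?case using Suc.prems by(simp add: flat_Suc)
qed simp

lemma flat_sum:
 fixes f :: "'i => complex => 'b::real_normed_vector"
 assumes S: "open S" "0 : S" and "finite I" "!!i. i : I ==> sm (f i) S" "!!i. i : I ==> flat j (f i)" shows "flat j (%z. SUM i:I. f i z)" using assms(3-)
proof(induction I rule: finite_induct)
 case empty
 have "flat j (%z::complex. 0::'b)" proof(induction j)
  case (Suc j)
  have "pd v (%z::complex. 0::'b) = (%z. 0)" for v by(rule ext) (rule pd_eq[OF has_derivative_const])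
  thus ?case using Suc by(simp add: flat_Suc)
 qed simp
 thus ?case by simp
next
 case (insert i I)
 thus ?case using flat_add[OF S, of "f i" "%z. SUM i:I. f i z" j] by(simp add: sm_sum S)
qed

lemma flat_linear:
 assumes L: "bounded_linear L" and S: "open S" "0 : S" shows "sm f S ==> flat j f ==> flat j (%z. L (f z))"
proof(induction j arbitrary: f)
 case (Suc j)
 have "flat j (pd v (%z. L (f z)))" for v proof(rule flat_cong[OF S])
  show "flat j (%z. L (pd v f z))" using Suc.prems by(intro Suc.IH sm_pd) (auto simp: flat_Suc)
  show "L (pd v f x) = pd v (%z. L (f z)) x" if "x : S" for x by(rule pd_lin[symmetric, OF L sm_dif[OF Suc.prems(1) that]])
 qed
 thus ?case using Suc.prems by(simp add: flat_Suc linear_0[OF bounded_linear.linear[OF L]])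
qed simp

lemma flat_diff:
 assumes S: "open S" "0 : S" and "sm f S" "sm g S" "flat j f" "flat j g" shows "flat j (%z. f z-g z)" using flat_add[OF S assms(3) sm_minus[OF S(1) assms(4)] assms(5)
   flat_linear[OF bounded_linear_minus[OF bounded_linear_ident] S assms(4,6)]] by simp

lemma flat_bilinear:
 assumes pr: "bounded_bilinear pr" and S: "open S" "0 : S" shows "sm f S ==> sm g S ==> flat a f ==> flat b g ==> n <= a+b ==> flat n (%z. pr (f z) (g z))"
proof(induction n arbitrary: f g a b)
 case (Suc n)
 have "f 0 = 0 | g 0 = 0" using Suc.prems by(cases a; cases b) (auto simp: flat_Suc)
 hence 0: "pr (f 0) (g 0) = 0" by(auto simp: bounded_bilinear.zero_left[OF pr] bounded_bilinear.zero_right[OF pr])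
 have "flat n (pd v (%z. pr (f z) (g z)))" for v proof(rule flat_cong[OF S])
  have 1: "flat n (%z. pr (f z) (pd v g z))" proof(cases b)
   case 0
   thus ?thesis using Suc.IH[OF Suc.prems(1) sm_pd[OF Suc.prems(2)] Suc.prems(3) flat_0] Suc.prems(5) by simp
  next
   case b': (Suc b')
   have "flat b' (pd v g)" using Suc.prems(4) unfolding b' by(simp add: flat_Suc)
   from Suc.IH[OF Suc.prems(1) sm_pd[OF Suc.prems(2)] Suc.prems(3) this] show ?thesis using Suc.prems(5) unfolding b' by simp
  qed
  have 2: "flat n (%z. pr (pd v f z) (g z))" proof(cases a)
   case 0
   thus ?thesis using Suc.IH[OF sm_pd[OF Suc.prems(1)] Suc.prems(2) flat_0 Suc.prems(4)] Suc.prems(5) by simp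
  next
   case a': (Suc a')
   have "flat a' (pd v f)" using Suc.prems(3) unfolding a' by(simp add: flat_Suc)
   from Suc.IH[OF sm_pd[OF Suc.prems(1)] Suc.prems(2) this Suc.prems(4)] show ?thesis using Suc.prems(5) unfolding a' by simp
  qed
  show "flat n (%z. pr (f z) (pd v g z)+pr (pd v f z) (g z))" by(rule flat_add[OF S _ _ 1 2]; intro sm_bilinear[OF pr S(1)] sm_pd Suc.prems)
  show "pr (f x) (pd v g x)+pr (pd v f x) (g x) = pd v (%z. pr (f z) (g z)) x" if "x : S" for x
   by(rule pd_bilinear[symmetric, OF pr sm_dif[OF Suc.prems(1) that] sm_dif[OF Suc.prems(2) that]])
 qed
 with 0 show ?case by(simp add: flat_Suc)
qed simp

lemma sm_pd_compose_sum:
 fixes Q :: "'e::euclidean_space => 'f::real_normed_vector"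
 assumes "open S" "open T" "sm Q T" "sm u S" "!!z. z : S ==> u z : T" "z : S" shows "pd v (%z. Q (u z)) z = (SUM i:Basis. (pd v u z.*i)*.pd i Q (u z))"
 by(rule pd_compose[OF sm_dif[OF assms(4,6)] sm_dif[OF assms(3) assms(5)[OF assms(6)]]])

text \<open>Differentiating once splits the difference into a term with the derivative of u - w and
  one with a difference of derivatives of \<open>Q\<close>; the induction hypothesis covers the
  latter.\<close>

lemma flat_compose_diff:
 fixes Q :: "'e::euclidean_space => 'f::real_normed_vector"
 assumes S: "open S" "0 : S" and T: "open T" and u: "sm u S" "!!z. z : S ==> u z : T" and w: "sm w S" "!!z. z : S ==> w z : T"
 shows "sm Q T ==> flat j (%z. u z-w z) ==> flat j (%z. Q (u z)-Q (w z))"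
proof(induction j arbitrary: Q)
 case (Suc j)
 have fl: "flat j (%z. u z-w z)" using flat_mono[OF Suc.prems(2)] by simp
 have sq: "sm (%z. pd i Q (u z)) S" "sm (%z. pd i Q (w z)) S" for i
  by(rule sm_comp[OF S(1) T sm_pd[OF Suc.prems(1)] u], assumption) (rule sm_comp[OF S(1) T sm_pd[OF Suc.prems(1)] w])
 have smQ: "sm (%z. Q (u z)) S" "sm (%z. Q (w z)) S" by(rule sm_comp[OF S(1) T Suc.prems(1) u], assumption) (rule sm_comp[OF S(1) T Suc.prems(1) w])
 have sd: "sm (%z. u z-w z) S" by(rule sm_diff[OF S(1) u(1) w(1)])
 have "flat j (pd v (%z. Q (u z)-Q (w z)))" for v proof(rule flat_cong[OF S])
  let ?f = "%i z. (pd v (%z. u z-w z) z.*i)*.pd i Q (u z)+(pd v w z.*i)*.(pd i Q (u z)-pd i Q (w z))"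
  have s1: "sm (%z. (pd v (%z. u z-w z) z.*i)*.pd i Q (u z)) S" and s2: "sm (%z. (pd v w z.*i)*.(pd i Q (u z)-pd i Q (w z))) S" for i
   by(intro sm_scaleR sm_inner sm_pd sd w sq sm_diff S)+
  show "flat j (%z. SUM i:Basis. ?f i z)" proof(rule flat_sum[OF S finite_Basis])
   fix i :: 'e assume i: "i : Basis"
   show "sm (?f i) S" by(rule sm_add[OF S(1) s1 s2])
   have 1: "flat j (%z. pd v (%z. u z-w z) z.*i)" using Suc.prems(2) by(intro flat_linear[OF bounded_linear_inner_left S] sm_pd sd) (auto simp: flat_Suc)
   have "flat j (%z. (pd v (%z. u z-w z) z.*i)*.pd i Q (u z))" by(rule flat_bilinear[OF bb_scaleR S sm_inner[OF S(1) sm_pd[OF sd]] sq(1) 1 flat_0]) simp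
   moreover have "flat j (%z. (pd v w z.*i)*.(pd i Q (u z)-pd i Q (w z)))" by(rule flat_bilinear[OF bb_scaleR S sm_inner[OF S(1) sm_pd[OF w(1)]] sm_diff[OF S(1) sq]
    flat_0 Suc.IH[OF sm_pd[OF Suc.prems(1)] fl]]) simp
   ultimately show "flat j (?f i)" by(rule flat_add[OF S s1 s2])
  qed
  fix x assume x: "x : S"
  have "pd v (%z. Q (u z)-Q (w z)) x = pd v (%z. Q (u z)) x-pd v (%z. Q (w z)) x" by(rule pd_diff[OF sm_dif[OF smQ(1) x] sm_dif[OF smQ(2) x]])
  also have "... = (SUM i:Basis. (pd v u x.*i)*.pd i Q (u x))-(SUM i:Basis. (pd v w x.*i)*.pd i Q (w x))"
   by(simp only: sm_pd_compose_sum[OF S(1) T Suc.prems(1) u x] sm_pd_compose_sum[OF S(1) T Suc.prems(1) w x])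
  also have "... = (SUM i:Basis. ?f i x)" by(simp add: pd_diff sm_dif[OF u(1) x] sm_dif[OF w(1) x]
    sum_subtractf[symmetric] inner_diff_left algebra_simps)
  finally show "(SUM i:Basis. ?f i x) = pd v (%z. Q (u z)-Q (w z)) x" by simp
 qed
 moreover have "u 0 = w 0" using Suc.prems(2) by(simp add: flat_Suc)
 ultimately show ?case by(simp add: flat_Suc)
qed simp

lemma flat_bound:
 assumes S: "open S" "0 : S" shows "sm f S ==> flat j f ==> ? C r. r > 0 & C > 0 & (! z. norm z < r --> norm (f z) <= C*norm z^j)"
proof(induction j arbitrary: f)
 case 0
 have "isCont f 0" using sm_cont[OF 0(1)] S by(simp add: continuous_on_eq_continuous_at)
 then obtain r where "r > 0" "!!z. dist z 0 < r ==> dist (f z) (f 0) < 1" unfolding continuous_at_eps_delta by(metis zero_less_one)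
 hence "norm (f z) <= (norm (f 0)+1)*norm z^0" if "norm z < r" for z using that norm_triangle_sub[of "f z" "f 0"] by(fastforce simp: dist_norm)
 thus ?case using `r > 0` by(intro exI[of _ "norm (f 0)+1"] exI[of _ r]) (auto simp: add_nonneg_pos)
next
 case (Suc j)
 obtain C1 r1 where 1: "r1 > 0" "C1 > 0" "!!z. norm z < r1 ==> norm (pd 1 f z) <= C1*norm z^j"
  using Suc.IH[OF sm_pd[OF Suc.prems(1)], of 1] Suc.prems(2) by(auto simp: flat_Suc)
 obtain C2 r2 where 2: "r2 > 0" "C2 > 0" "!!z. norm z < r2 ==> norm (pd \<i> f z) <= C2*norm z^j"
  using Suc.IH[OF sm_pd[OF Suc.prems(1)], of \<i>] Suc.prems(2) by(auto simp: flat_Suc)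
 obtain r3 where 3: "r3 > 0" "ball 0 r3 <= S" using S open_contains_ball by blast
 define r where "r = min r1 (min r2 r3)"
 have r: "r > 0" using 1 2 3 by(simp add: r_def)
 have "norm (f z) <= (C1+C2)*norm z^Suc j" if z: "norm z < r" for z proof -
  have "norm (f z-f 0) <= ((C1+C2)*norm z^j)*norm (z-0)" proof(rule differentiable_bound[of "cball 0 (norm z)" f "%z h. pd h f z"])
   fix x :: complex assume x: "x : cball 0 (norm z)"
   hence xS: "x : S" using z 3 by(auto simp: r_def)
   show "(f has_derivative (%h. pd h f x)) (at x within cball 0 (norm z))" using sm_deriv[OF Suc.prems(1) xS] has_derivative_at_withinI by blast
   show "onorm (%h. pd h f x) <= (C1+C2)*norm z^j" proof(rule onorm_le)
    fix h :: complex
    have xp: "norm x^j <= norm z^j" using x by(intro power_mono) auto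
    have "norm (pd 1 f x)+norm (pd \<i> f x) <= C1*norm x^j+C2*norm x^j" using x z 1(3)[of x] 2(3)[of x] by(intro add_mono) (auto simp: r_def)
    also have "... <= (C1+C2)*norm z^j" using mono_l[OF xp, of "C1+C2"] 1(2) 2(2) by(simp add: algebra_simps)
    finally have "(norm (pd 1 f x)+norm (pd \<i> f x))*norm h <= ((C1+C2)*norm z^j)*norm h" by(rule mono_r) simp
    thus "norm (pd h f x) <= (C1+C2)*norm z^j*norm h" using pd_linear_bound[OF sm_dif[OF Suc.prems(1) xS], of h] by linarith
   qed
  qed auto
  thus ?thesis using Suc.prems(2) by(simp add: flat_Suc mult_ac)
 qed
 thus ?case using r 1(2) 2(2) by(intro exI[of _ "C1+C2"] exI[of _ r]) auto
qed

text \<open>While the defect in the Cauchy-Riemann equation is flat enough, a derivative in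
  direction \<open>v\<close> acts at 0 like \<open>v\<close> times the derivative in direction 1. So
  flatness can be read off from the pure x-derivatives.\<close>

lemma CR_flat:
 fixes d :: "complex => C2"
 assumes S: "open S" "0 : S" shows "sm d S ==> flat (length vs) (%z. pd \<i> d z-cmul \<i> (pd 1 d z)) ==>
  pds vs d 0 = cmul (prod_list vs) ((pd 1 ^^ length vs) d 0)"
proof(induction vs arbitrary: d)
 case (Cons v vs)
 let ?e = "%d z. pd \<i> d z-cmul \<i> (pd 1 d z)"
 have sme: "sm (?e d) S" by(intro sm_diff sm_lin[OF bl_cmul] sm_pd Cons.prems S)
 have pv: "pd v d z = cmul v (pd 1 d z)+Im v *. ?e d z" if "z : S" for z using pd_Basis[OF sm_dif[OF Cons.prems(1) that], of v]
  by(simp add: Basis_complex_def cmul_def prod_eq_iff complex_eq_iff algebra_simps)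
 have "pds vs (pd v d) 0 = pds vs (%z. cmul v (pd 1 d z)+Im v *. ?e d z) 0" by(rule pds_cong[OF S(1) pv S(2)])
 also have "... = cmul v (pds vs (pd 1 d) 0)+Im v *. pds vs (?e d) 0" proof -
  have gen: "pds vs (%z. cmul v (f z)+Im v *. g z) 0 = cmul v (pds vs f 0)+Im v *. pds vs g 0"
   if "sm f S" "sm g S" for f g using that proof(induction vs arbitrary: f g)
   case (Cons w vs)
   have "pds vs (pd w (%z. cmul v (f z)+Im v *. g z)) 0 = pds vs (%z. cmul v (pd w f z)+Im v *. pd w g z) 0" proof(rule pds_cong[OF S(1) _ S(2)])
    fix z assume z: "z : S"
    show "pd w (%z. cmul v (f z)+Im v *. g z) z = cmul v (pd w f z)+Im v *. pd w g z" by(rule pd_eq) (intro has_derivative_add bounded_linear.has_derivative[OF bl_cmul]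
    has_derivative_scaleR_right sm_deriv[OF Cons.prems(1) z] sm_deriv[OF Cons.prems(2) z])
   qed
   thus ?case using Cons.IH[OF sm_pd sm_pd, OF Cons.prems] by simp
  qed simp
  show ?thesis by(rule gen[OF sm_pd[OF Cons.prems(1)] sme])
 qed
 also have "pds vs (?e d) 0 = 0" using Cons.prems(2) by(simp add: flat_def)
 also have "pds vs (pd 1 d) 0 = cmul (prod_list vs) ((pd 1 ^^ length vs) (pd 1 d) 0)" proof(rule Cons.IH[OF sm_pd[OF Cons.prems(1)]])
  show "flat (length vs) (?e (pd 1 d))" proof(rule flat_cong[OF S])
   show "flat (length vs) (pd 1 (?e d))" using Cons.prems(2) by(simp add: flat_Suc)
   fix z assume z: "z : S"
   have "pd 1 (?e d) z = pd 1 (pd \<i> d) z-cmul \<i> (pd 1 (pd 1 d) z)" by(rule pd_eq) (intro has_derivative_diff bounded_linear.has_derivative[OF bl_cmul]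
    sm_deriv[OF sm_pd[OF Cons.prems(1)] z])
   thus "pd 1 (?e d) z = ?e (pd 1 d) z" by(simp add: pd_symmetric_smooth[OF S(1) z Cons.prems(1), of 1 \<i>])
  qed
 qed
 finally show ?case by(simp add: funpow_swap1)
qed simp

lemma flat_CR_step:
 fixes d :: "complex => C2"
 assumes S: "open S" "0 : S" and "sm d S" "flat j (%z. pd \<i> d z-cmul \<i> (pd 1 d z))" "flat j d" "(pd 1 ^^ j) d 0 = 0" shows "flat (Suc j) d" unfolding flat_def
proof(intro allI impI)
 fix vs :: "complex list" assume "length vs < Suc j"
 then consider "length vs < j" | "length vs = j" by linarith
 thus "pds vs d 0 = 0" proof cases
  case 1
  thus ?thesis using assms(5) by(simp add: flat_def)
 next
  case 2
  thus ?thesis using CR_flat[OF S assms(3), of vs] assms(4,6) by simp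
 qed
qed

text \<open>
  Two solutions of the same quasilinear Cauchy--Riemann equation, with equal pure
  \<open>x\<close>-derivatives below order \<open>k\<close>, differ by a complex monomial of degree \<open>k\<close> up to order \<open>k + 1\<close>.
\<close>

lemma disc_jet_difference:
 fixes Jm :: "C2 => C2 => C2"
 assumes S: "open S" "0 : S" and T: "open T" and smJ: "!!v. sm (%z. Jm z v) T" and lin: "!!z. z : T ==> linear (Jm z)" and J0: "Jm 0 = J_st"
  and U: "sm U S" "!!z. z : S ==> U z : T" "!!z. z : S ==> pd \<i> U z = Jm (U z) (pd 1 U z)" "U 0 = 0"
  and V: "sm V S" "!!z. z : S ==> V z : T" "!!z. z : S ==> pd \<i> V z = Jm (V z) (pd 1 V z)" "V 0 = 0"
  and jets: "!!j. 1 <= j ==> j < k ==> (pd 1 ^^ j) U 0 = (pd 1 ^^ j) V 0" and k: "k >= 1" and c: "(pd 1 ^^ k) U 0-(pd 1 ^^ k) V 0 = fact k*.c"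
 shows "flat (Suc k) (%z. U z-V z-cmul (z^k) c)"
proof -
 let ?d = "%z. U z-V z"
 let ?e = "%d z. pd \<i> d z-cmul \<i> (pd 1 d z)"
 have sd: "sm ?d S" by(rule sm_diff[OF S(1) U(1) V(1)])
 have sJ: "sm (%z. Jm (U z) i) S" "sm (%z. Jm (V z) i) S" for i by(rule sm_comp[OF S(1) T smJ U(1,2)], assumption) (rule sm_comp[OF S(1) T smJ V(1,2)])
 have pdd: "pd v ?d z = pd v U z-pd v V z" if "z : S" for v z by(rule pd_diff[OF sm_dif[OF U(1) that] sm_dif[OF V(1) that]])
 \<comment> \<open>In the difference of the two equations the first term is as flat as
   \<open>?d\<close>. The second contains a derivative of \<open>?d\<close>, which is one order less
   flat, but regains that order from the factor J (V) - J_st vanishing at 0.\<close>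
 have e_flat: "flat j (?e ?d)" if fl: "flat j ?d" for j proof(rule flat_cong[OF S])
  let ?f = "%i z. (pd 1 U z.*i)*.(Jm (U z) i-Jm (V z) i)+(pd 1 ?d z.*i)*.(Jm (V z) i-J_st i)"
  have s1: "sm (%z. (pd 1 U z.*i)*.(Jm (U z) i-Jm (V z) i)) S" and s2: "sm (%z. (pd 1 ?d z.*i)*.(Jm (V z) i-J_st i)) S" for i
   by(intro sm_scaleR sm_inner sm_diff sm_pd sJ U sd S sm_const)+
  show "flat j (%z. SUM i:Basis. ?f i z)" proof(rule flat_sum[OF S finite_Basis])
   fix i :: C2 assume i: "i : Basis"
   show "sm (?f i) S" by(rule sm_add[OF S(1) s1 s2])
   have 1: "flat j (%z. (pd 1 U z.*i)*.(Jm (U z) i-Jm (V z) i))" by(rule flat_bilinear[OF bb_scaleR S sm_inner[OF S(1) sm_pd[OF U(1)]] sm_diff[OF S(1) sJ]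
    flat_0 flat_compose_diff[OF S T U(1,2) V(1,2) smJ fl]]) simp_all
   have 2: "flat j (%z. (pd 1 ?d z.*i)*.(Jm (V z) i-J_st i))" proof(rule flat_bilinear[OF bb_scaleR S sm_inner[OF S(1) sm_pd[OF sd]] sm_diff[OF S(1) sJ(2) sm_const]])
    show "flat (j-1) (%z. pd 1 ?d z.*i)" proof(cases j)
    case (Suc n)
    thus ?thesis using fl by(intro flat_linear[OF bounded_linear_inner_left S sm_pd[OF sd]]) (auto simp: flat_Suc)
    qed simp
    show "flat 1 (%z. Jm (V z) i-J_st i)" by(simp add: flat_Suc[of 0, simplified] V(4) J0)
   qed simp
   show "flat j (?f i)" by(rule flat_add[OF S s1 s2 1 2])
  qed
  fix z assume z: "z : S"
  have JB: "Jm y v = (SUM i:Basis. (v.*i)*.Jm y i)" if "y : T" for y v by(rule lin_Basis[OF lin[OF that]])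
  have SB: "cmul \<i> v = (SUM i:Basis. (v.*i)*.J_st i)" for v unfolding J_st_cmul by(rule lin_Basis[OF bounded_linear.linear[OF bl_cmul]])
  have "?e ?d z = Jm (U z) (pd 1 U z)-Jm (V z) (pd 1 V z)-cmul \<i> (pd 1 ?d z)" by(simp add: pdd[OF z] U(3)[OF z] V(3)[OF z])
  also have "... = (SUM i:Basis. ?f i z)" unfolding JB[OF U(2)[OF z], of "pd 1 U z"] JB[OF V(2)[OF z], of "pd 1 V z"] SB
   by(simp add: pdd[OF z] sum_subtractf[symmetric] inner_diff_left algebra_simps)
  finally show "(SUM i:Basis. ?f i z) = ?e ?d z" by simp
 qed
 have pd1d: "(pd 1 ^^ j) ?d 0 = (pd 1 ^^ j) U 0-(pd 1 ^^ j) V 0" for j proof -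
  have "pds vs (%z. f z-g z) x = pds vs f x-pds vs g x" if "sm f S" "sm g S" "x : S"
   for vs and f g :: "complex => C2" and x using that proof(induction vs arbitrary: f g)
   case (Cons w vs)
   have "pds vs (pd w (%z. f z-g z)) x = pds vs (%z. pd w f z-pd w g z) x" by(rule pds_cong[OF S(1) pd_diff Cons.prems(3)])
    (intro sm_dif[OF Cons.prems(1)] sm_dif[OF Cons.prems(2)], assumption)+
   thus ?case using Cons.IH[OF sm_pd sm_pd, OF Cons.prems] by simp
  qed simp
  from this[OF U(1) V(1) S(2)] show ?thesis by(simp add: pds_replicate)
 qed
 have fj: "flat j ?d" if "j <= k" for j using that proof(induction j)
  case (Suc j)
  have "(pd 1 ^^ j) ?d 0 = 0" proof(cases "j = 0")
   case False
   thus ?thesis using jets[of j] Suc.prems by(simp add: pd1d)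
  qed (simp add: U(4) V(4))
  thus ?case using Suc by(intro flat_CR_step[OF S sd e_flat]) auto
 qed simp
 let ?m = "%z. cmul (z^k) c"
 have sm: "sm ?m UNIV" by(rule sm_lin[OF bl_cmul_left open_UNIV smooth_power])
 hence smS: "sm ?m S" by(rule sm_subset) simp
 \<comment> \<open>The monomial solves the Cauchy-Riemann equation exactly, so subtracting it leaves
   the defect unchanged.\<close>
 have pm: "pd v ?m z = cmul v (pd 1 ?m z)" for v z by(simp add: pd_lin[OF bl_cmul_left sm_dif[OF smooth_power UNIV_I]] pd_power mult_ac)
 have em: "?e (%z. ?d z-?m z) z = ?e ?d z" if "z : S" for z proof -
  have "pd v (%z. ?d z-?m z) z = pd v ?d z-pd v ?m z" for v by(rule pd_diff[OF sm_dif[OF sd that] sm_dif[OF smS that]])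
  thus ?thesis using pm[of \<i> z] by(simp add: cmul_diff_right)
 qed
 have jm: "(pd 1 ^^ j) ?m 0 = (if j = k then fact k*.c else 0)" for j unfolding pds_replicate pds_linear[OF bl_cmul_left smooth_power] pds_power
  using cmul_of_real[of "fact k" c] by auto
 have fm: "flat j ?m" if "j <= k" for j unfolding flat_def proof(intro allI impI)
  fix vs :: "complex list" assume l: "length vs < j"
  have "pds vs ?m 0 = cmul (prod_list vs) ((pd 1 ^^ length vs) ?m 0)" proof(rule CR_flat[OF open_UNIV UNIV_I sm])
   have "(%z. pd \<i> ?m z-cmul \<i> (pd 1 ?m z)) = (%z. SUM i:({}::nat set). 0)" unfolding pm[of \<i>] by simp
   thus "flat (length vs) (%z. pd \<i> ?m z-cmul \<i> (pd 1 ?m z))" using flat_sum[OF open_UNIV UNIV_I, of "{}::nat set" "%i z. 0 :: C2" "length vs"] by simp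
  qed
  thus "pds vs ?m 0 = 0" using l that by(simp add: jm)
 qed
 show ?thesis proof(rule flat_CR_step[OF S sm_diff[OF S(1) sd smS]])
  show "flat k (?e (%z. ?d z-?m z))" by(rule flat_cong[OF S _ e_flat[OF fj[OF order_refl]]]) (simp add: em)
  show "flat k (%z. ?d z-?m z)" by(rule flat_diff[OF S sd smS fj fm]) simp_all
  have "pds vs (%z. ?d z-?m z) 0 = pds vs ?d 0-pds vs ?m 0" for vs proof -
   have "pds vs (%z. f z-g z) 0 = pds vs f 0-pds vs g 0" if "sm f S" "sm g S"
    for f g :: "complex => C2" using that proof(induction vs arbitrary: f g)
    case (Cons w vs)
    have "pds vs (pd w (%z. f z-g z)) 0 = pds vs (%z. pd w f z-pd w g z) 0" by(rule pds_cong[OF S(1) pd_diff S(2)])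
    (intro sm_dif[OF Cons.prems(1)] sm_dif[OF Cons.prems(2)], assumption)+
    thus ?case using Cons.IH[OF sm_pd sm_pd, OF Cons.prems] by simp
   qed simp
   from this[OF sd smS] show ?thesis .
  qed
  hence "(pd 1 ^^ k) (%z. ?d z-?m z) 0 = (pd 1 ^^ k) ?d 0-(pd 1 ^^ k) ?m 0" by(simp add: pds_replicate)
  thus "(pd 1 ^^ k) (%z. ?d z-?m z) 0 = 0" by(simp add: pd1d jm c)
 qed
qed

subsection \<open>Charts and discs\<close>

lemma chart_facts:
 assumes "is_chart c" shows "open (chart_dom c)" "open (img c)" "continuous_on (chart_dom c) (coord c)" "continuous_on (img c) (coord_inv c)"
  "p : chart_dom c ==> coord_inv c (coord c p) = p" "z : img c ==> coord c (coord_inv c z) = z" "z : img c ==> coord_inv c z : chart_dom c"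
 using assms unfolding is_chart_def homeomorphism_def by auto

lemma open_coord_image:
 assumes c: "is_chart c" and S: "open S" shows "open (coord c ` (chart_dom c Int S))"
proof -
 have "coord c ` (chart_dom c Int S) = coord_inv c -` S Int (img c)" using chart_facts(5-7)[OF c] by(auto simp: image_iff)
 thus ?thesis using continuous_on_open_vimage[OF chart_facts(2)[OF c], of "coord_inv c"] chart_facts(4)[OF c] S by metis
qed

lemma ac_facts:
 assumes "almost_complex_manifold A J" "c : A" shows "is_chart c" "x : img c ==> linear (J c x)" "sm (%x. J c x v) (img c)" "x : img c ==> J c x (J c x v) = - v"
  "d : A ==> sm (transition c d) (coord c ` (chart_dom c Int chart_dom d))" "d : A ==> p : chart_dom c Int chart_dom d ==>
   pd (J c (coord c p) v) (transition c d) (coord c p) = J d (coord d p) (pd v (transition c d) (coord c p))"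
proof -
 have S: "smooth_structure A" and T: "smooth_tensor11 A J" and J2: "! c:A. ! x : img c. ! v. J c x (J c x v) = - v"
  by(rule conjunct1[OF assms(1)[unfolded almost_complex_manifold_def]]
   conjunct1[OF conjunct2[OF assms(1)[unfolded almost_complex_manifold_def]]]
   conjunct2[OF conjunct2[OF assms(1)[unfolded almost_complex_manifold_def]]])+
 show "is_chart c" using S assms(2) by(simp add: smooth_structure_def)
 show "x : img c ==> linear (J c x)" "sm (%x. J c x v) (img c)" using T assms(2) unfolding smooth_tensor11_def by fast+
 show "x : img c ==> J c x (J c x v) = - v" using J2 assms(2) by fast
 have "! d:A. compatible c d" using S assms(2) unfolding smooth_structure_def by fast
 thus "d : A ==> sm (transition c d) (coord c ` (chart_dom c Int chart_dom d))" unfolding compatible_def by fast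
 have "! d:A. ! p : chart_dom c Int chart_dom d. ! v.
    pd (J c (coord c p) v) (transition c d) (coord c p) = J d (coord d p) (pd v (transition c d) (coord c p))"
  using T assms(2) unfolding smooth_tensor11_def pd_def by fast
 thus "d : A ==> p : chart_dom c Int chart_dom d ==>
   pd (J c (coord c p) v) (transition c d) (coord c p) = J d (coord d p) (pd v (transition c d) (coord c p))" by fast
qed

lemma disc_in_chart:
 fixes u :: "complex => 'a::{t2_space, second_countable_topology}"
 assumes A: "almost_complex_manifold A J" and c: "c : A" and u: "J_holomorphic_disc A J u" shows "open {ze : DD. u ze : chart_dom c}"
  "sm (coord c o u) {ze : DD. u ze : chart_dom c}" "ze : DD ==> u ze : chart_dom c ==> J c (coord c (u ze)) (pd h (coord c o u) ze) = pd (\<i>*h) (coord c o u) ze"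
proof -
 have "{ze : DD. u ze : chart_dom c} = u -` chart_dom c Int DD" by auto
 thus "open {ze : DD. u ze : chart_dom c}" using u continuous_on_open_vimage[OF open_ball, of 0 1 u] chart_facts(1)[OF ac_facts(1)[OF A c]]
  unfolding J_holomorphic_disc_def by metis
qed (use u c in \<open>auto simp: J_holomorphic_disc_def pd_def\<close>)

lemma pd_complex:
 assumes "f differentiable (at z)" shows "pd h f z = Re h*.pd 1 f z+Im h*.pd \<i> f z"
proof -
 have l: "linear (%v. pd v f z)" by(rule deriv_lin[OF hd_pd[OF assms]])
 have "pd h f z = pd (Re h*.1+Im h*.\<i>) f z" by(rule arg_cong[where f = "%h. pd h f z"]) (simp add: complex_eq_iff)
 thus ?thesis using linear_add[OF l] linear_scale[OF l] by simp
qed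

lemma chain_pd:
 assumes "g differentiable (at x)" "f differentiable (at (g x))" shows "pd v (%x. f (g x)) x = pd (pd v g x) f (g x)"
 by(rule pd_eq[OF deriv_comp[OF hd_pd[OF assms(1)] hd_pd[OF assms(2)]]])

lemma dif_comp: "f differentiable (at (g x)) ==> g differentiable (at x) ==> (%x. f (g x)) differentiable (at x)"
 using differentiable_chain_at[of g x f] by(simp add: o_def)

text \<open>Holomorphy is checked in one chart and carried to all others by the transformation law
  of the tensor.\<close>

lemma disc_of_chart:
 fixes c :: "('a::{t2_space, second_countable_topology}) chart"
 assumes A: "almost_complex_manifold A J" and c: "c : A" and U: "sm U (DD)" "!!z. z : DD ==> U z : img c" "!!z. z : DD ==> pd \<i> U z = J c (U z) (pd 1 U z)"
 shows "J_holomorphic_disc A J (coord_inv c o U)" unfolding J_holomorphic_disc_def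
proof(intro conjI ballI impI allI)
 note ch = chart_facts[OF ac_facts(1)[OF A c]]
 let ?u = "coord_inv c o U"
 show cu: "continuous_on (DD) ?u" unfolding o_def by(rule cont_comp[OF ch(4) sm_cont[OF U(1)]]) (use U(2) in blast)
 fix d assume d: "d : A"
 let ?S = "{ze : DD. ?u ze : chart_dom d}" and ?T = "coord c ` (chart_dom c Int chart_dom d)"
 have "?S = ?u -` chart_dom d Int DD" by auto
 hence oS: "open ?S" using cu continuous_on_open_vimage[OF open_ball, of 0 1 ?u] chart_facts(1)[OF ac_facts(1)[OF A d]] by metis
 have oT: "open ?T" by(rule open_coord_image[OF ac_facts(1)[OF A c] chart_facts(1)[OF ac_facts(1)[OF A d]]])
 have ST: "U z : ?T" if "z : ?S" for z using that U(2)[of z] ch(6,7)[of "U z"] by(intro image_eqI[of _ _ "coord_inv c (U z)"]) auto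
 have eq: "coord d o ?u = (%z. transition c d (U z))" by(auto simp: transition_def)
 note tr = ac_facts(5)[OF A c d]
 show "sm (coord d o ?u) ?S" unfolding eq by(rule sm_comp[OF oS oT tr sm_subset[OF U(1)] ST]) auto
 fix z h :: complex assume z: "z : DD" and "?u z : chart_dom d"
 hence zS: "z : ?S" by auto
 have dU: "U differentiable (at z)" by(rule sm_dif[OF U(1) z])
 have ch': "pd h (coord d o ?u) z = pd (pd h U z) (transition c d) (U z)" for h unfolding eq by(rule chain_pd[OF dU sm_dif[OF tr ST[OF zS]]])
 have l: "linear (J c (U z))" by(rule ac_facts(2)[OF A c U(2)[OF z]])
 have "pd (\<i>*h) U z = J c (U z) (pd h U z)" using U(3)[OF z] ac_facts(4)[OF A c U(2)[OF z]]
  by(simp add: pd_complex[OF dU, of h] pd_complex[OF dU, of "\<i>*h"] linear_add[OF l] linear_scale[OF l])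
 moreover have "coord c (?u z) = U z" using ch(6)[OF U(2)[OF z]] by simp
 moreover have "?u z : chart_dom c Int chart_dom d" using ch(7)[OF U(2)[OF z]] zS by simp
 ultimately have "pd (\<i>*h) (coord d o ?u) z = J d (coord d (?u z)) (pd h (coord d o ?u) z)" unfolding ch' using ac_facts(6)[OF A c d, of "?u z" "pd h U z"] by simp
 thus "J d (coord d (?u z)) (frechet_derivative (coord d o ?u) (at z) h) = frechet_derivative (coord d o ?u) (at z) (\<i>*h)" unfolding pd_def by simp
qed

text \<open>The equation u_y = J (u) u_x is equivalent to u_x + i u_y = i (J (u) - J_st) u_x, whose
  coefficients vanish at the origin because J is standard there.\<close>

lemma disc_with_jet:
 fixes c :: "('a::{t2_space, second_countable_topology}) chart"
 assumes A: "almost_complex_manifold A J" and c: "c : A" and z: "0 : img c" "J c 0 = J_st" shows "EX t>0. t <= 1 & (? U. sm U (DD) & U 0 = 0 &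
  (! j. 1 <= j & j <= N --> (pd 1 ^^ j) U 0 = t^j*.(fact j*.h j)) & (! z:DD. U z : img c & pd \<i> U z = J c (U z) (pd 1 U z)))"
proof -
 note ch = chart_facts[OF ac_facts(1)[OF A c]]
 obtain r0 where r0: "r0 > 0" "ball 0 r0 <= img c" using ch(2) z(1) open_contains_ball by blast
 let ?b = "%z v. cmul \<i> (J c z v-J_st v)"
 have sm: "sm (%z. ?b z i) (ball 0 r0)" for i by(rule sm_lin[OF bl_cmul open_ball
    sm_diff[OF open_ball sm_subset[OF ac_facts(3)[OF A c] r0(2)] sm_const]])
 have lin: "linear (?b z)" if "z : ball 0 r0" for z proof -
  have l: "linear (J c z)" using ac_facts(2)[OF A c] that r0(2) by blast
  show ?thesis by(rule linearI) (simp_all add: linear_add[OF l] linear_scale[OF l] J_st_cmul cmul_add_right cmul_scaleR_right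
    cmul_diff_right scaleR_diff_right algebra_simps)
 qed
 have b0: "?b 0 i = 0" for i using z(2) by simp
 obtain t u where tu: "t > 0" "t <= 1" "sm u UNIV" "u 0 = 0" "! j. 1 <= j & j <= N --> (pd 1 ^^ j) u 0 = t^j*.(fact j*.h j)"
  "! z:DD. u z : ball 0 r0 & pd 1 u z+cmul \<i> (pd \<i> u z) = ?b (u z) (pd 1 u z)"
  by(rule exE[OF local_discs[where N = N and h = h, OF r0(1) sm lin b0]]) (assumption, elim exE conjE, rule that)
 have "pd \<i> u z = J c (u z) (pd 1 u z)" if "z : DD" for z proof -
  have "cmul \<i> (pd \<i> u z) = cmul \<i> (J c (u z) (pd 1 u z))" using tu(6) that by(auto simp: J_st_cmul cmul_diff_right cmul_minus1)
  hence "cmul (- \<i>) (cmul \<i> (pd \<i> u z)) = cmul (- \<i>) (cmul \<i> (J c (u z) (pd 1 u z)))" by simp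
  thus ?thesis unfolding cmul_cmul by simp
 qed
 thus ?thesis using tu r0(2) sm_subset[OF tu(3) subset_UNIV, of "DD"] by blast
qed

subsection \<open>The Laplacian along discs and the maximum principle\<close>

definition lap :: "(complex => 'b::real_normed_vector) => complex => 'b" where "lap f z = pd 1 (pd 1 f) z+pd \<i> (pd \<i> f) z"

lemma pd_tensor_apply:
 fixes Jm :: "'e::euclidean_space => 'f::euclidean_space => 'g::real_normed_vector"
 assumes U: "U differentiable (at z)" and w: "w differentiable (at z)" and T: "open T" "U z : T" and S: "open S" "z : S" "!!z. z : S ==> U z : T"
  and Jd: "!!v. (%x. Jm x v) differentiable (at (U z))" and lin: "!!x. x : T ==> linear (Jm x)"
 shows "pd v (%z. Jm (U z) (w z)) z = pd (pd v U z) (%x. Jm x (w z)) (U z)+Jm (U z) (pd v w z)"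
proof -
 have JUd: "(%z. Jm (U z) i) differentiable (at z)" for i using dif_comp[OF Jd U] by simp
 have eq: "pd v (%z. Jm (U z) (w z)) z = pd v (%z. SUM i:Basis. (w z.*i)*.Jm (U z) i) z" by(rule pd_cong[OF S(1) lin_Basis[OF lin[OF S(3)]] S(2)])
 have wd: "(%z. w z.*i) differentiable (at z)" for i using w by(rule differentiable_inner) simp
 have e2: "pd (pd v U z) (%x. Jm x (w z)) (U z) = pd (pd v U z) (%x. SUM i:Basis. (w z.*i)*.Jm x i) (U z)" by(rule pd_cong[OF T(1) lin_Basis[OF lin] T(2)])
 have e3: "pd u (%x. SUM i:Basis. (w z.*i)*.Jm x i) (U z) = (SUM i:Basis. (w z.*i)*.pd u (%x. Jm x i) (U z))" for u
  by(subst pd_sum) (auto simp: pd_scaleR_c[OF Jd] intro!: differentiable_scaleR Jd)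
 have e4: "pd v (%z. (w z.*i)*.Jm (U z) i) z = (w z.*i)*.pd (pd v U z) (%x. Jm x i) (U z)+(pd v w z.*i)*.Jm (U z) i" for i
  by(simp add: pd_bilinear[OF bb_scaleR wd JUd] chain_pd[OF U Jd]
    pd_lin[OF bounded_linear_inner_left w])
 have "pd v (%z. Jm (U z) (w z)) z = (SUM i:Basis. (w z.*i)*.pd (pd v U z) (%x. Jm x i) (U z)+(pd v w z.*i)*.Jm (U z) i)"
  unfolding eq by(subst pd_sum) (auto intro!: differentiable_scaleR wd JUd simp: e4)
 also have "... = pd (pd v U z) (%x. Jm x (w z)) (U z)+Jm (U z) (pd v w z)" unfolding e2 e3 lin_Basis[OF lin[OF T(2)], of "pd v w z"] by(simp add: sum.distrib)
 finally show ?thesis .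
qed

text \<open>No second derivatives remain: u_yy contains J applied to u_xy, which contains J applied
  to u_xx, and J^2 = -1 cancels the other term u_xx. The Laplacian of a disc is thus quadratic in
  its gradient, with coefficients from the derivative of J.\<close>

lemma lap_disc:
 fixes Jm :: "C2 => C2 => C2"
 assumes S: "open S" "z : S" and T: "open T" and smJ: "!!v. sm (%z. Jm z v) T" and lin: "!!x. x : T ==> linear (Jm x)" and J2: "!!x v. x : T ==> Jm x (Jm x v) = - v"
  and U: "sm U S" "!!z. z : S ==> U z : T" "!!z. z : S ==> pd \<i> U z = Jm (U z) (pd 1 U z)"
 shows "lap U z = pd (pd \<i> U z) (%x. Jm x (pd 1 U z)) (U z)+Jm (U z) (pd (pd 1 U z) (%x. Jm x (pd 1 U z)) (U z))"
proof -
 note D = sm_dif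
 have Ti: "U z : T" by(rule U(2)[OF S(2)])
 have ap: "pd v (pd \<i> U) z = pd (pd v U z) (%x. Jm x (pd 1 U z)) (U z)+Jm (U z) (pd v (pd 1 U) z)" for v proof -
  have "pd v (pd \<i> U) z = pd v (%z. Jm (U z) (pd 1 U z)) z" by(rule pd_cong[OF S(1) U(3) S(2)])
  also have "... = pd (pd v U z) (%x. Jm x (pd 1 U z)) (U z)+Jm (U z) (pd v (pd 1 U) z)"
   by(rule pd_tensor_apply[OF D[OF U(1) S(2)] D[OF sm_pd[OF U(1)] S(2)] T Ti S U(2) D[OF smJ Ti] lin])
  finally show ?thesis .
 qed
 have sym: "pd \<i> (pd 1 U) z = pd 1 (pd \<i> U) z" by(rule pd_symmetric_smooth[OF S U(1)])
 have l: "linear (Jm (U z))" by(rule lin[OF Ti])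
 show ?thesis unfolding lap_def ap[of \<i>] sym ap[of 1] linear_add[OF l] J2[OF Ti] by simp
qed

lemma Ck2_dif:
 assumes "Ck_on 2 f S" "x : S" shows "f differentiable (at x)" "pd v f differentiable (at x)"
proof -
 have "Ck_on (Suc (Suc 0)) f S" using assms(1) by(simp add: numeral_2_eq_2)
 hence "! x:S. f differentiable (at x)" "Ck_on (Suc 0) (pd v f) S" using Ck_Suc by blast+
 thus "f differentiable (at x)" "pd v f differentiable (at x)" using assms(2) by(auto simp: Ck_Suc)
qed

lemma lap_compose:
 fixes F :: "'e::euclidean_space => real"
 assumes S: "open S" "z : S" and T: "open T" and F: "Ck_on 2 F T" and U: "sm U S" "!!z. z : S ==> U z : T"
 shows "lap (%z. F (U z)) z = pd (pd 1 U z) (pd (pd 1 U z) F) (U z)+pd (pd \<i> U z) (pd (pd \<i> U z) F) (U z)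
  + pd (lap U z) F (U z)"
proof -
 note D = sm_dif
 note dF = Ck2_dif[OF F]
 have dU: "U differentiable (at z)" "pd v U differentiable (at z)" if "z : S" for z v using D[OF U(1) that] D[OF sm_pd[OF U(1)] that] by auto
 have Ti: "U z : T" by(rule U(2)[OF S(2)])
 have pF: "pd w (pd v F) (U z) = (SUM i:Basis. (v.*i)*.pd w (pd i F) (U z))" for v w proof -
  have "pd w (pd v F) (U z) = pd w (%x. SUM i:Basis. (v.*i)*.pd i F x) (U z)" by(rule pd_cong[OF T pd_Basis[OF dF(1)] Ti])
  also have "... = (SUM i:Basis. (v.*i)*.pd w (pd i F) (U z))"
   by(subst pd_sum) (auto intro!: differentiable_scaleR dF(2)[OF Ti] simp only: pd_scaleR_c[OF dF(2)[OF Ti]] differentiable_const)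
  finally show ?thesis .
 qed
 have "pd v (pd v (%z. F (U z))) z = pd (pd v U z) (pd (pd v U z) F) (U z)+pd (pd v (pd v U) z) F (U z)" for v proof -
  have "pd v (pd v (%z. F (U z))) z = pd v (%z. SUM i:Basis. (pd v U z.*i)*.pd i F (U z)) z" by(rule pd_cong[OF S(1) pd_compose[OF dU(1) dF(1)[OF U(2)]] S(2)])
  also have "... = (SUM i:Basis. pd v (%z. (pd v U z.*i)*.pd i F (U z)) z)"
   by(rule pd_sum, intro differentiable_scaleR differentiable_inner dU[OF S(2)] differentiable_const
    dif_comp[OF dF(2)[OF Ti] dU(1)[OF S(2)]])
  also have "... = (SUM i:Basis. (pd v U z.*i)*.pd (pd v U z) (pd i F) (U z)+(pd v (pd v U) z.*i)*.pd i F (U z))" proof(rule sum.cong[OF refl])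
   fix i
   have "(%z. pd v U z.*i) differentiable (at z)" by(rule differentiable_inner[OF dU(2)[OF S(2)]]) simp
   thus "pd v (%z. (pd v U z.*i)*.pd i F (U z)) z = (pd v U z.*i)*.pd (pd v U z) (pd i F) (U z)+(pd v (pd v U) z.*i)*.pd i F (U z)"
    using dif_comp[OF dF(2)[OF Ti] dU(1)[OF S(2)], of i] by(subst pd_bilinear[OF bb_scaleR])
    (auto simp: chain_pd[OF dU(1)[OF S(2)] dF(2)[OF Ti]] pd_lin[OF bounded_linear_inner_left dU(2)[OF S(2)]])
  qed
  also have "... = pd (pd v U z) (pd (pd v U z) F) (U z)+pd (pd v (pd v U) z) F (U z)"
   unfolding pF[of "pd v U z" "pd v U z"] pd_Basis[OF dF(1)[OF Ti], of "pd v (pd v U) z"] by(simp add: sum.distrib)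
  finally show ?thesis .
 qed
 moreover have "pd (lap U z) F (U z) = pd (pd 1 (pd 1 U) z) F (U z)+pd (pd \<i> (pd \<i> U) z) F (U z)"
  unfolding lap_def by(rule linear_add[OF deriv_lin[OF hd_pd[OF dF(1)[OF Ti]]]])
 ultimately show ?thesis unfolding lap_def[of "%z. F (U z)"] by simp
qed

text \<open>This turns plurisubharmonicity into subharmonicity along discs. The terms of the Levi
  form with a derivative of J match the Laplacian of the disc.\<close>

lemma levi_form_lap:
 fixes c :: "('a::{t2_space, second_countable_topology}) chart"
 assumes A: "almost_complex_manifold A J" and c: "c : A" and T: "open T" "T <= img c" and F: "Ck_on 2 (in_chart rh c) T" and S: "open S" "z : S"
  and U: "sm U S" "!!z. z : S ==> U z : T" "!!z. z : S ==> pd \<i> U z = J c (U z) (pd 1 U z)" shows "lap (%z. in_chart rh c (U z)) z = levi_form J rh c (U z) (pd 1 U z)"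
proof -
 let ?F = "in_chart rh c" and ?x = "U z" and ?a = "pd 1 U z" and ?J = "J c"
 note D = sm_dif
 note dF = Ck2_dif[OF F]
 have x: "?x : T" by(rule U(2)[OF S(2)])
 have smJ: "sm (%x. ?J x v) T" for v by(rule sm_subset[OF ac_facts(3)[OF A c] T(2)])
 have lin: "linear (?J x)" and J2: "?J x (?J x v) = - v" if "x : T" for x v by(rule ac_facts(2,4)[OF A c subsetD[OF T(2) that]])+
 define b where "b = ?J ?x ?a"
 have b: "pd \<i> U z = b" unfolding b_def by(rule U(3)[OF S(2)])
 have Fl: "linear (%v. pd v ?F ?x)" by(rule deriv_lin[OF hd_pd[OF dF(1)[OF x]]])
 have al: "frechet_derivative (%y. dc J rh c y w) (at ?x) v = - (pd v (pd (?J ?x w) ?F) ?x+pd (pd v (%y. ?J y w) ?x) ?F ?x)" for v w proof -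
  have jd: "(%y. ?J y w) differentiable (at ?x)" by(rule D[OF smJ x])
  have "frechet_derivative (%y. dc J rh c y w) (at ?x) v = pd v (%y. - pd (?J y w) ?F y) ?x" unfolding dc_def pd_def ..
  also have "... = - pd v (%y. pd (?J y w) ?F y) ?x" proof(rule pd_minus)
   have "(%y. SUM i:Basis. (?J y w.*i)*.pd i ?F y) differentiable (at ?x)"
    by(rule differentiable_sum[OF finite_Basis], rule ballI, intro differentiable_scaleR differentiable_inner jd dF(2)[OF x] differentiable_const)
   moreover have "pd (?J y w) ?F y = (SUM i:Basis. (?J y w.*i)*.pd i ?F y)" if "y : T" for y by(rule pd_Basis[OF dF(1)[OF that]])
   ultimately show "(%y. pd (?J y w) ?F y) differentiable (at ?x)" by(simp only: frechet_cong(2)[OF T(1) _ x, of "%y. pd (?J y w) ?F y"])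
  qed
  also have "pd v (%y. pd (?J y w) ?F y) ?x = pd (pd v (%y. y) ?x) (%y. pd (?J ?x w) ?F y) ?x+pd (pd v (%y. ?J y w) ?x) ?F ?x"
   by(rule pd_tensor_apply[where U = "%y. y", OF _ jd T(1) x T(1) x]) (auto simp: dF(2)[OF x] intro: deriv_lin[OF hd_pd[OF dF(1)]])
  also have "pd v (%y. y) ?x = v" by(rule pd_eq[OF has_derivative_ident])
  finally show ?thesis .
 qed
 \<comment> \<open>Differentiating J^2 = -1 in the direction \<open>?a\<close> gives J (D_a J) a = -
   (D_a J) b. This brings the Laplacian of \<open>U\<close> into the antisymmetric form in which it
   occurs in the Levi form.\<close>
 have "0 = pd ?a (%y. - ?a) ?x" by(simp add: pd_eq[OF has_derivative_const])
 also have "... = pd ?a (%y. ?J y (?J y ?a)) ?x" by(rule pd_cong[OF T(1) J2[symmetric] x])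
 also have "... = pd (pd ?a (%y. y) ?x) (%y. ?J y (?J ?x ?a)) ?x+?J ?x (pd ?a (%y. ?J y ?a) ?x)"
  by(rule pd_tensor_apply[where U = "%y. y", OF _ D[OF smJ x] T(1) x T(1) x]) (auto simp: D[OF smJ x] lin)
 also have "pd ?a (%y. y) ?x = ?a" by(rule pd_eq[OF has_derivative_ident])
 finally have DJ: "?J ?x (pd ?a (%y. ?J y ?a) ?x) = - pd ?a (%y. ?J y b) ?x" unfolding b_def by(metis add.inverse_unique add.commute)
 have lp: "lap U z = pd b (%y. ?J y ?a) ?x-pd ?a (%y. ?J y b) ?x" using lap_disc[OF S T(1) smJ lin J2 U] unfolding DJ b by simp
 have Jb: "?J ?x b = - ?a" unfolding b_def by(rule J2[OF x])
 have mF: "pd v (pd (- w) ?F) ?x = - pd v (pd w ?F) ?x" for v w proof -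
  have "pd v (pd (- w) ?F) ?x = pd v (%y. - pd w ?F y) ?x" by(rule pd_cong[OF T(1) linear_neg[OF deriv_lin[OF hd_pd[OF dF(1)]]] x])
  thus ?thesis by(simp add: pd_minus[OF dF(2)[OF x]])
 qed
 have "levi_form J rh c ?x ?a = pd ?a (pd ?a ?F) ?x+pd b (pd b ?F) ?x+pd (lap U z) ?F ?x"
  unfolding levi_form_def ext_deriv_def b_def[symmetric] al Jb lp linear_diff[OF Fl] mF using b_def by simp
 thus ?thesis using lap_compose[OF S T(1) F U(1,2)] unfolding b by simp
qed

section \<open>Maxima and the Laplacian\<close>

lemma deriv2_at_max:
 fixes f :: "'a::euclidean_space => real"
 assumes S: "open S" "z : S" and f: "Ck_on 2 f S" and max: "!!y. y : S ==> f y <= f z" shows "pd v (pd v f) z <= 0"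
proof(rule ccontr)
 assume "~pd v (pd v f) z <= 0"
 note dF = Ck2_dif[OF f]
 obtain e where e: "e > 0" "ball z e <= S" using S open_contains_ball by blast
 define d where "d = e/(norm v+1)"
 have d: "d > 0" using e by(simp add: d_def add_nonneg_pos)
 have mem: "z+t*.v : S" if "abs t < d" for t proof -
  have "abs t*norm v <= abs t*(norm v+1)" by(rule mono_l) auto
  also have "... < d*(norm v+1)" using that by(intro mult_strict_right_mono) (auto simp: add_nonneg_pos)
  also have "... = e" unfolding d_def by(simp add: add_nonneg_eq_0_iff)
  finally show ?thesis using e(2) by(auto simp: dist_norm)
 qed
 have line: "((%s. g (z+s*.v)) has_real_derivative pd v g (z+s*.v)) (at s)"
  if "g differentiable (at (z+s*.v))" for g :: "'a => real" and s proof -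
  have "((%s. z+s*.v) has_derivative (%h. h*.v)) (at s)" by(auto intro!: derivative_eq_intros)
  from deriv_comp[OF this hd_pd[OF that]]
  have "((%s. g (z+s*.v)) has_derivative (%h. pd (h*.v) g (z+s*.v))) (at s)" .
  moreover have "pd (h*.v) g (z+s*.v) = pd v g (z+s*.v)*h" for h using linear_scale[OF deriv_lin[OF hd_pd[OF that]]] by simp
  ultimately show ?thesis by(simp add: hfd_def)
 qed
 have g0: "pd v f (z+0*.v) = 0" proof(rule DERIV_local_max[OF line d])
  show "f differentiable (at (z+0*.v))" using dF(1)[OF S(2)] by simp
  show "! y. abs (0-y) < d --> f (z+y*.v) <= f (z+0*.v)" using max mem by simp
 qed
 have "((%s. pd v f (z+s*.v)) has_real_derivative pd v (pd v f) z) (at 0)" using line[of "pd v f" 0] dF(2)[OF S(2)] by simp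
 from DERIV_pos_inc_right[OF this] `~_` obtain d' where d': "d' > 0" "!!h. 0 < h ==> h < d' ==> pd v f (z+h*.v) > 0" using g0 by auto
 define t where "t = min d d'/2"
 have t: "0 < t" "t < d" "t < d'" using d d' by(auto simp: t_def)
 have "? s. 0 < s & s < t & f (z+t*.v)-f (z+0*.v) = (t-0)*pd v f (z+s*.v)" by(rule MVT2[OF t(1)]) (use t mem in \<open>auto intro!: line dF(1)\<close>)
 then obtain s where "0 < s" "s < t" "f (z+t*.v)-f z = t*pd v f (z+s*.v)" by auto
 moreover have "t*pd v f (z+s*.v) > 0" using d'(2)[of s] calculation t by auto
 ultimately show False using max[OF mem[of t]] t by auto
qed

lemma lap_at_max:
 fixes f :: "complex => real"
 assumes "open S" "z : S" "Ck_on 2 f S" "!!y. y : S ==> f y <= f z" shows "lap f z <= 0"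
 unfolding lap_def using deriv2_at_max[OF assms, of 1] deriv2_at_max[OF assms, of \<i>] by simp

lemma lap_add:
 fixes f g :: "complex => real"
 assumes "open S" "z : S" "Ck_on 2 f S" "Ck_on 2 g S" shows "lap (%z. f z+g z) z = lap f z+lap g z"
proof -
 note d = Ck2_dif[OF assms(3)] Ck2_dif[OF assms(4)]
 have "pd v (pd v (%z. f z+g z)) z = pd v (pd v f) z+pd v (pd v g) z" for v proof -
  have "pd v (pd v (%z. f z+g z)) z = pd v (%z. pd v f z+pd v g z) z" by(rule pd_cong[OF assms(1) pd_add assms(2)]) (rule d, assumption)+
  also have "... = pd v (pd v f) z+pd v (pd v g) z" by(rule pd_add) (rule d[OF assms(2)])+
  finally show ?thesis .
 qed
 thus ?thesis unfolding lap_def by simp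
qed

lemma lap_scale:
 fixes f :: "complex => real"
 assumes "open S" "z : S" "Ck_on 2 f S" shows "lap (%z. c*f z) z = c*lap f z"
proof -
 note d = Ck2_dif[OF assms(3)]
 have "pd v (pd v (%z. c*f z)) z = c*pd v (pd v f) z" for v proof -
  have "pd v (pd v (%z. c*f z)) z = pd v (%z. c*pd v f z) z"
   by(rule pd_cong[OF assms(1) pd_scaleR_c[where 'b = real and c = c, simplified] assms(2)]) (rule d, assumption)
  also have "... = c*pd v (pd v f) z" by(rule pd_scaleR_c[where 'b = real and c = c, simplified]) (rule d[OF assms(2)])
  finally show ?thesis .
 qed
 thus ?thesis unfolding lap_def by(simp add: algebra_simps)
qed

lemma lap_normsq: "lap (%z. z.*z) (z :: complex) = 4"
proof -
 have 1: "pd v (%z. z.*z) = (%z. 2*(z.*v))" for v :: complex by(rule ext, rule pd_eq) (auto intro!: derivative_eq_intros simp: inner_commute)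
 have 2: "pd v (%z. 2*(z.*v)) z = 2*(v.*v)" for v :: complex by(rule pd_eq) (auto intro!: derivative_eq_intros)
 show ?thesis unfolding lap_def 1 2 by(simp add: inner_complex_def)
qed

text \<open>Adding e |z|^2 makes the Laplacian positive, which excludes interior maxima; e is
  arbitrary.\<close>

lemma subharmonic_max_principle:
 fixes s :: "complex => real"
 assumes S: "open S" "cball 0 1 <= S" and s: "Ck_on 2 s S" and l: "!!z. norm z < 1 ==> lap s z >= 0" and M: "!!z. norm z = 1 ==> s z <= M" and z: "norm z <= 1"
 shows "s z <= M"
proof(rule field_le_epsilon)
 fix e :: real assume e: "e > 0"
 let ?f = "%z. s z+e*(z.*z)"
 have sq: "Ck_on 2 (%z::complex. e*(z.*z)) T" for T by(rule Ck_subset[of _ _ UNIV]) (simp_all add: Ck_mult[OF open_UNIV Ck_const Ck_normsq])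
 have cf: "Ck_on 2 ?f S" by(rule Ck_add[OF S(1) s sq])
 have "continuous_on (cball 0 1) ?f" by(rule cont_sub[OF Ck_cont[OF cf] S(2)])
 then obtain x where x: "x : cball 0 1" "!!y. y : cball 0 1 ==> ?f y <= ?f x" using continuous_attains_sup[of "cball 0 1" ?f] by auto
 have "norm x = 1" proof(rule ccontr)
  assume "norm x ~= 1"
  hence xb: "x : DD" using x(1) by auto
  have bs: "DD <= S" using S(2) ball_subset_cball by blast
  have "lap ?f x <= 0" by(rule lap_at_max[OF open_ball xb Ck_subset[OF cf bs] x(2)]) auto
  moreover have "lap ?f x = lap s x+e*4" using lap_add[OF open_ball xb Ck_subset[OF s bs] sq] lap_scale[OF open_UNIV UNIV_I Ck_normsq, of e x] by(simp add: lap_normsq)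
  ultimately show False using l[of x] xb e by auto
 qed
 hence "?f x <= M+e" using M[of x] by(simp add: dot_sq)
 moreover have "s z <= ?f z" using e by simp
 ultimately show "s z <= M+e" using x(2)[of z] z by auto
qed

subsection \<open>Homogeneous polynomials on the circle\<close>

definition hpoly :: "nat => (nat => real) => complex => real" where "hpoly k a ze = (SUM j<=k. Re ze^j*Im ze^(k-j)*a j)"

lemma first_taylor_degree_real:
 fixes f :: "complex => real" shows "first_taylor_degree f k \<longleftrightarrow> (? a. (? j<=k. a j ~= 0) & (%ze. f ze-hpoly k a ze) : o[at 0](%ze. norm ze^k))"
 unfolding first_taylor_degree_def hpoly_def by simp

lemma hpoly_scale: "hpoly k a (of_real t*ze) = t^k*hpoly k a ze" unfolding hpoly_def sum_distrib_left
 by(rule sum.cong) (auto simp: power_mult_distrib le_imp_power_dvd algebra_simps simp flip: power_add)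

lemma hpoly_at_0: "k >= 1 ==> hpoly k a 0 = 0" by(auto simp: hpoly_def power_0_left intro!: sum.neutral)

text \<open>On the line Im = 1 the form becomes a polynomial in one variable with the same
  coefficients.\<close>

lemma hpoly_nonzero:
 assumes "!!ze. hpoly k a ze = 0" "j <= k" shows "a j = 0"
proof -
 have "(SUM j<=k. a j*x^j) = 0" for x :: real using assms(1)[of "Complex x 1"] by(simp add: hpoly_def mult.commute)
 thus ?thesis using polyfun_eq_0[where c = a and n = k] assms(2) by auto
qed

lemma continuous_hpoly: "continuous_on S (hpoly k a)" unfolding hpoly_def[abs_def] by(intro continuous_intros)

lemma smallo_at_0:
 fixes f :: "complex => real" shows "f : o[at 0](%ze. norm ze^k) \<longleftrightarrow> (ALL e>0. EX d>0. ! ze. ze ~= 0 & norm ze < d --> abs (f ze) <= e*norm ze^k)"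
proof -
 have "f : o[at 0](%ze. norm ze^k) \<longleftrightarrow> (ALL e>0. eventually (%ze. norm (f ze) <= e*norm (norm ze^k)) (at 0))" unfolding smallo_def by simp
 thus ?thesis by(simp add: eventually_at power_abs)
qed

text \<open>Comparison along rays: a form of degree k' <= k that is o(|zeta|^k') vanishes on every
  ray, hence identically.\<close>

lemma taylor_degree_gt:
 fixes f :: "complex => real"
 assumes f: "f : o[at 0](%ze. norm ze^k)" and k': "first_taylor_degree f k'" shows "k < k'"
proof(rule ccontr)
 assume "~k < k'"
 hence kk: "k' <= k" by simp
 obtain a where a: "? j<=k'. a j ~= 0" "(%ze. f ze-hpoly k' a ze) : o[at 0](%ze. norm ze^k')" using k' unfolding first_taylor_degree_real by blast
 have "hpoly k' a og = 0" for og proof(rule ccontr)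
  assume P: "hpoly k' a og ~= 0"
  hence "norm og^k' > 0" by(cases "og = 0"; cases k') (auto simp: hpoly_at_0)
  define e where "e = abs (hpoly k' a og)/(4*norm og^k')"
  have e: "e > 0" using P `norm og ^ k' > 0` by(simp add: e_def)
  from a(2) e obtain d1 where d1: "d1 > 0" "!!ze. ze ~= 0 ==> norm ze < d1 ==> abs (f ze-hpoly k' a ze) <= e*norm ze^k'" unfolding smallo_at_0 by blast
  from f e obtain d2 where d2: "d2 > 0" "!!ze. ze ~= 0 ==> norm ze < d2 ==> abs (f ze) <= e*norm ze^k" unfolding smallo_at_0 by blast
  have small: "abs (hpoly k' a ze) <= 2*e*norm ze^k'" if "ze ~= 0" "norm ze < d1" "norm ze < d2" "norm ze <= 1" for ze proof -
   have "norm ze^k <= norm ze^k'" by(rule power_decreasing[OF kk]) (use that in auto)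
   hence "e*norm ze^k <= e*norm ze^k'" using e by simp
   thus ?thesis using d1(2)[of ze] d2(2)[of ze] that by linarith
  qed
  define t where "t = min (min d1 d2) 1/2/(norm og+1)"
  have t: "t > 0" using d1 d2 by(simp add: t_def add_nonneg_pos)
  have "norm (of_real t * og) <= t*(norm og+1)" using t by(simp add: norm_mult algebra_simps)
  also have "... = min (min d1 d2) 1/2" proof -
   have "norm og+1 ~= 0" using norm_ge_zero[of og] by linarith
   thus ?thesis unfolding t_def by(rule iffD1[OF nonzero_eq_divide_eq refl])
  qed
  finally have n: "norm (of_real t * og) <= min (min d1 d2) 1/2" .
  show False proof(cases "og = 0")
   case True
   have "k' = 0" using P True by(cases k') (auto simp: hpoly_at_0)
   have "abs (hpoly k' a (of_real t)) <= 2*e*norm (of_real t :: complex)^k'" proof(rule small)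
    have "t <= min (min d1 d2) 1/2" using True by(simp add: t_def)
    thus "norm (of_real t :: complex) < d1" "norm (of_real t :: complex) < d2" "norm (of_real t :: complex) <= 1" using t d1 d2 by auto
   qed (use t in auto)
   moreover have "hpoly k' a (of_real t) = hpoly k' a og" by(simp add: hpoly_def `k' = 0`)
   ultimately show False using P by(simp add: e_def `k' = 0`)
  next
   case False
   have "abs (hpoly k' a (of_real t * og)) <= 2*e*norm (of_real t * og)^k'" by(rule small) (use n d1 d2 t False in auto)
   hence "t^k'*abs (hpoly k' a og) <= t^k'*(2*e*norm og^k')" unfolding hpoly_scale using t by(simp add: abs_mult norm_mult power_mult_distrib mult_ac)
   hence "abs (hpoly k' a og) <= 2*e*norm og^k'" using t by simp
   also have "... = abs (hpoly k' a og)/2" using `norm og ^ k' > 0` False by(simp add: e_def)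
   finally show False using P by simp
  qed
 qed
 thus False using a(1) hpoly_nonzero by blast
qed

text \<open>With p = a + z q, on the unit circle cnj og p (og) = a cnj og + q (og), and the real
  part of a cnj og is that of og cnj a. Combining this with og p (og) gives the products with Re og
  and Im og as real parts of polynomials.\<close>

lemma circle_mult:
 fixes p :: "complex poly" shows "? p1. degree p1 <= Suc (degree p) & (! og. norm og = 1 --> Re og*Re (poly p og) = Re (poly p1 og))"
  and "? p2. degree p2 <= Suc (degree p) & (! og. norm og = 1 --> Im og*Re (poly p og) = Re (poly p2 og))"
proof -
 obtain a q where p: "p = pCons a q" by(rule pCons_cases)
 have dq: "degree q <= degree p" unfolding p by(simp add: degree_pCons_le)
 have dl: "degree [:0, x:] <= Suc (degree p)" for x :: complex by(rule order_trans[OF degree_pCons_le]) simp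
 have d1: "degree (smult x (pCons 0 p)) <= Suc (degree p)" for x by(rule order_trans[OF degree_smult_le degree_pCons_le])
 have d2: "degree (smult x q) <= Suc (degree p)" for x by(rule order_trans[OF degree_smult_le]) (use dq in simp)
 have id: "Re og^2+Im og^2 = 1" if "norm og = 1" for og using that by(metis cmod_power2 one_power2)
 have e1: "Re og*Re (poly p og) = Re (poly (smult (1/2) (pCons 0 p) + [:0, cnj a/2:] + smult (1/2) q) og)" if "norm og = 1" for og proof -
  have "cnj og * og = 1" using id[OF that] by(simp add: complex_eq_iff sq_eq)
  hence "cnj og*poly p og = cnj og*a+poly q og" unfolding p by(simp add: algebra_simps)
  hence "Re (cnj og*poly p og) = Re (cnj og*a+poly q og)" by simp
  moreover have "Re og*Re Z = Re ((og*Z + og*cnj a+Q)/2)" if "Re (cnj og*Z) = Re (cnj og*a+Q)" for Z Q using that by(simp add: field_simps)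
  moreover have "poly (smult (1/2) (pCons 0 p) + [:0, cnj a/2:] + smult (1/2) q) og = (og*poly p og + og*cnj a+poly q og)/2"
   unfolding poly_add poly_smult poly_pCons[of 0 p] by(simp add: field_simps)
  ultimately show ?thesis by(simp only:)
 qed
 show "? p1. degree p1 <= Suc (degree p) & (! og. norm og = 1 --> Re og*Re (poly p og) = Re (poly p1 og))"
  by(rule exI[of _ "smult (1/2) (pCons 0 p) + [:0, cnj a/2:] + smult (1/2) q"], rule conjI[OF degree_add_le[OF degree_add_le[OF d1 dl] d2]]) (use e1 in blast)
 have e2: "Im og*Re (poly p og) = Re (poly (smult (- \<i>/2) (pCons 0 p) + [:0, - \<i>*cnj a/2:] + smult (\<i>/2) q) og)" if "norm og = 1" for og proof -
  have "cnj og * og = 1" using id[OF that] by(simp add: complex_eq_iff sq_eq)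
  hence "cnj og*poly p og = cnj og*a+poly q og" unfolding p by(simp add: algebra_simps)
  hence "Im (cnj og*poly p og) = Im (cnj og*a+poly q og)" by simp
  moreover have "Im og*Re Z = Re (- \<i>*((og*Z + og*cnj a-Q)/2))" if "Im (cnj og*Z) = Im (cnj og*a+Q)" for Z Q using that by(simp add: field_simps)
  moreover have "poly (smult (- \<i>/2) (pCons 0 p) + [:0, - \<i>*cnj a/2:] + smult (\<i>/2) q) og =
    - \<i>*((og*poly p og + og*cnj a-poly q og)/2)" unfolding poly_add poly_smult poly_pCons[of 0 p] by(simp add: field_simps)
  ultimately show ?thesis by(simp only:)
 qed
 show "? p2. degree p2 <= Suc (degree p) & (! og. norm og = 1 --> Im og*Re (poly p og) = Re (poly p2 og))"
  by(rule exI[of _ "smult (- \<i>/2) (pCons 0 p) + [:0, - \<i>*cnj a/2:] + smult (\<i>/2) q"], rule conjI[OF degree_add_le[OF degree_add_le[OF d1 dl] d2]]) (use e2 in blast)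
qed

lemma circle_monomial: "? p :: complex poly. degree p <= i+j & (! og. norm og = 1 --> Re og^i*Im og^j = Re (poly p og))"
proof(induction i)
 case 0
 show ?case proof(induction j)
  case 0
  show ?case by(rule exI[of _ 1]) simp
 next
  case (Suc j)
  then obtain p :: "complex poly" where p: "degree p <= j" "! og. norm og = 1 --> Im og^j = Re (poly p og)" by auto
  thus ?case using circle_mult(2)[of p] by(metis add_0 le_trans mult_1 power_0 power_Suc Suc_le_mono)
 qed
next
 case (Suc i)
 then obtain p :: "complex poly" where p: "degree p <= i+j" "! og. norm og = 1 --> Re og^i*Im og^j = Re (poly p og)" by auto
 obtain p1 where p1: "degree p1 <= Suc (degree p)" "! og. norm og = 1 --> Re og*Re (poly p og) = Re (poly p1 og)" using circle_mult(1)[of p] by blast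
 show ?case proof(rule exI[of _ p1], intro conjI allI impI)
  show "degree p1 <= Suc i+j" using p1(1) p(1) by simp
  fix og :: complex assume "norm og = 1"
  thus "Re og^Suc i*Im og^j = Re (poly p1 og)" using p(2) p1(2) by(simp add: mult.assoc)
 qed
qed

text \<open>\<open>Re p\<close> is the harmonic extension of the values of the form on the circle;
  the bound on the degree is what the comparison along rays uses.\<close>

lemma hpoly_on_circle: "? p :: complex poly. degree p <= k & (! og. norm og = 1 --> hpoly k a og = Re (poly p og))"
proof -
 have "? p :: complex poly. degree p <= k & (! og. norm og = 1 --> Re og^j*Im og^(k-j) = Re (poly p og))" if "j <= k" for j using circle_monomial[of j "k-j"] that by simp
 hence "! j:{..k}. ? p :: complex poly. degree p <= k & (! og. norm og = 1 --> Re og^j*Im og^(k-j) = Re (poly p og))" by simp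
 from bchoice[OF this] obtain p :: "nat => complex poly" where
  p: "!!j. j <= k ==> degree (p j) <= k" "!!j og. j <= k ==> norm og = 1 ==> Re og^j*Im og^(k-j) = Re (poly (p j) og)" by auto
 let ?p = "SUM j<=k. smult (of_real (a j)) (p j)"
 show ?thesis proof(rule exI[of _ ?p], intro conjI allI impI)
  show "degree ?p <= k" by(rule degree_sum_le) (auto intro: order_trans[OF degree_smult_le] p(1))
  fix og :: complex assume "norm og = 1"
  thus "hpoly k a og = Re (poly ?p og)" unfolding hpoly_def by(simp add: poly_sum p(2) mult.commute)
 qed
qed

text \<open>If the harmonic extension of the boundary values of a homogeneous polynomial of degree \<open>k\<close>
  dominates it and vanishes at the origin, comparing both along rays shows that all lower order
  terms of the extension vanish.\<close>

lemma dominated_hpoly: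
 fixes p :: "complex poly"
 assumes k: "k >= 1" and deg: "degree p <= k" and circ: "!!og. norm og = 1 ==> hpoly k a og = Re (poly p og)"
  and dom: "!!ze. norm ze <= 1 ==> hpoly k a ze <= Re (poly p ze)" and z: "Re (coeff p 0) <= 0" shows "? ap. ! ze. hpoly k a ze = Re (ap*ze^k)"
proof -
 have P0: "hpoly k a 0 = 0" using k by(rule hpoly_at_0)
 hence z0: "Re (coeff p 0) = 0" using dom[of 0] z by(simp add: poly_0_coeff_0)
 \<comment> \<open>By homogeneity an identity on the circle extends to the plane.\<close>
 have ray: "hpoly k a ze = Re (ap*ze^k)" if "!!og. norm og = 1 ==> hpoly k a og = Re (ap * og^k)" for ap ze proof(cases "ze = 0")
  case True thus ?thesis using P0 k by simp
 next
  case False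
  hence s: "ze = of_real (norm ze) * sgn ze" by(simp add: sgn_eq)
  have "hpoly k a ze = norm ze^k*hpoly k a (sgn ze)" using hpoly_scale[of k a "norm ze" "sgn ze"] s by simp
  also have "... = norm ze^k*Re (ap * sgn ze^k)" using that[of "sgn ze"] False by(simp add: norm_sgn)
  also have "... = Re (of_real (norm ze^k)*(ap * sgn ze^k))" by(simp only: times_complex.sel Re_complex_of_real Im_complex_of_real mult_zero_left diff_zero)
  also have "of_real (norm ze^k)*(ap * sgn ze^k) = ap*(of_real (norm ze) * sgn ze)^k" by(simp add: power_mult_distrib)
  finally show ?thesis using s by simp
 qed
 show ?thesis proof(cases "p = [:coeff p 0:]")
  case True
  hence pc: "poly p og = coeff p 0" for og by(metis poly_pCons poly_0 mult_zero_right add.right_neutral)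
  have "hpoly k a ze = Re (0*ze^k)" for ze by(rule ray) (simp add: circ z0 pc)
  thus ?thesis by blast
 next
  case False
  define p' where "p' = p - [:coeff p 0:]"
  have p': "p' ~= 0" using False by(auto simp: p'_def)
  \<comment> \<open>The number \<open>d\<close> below is the order of vanishing of p - p(0) at 0.
    For d = k the polynomial is a constant plus a monomial of degree \<open>k\<close>; for d < k one
    ray gives a contradiction.\<close>
  obtain q where q: "p' = [:- 0, 1:]^order 0 p'*q" "~[:- 0, 1:] dvd q" using order_decomp[OF p'] by blast
  define d where "d = order 0 p'"
  have q0: "poly q 0 ~= 0" using q(2) by(simp add: poly_eq_0_iff_dvd)
  have pq: "poly p z = coeff p 0+z^d*poly q z" for z proof -
   have "poly p' z = z^d*poly q z" by(subst q(1)) (simp add: d_def poly_power)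
   thus ?thesis unfolding p'_def by(simp add: algebra_simps)
  qed
  have "d ~= 0" using pq[of 0] q0 by(auto simp: poly_0_coeff_0)
  have dk: "d+degree q <= k" proof -
   have "degree p' = d+degree q" by(subst q(1), subst degree_mult_eq) (use q0 p' q(1) in \<open>auto simp: d_def degree_power_eq\<close>)
   moreover have "degree p' <= k" unfolding p'_def by(rule degree_diff_le) (use deg in auto)
   ultimately show ?thesis by simp
  qed
  show ?thesis proof(cases "d = k")
   case True
   hence "degree q = 0" using dk by simp
   then obtain ap where qa: "q = [:ap:]" by(metis degree_eq_zeroE)
   show ?thesis proof(rule exI[of _ ap], rule allI, rule ray)
    fix og :: complex assume "norm og = 1"
    thus "hpoly k a og = Re (ap * og^k)" using circ[of og] z0 by(simp add: pq True qa mult.commute)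
   qed
  next
   case False
   hence "d < k" using dk by simp
   \<comment> \<open>The direction in which og^d q(0) is a negative number. Along this ray Re p
     behaves like a negative multiple of r^d and cannot dominate a multiple of r^k for small r,
     since d < k.\<close>
   define og where "og = cis ((pi-Arg (poly q 0))/d)"
   have om: "norm og = 1" by(simp add: og_def)
   have "real d*((pi-Arg (poly q 0))/d) = pi-Arg (poly q 0)" using `d ~= 0` by simp
   hence "og^d = cis (pi-Arg (poly q 0))" unfolding og_def Complex.DeMoivre by(simp only:)
   moreover have "poly q 0 = of_real (norm (poly q 0))*cis (Arg (poly q 0))" using rcis_cmod_Arg[of "poly q 0"] by(simp add: rcis_def)
   ultimately have "og^d*poly q 0 = of_real (norm (poly q 0))*(cis (pi-Arg (poly q 0))*cis (Arg (poly q 0)))" by(metis mult.left_commute)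
   hence wq: "og^d*poly q 0 = - of_real (norm (poly q 0))" by(simp add: cis_mult)
   have "((%r. Re (og^d*poly q (of_real r * og))-r^(k-d)*hpoly k a og) --->
    Re (og^d*poly q (of_real 0 * og))-0^(k-d)*hpoly k a og) (at_right 0)" by(intro tendsto_intros)
   moreover have "\<forall>\<^sub>F r in at_right 0. Re (og^d*poly q (of_real r * og))-r^(k-d)*hpoly k a og >= 0" unfolding eventually_at_right_field
   proof(rule exI[of _ 1], intro conjI allI impI)
    fix r :: real assume r: "0 < r" "r < 1"
    have "r^k*hpoly k a og <= Re (poly p (of_real r * og))" using dom[of "of_real r * og"] r om by(simp add: hpoly_scale norm_mult)
    also have "... = Re (of_real (r^d)*(og^d*poly q (of_real r * og)))" using z0 by(simp add: pq power_mult_distrib mult.assoc)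
    also have "... = r^d*Re (og^d*poly q (of_real r * og))" using Re_complex_of_real times_complex.sel(1)[of "of_real (r^d)"] by simp
    finally have "r^d*(r^(k-d)*hpoly k a og) <= r^d*Re (og^d*poly q (of_real r * og))" using `d < k` by(simp add: mult.assoc[symmetric] power_add[symmetric])
    thus "Re (og^d*poly q (of_real r * og))-r^(k-d)*hpoly k a og >= 0" using r by simp
   qed simp
   ultimately have "Re (og^d*poly q (of_real 0 * og))-0^(k-d)*hpoly k a og >= 0" by(intro tendsto_lowerbound[where F = "at_right 0"]) auto
   hence "Re (og^d*poly q 0) >= 0" using `d < k` by(simp add: power_0_left)
   thus ?thesis using wq q0 by simp
  qed
 qed
qed

lemma pd_poly: "pd v (poly (p :: complex poly)) z = poly (pderiv p) z * v" by(rule pd_eq) (use poly_DERIV[of p z] in \<open>simp add: hfd_def\<close>)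

lemma sm_poly: "sm (poly (p :: complex poly)) S"
proof -
 have "Ck_on n (poly p) S" for n proof(induction n arbitrary: p)
  case (Suc n)
  have "pd v (poly p) = (%z. poly (smult v (pderiv p)) z)" for v by(rule ext) (simp add: pd_poly)
  moreover have "Ck_on n (%z. poly (smult v (pderiv p)) z) S" for v using Suc.IH[of "smult v (pderiv p)"] by(simp only:)
  moreover have "poly p differentiable (at z)" for z using poly_DERIV[of p z] by(auto simp: hfd_def differentiable_def)
  ultimately show ?case unfolding Ck_Suc by simp
 qed (use continuous_on_poly[OF continuous_on_id] in simp)
 thus ?thesis by(simp add: smooth_on_def)
qed

lemma lap_Re_poly: "lap (%z. Re (poly (p :: complex poly) z)) z = 0"
proof -
 have d: "poly p differentiable (at z)" for p :: "complex poly" and z by(rule sm_dif[OF sm_poly UNIV_I])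
 have e: "pd v (%z. Re (poly p z)) = (%z. Re (poly (smult v (pderiv p)) z))" for v and p :: "complex poly"
  by(rule ext) (simp add: pd_lin[OF bounded_linear_Re d] pd_poly mult.commute)
 show ?thesis unfolding lap_def e by(simp add: pderiv_smult)
qed

subsection \<open>The disc of maximal contact\<close>

declare split_paired_All [simp del] split_paired_Ex [simp del]

lemma order1_taylor:
 fixes U :: "complex => C2"
 assumes U: "U differentiable (at 0)" and nz: "pd 1 U 0 ~= 0" shows "first_taylor_degree (%ze. U ze-U 0) 1" unfolding first_taylor_degree_def
proof(rule exI[of _ "%j::nat. if j = 0 then pd \<i> U 0 else pd 1 U 0"], intro conjI)
 show "? j<=1::nat. (if j = 0 then pd \<i> U 0 else pd 1 U 0) ~= 0" using nz by(intro exI[of _ "1::nat"]) simp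
 have e: "(SUM j<=1::nat. (Re ze^j*Im ze^(1-j))*.(if j = 0 then pd \<i> U 0 else pd 1 U 0)) = pd ze U 0" for ze by(simp add: pd_complex[OF U, of ze])
 have "((%ze. norm (U ze-U 0-pd ze U 0)/norm ze) ---> 0) (at 0)" using hd_pd[OF U] unfolding has_derivative_at by simp
 thus "(%ze. norm (U ze-U 0-(SUM j<=1::nat. (Re ze^j*Im ze^(1-j))*.(if j = 0 then pd \<i> U 0 else pd 1 U 0)))) : o[at 0](%ze. norm ze^1)"
  unfolding e by(intro smalloI_tendsto) (auto simp: eventually_at_filter)
qed

locale boundary_point =
 fixes A :: "('a::{t2_space, second_countable_topology}) chart set" and J :: "'a tensor11" and D W :: "'a set" and rh :: "'a => real"
  and q :: 'a and m :: nat and c :: "'a chart"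
 assumes acm: "almost_complex_manifold A J" and W: "open W" "closure D <= W" and def_fun: "C2_defining_function A W rh D" and psh: "J_plurisubharmonic_on A J rh W"
  and q: "q : frontier D" and type_q: "dangelo_type A J rh q = ereal (2*real m)" and adapted: "adapted_coordinates A J rh q c"
begin

definition "X = coord c ` (chart_dom c Int W)"
abbreviation "r == in_chart rh c"

lemma c: "c : A" "q : chart_dom c" "coord c q = 0" "J c 0 = J_st" using adapted unfolding adapted_coordinates_def by simp_all

lemmas cf = chart_facts[OF ac_facts(1)[OF acm c(1)]]
lemmas Jf = ac_facts(2-4)[OF acm c(1)]

lemma X: "open X" "0 : X" "X <= img c"
proof -
 show "open X" unfolding X_def by(rule open_coord_image[OF ac_facts(1)[OF acm c(1)] W(1)])
 have "q : W" using q W(2) by(auto simp: frontier_def)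
 thus "0 : X" unfolding X_def using c by(intro image_eqI[of _ _ q]) auto
qed (auto simp: X_def)

lemma D_eq: "D = {p : W. rh p < 0}" and r_C2: "Ck_on 2 r X" using def_fun c(1) unfolding C2_defining_function_def X_def by blast+

lemma r_diff: "z : X ==> r differentiable (at z)" by(rule Ck2_dif[OF r_C2])

lemma levi_nonneg: "z : X ==> levi_form J rh c z v >= 0" using psh c(1) unfolding J_plurisubharmonic_on_def X_def by blast

lemma r_quadratic: "? C R. C > 0 & R > 0 & (! z. norm z < R --> abs (r z-Re (snd z)) <= C*norm z^2)" and r_0: "r 0 = 0"
proof -
 have "(%z. r z-Re (snd z)) : O[at 0](%z. (norm z)^2)" using adapted unfolding adapted_coordinates_def by simp
 then obtain C where C: "C > 0" "eventually (%z. norm (r z-Re (snd z)) <= C*norm ((norm z)^2)) (at 0)" by(elim landau_o.bigE)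
 then obtain R where R: "R > 0" "!!z. z ~= 0 ==> norm z < R ==> abs (r z-Re (snd z)) <= C*norm z^2" by(auto simp: eventually_at dist_norm)
 have "isCont r 0" using r_diff[OF X(2)] by(rule differentiable_imp_continuous_within)
 hence "((%z. r z-Re (snd z)) ---> r 0-Re (snd (0 :: C2))) (at 0)" unfolding isCont_def by(intro tendsto_intros)
 moreover have "((%z. r z-Re (snd z)) ---> 0) (at 0)" proof(rule Lim_null_comparison)
  show "eventually (%z. norm (r z-Re (snd z)) <= C*(norm z)^2) (at 0)" using C(2) by simp
  have "((%z::C2. C*(norm z)^2) ---> C*(norm (0 :: C2))^2) (at 0)" by(intro tendsto_intros)
  thus "((%z::C2. C*(norm z)^2) ---> 0) (at 0)" by simp
 qed
 ultimately show r0: "r 0 = 0" using tendsto_unique[OF at_neq_bot] by fastforce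
 have "abs (r z-Re (snd z)) <= C*norm z^2" if "norm z < R" for z by(cases "z = 0") (use R(2) that r0 in auto)
 thus "? C R. C > 0 & R > 0 & (! z. norm z < R --> abs (r z-Re (snd z)) <= C*norm z^2)" using C(1) R(1) by blast
qed

lemma pd_r: "pd v r 0 = Re (snd v)"
proof -
 obtain C R where CR: "C > 0" "R > 0" "!!z. norm z < R ==> abs (r z-Re (snd z)) <= C*norm z^2" using r_quadratic by blast
 have "((%z. r z) has_derivative (%v. Re (snd v))) (at 0)" unfolding has_derivative_at proof(intro conjI)
  show "bounded_linear (%v::C2. Re (snd v))" by(rule bounded_linear_compose[OF bounded_linear_Re bl_snd])
  show "((%h. norm (r (0+h)-r 0-Re (snd h))/norm h) ---> 0) (at 0)" proof(rule Lim_null_comparison)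
   show "eventually (%h. norm (norm (r (0+h)-r 0-Re (snd h))/norm h) <= C*norm h) (at 0)" unfolding eventually_at proof(intro exI[of _ R] conjI ballI impI)
    fix h :: C2 assume "h ~= 0 & dist h 0 < R"
    thus "norm (norm (r (0+h)-r 0-Re (snd h))/norm h) <= C*norm h" using CR(3)[of h] by(simp add: r_0 divide_le_eq sq_eq mult.assoc)
   qed (rule CR)
   have "((%z::C2. C*norm z) ---> C*norm (0 :: C2)) (at 0)" by(intro tendsto_intros)
   thus "((%z::C2. C*norm z) ---> 0) (at 0)" by simp
  qed
 qed
 thus ?thesis by(rule pd_eq)
qed

text \<open>Strict differentiability at 0: it compares the values at any two nearby points, which is
  needed because both points move below. The bounds e/4 account for the four real
  coordinates.\<close>

lemma r_strict:
 assumes "e > 0" shows "EX R>0. ball 0 R <= X & (! x y. norm x < R --> norm y < R --> abs (r x-r y-Re (snd (x-y))) <= e*norm (x-y))"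
proof -
 let ?g = "%z. r z-Re (snd z)" and ?L = "%z::C2. Re (snd z)"
 have bl: "bounded_linear ?L" by(rule bounded_linear_compose[OF bounded_linear_Re bl_snd])
 have g: "Ck_on (Suc 0) ?g X" by(rule Ck_mono[OF Ck_diff[OF X(1) r_C2 Ck_bl[OF bl]]]) simp
 have p0: "pd i ?g 0 = 0" for i by(subst pd_diff[OF r_diff[OF X(2)] bounded_linear_imp_differentiable[OF bl]])
    (simp add: pd_r pd_eq[OF bounded_linear_imp_has_derivative[OF bl]])
 have ev: "eventually (%z. abs (f z) < e/4) (nhds 0)" if f: "continuous_on X f" "f 0 = 0" for f :: "C2 => real" proof -
  have "continuous (at 0) f" using continuous_on_eq_continuous_at[OF X(1)] f(1) X(2) by blast
  then obtain d where "d > 0" "! x'. dist x' 0 < d --> dist (f x') (f 0) < e/4" unfolding continuous_at_eps_delta using assms by(meson divide_pos_pos zero_less_numeral)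
  thus ?thesis using f(2) by(auto simp: eventually_nhds_metric)
 qed
 have gd: "! x:X. ?g differentiable (at x)" using g Ck_Suc by blast
 have "eventually (%z. abs (?g z) < e/4) (nhds 0)" by(rule ev[OF Ck_cont[OF g]]) (simp add: r_0)
 moreover have "eventually (%z. abs (pd i ?g z) < e/4) (nhds 0)" for i by(rule ev[OF continuous_pd[OF g] p0])
 moreover have "eventually (%z. z : X) (nhds 0)" by(rule eventually_nhds_in_open[OF X(1,2)])
 ultimately have "eventually (%z. z : X & abs (?g z) < e/4 & (! i:Basis. abs (pd i ?g z) < e/4)) (nhds 0)"
  by(intro eventually_conj eventually_ball_finite finite_Basis ballI)
 then obtain R where R: "R > 0" "!!z. norm z < R ==> z : X & abs (?g z) < e/4 & (! i:Basis. abs (pd i ?g z) < e/4)" by(auto simp: eventually_nhds_metric)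
 have "abs (?g x-?g y) <= e*norm (x-y)" if "norm x < R" "norm y < R" for x y proof -
  have "Qb (Suc 0) ?g (e/4) (ball 0 R)" using R(2) unfolding Qb.simps by(force intro: less_imp_le)
  from Qb_lipschitz[OF this convex_ball, of x y] that R(2)
  have "norm (?g x-?g y) <= real (DIM(C2))*(e/4)*norm (x-y)" using gd by auto
  thus ?thesis by simp
 qed
 thus ?thesis using R by(intro exI[of _ R]) (auto simp: algebra_simps)
qed

text \<open>The last two conditions say that the disc is tangent to the complex tangent space and
  regular at 0. Tangency gives contact of order at least 2; regularity gives multiplicity at most
  1.\<close>

definition chart_disc :: "(complex => C2) => bool" where "chart_disc U \<longleftrightarrow> sm U (DD) & U 0 = 0 &
   (! z:DD. U z : img c & pd \<i> U z = J c (U z) (pd 1 U z)) &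
   snd (pd 1 U 0) = 0 & fst (pd 1 U 0) ~= 0"

lemma chart_discD:
 assumes "chart_disc U" shows "sm U (DD)" "U 0 = 0" "z : DD ==> U z : img c" "z : DD ==> pd \<i> U z = J c (U z) (pd 1 U z)" "snd (pd 1 U 0) = 0" "fst (pd 1 U 0) ~= 0"
 using assms by(auto simp: chart_disc_def)

text \<open>For a disc of multiplicity at most 1 the type bounds the contact order itself. The disc
  is not constant because its derivative at 0 does not vanish.\<close>

lemma contact_bound:
 assumes U: "chart_disc U" shows "? k<=2*m. first_taylor_degree (r o U) k"
proof -
 note Uf = chart_discD[OF U]
 define u where "u = coord_inv c o U"
 have u: "J_holomorphic_disc A J u" unfolding u_def by(rule disc_of_chart[OF acm c(1) Uf(1,3,4)])
 have u0: "u 0 = q" using cf(5)[OF c(2)] by(simp add: u_def Uf(2) c(3)[symmetric])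
 have cu: "coord c (u z) = U z" if "z : DD" for z using cf(6)[OF Uf(3)[OF that]] by(simp add: u_def)
 have nc: "~u constant_on DD" proof
  assume "u constant_on DD"
  then obtain p where "!!z. z : DD ==> u z = p" unfolding constant_on_def by blast
  hence Up: "U z = coord c p" if "z : DD" for z using cu[OF that] that by simp
  have "pd 1 U 0 = pd 1 (%z::complex. coord c p) 0" by(rule pd_cong[OF open_ball[of 0 1] Up]) auto
  thus False using Uf(6) by(simp add: pd_eq[OF has_derivative_const])
 qed
 have "first_taylor_degree (%ze. U ze-U 0) 1" using Uf(6) by(intro order1_taylor sm_dif[OF Uf(1)]) auto
 moreover have "first_taylor_degree (%ze. coord c (u ze)-coord c (u 0)) 1 \<longleftrightarrow> first_taylor_degree (%ze. U ze-U 0) 1" unfolding first_taylor_degree_def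
 proof(intro arg_cong[where f = Ex] ext conj_cong refl landau_o.small.in_cong)
  fix a :: "nat => C2"
  have "eventually (%ze. ze : DD) (at (0::complex))" by(rule eventually_at_in_open') auto
  thus "\<forall>\<^sub>F ze in at 0. norm (coord c (u ze)-coord c (u 0)-(SUM j<=1::nat. (Re ze^j*Im ze^(1-j))*.a j)) =
    norm (U ze-U 0-(SUM j<=1::nat. (Re ze^j*Im ze^(1-j))*.a j))" by(rule eventually_mono) (simp add: cu)
 qed
 ultimately have mult: "disc_multiplicity A u <= 1"
  unfolding disc_multiplicity_def using c u0 by(intro Inf_lower) (auto intro!: exI[of _ 1] exI[of _ c] simp: one_ereal_def)
 have mult0: "0 <= disc_multiplicity A u" and con0: "0 <= contact_order rh u" unfolding disc_multiplicity_def contact_order_def by(auto intro!: Inf_greatest)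
 have "contact_order rh u/disc_multiplicity A u <= ereal (2*real m)" unfolding type_q[symmetric] dangelo_type_def by(rule Sup_upper) (use u u0 nc in blast)
 moreover have "contact_order rh u <= contact_order rh u/disc_multiplicity A u" proof -
  have "inverse 1 <= inverse (disc_multiplicity A u)" by(rule ereal_inverse_antimono[OF mult0 mult])
  hence "contact_order rh u*1 <= contact_order rh u*inverse (disc_multiplicity A u)" by(intro ereal_mult_left_mono con0) (simp add: one_ereal_def)
  thus ?thesis by(simp add: divide_ereal_def)
 qed
 ultimately have "contact_order rh u <= ereal (2*real m)" by(rule order_trans[rotated])
 \<comment> \<open>A strict bound is needed to extract an attained degree from the infimum; as
   degrees are integers, being below 2m + 1 means being at most 2m.\<close>
 hence "contact_order rh u < ereal (real (2*m+1))" by(rule le_less_trans) simp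
 then obtain k where "first_taylor_degree (rh o u) k" "ereal (real k) < ereal (real (2*m+1))" unfolding contact_order_def Inf_less_iff by blast
 moreover have "rh o u = r o U" by(simp add: u_def in_chart_def o_assoc)
 ultimately show ?thesis by(intro exI[of _ k]) auto
qed

lemma disc_scale:
 assumes U: "chart_disc U" and t: "0 < t" "t <= 1" shows "chart_disc (%z. U (t*.z))" "!!v z. norm (t*.z) < 1 ==> pd v (%z. U (t*.z)) z = t*.pd v U (t*.z)"
proof -
 note Uf = chart_discD[OF U]
 have mem: "t*.z : DD" if "z : DD" for z :: complex using that t mult_left_le_one_le[of "norm z" t] by simp
 show pd: "!!v z. norm (t*.z) < 1 ==> pd v (%z. U (t*.z)) z = t*.pd v U (t*.z)" by(rule pd_rescaled[OF sm_dif[OF Uf(1)]]) simp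
 show "chart_disc (%z. U (t*.z))" unfolding chart_disc_def proof(intro conjI ballI)
  show "sm (%z. U (t*.z)) (DD)" by(rule smooth_rescaled[OF Uf(1) open_ball open_ball mem])
  fix z :: complex assume "z : DD"
  note m = mem[OF this]
  hence m': "norm (t*.z) < 1" by simp
  show "U (t*.z) : img c" by(rule Uf(3)[OF m])
  show "pd \<i> (%z. U (t*.z)) z = J c (U (t*.z)) (pd 1 (%z. U (t*.z)) z)" unfolding pd[OF m'] Uf(4)[OF m] linear_scale[OF Jf(1)[OF Uf(3)[OF m]]] ..
 qed (use Uf pd[of 0] t in auto)
qed

end

lemma pd_iterate_rescaled:
 fixes U :: "complex => 'b::real_normed_vector"
 assumes U: "sm U (DD)" and t: "0 < t" "t <= 1" shows "z : DD ==> (pd 1 ^^ j) (%z. U (t*.z)) z = t^j*.(pd 1 ^^ j) U (t*.z)"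
proof(induction j arbitrary: z)
 case (Suc j)
 have m: "t*.z : DD" if "z : DD" for z :: complex using that t mult_left_le_one_le[of "norm z" t] by simp
 have d: "(pd 1 ^^ j) U differentiable (at (t*.z))" unfolding pds_replicate by(rule sm_dif[OF sm_pds[OF U] m[OF Suc.prems]])
 have d': "(%z. (pd 1 ^^ j) U (t*.z)) differentiable (at z)" using d by(rule dif_comp[of "(pd 1 ^^ j) U" "%z. t*.z"]) simp
 have "(pd 1 ^^ Suc j) (%z. U (t*.z)) z = pd 1 (%z. t^j*.(pd 1 ^^ j) U (t*.z)) z"
  using pd_cong[of "DD" "(pd 1 ^^ j) (%z. U (t*.z))", OF open_ball Suc.IH Suc.prems] by simp
 also have "... = t^j*.t*.pd 1 ((pd 1 ^^ j) U) (t*.z)" unfolding pd_scaleR_c[OF d'] pd_rescaled[OF d] ..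
 finally show ?case by(simp add: mult.commute)
qed simp

context boundary_point
begin

lemma chart_0: "0 : img c" using X by blast

lemma chart_disc_exists: "? U. chart_disc U"
proof -
 from disc_with_jet[where N = 1 and h = "%j. (1, 0)", OF acm c(1) chart_0 c(4)] obtain t U where
  tU: "t > 0" "sm U (DD)" "U 0 = 0" "! j. 1 <= j & j <= 1 --> (pd 1 ^^ j) U 0 = t^j*.(fact j*.(1, 0))"
  "! z:DD. U z : img c & pd \<i> U z = J c (U z) (pd 1 U z)" by(elim exE conjE) (rule that)
 have "pd 1 U 0 = t*.(1, 0)" using tU(4)[rule_format, of 1] by simp
 hence "chart_disc U" using tU unfolding chart_disc_def by simp
 thus "? U. chart_disc U" by blast
qed

lemma chart_disc_pd_i: "chart_disc U ==> pd \<i> U 0 = J_st (pd 1 U 0)" using chart_discD(4)[of U 0] chart_discD(2)[of U] c(4) by simp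

text \<open>Both real directions of the disc at 0 lie in the kernel of the differential of
  \<open>r\<close>.\<close>

lemma contact_ge_2:
 assumes U: "chart_disc U" and k: "first_taylor_degree (r o U) k" shows "2 <= k"
proof -
 note Uf = chart_discD[OF U]
 have dU: "U differentiable (at 0)" by(rule sm_dif[OF Uf(1)]) simp
 have dr: "r differentiable (at (U 0))" using r_diff[OF X(2)] Uf(2) by simp
 have "snd (pd h U 0) = 0" for h unfolding pd_complex[OF dU, of h] chart_disc_pd_i[OF U] by(simp add: J_st_def Uf(5))
 hence "pd h (r o U) 0 = 0" for h unfolding o_def chain_pd[OF dU dr] by(simp add: Uf(2) pd_r)
 hence "((r o U) has_derivative (%h. 0)) (at 0)" using hd_pd[of "r o U" 0] dif_comp[OF dr dU] by(simp add: o_def)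
 hence "((%z. norm ((r o U) z)/norm z) ---> 0) (at 0)" unfolding has_derivative_at by(simp add: Uf(2) r_0)
 hence "((%z. (r o U) z/norm z^1) ---> 0) (at 0)" by(subst tendsto_rabs_zero_iff[symmetric]) simp
 hence "r o U : o[at 0](%z. norm z^1)" by(intro smalloI_tendsto) (auto simp: eventually_at_filter)
 from taylor_degree_gt[OF this k] show ?thesis by simp
qed

lemma disc_near_X:
 assumes "chart_disc U" shows "EX d>0. d <= 1 & (! z. norm z < d --> U z : X)"
proof -
 note Uf = chart_discD[OF assms]
 have "open (U -` X Int DD)" using continuous_on_open_vimage[OF open_ball, of 0 1 U] sm_cont[OF Uf(1)] X(1) by blast
 moreover have "0 : U -` X Int DD" using X(2) Uf(2) by simp
 ultimately obtain d where "d > 0" "ball 0 d <= U -` X Int DD" using open_contains_ball by blast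
 thus ?thesis by(intro exI[of _ "min d 1"]) auto
qed

text \<open>By plurisubharmonicity r (U (t z))/t^k is subharmonic, and it is uniformly close to the
  form on the closed unit disc. The maximum principle compares it with the harmonic function Re p,
  which agrees with the form on the circle.\<close>

lemma contact_dominated:
 assumes U: "chart_disc U" and k: "k >= 1" and con: "(%ze. r (U ze)-hpoly k a ze) : o[at 0](%ze. norm ze^k)"
  and circ: "!!og. norm og = 1 ==> hpoly k a og = Re (poly p og)" and z: "norm ze0 <= 1" shows "hpoly k a ze0 <= Re (poly p ze0)"
proof(rule field_le_epsilon)
 fix e :: real assume "e > 0"
 define ep where "ep = e/2"
 have ep: "ep > 0" using `e > 0` by(simp add: ep_def)
 note Uf = chart_discD[OF U]
 from con ep obtain d where d: "d > 0" "!!ze. ze ~= 0 ==> norm ze < d ==> abs (r (U ze)-hpoly k a ze) <= ep*norm ze^k" unfolding smallo_at_0 by blast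
 obtain d' where d': "d' > 0" "d' <= 1" "!!z. norm z < d' ==> U z : X" using disc_near_X[OF U] by blast
 define t where "t = min d d'/4"
 have t: "0 < t" "4*t <= d" "4*t <= d'" "t <= 1" using d d' by(auto simp: t_def)
 \<comment> \<open>Larger than the unit disc, because the maximum principle requires an open
   neighbourhood of the closed disc.\<close>
 let ?B = "ball 0 2 :: complex set"
 have mem: "norm (t*.z) < d" "norm (t*.z) < d'" "t*.z : DD" if "z : ?B" for z proof -
  have "t*norm z <= t*2" using that t by(intro mono_l) auto
  hence n: "norm (t*.z) <= t*2" unfolding norm_scaleR using t by simp
  show "norm (t*.z) < d" "norm (t*.z) < d'" using n t d' by linarith+
  show "t*.z : DD" unfolding mem_ball dist_0_norm using n t d' by linarith
 qed
 define V where "V = (%z. U (t*.z))"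
 have smV: "sm V ?B" unfolding V_def by(rule smooth_rescaled[OF Uf(1) open_ball open_ball mem(3)])
 have VX: "V z : X" if "z : ?B" for z unfolding V_def by(rule d'(3)[OF mem(2)[OF that]])
 have pdV: "pd v V z = t*.pd v U (t*.z)" if "z : ?B" for v z unfolding V_def by(rule pd_rescaled[OF sm_dif[OF Uf(1) mem(3)[OF that]]])
 have eqV: "pd \<i> V z = J c (V z) (pd 1 V z)" if "z : ?B" for z
  unfolding pdV[OF that] by(simp only: V_def Uf(4)[OF mem(3)[OF that]] linear_scale[OF Jf(1)[OF Uf(3)[OF mem(3)[OF that]]]])
 let ?s = "%z. inverse (t^k)*r (V z)" and ?g = "%z. Re (poly (- p) z)"
 have rV: "Ck_on 2 (%z. r (V z)) ?B" by(rule Ck_compose[OF open_ball X(1) r_C2 sm_Ck[OF smV] VX])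
 have s: "Ck_on 2 ?s ?B" by(rule Ck_mult[OF open_ball Ck_const rV])
 have g: "Ck_on 2 ?g ?B" by(rule sm_Ck[OF sm_lin[OF bounded_linear_Re open_ball sm_poly]])
 have est: "abs (?s z-hpoly k a z) <= ep" if "norm z <= 1" for z proof(cases "z = 0")
  case True
  thus ?thesis using ep k by(simp add: V_def Uf(2) r_0 hpoly_at_0)
 next
  case False
  have "abs (r (V z)-t^k*hpoly k a z) <= ep*norm (t*.z)^k" using d(2)[of "t*.z"] mem(1)[of z] that False t hpoly_scale[of k a t z] by(simp add: V_def scaleR_conv_of_real)
  also have "... = t^k*(ep*norm z^k)" using t by(simp add: power_mult_distrib)
  also have "... <= t^k*ep" using t ep that power_le_one[of "norm z" k] by(intro mono_l) (auto intro: mult_left_le)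
  finally have "inverse (t^k)*abs (r (V z)-t^k*hpoly k a z) <= inverse (t^k)*(t^k*ep)" using t by(intro mono_l) auto
  also have "inverse (t^k)*abs (r (V z)-t^k*hpoly k a z) = abs (inverse (t^k)*(r (V z)-t^k*hpoly k a z))" using t by(simp add: abs_mult)
  finally have "abs (inverse (t^k)*(r (V z)-t^k*hpoly k a z)) <= inverse (t^k)*(t^k*ep)" .
  moreover have "inverse (t^k)*(t^k*x) = x" for x using t by simp
  ultimately show ?thesis by(simp only: right_diff_distrib)
 qed
 have "?s ze0+?g ze0 <= ep" proof(rule subharmonic_max_principle[OF open_ball _ Ck_add[OF open_ball s g] _ _ z])
  fix w :: complex assume w: "norm w < 1"
  hence wB: "w : ?B" by simp
  have "lap (%z. r (V z)) w >= 0" using levi_form_lap[OF acm c(1) X(1,3) r_C2 open_ball wB smV VX eqV] levi_nonneg[OF VX[OF wB]] by simp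
  thus "0 <= lap (%z. ?s z+?g z) w" unfolding lap_add[OF open_ball wB s g] lap_scale[OF open_ball wB rV] lap_Re_poly using t by simp
 next
  fix w :: complex assume w: "norm w = 1"
  thus "?s w+?g w <= ep" using est[of w] circ[OF w] by simp
 qed auto
 hence "?s ze0-Re (poly p ze0) <= ep" by simp
 moreover have "hpoly k a ze0-?s ze0 <= ep" using est[OF z] by(simp only: abs_le_iff minus_diff_eq)
 ultimately show "hpoly k a ze0 <= Re (poly p ze0)+e" unfolding ep_def by linarith
qed

text \<open>The correction is made in the normal direction: lowering the second component of the
  k-th Taylor coefficient by \<open>ap\<close> changes \<open>r\<close>, to first order, by -Re (ap
  z^k), which cancels the leading term. The rest of the disc changes by O(|z|^(k+1)), and strict
  differentiability of \<open>r\<close> covers the remaining error.\<close>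

lemma improve_contact:
 assumes U: "chart_disc U" and k: "k >= 2" and con: "(%ze. r (U ze)-Re (ap*ze^k)) : o[at 0](%ze. norm ze^k)" shows "? V. chart_disc V & (r o V) : o[at 0](%ze. norm ze^k)"
proof -
 note Uf = chart_discD[OF U]
 let ?jet = "%j. (1/fact j)*.(pd 1 ^^ j) U 0"
 define h where "h = (%j. if j = k then ?jet k-(0, ap) else ?jet j)"
 from disc_with_jet[where N = k and h = h, OF acm c(1) chart_0 c(4)] obtain t V where
  t: "t > 0" "t <= 1" and V: "sm V (DD)" "V 0 = 0" "! j. 1 <= j & j <= k --> (pd 1 ^^ j) V 0 = t^j*.(fact j*.h j)"
  "! z:DD. V z : img c & pd \<i> V z = J c (V z) (pd 1 V z)" by(elim exE conjE) (rule that)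
 \<comment> \<open>The new disc realises its jet only up to a dilation by \<open>t\<close>, so it is
   compared with the dilated disc instead of \<open>U\<close>.\<close>
 define Q where "Q = (%z. U (t*.z))"
 have cQ: "chart_disc Q" unfolding Q_def by(rule disc_scale(1)[OF U t])
 note Qf = chart_discD[OF cQ]
 have jQ: "(pd 1 ^^ j) Q 0 = t^j*.(pd 1 ^^ j) U 0" for j using pd_iterate_rescaled[OF Uf(1) t, of 0 j] by(simp add: Q_def)
 have jV: "(pd 1 ^^ j) V 0 = (pd 1 ^^ j) Q 0" if "1 <= j" "j < k" for j using V(3)[rule_format, of j] that by(simp add: jQ h_def)
 have V1: "pd 1 V 0 = pd 1 Q 0" using jV[of 1] k by simp
 have cV: "chart_disc V" unfolding chart_disc_def using V Qf V1 by simp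
 note Vf = chart_discD[OF cV]
 let ?c = "- (t^k)*.(0, ap)"
 have ck: "(pd 1 ^^ k) V 0-(pd 1 ^^ k) Q 0 = fact k*.?c" using V(3)[rule_format, of k] k by(simp add: jQ h_def scaleR_diff_right)
 let ?E = "%z. V z-Q z-cmul (z^k) ?c"
 have "flat (Suc k) ?E" by(rule disc_jet_difference[where S = "DD" and T = "img c" and Jm = "J c"]) (use cf(2) Jf c(4) Vf Qf jV ck k in auto)
 moreover have "sm ?E (DD)" by(rule sm_diff[OF open_ball sm_diff[OF open_ball Vf(1) Qf(1)]
    sm_lin[OF bl_cmul_left open_ball smooth_power]])
 ultimately obtain C R where C: "R > 0" "C > 0" "!!z. norm z < R ==> norm (?E z) <= C*norm z^Suc k" using flat_bound[of "DD" ?E "Suc k"] by auto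
 have "(r o V) : o[at 0](%ze. norm ze^k)" unfolding smallo_at_0 proof(intro allI impI)
  fix e :: real assume e: "e > 0"
  define M where "M = C+norm ap"
  have M: "M > 0" using C by(simp add: M_def add_pos_nonneg)
  define e' where "e' = e/(3*M)"
  have e': "e' > 0" using e M by(simp add: e'_def)
  obtain R' where R': "R' > 0" "!!x y. norm x < R' ==> norm y < R' ==> abs (r x-r y-Re (snd (x-y))) <= e'*norm (x-y)" using r_strict[OF e'] by blast
  have sm: "EX d>0. d <= 1 & (! z. norm z < d --> norm (F z) < R')" if "chart_disc F" for F proof -
   note Ff = chart_discD[OF that]
   have "isCont F 0" using sm_cont[OF Ff(1)] continuous_on_eq_continuous_at[of "DD" F] by simp
   then obtain d where "d > 0" "! x'. dist x' 0 < d --> dist (F x') (F 0) < R'" unfolding continuous_at_eps_delta using R'(1) by blast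
   thus ?thesis using Ff(2) by(intro exI[of _ "min d 1"]) auto
  qed
  obtain d1 where d1: "d1 > 0" "d1 <= 1" "!!z. norm z < d1 ==> norm (V z) < R'" using sm[OF cV] by blast
  obtain d2 where d2: "d2 > 0" "!!z. norm z < d2 ==> norm (Q z) < R'" using sm[OF cQ] by blast
  have "e/3 > 0" using e by simp
  with con obtain d3 where d3: "d3 > 0" "!!ze. ze ~= 0 ==> norm ze < d3 ==> abs (r (U ze)-Re (ap*ze^k)) <= e/3*norm ze^k" unfolding smallo_at_0 by blast
  define d where "d = min (min (min d1 d2) (min d3 R)) (e/(3*C))"
  have d: "d > 0" using d1 d2 d3 C e by(simp add: d_def)
  have "abs ((r o V) z) <= e*norm z^k" if z: "z ~= 0" "norm z < d" for z proof -
   have zz: "norm z < d1" "norm z < d2" "norm z < d3" "norm z < R" "norm z < e/(3*C)" "norm z <= 1" using z(2) d1(2) by(auto simp: d_def)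
   have tk: "t^k <= 1" using t by(simp add: power_le_one)
   define Ez where "Ez = ?E z"
   have E: "norm (Ez) <= C*norm z*norm z^k" using C(3)[OF zz(4)] by(simp add: Ez_def mult.assoc)
   have E1: "C*norm z*norm z^k <= C*norm z^k" using C(2) zz(6) by(simp add: mult.assoc mult_left_le_one_le)
   have E2: "C*norm z*norm z^k <= e/3*norm z^k" using zz(5) C by(intro mono_r) (auto simp: field_simps)
   have VQ: "V z-Q z = Ez+cmul (z^k) ?c" by(simp add: Ez_def)
   have nc: "norm (cmul (z^k) ?c) <= norm ap*norm z^k" proof -
    have "norm ?c = t^k*norm ap" using t by simp
    also have "... <= norm ap" using tk t by(simp add: mult_left_le_one_le)
    finally have "norm z^k*norm ?c <= norm z^k*norm ap" by(rule mono_l) simp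
    thus ?thesis unfolding norm_cmul norm_power by(simp only: mult.commute)
   qed
   have "norm (V z-Q z) <= M*norm z^k" unfolding VQ using tri_ineq[of "Ez" "cmul (z^k) ?c"] E E1 nc by(simp only: M_def distrib_right)
   hence "e'*norm (V z-Q z) <= e'*(M*norm z^k)" using e' by simp
   also have "... = e/3*norm z^k" using M by(simp add: e'_def)
   finally have 1: "abs (r (V z)-r (Q z)-Re (snd (V z-Q z))) <= e/3*norm z^k" using R'(2)[OF d1(3)[OF zz(1)] d2(2)[OF zz(2)]] by simp
   have sVQ: "snd (V z-Q z) = snd (Ez)+z^k*(- (of_real t^k*ap))" unfolding VQ by(simp add: cmul_def scaleR_conv_of_real)
   have 2: "abs (Re (snd (V z-Q z))+Re (ap*(t*.z)^k)) <= e/3*norm z^k" proof -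
    have "ap*(t*.z)^k = z^k*(of_real t^k*ap)" by(simp add: scaleR_conv_of_real power_mult_distrib)
    hence "Re (snd (V z-Q z))+Re (ap*(t*.z)^k) = Re (snd (Ez))" unfolding sVQ by simp
    moreover have "abs (Re (snd (Ez))) <= norm (Ez)" using abs_Re_le_cmod[of "snd (Ez)"] norm_snd_le[of "snd Ez" "fst Ez"] by(simp del: norm_Pair)
    ultimately show ?thesis using E E2 by linarith
   qed
   have "norm (t*.z) <= norm z" using t by(simp add: mult_left_le_one_le)
   hence "abs (r (Q z)-Re (ap*(t*.z)^k)) <= e/3*norm (t*.z)^k" unfolding Q_def using z zz t `norm (t *\<^sub>R z) <= norm z` by(intro d3(2)) (simp, linarith)
   also have "... <= e/3*norm z^k" using e `norm (t *\<^sub>R z) <= norm z` by(intro mono_l power_mono) auto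
   finally have 3: "abs (r (Q z)-Re (ap*(t*.z)^k)) <= e/3*norm z^k" .
   have "e*norm z^k = e/3*norm z^k+e/3*norm z^k+e/3*norm z^k" by simp
   thus ?thesis using 1 2 3 unfolding o_def abs_le_iff by linarith
  qed
  thus "EX d>0. ! ze. ze ~= 0 & norm ze < d --> abs ((r o V) ze) <= e*norm ze^k" using d by blast
 qed
 thus ?thesis using cV by blast
qed

text \<open>The maximum runs over the degrees up to 2m attained by chart discs. By
  \<open>contact_bound\<close> a disc of improved contact attains such a degree as well, and it
  would be larger.\<close>

theorem good_disc: "? U k a p. chart_disc U & 2 <= k & k <= 2*m & (! og. norm og = 1 --> hpoly k a og = Re (poly p og)) &
  Re (coeff p 0) > 0 & (%ze. r (U ze)-hpoly k a ze) : o[at 0](%ze. norm ze^k)"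
proof -
 define K where "K = {k. k <= 2*m & (? U. chart_disc U & first_taylor_degree (r o U) k)}"
 have fK: "finite K" by(rule finite_subset[of _ "{..2*m}"]) (auto simp: K_def)
 have "K ~= {}" using chart_disc_exists contact_bound unfolding K_def by blast
 define k where "k = Max K"
 have "k : K" unfolding k_def by(rule Max_in[OF fK `K ~= {}`])
 then obtain U where U: "k <= 2*m" "chart_disc U" "first_taylor_degree (r o U) k" unfolding K_def by blast
 have k2: "2 <= k" by(rule contact_ge_2[OF U(2,3)])
 from U(3) obtain a where con: "(%ze. r (U ze)-hpoly k a ze) : o[at 0](%ze. norm ze^k)" unfolding first_taylor_degree_real o_def by blast
 obtain p where p: "degree p <= k" "!!og. norm og = 1 ==> hpoly k a og = Re (poly p og)" using hpoly_on_circle by blast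
 have dom: "hpoly k a ze <= Re (poly p ze)" if "norm ze <= 1" for ze by(rule contact_dominated[OF U(2) _ con p(2) that]) (use k2 in auto)
 have "Re (coeff p 0) > 0" proof(rule ccontr)
  assume "~Re (coeff p 0) > 0"
  then obtain ap where "! ze. hpoly k a ze = Re (ap*ze^k)" using dominated_hpoly[OF _ p dom] k2 by fastforce
  hence "(%ze. r (U ze)-Re (ap*ze^k)) : o[at 0](%ze. norm ze^k)" using con by(simp only:)
  from improve_contact[OF U(2) k2 this] obtain V where V: "chart_disc V" "(r o V) : o[at 0](%ze. norm ze^k)" by blast
  from contact_bound[OF V(1)] obtain k' where k': "k' <= 2*m" "first_taylor_degree (r o V) k'" by blast
  have "k < k'" by(rule taylor_degree_gt[OF V(2) k'(2)])
  moreover have "k' <= k" unfolding k_def by(rule Max_ge[OF fK]) (use k' V in \<open>auto simp: K_def\<close>)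
  ultimately show False by simp
 qed
 thus ?thesis using U k2 p con by blast
qed

end

subsection \<open>Straightening a disc\<close>

lemma pd_i_rotate:
 assumes "linear L" "f differentiable (at z)" "pd \<i> f z = L (pd 1 f z)" "L (pd \<i> f z) = - pd 1 f z" shows "pd (\<i>*h) f z = L (pd h f z)"
 using assms by(simp add: pd_complex[OF assms(2), of h] pd_complex[OF assms(2), of "\<i>*h"] linear_add linear_scale)

text \<open>The inverse function theorem only yields differentiability of the inverse. Cramer's
  rule, with determinant Im (cnj f_x f_y), writes its derivative as a smooth function of the inverse
  itself, and smoothness follows by induction.\<close>

lemma smooth_planar_inverse:
 fixes f :: "complex => complex"
 assumes f: "sm f (DD)" and d0: "pd 1 f 0 = l" "pd \<i> f 0 = \<i>*l" "l ~= 0" shows "? S V g. open S & 0 : S & S <= DD & open V & homeomorphism S V f g & sm g V &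
  (! x:S. ! h. pd h f x = 0 --> h = 0)"
proof -
 let ?d = "%x. Im (cnj (pd 1 f x)*pd \<i> f x)"
 define B where "B = {x : DD. ?d x ~= 0}"
 note D = sm_dif[OF f] and C = sm_cont[OF sm_pd[OF f]]
 have "continuous_on (DD) ?d" by(intro continuous_intros C)
 moreover have "B = ?d -` (- {0}) Int DD" by(auto simp: B_def)
 ultimately have oB: "open B" using continuous_on_open_vimage[OF open_ball, of 0 1 ?d] by(metis open_Compl closed_singleton)
 have "?d 0 = (Re l)^2+(Im l)^2" by(simp add: d0 sq_eq)
 moreover have "(Re l)^2+(Im l)^2 ~= 0" using d0(3) by(simp add: complex_eq_iff)
 ultimately have B0: "0 : B" unfolding B_def by(simp del: times_complex.sel)
 have BB: "B <= DD" by(auto simp: B_def)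
 have bl: "bounded_linear (%v. pd v f x)" if "x : B" for x using has_derivative_bounded_linear[OF hd_pd[OF D]] that BB by blast
 let ?f' = "%x. Blinfun (%v. pd v f x)"
 have app: "blinfun_apply (?f' x) = (%v. pd v f x)" if "x : B" for x by(rule bounded_linear_Blinfun_apply[OF bl[OF that]])
 have der: "(f has_derivative blinfun_apply (?f' x)) (at x)" if "x : B" for x unfolding app[OF that] using hd_pd[OF D] that BB by blast
 have cont: "continuous_on B ?f'" proof(rule continuous_on_blinfun_componentwise)
  fix i :: complex
  show "continuous_on B (%x. ?f' x i)" using cont_sub[OF C BB, of i] by(rule continuous_on_eq) (simp add: app)
 qed
 have pl: "pd h f 0 = l*h" for h using d0 by(simp add: pd_complex[OF D, of 0 h] complex_eq_iff algebra_simps)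
 have iv: "Blinfun (%v. v/l) o\<^sub>L ?f' 0 = id_blinfun" proof(rule blinfun_eqI)
  fix v
  have "bounded_linear (%v. v/l)" by(rule bounded_linear_divide)
  thus "blinfun_apply (Blinfun (%v. v/l) o\<^sub>L ?f' 0) v = blinfun_apply id_blinfun v"
   using d0(3) by(simp add: bounded_linear_Blinfun_apply bounded_linear_Blinfun_apply[OF bounded_linear_mult_right] pl)
 qed
 obtain S V g g' where
  S: "open S" "S <= B" "0 : S" "open V" "homeomorphism S V f g" and g: "!!y. y : V ==> (g has_derivative g' y) (at y)"
  by(rule inverse_function_theorem[OF oB der cont B0 iv], assumption, rule that, assumption+)
 have gS: "g y : S" "f (g y) = y" if "y : V" for y using S(5) that unfolding homeomorphism_def by auto
 have SB: "x : DD" "?d x ~= 0" if "x : S" for x using S(2) that by(auto simp: B_def)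
 have solve: "Re w = Im (cnj (pd w f x)*pd \<i> f x)/?d x" "Im w = Im (cnj (pd 1 f x)*pd w f x)/?d x" if "x : S" for x w
  using SB(2)[OF that] unfolding pd_complex[OF D[OF SB(1)[OF that]], of w] by(simp_all add: field_simps)
 let ?R = "%v x. Complex (Im (cnj v * pd \<i> f x)*inverse (?d x)) (Im (cnj (pd 1 f x) * v)*inverse (?d x))"
 have g'eq: "(g has_derivative (%v. ?R v (g y))) (at y)" if y: "y : V" for y proof -
  have "pd v (%y. f (g y)) y = v" for v using pd_cong[OF S(4) gS(2) y] by(simp add: pd_eq[OF has_derivative_ident])
  moreover have "pd v (%y. f (g y)) y = pd (pd v g y) f (g y)" for v by(rule chain_pd[OF differentiableI[OF g[OF y]] D[OF SB(1)[OF gS(1)[OF y]]]])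
  ultimately have "pd v g y = ?R v (g y)" for v using solve[OF gS(1)[OF y], of "pd v g y"] by(simp add: complex_eq_iff divide_inverse)
  thus ?thesis using hd_pd[OF differentiableI[OF g[OF y]]] by(simp only:)
 qed
 have smR: "sm (?R v) S" for v proof -
  have fS: "sm f S" by(rule sm_subset[OF f]) (use SB in blast)
  note P = sm_pd[OF fS]
  have cn: "sm (%x. cnj (pd 1 f x)) S" by(rule sm_lin[OF bounded_linear_cnj S(1) P])
  have im: "sm (%x. Im (F x)) S" if "sm F S" for F by(rule sm_lin[OF bounded_linear_Im S(1) that])
  have 1: "sm (%x. inverse (?d x)) S" by(rule sm_inverse[OF S(1) im[OF sm_mult[OF S(1) cn P]] SB(2)])
  have a: "sm (%x. (Im (cnj v * pd \<i> f x)*inverse (?d x))*.1+(Im (cnj (pd 1 f x) * v)*inverse (?d x))*.\<i>) S"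
   by(rule sm_add[OF S(1) sm_scaleR[OF S(1) sm_mult[OF S(1) im[OF sm_mult[OF S(1) sm_const P]] 1] sm_const]
    sm_scaleR[OF S(1) sm_mult[OF S(1) im[OF sm_mult[OF S(1) cn sm_const]] 1] sm_const]])
  show ?thesis by(rule sm_cong[OF S(1) _ a]) (simp add: complex_eq_iff)
 qed
 have "Ck_on n g V" for n proof(induction n)
  case 0
  thus ?case using S(5) unfolding homeomorphism_def by simp
 next
  case (Suc n)
  show ?case by(rule Ck_SucI[OF S(4) g'eq Ck_compose[OF S(4,1) sm_Ck[OF smR] Suc gS(1)]])
 qed
 hence "sm g V" by(simp add: smooth_on_def)
 moreover have "! x:S. ! h. pd h f x = 0 --> h = 0" proof(intro ballI allI impI)
  fix x h assume "x : S" "pd h f x = 0"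
  thus "h = 0" using solve[of x h] by(simp add: complex_eq_iff)
 qed
 ultimately show ?thesis using S BB by blast
qed

lemma dif_bound_at_0:
 assumes "f differentiable (at 0)" "f 0 = 0" shows "? C d. C > 0 & d > 0 & (! z. norm z < d --> norm (f z) <= C*norm z)"
proof -
 obtain f' where f': "(f has_derivative f') (at 0)" using assms(1) by(auto simp: differentiable_def)
 then obtain d where d: "d > 0" "!!y. norm y < d ==> norm (f y-f' y) <= norm y" unfolding has_derivative_at_alt using assms(2) by(metis diff_zero mult_1 zero_less_one)
 obtain K where K: "K > 0" "!!y. norm (f' y) <= norm y*K" using bounded_linear.pos_bounded[OF has_derivative_bounded_linear[OF f']] by blast
 have "norm (f y) <= (K+1)*norm y" if "norm y < d" for y using d(2)[OF that] K(2)[of y] tri_ineq[of "f' y" "f y-f' y"] by(simp add: algebra_simps)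
 thus ?thesis using d(1) K(1) by(intro exI[of _ "K+1"] exI[of _ d]) auto
qed

text \<open>A change of coordinates by the diffeomorphism \<open>Ps\<close> with inverse
  \<open>Th\<close>. The new chart belongs to the atlas because the atlas is maximal.\<close>

lemma new_chart:
 fixes c :: "('a::{t2_space, second_countable_topology}) chart"
 assumes acm: "almost_complex_manifold A J" and c: "c : A" and Q: "open Q" "open V" and Th: "sm Th Q" and Ps: "sm Ps V"
  and inv_Th: "! w:Q. Th w : V & Ps (Th w) = w" and inv_Ps: "! z:V. Ps z : Q & Th (Ps z) = z"
 defines "c' == ({p : chart_dom c. coord c p : V}, Ps o coord c)" shows "c' : A" "img c' = {w : Q. Th w : img c}" "w : img c' ==> coord_inv c' w = coord_inv c (Th w)"
proof -
 note inv = inv_Th[rule_format] inv_Ps[rule_format]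
 note cf = chart_facts[OF ac_facts(1)[OF acm c]]
 let ?W = "{w : Q. Th w : img c}" and ?D = "{p : chart_dom c. coord c p : V}"
 have mem: "p : ?D ==> Ps (coord c p) : ?W & coord_inv c (Th (Ps (coord c p))) = p" for p using inv(2)[of "coord c p"] cf(5) by auto
 have mem': "w : ?W ==> coord_inv c (Th w) : ?D & Ps (coord c (coord_inv c (Th w))) = w" for w using inv(1)[of w] cf(6,7)[of "Th w"] by auto
 show im: "img c' = ?W" proof
  show "img c' <= ?W" using mem by(auto simp: c'_def)
  show "?W <= img c'" proof
   fix w assume "w : ?W"
   thus "w : img c'" using mem'[of w] by(intro image_eqI[of _ _ "coord_inv c (Th w)"]) (auto simp: c'_def)
  qed
 qed
 have inj: "inj_on (coord c') (chart_dom c')" by(rule inj_on_inverseI[of _ "%w. coord_inv c (Th w)"]) (use mem in \<open>auto simp: c'_def\<close>)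
 have ci: "coord_inv c' w = coord_inv c (Th w)" if "w : ?W" for w using inv_into_f_f[OF inj, of "coord_inv c (Th w)"] mem'[OF that] by(simp add: coord_inv_def c'_def)
 thus "w : img c' ==> coord_inv c' w = coord_inv c (Th w)" unfolding im .
 have "?D = coord c -` V Int chart_dom c" by auto
 hence oD: "open ?D" using continuous_on_open_vimage[OF cf(1), of "coord c"] cf(3) Q(2) by metis
 have "?W = Th -` (img c) Int Q" by auto
 hence oW: "open ?W" using continuous_on_open_vimage[OF Q(1), of Th] sm_cont[OF Th] cf(2) by metis
 have ch: "is_chart c'" unfolding is_chart_def im homeomorphism_def proof(intro conjI ballI)
  show "open (chart_dom c')" using oD by(simp add: c'_def)
  show "continuous_on (chart_dom c') (coord c')" using cont_comp[OF sm_cont[OF Ps] cont_sub[OF cf(3)], of ?D] by(auto simp: c'_def o_def)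
  have "continuous_on ?W (%w. coord_inv c (Th w))" by(rule cont_comp[OF cf(4) cont_sub[OF sm_cont[OF Th]]]) auto
  thus "continuous_on ?W (coord_inv c')" by(rule continuous_on_eq) (simp add: ci)
  show "coord_inv c' (coord c' p) = p" if "p : chart_dom c'" for p using inv_into_f_f[OF inj that] by(simp add: coord_inv_def)
  show "coord c' (coord_inv c' w) = w" if "w : ?W" for w using mem'[OF that] by(simp add: ci[OF that]) (simp add: c'_def)
  show "coord_inv c' ` ?W = chart_dom c'" proof
   show "coord_inv c' ` ?W <= chart_dom c'" proof
    fix p assume "p : coord_inv c' ` ?W"
    then obtain w where "w : ?W" "p = coord_inv c' w" by blast
    thus "p : chart_dom c'" using mem'[of w] ci[of w] by(simp add: c'_def)
   qed
   show "chart_dom c' <= coord_inv c' ` ?W" proof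
    fix p assume "p : chart_dom c'"
    hence p: "p : ?D" by(simp add: c'_def)
    show "p : coord_inv c' ` ?W" using mem[OF p] ci[of "Ps (coord c p)"] by(intro image_eqI[of _ _ "Ps (coord c p)"]) auto
   qed
  qed
 qed (simp_all only: im oW)
 have "compatible c' d" if d: "d : A" for d unfolding compatible_def proof
  note oc = open_coord_image[OF _ chart_facts(1)[OF ac_facts(1)[OF acm]]]
  let ?S = "coord c' ` (chart_dom c' Int chart_dom d)" and ?T = "coord c ` (chart_dom c Int chart_dom d)"
  have oS: "open ?S" by(rule oc[OF ch d])
  have oT: "open ?T" by(rule oc[OF ac_facts(1)[OF acm c] d])
  have SW: "?S <= ?W" unfolding im[symmetric] by blast
  have ST: "Th w : ?T" if w: "w : ?S" for w proof -
   obtain p where p: "p : ?D" "p : chart_dom d" "w = Ps (coord c p)" using w by(auto simp: c'_def)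
   hence "Th w = coord c p" using inv(2)[of "coord c p"] by simp
   thus ?thesis using p by simp
  qed
  have sm: "sm (%w. transition c d (Th w)) ?S" by(rule sm_comp[OF oS oT ac_facts(5)[OF acm c d] sm_subset[OF Th] ST]) (use SW in auto)
  show "sm (transition c' d) ?S" proof(rule sm_cong[OF oS _ sm])
   fix w assume "w : ?S"
   hence "coord_inv c' w = coord_inv c (Th w)" by(rule ci[OF subsetD[OF SW]])
   thus "transition c d (Th w) = transition c' d w" by(simp add: transition_def)
  qed
  let ?S' = "coord d ` (chart_dom c' Int chart_dom d)"
  have oS': "open ?S'" using open_coord_image[OF ac_facts(1)[OF acm d] chart_facts(1)[OF ch]] by(simp add: Int_commute)
  have df: "!!p. p : chart_dom d ==> coord_inv d (coord d p) = p" by(rule chart_facts(5)[OF ac_facts(1)[OF acm d]])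
  have sub: "?S' <= coord d ` (chart_dom d Int chart_dom c)" by(auto simp: c'_def)
  have "sm (%z. Ps (transition d c z)) ?S'" by(rule sm_comp[OF oS' Q(2) Ps sm_subset[OF ac_facts(5)[OF acm d c] sub]]) (auto simp: transition_def df c'_def)
  thus "sm (transition d c') ?S'" by(simp add: transition_def c'_def o_def)
 qed
 thus "c' : A" using acm ch unfolding almost_complex_manifold_def smooth_structure_def by blast
qed

context boundary_point
begin

text \<open>The point with new coordinates (zeta, w2) is U zeta + (0, w2) in the old ones, so the
  disc becomes the axis w2 = 0 with its own parameter as coordinate. The last condition says that
  the axis is a disc.\<close>

definition "straight U c' R C \<longleftrightarrow> c' : A & R > 0 & C > 0 & (! w. norm w < R --> w : img c') &
  (! w : img c'. coord_inv c' w = coord_inv c (U (fst w)+(0, snd w))) & (! p : chart_dom c'. coord c p = U (fst (coord c' p))+(0, snd (coord c' p))) &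
  (! p : chart_dom c. norm (coord c p) < R --> p : chart_dom c' & norm (coord c' p) <= C*norm (coord c p)) &
  J c' 0 = J_st & (! ze h. (ze, 0) : img c' --> J c' (ze, 0) (h, 0) = (\<i>*h, 0))"

lemma straightD:
 assumes "straight U c' R C" shows "c' : A" "R > 0" "C > 0" "norm w < R ==> w : img c'" "w : img c' ==> coord_inv c' w = coord_inv c (U (fst w)+(0, snd w))"
  "p : chart_dom c' ==> coord c p = U (fst (coord c' p))+(0, snd (coord c' p))"
  "p : chart_dom c ==> norm (coord c p) < R ==> p : chart_dom c' & norm (coord c' p) <= C*norm (coord c p)"
  "J c' 0 = J_st" "(ze, 0) : img c' ==> J c' (ze, 0) (h, 0) = (\<i>*h, 0)" using assms unfolding straight_def by blast+

text \<open>The first component of \<open>U\<close> has an invertible derivative at 0, so (zeta, w2)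
  -> U zeta + (0, w2) is a local diffeomorphism. That \<open>U\<close> is a disc means that J is
  standard on vectors tangent to the axis.\<close>

theorem straightened_chart:
 assumes U: "chart_disc U" shows "? c' R C. straight U c' R C"
proof -
 note Uf = chart_discD[OF U]
 let ?f = "%z. fst (U z)"
 have dU: "U differentiable (at z)" if "z : DD" for z by(rule sm_dif[OF Uf(1) that])
 have f: "sm ?f (DD)" by(rule sm_lin[OF bl_fst open_ball Uf(1)])
 have pf: "pd h ?f z = fst (pd h U z)" if "z : DD" for h z by(rule pd_lin[OF bl_fst dU[OF that]])
 have "pd \<i> ?f 0 = \<i>*pd 1 ?f 0" using pf[of 0] chart_disc_pd_i[OF U] by(simp add: J_st_def)
 from smooth_planar_inverse[OF f refl this] pf[of 0 1] Uf(6) obtain S V g where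
  S: "open S" "0 : S" "S <= DD" "open V" and hom: "homeomorphism S V ?f g" and g: "sm g V" and inj: "!!x h. x : S ==> pd h ?f x = 0 ==> h = 0" by auto
 define Th where "Th = (%w. U (fst w)+(0, snd w))"
 define Ps where "Ps = (%z::C2. (g (fst z), snd z-snd (U (g (fst z)))))"
 define Q where "Q = (fst -` S :: C2 set)"
 define V' where "V' = (fst -` V :: C2 set)"
 have oO: "open Q" "open V'" unfolding Q_def V'_def by(rule open_vimage_fst[OF S(1)] open_vimage_fst[OF S(4)])+
 have bl0: "bounded_linear (%w::C2. (0::complex, snd w))" by(intro bounded_linear_Pair bounded_linear_zero bl_snd)
 have sfst: "sm fst T" "sm snd T" for T :: "C2 set" by(rule sm_bl[OF bl_fst] sm_bl[OF bl_snd])+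
 have sT: "sm Th Q" unfolding Th_def by(rule sm_add[OF oO(1) sm_comp[OF oO(1) open_ball Uf(1) sfst(1)] sm_bl[OF bl0]]) (use S in \<open>auto simp: Q_def\<close>)
 have gS: "g y : S" "fst (U (g y)) = y" if "y : V" for y using hom that unfolding homeomorphism_def by auto
 have fV: "fst (U x) : V" "g (fst (U x)) = x" if "x : S" for x using hom that unfolding homeomorphism_def by auto
 have sg: "sm (%z. g (fst z)) V'" by(rule sm_comp[OF oO(2) S(4) g sfst(1)]) (simp add: V'_def)
 have sP: "sm Ps V'" unfolding Ps_def by(rule sm_Pair[OF oO(2) sg sm_diff[OF oO(2) sfst(2)
    sm_lin[OF bl_snd oO(2) sm_comp[OF oO(2) open_ball Uf(1) sg]]]]) (use subsetD[OF S(3) gS(1)] in \<open>simp add: V'_def\<close>)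
 have inv: "w : Q ==> Th w : V' & Ps (Th w) = w" "z : V' ==> Ps z : Q & Th (Ps z) = z" for w z using fV gS by(auto simp: Q_def V'_def Th_def Ps_def prod_eq_iff)
 define c' where "c' = ({p : chart_dom c. coord c p : V'}, Ps o coord c)"
 have "! w:Q. Th w : V' & Ps (Th w) = w" "! z:V'. Ps z : Q & Th (Ps z) = z" using inv by blast+
 note nc = new_chart[OF acm c(1) oO sT sP this, folded c'_def]
 have T0: "Th 0 = 0" by(simp add: Th_def Uf(2) zero_prod_def[symmetric])
 have O0: "0 : Q" using S(2) by(simp add: Q_def)
 have V0: "0 : V'" using inv(1)[OF O0] T0 by simp
 have P0: "Ps 0 = 0" using inv(1)[OF O0] T0 by simp
 have W0: "0 : img c'" unfolding nc(2) using O0 T0 chart_0 by simp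
 note cf' = chart_facts[OF ac_facts(1)[OF acm nc(1)]]
 obtain R1 where R1: "R1 > 0" "ball 0 R1 <= img c'" using cf'(2) W0 open_contains_ball by blast
 obtain R2 where R2: "R2 > 0" "ball 0 R2 <= V'" using oO(2) V0 open_contains_ball by blast
 obtain C R3 where C: "C > 0" "R3 > 0" "!!z. norm z < R3 ==> norm (Ps z) <= C*norm z" using dif_bound_at_0[OF sm_dif[OF sP V0] P0] by blast
 define R where "R = min R1 (min R2 R3)"
 note af = ac_facts[OF acm nc(1)]
 have ci: "coord_inv c' w = coord_inv c (Th w)" "w : Q" "Th w : img c" if "w : img c'" for w using nc(3)[OF that] that unfolding nc(2) by auto
 have tr: "pd v (transition c' c) w = pd v Th w" if w: "w : img c'" for v w by(rule pd_cong[OF cf'(2) _ w]) (simp add: transition_def ci(1) cf(6)[OF ci(3)])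
 have pT: "pd v Th w = pd (fst v) U (fst w)+(0, snd v)" if "w : Q" for v w proof -
  have w: "fst w : DD" using that S by(auto simp: Q_def)
  show ?thesis unfolding Th_def by(subst pd_add[OF dif_comp[OF dU[OF w] bounded_linear_imp_differentiable[OF bl_fst]]
    bounded_linear_imp_differentiable[OF bl0]], subst chain_pd[OF bounded_linear_imp_differentiable[OF bl_fst] dU[OF w]])
    (simp add: pd_eq[OF bounded_linear_imp_has_derivative[OF bl0]] pd_eq[OF bounded_linear_imp_has_derivative[OF bl_fst]])
 qed
 \<comment> \<open>The transformation law of the tensor, with the transition map written as
   \<open>Th\<close>.\<close>
 have key: "pd (J c' w v) Th w = J c (Th w) (pd v Th w)" if w: "w : img c'" for w v proof -
  have p: "coord_inv c' w : chart_dom c' Int chart_dom c" "coord c' (coord_inv c' w) = w" "coord c (coord_inv c' w) = Th w"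
   using cf'(6,7)[OF w] by(auto simp: ci(1)[OF w] cf(6,7)[OF ci(3)[OF w]])
  show ?thesis using af(6)[OF c(1) p(1), of v] unfolding p(2,3) tr[OF w] .
 qed
 have injTh: "v = v'" if w: "w : Q" and e: "pd v Th w = pd v' Th w" for v v' w proof -
  have wS: "fst w : S" using w by(simp add: Q_def)
  hence wB: "fst w : DD" using S by blast
  have l: "linear (%h. pd h ?f (fst w))" by(rule deriv_lin[OF hd_pd[OF sm_dif[OF f wB]]])
  have "pd (fst v) ?f (fst w) = pd (fst v') ?f (fst w)" using arg_cong[OF e, of fst] by(simp add: pT[OF w] pf[OF wB])
  hence "pd (fst v-fst v') ?f (fst w) = 0" using linear_diff[OF l] by simp
  hence "fst v = fst v'" using inj[OF wS] by fastforce
  thus ?thesis using e by(simp add: pT[OF w] prod_eq_iff)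
 qed
 have J1: "J c' (ze, 0) (h, 0) = (\<i>*h, 0)" if w: "(ze, 0) : img c'" for ze h proof(rule injTh[OF ci(2)[OF w]])
  have z: "ze : DD" using ci(2)[OF w] S by(auto simp: Q_def)
  have T: "Th (ze, 0) = U ze" by(simp add: Th_def zero_prod_def[symmetric])
  have "pd (\<i>*h) U ze = J c (U ze) (pd h U ze)" using Uf(4)[OF z] Jf(3)[OF Uf(3)[OF z]] by(intro pd_i_rotate[OF Jf(1)[OF Uf(3)[OF z]] dU[OF z]]) auto
  moreover have "pd (J c' (ze, 0) (h, 0)) Th (ze, 0) = J c (U ze) (pd h U ze)"
   using key[OF w, of "(h, 0)"] unfolding T pT[OF ci(2)[OF w], of "(h, 0)"] by(simp add: zero_prod_def[symmetric])
  ultimately show "pd (J c' (ze, 0) (h, 0)) Th (ze, 0) = pd (\<i>*h, 0) Th (ze, 0)" unfolding pT[OF ci(2)[OF w], of "(\<i>*h, 0)"] by(simp add: zero_prod_def[symmetric])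
 qed
 have J0: "J c' 0 = J_st" proof
  fix v :: C2
  have z: "(0::complex) : DD" by simp
  have "pd (\<i>*h) U 0 = J_st (pd h U 0)" for h using pd_i_rotate[OF Jf(1)[OF Uf(3)[OF z]] dU[OF z], of h] Uf(4)[OF z] Jf(3)[OF Uf(3)[OF z]] by(simp add: Uf(2) c(4))
  moreover have "J_st (x+(0, y)) = J_st x+(0, \<i>*y)" for x y by(simp add: J_st_def prod_eq_iff algebra_simps)
  ultimately have "J_st (pd v Th 0) = pd (J_st v) Th 0" unfolding pT[OF O0] by(simp add: J_st_def)
  hence "pd (J c' 0 v) Th 0 = pd (J_st v) Th 0" by(simp only: key[OF W0] T0 c(4))
  thus "J c' 0 v = J_st v" by(rule injTh[OF O0])
 qed
 show ?thesis unfolding straight_def proof(rule exI[of _ c'], rule exI[of _ R], rule exI[of _ C], intro conjI allI ballI impI)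
  fix p assume p: "p : chart_dom c" "norm (coord c p) < R"
  have "coord c p : V'" using p(2) R2(2) by(auto simp: R_def)
  thus "p : chart_dom c'" using p by(simp add: c'_def)
  show "norm (coord c' p) <= C*norm (coord c p)" using p C(3)[of "coord c p"] by(simp add: c'_def R_def)
 next
  fix p assume "p : chart_dom c'"
  thus "coord c p = U (fst (coord c' p))+(0, snd (coord c' p))" using inv(2)[of "coord c p"] by(simp_all add: c'_def Th_def)
 next
  fix w assume w: "w : img c'"
  show "coord_inv c' w = coord_inv c (U (fst w)+(0, snd w))" using ci(1)[OF w] by(simp add: Th_def)
 next
  fix w :: C2 assume "norm w < R"
  thus "w : img c'" using R1(2) by(auto simp: R_def)
 qed (use nc(1) C R1 R2 J0 J1 in \<open>simp_all add: R_def\<close>)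
qed

end

subsection \<open>A truncated logarithm\<close>

text \<open>\<open>lsc (\<bar>g\<bar>\<^sup>2)\<close> behaves like \<open>ln (\<bar>g\<bar>\<^sup>2) + \<bar>g\<bar>\<close> near the zeros of \<open>g\<close>, where the second term makes up for
  the failure of \<open>g\<close> to be holomorphic, and it vanishes for \<open>\<bar>g\<bar> \<ge> 1\<close>.\<close>

definition lsc0 :: "real => real" where "lsc0 s = ln s-2 * s+s^2/2+sqrt s-2/3*(s * sqrt s)+1/5*(s^2 * sqrt s)"
definition lsc :: "real => real" where "lsc s = (if s < 1 then lsc0 s-lsc0 1 else 0)"
text \<open>The derivative of ln s + sqrt s times (1-s)^2, cut off at s = 1; the square makes
  \<open>lsc\<close> of class C^2 there. \<open>lsc0\<close> is the resulting primitive on (0,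
  1).\<close>

definition lsc1 :: "real => real" where "lsc1 s = cutpow 2 (1-s)*(inverse s+inverse (sqrt s)/2)"
definition lsc2 :: "real => real" where "lsc2 s = - 2*cutpow 1 (1-s)*(inverse s+inverse (sqrt s)/2)
  - cutpow 2 (1-s)*((inverse s)^2+inverse s*inverse (sqrt s)/4)"

lemma DERIV_lsc1:
 assumes "s > 0" shows "(lsc1 has_real_derivative lsc2 s) (at s)"
proof -
 have 1: "((%s. cutpow 2 (1-s)) has_real_derivative-2*cutpow 1 (1-s)) (at s)" proof -
  have a: "(cutpow 2 has_real_derivative 2*cutpow 1 (1-s)) (at (1-s))" using DERIV_cutpow[of 1 "1-s"] by(simp add: numeral_2_eq_2)
  have b: "((%s. 1-s) has_real_derivative-1) (at s)" using DERIV_diff[OF DERIV_const DERIV_ident] by simp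
  show ?thesis by(rule DERIV_cong[OF DERIV_chain2[where g = "%s. 1-s" and x = s, OF a b]]) simp
 qed
 have 2: "((%s. inverse s+inverse (sqrt s)/2) has_real_derivative
   - ((inverse s)^2+inverse s*inverse (sqrt s)/4)) (at s)" proof -
  have "((%s. inverse s+inverse (sqrt s)/2) has_real_derivative (- (inverse s^Suc (Suc 0)) + - ((inverse (sqrt s)/2)*inverse (sqrt s^Suc (Suc 0)))/2)) (at s)"
   using assms by(intro DERIV_add DERIV_cdivide DERIV_inverse DERIV_inverse_fun DERIV_real_sqrt) auto
  thus ?thesis by(rule DERIV_cong) (use assms in \<open>simp add: sq_eq\<close>)
 qed
 show ?thesis unfolding lsc1_def[abs_def] lsc2_def by(rule DERIV_cong[OF DERIV_mult[OF 1 2]]) (simp add: algebra_simps)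
qed

lemma DERIV_lsc0:
 assumes "s > 0" shows "(lsc0 has_real_derivative (1-s)^2*(inverse s+inverse (sqrt s)/2)) (at s)"
proof -
 define r where "r = sqrt s"
 have r: "r > 0" "s = r*r" using assms by(simp_all add: r_def)
 have d: "(sqrt has_real_derivative inverse r/2) (at s)" unfolding r_def by(rule DERIV_real_sqrt[OF assms])
 have d2: "((%s. s^2) has_real_derivative 2 * s) (at s)" using DERIV_pow[of 2 s] by simp
 have "(lsc0 has_real_derivative inverse s-2*1+2 * s/2+inverse r/2-2/3*(1 * sqrt s+inverse r/2 * s)
   + 1/5*(2 * s * sqrt s+inverse r/2 * s^2)) (at s)" unfolding lsc0_def[abs_def]
  by(rule DERIV_add[OF DERIV_diff[OF DERIV_add[OF DERIV_add[OF DERIV_diff[OF DERIV_ln[OF assms] DERIV_cmult[OF DERIV_ident]]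
    DERIV_cdivide[OF d2]] d] DERIV_cmult[OF DERIV_mult[OF DERIV_ident d]]] DERIV_cmult[OF DERIV_mult[OF d2 d]]])
 also have "inverse s-2*1+2 * s/2+inverse r/2-2/3*(1 * sqrt s+inverse r/2 * s)+1/5*(2 * s * sqrt s+inverse r/2 * s^2)
   = inverse s-2+s+inverse r/2-2/3*(r+s*(inverse r/2))+1/5*(2 * s*r+s^2*(inverse r/2))" by(simp add: r_def mult_ac)
 also have "inverse s-2+s+inverse r/2-2/3*(r+s*(inverse r/2))+1/5*(2 * s*r+s^2*(inverse r/2))
   = (1-s)^2*(inverse s+inverse r/2)" using r(1) unfolding r(2) by(simp add: field_simps sq_eq)
 finally show ?thesis by(simp add: r_def)
qed

lemma DERIV_lsc:
 assumes "s > 0" shows "(lsc has_real_derivative lsc1 s) (at s)"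
proof -
 consider "s < 1" | "s > 1" | "s = 1" by linarith
 thus ?thesis proof cases
  case 1
  have "((%s. lsc0 s-lsc0 1) has_real_derivative lsc1 s) (at s)" using DERIV_lsc0[OF assms] 1 by(auto intro!: derivative_eq_intros simp: lsc1_def cutpow_def)
  thus ?thesis by(rule has_field_derivative_transform_within_open[where S = "{..<1}"]) (use 1 in \<open>auto simp: lsc_def\<close>)
 next
  case 2
  have "((%s. 0) has_real_derivative lsc1 s) (at s)" using 2 by(simp add: lsc1_def cutpow_def)
  thus ?thesis by(rule has_field_derivative_transform_within_open[where S = "{1<..}"]) (use 2 in \<open>auto simp: lsc_def\<close>)
 next
  case 3
  have "(lsc0 has_real_derivative 0) (at 1)" using DERIV_lsc0[of 1] by simp
  hence t: "((%h. abs ((lsc0 (1+h)-lsc0 1)/h)) ---> abs (0)) (at 0)" unfolding hfd_def DERIV_def by(intro tendsto_rabs) (simp add: DERIV_def[symmetric] hfd_def)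
  have "((%h. (lsc (1+h)-lsc 1)/h) ---> 0) (at 0)" proof(rule Lim_null_comparison)
   show "eventually (%h. norm ((lsc (1+h)-lsc 1)/h) <= abs ((lsc0 (1+h)-lsc0 1)/h)) (at 0)" by(rule always_eventually) (simp add: lsc_def)
  qed (use t in simp)
  thus ?thesis unfolding 3 DERIV_def by(simp add: lsc1_def cutpow_def)
 qed
qed

lemma Ck2_real:
 fixes h :: "real => real"
 assumes T: "open T" and "!!x. x : T ==> (h has_real_derivative h1 x) (at x)" "!!x. x : T ==> (h1 has_real_derivative h2 x) (at x)" "continuous_on T h2"
 shows "Ck_on 2 h T"
proof -
 have mult: "Ck_on k (%x. f x * v) T" if "Ck_on k f T" for k and f :: "real => real" and v by(rule Ck_lin[OF bounded_linear_mult_left T that])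
 have "Ck_on (Suc 0) h1 T" by(rule Ck_SucI[OF T assms(3)[unfolded hfd_def] mult]) (use assms(4) in auto)
 hence "Ck_on (Suc (Suc 0)) h T" by(intro Ck_SucI[OF T assms(2)[unfolded hfd_def] mult])
 thus ?thesis by(simp add: numeral_2_eq_2)
qed

lemma Ck2_lsc: "Ck_on 2 lsc {0<..}"
proof(rule Ck2_real)
 have "continuous_on {0<..} (%s::real. cutpow n (1-s))" for n unfolding cutpow_def by(intro continuous_intros)
 thus "continuous_on {0<..} lsc2" unfolding lsc2_def[abs_def] by(intro continuous_intros) auto
qed (use DERIV_lsc DERIV_lsc1 in auto)

lemma lsc_le: "s > 0 ==> lsc s <= ln s+3" and lsc_ge: "s > 0 ==> s < 1 ==> ln s-2 <= lsc s"
proof -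
 have e: "lsc0 1 = - 29/30" by(simp add: lsc0_def)
 have b: "0 <= sqrt s" "sqrt s <= 1" "0 <= s * sqrt s" "s * sqrt s <= sqrt s" "0 <= s^2 * sqrt s" "s^2 * sqrt s <= 1" "0 <= s^2" "s^2 <= 1"
  if "s > 0" "s < 1" using that by(auto simp: mult_left_le_one_le power_le_one intro!: mult_le_one)
 have l: "lsc s = lsc0 s+29/30" if "s < 1" using that by(simp add: lsc_def e)
 show "ln s-2 <= lsc s" if "s > 0" "s < 1" using b[OF that] that(2) unfolding l[OF that(2)] lsc0_def[of s] by linarith
 show "lsc s <= ln s+3" if "s > 0" proof(cases "s < 1")
  case True thus ?thesis using b[OF that True] that unfolding l[OF True] lsc0_def[of s] by linarith
 next
  case False thus ?thesis by(simp add: lsc_def add_nonneg_nonneg)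
 qed
qed

lemma lsc_nonpos: "s > 0 ==> lsc s <= 0"
proof(cases "s < 1")
 case True
 assume s: "s > 0"
 have "lsc s <= lsc 1" proof(rule DERIV_nonneg_imp_nondecreasing[of s 1])
  fix x assume "s <= x" "x <= 1"
  thus "? y. (lsc has_real_derivative y) (at x) & 0 <= y" using DERIV_lsc[of x] s by(intro exI[of _ "lsc1 x"]) (auto simp: lsc1_def cutpow_def)
 qed (use True in simp)
 thus ?thesis by(simp add: lsc_def)
qed (simp add: lsc_def)

text \<open>Comparable to \<open>s\<close> on [0, 1) and equal to 1 from there on. Passing to the
  exponential avoids the value minus infinity of the logarithm at the zeros of g.\<close>

definition tau :: "real => real" where "tau s = (if s <= 0 then 0 else exp (lsc s))"

lemma tau_bounds: "0 <= tau s" "tau s <= 1" "s >= 0 ==> tau s <= exp 3 * s" "s >= 1 ==> tau s = 1" "0 <= s ==> s < 1 ==> s <= exp 2*tau s"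
proof -
 show "0 <= tau s" "tau s <= 1" "s >= 1 ==> tau s = 1" using lsc_nonpos[of s] by(auto simp: tau_def lsc_def)
 show "tau s <= exp 3 * s" if "s >= 0" proof(cases "s = 0")
  case False
  hence "exp (lsc s) <= exp (ln s+3)" using lsc_le[of s] that by simp
  thus ?thesis using False that by(simp add: tau_def exp_add mult.commute)
 qed (simp add: tau_def)
 show "s <= exp 2*tau s" if "0 <= s" "s < 1" proof(cases "s = 0")
  case False
  hence "exp (ln s) <= exp (2+lsc s)" using lsc_ge[of s] that unfolding exp_le_cancel_iff by linarith
  thus ?thesis using False that by(simp add: tau_def exp_add)
 qed (simp add: tau_def)
qed

lemma continuous_tau: "continuous_on {0..} tau"
proof -
 have "continuous_on {0<..} (%s. exp (lsc s))" by(intro continuous_intros Ck_cont[OF Ck2_lsc])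
 hence c: "continuous_on {0<..} tau" by(rule continuous_on_eq) (simp add: tau_def)
 have "continuous (at s within {0..}) tau" if "s >= 0" for s proof(cases "s = 0")
  case True
  have "(tau ---> 0) (at 0 within {0..})" proof(rule Lim_null_comparison)
   show "eventually (%s. norm (tau s) <= exp 3 * s) (at 0 within {0..})" unfolding eventually_at_filter by(rule always_eventually) (auto simp: tau_bounds)
   have "((%s::real. exp 3 * s) ---> exp 3*0) (at 0 within {0..})" by(intro tendsto_intros)
   thus "((%s::real. exp 3 * s) ---> 0) (at 0 within {0..})" by simp
  qed
  thus ?thesis by(simp add: True continuous_within tau_def)
 next
  case False
  hence "isCont tau s" using c that by(simp add: continuous_on_eq_continuous_at)
  thus ?thesis by(rule continuous_at_imp_continuous_at_within)
 qed
 thus ?thesis by(simp add: continuous_on_eq_continuous_within)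
qed

text \<open>Bessel's inequality for X and iX, which are orthogonal over the reals and have the same
  norm.\<close>

lemma complex_Bessel: "(g.*X)^2+(g.*cmul \<i> X)^2 <= (norm g)^2*(norm X)^2"
proof -
 define q where "q = (g.*X)^2+(g.*cmul \<i> X)^2"
 have o: "X.*cmul \<i> X = 0" by(simp add: cmul_def inner_prod_def inner_complex_def)
 have n: "cmul \<i> X.*cmul \<i> X = X.*X" by(simp add: dot_sq norm_cmul)
 let ?v = "(g.*X)*.X+(g.*cmul \<i> X)*.cmul \<i> X"
 have gv: "g.*?v = q" by(simp add: q_def inner_add_right sq_eq)
 have "?v.*?v = q*(X.*X)" by(simp add: q_def inner_add_right inner_add_left o n inner_commute[of "cmul \<i> X" X] sq_eq algebra_simps)
 hence vn: "(norm ?v)^2 = q*(norm X)^2" by(simp only: dot_sq)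
 have "q^2 <= (norm g*norm ?v)^2" using Cauchy_Schwarz_ineq2[of g ?v] unfolding gv by(intro power2_le_iff_abs_le[THEN iffD2]) auto
 hence q2: "q*q <= q*((norm g)^2*(norm X)^2)" unfolding power_mult_distrib vn by(simp add: sq_eq mult_ac)
 have "q >= 0" by(simp add: q_def)
 hence "q <= (norm g)^2*(norm X)^2" using q2 by(cases "q = 0") (auto simp: mult_le_cancel_left_pos)
 thus ?thesis by(simp only: q_def)
qed

text \<open>For X = g_x, Y = g_y and Z the Laplacian of g the right-hand side is the Laplacian of
  lsc (|g|^2). With s = |g|^2 the summand |g| contributes u |X|^2, where u = (1-s)^2/|g|. The
  failure of Y = iX and Z = 0 costs at most de (24 u + 42) |X|^2, which is less than u |X|^2 up to a
  bounded multiple of |X|^2. Differentiating the cut-off costs at most 12 |X|^2.\<close>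

lemma lsc_subharmonic:
 fixes g X Y Z :: C2
 assumes g: "g ~= 0" and de: "0 <= de" "de <= 1/36" and Y: "norm (Y-cmul \<i> X) <= de*norm g*norm X" and Z: "norm Z <= de*(norm X)^2"
 shows "- 14*(norm X)^2 <= lsc1 (g.*g)*(2*(g.*Z)+2*(X.*X)+2*(Y.*Y))
  + lsc2 (g.*g)*((2*(g.*X))^2+(2*(g.*Y))^2)"
proof(cases "norm g < 1")
 case False
 hence "1 <= (norm g)^2" by simp
 hence "cutpow n (1-(norm g)^2) = 0" if "n >= 1" for n using that by(simp add: cutpow_def)
 thus ?thesis by(simp add: lsc1_def lsc2_def dot_sq)
next
 case True
 define si n where "si = norm g" and "n = norm X"
 have si: "0 < si" "si < 1" and n: "n >= 0" using g True by(simp_all add: si_def n_def)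
 define s where "s = si^2"
 have s: "0 < s" "s < 1" "s <= si" "sqrt s = si" using si power_less_one_iff[of si 2] by(simp_all add: s_def) (simp add: sq_eq)
 have gs: "g.*g = s" by(simp add: dot_sq s_def si_def)
 define u where "u = (1-s)^2/si"
 have u: "u >= 0" using si by(simp add: u_def)
 have cp: "cutpow n (1-s) = (1-s)^n" for n using s(2) by(simp add: cutpow_def)
 have l1: "lsc1 s = (1-s)^2*(inverse s+inverse si/2)" and
  l2: "lsc2 s = - 2*(1-s)^1*(inverse s+inverse si/2)-(1-s)^2*((inverse s)^2+inverse s*inverse si/4)" unfolding lsc1_def lsc2_def cp s(4) by(rule refl)+
 have l1p: "lsc1 s >= 0" and l2n: "lsc2 s <= 0" proof -
  show "lsc1 s >= 0" unfolding l1 using s si by simp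
  have "0 <= 2*(1-s)^1*(inverse s+inverse si/2)" "0 <= (1-s)^2*((inverse s)^2+inverse s*inverse si/4)" using s si by(simp_all del: power_one_right)
  thus "lsc2 s <= 0" unfolding l2 by linarith
 qed
 have d1: "- (si*de*n^2) <= g.*Z" proof -
  have "abs (g.*Z) <= si*norm Z" unfolding si_def by(rule Cauchy_Schwarz_ineq2)
  also have "... <= si*(de*n^2)" using Z si by(intro mono_l) (auto simp: n_def)
  finally show ?thesis by(simp add: abs_le_iff mult.assoc)
 qed
 have Yn: "norm (Y-cmul \<i> X) <= de * si*n" using Y by(simp add: si_def n_def)
 have "n-de * si*n <= norm Y" using Yn norm_triangle_ineq2[of "cmul \<i> X" Y] by(simp add: norm_cmul n_def norm_minus_commute)
 moreover have "de * si <= 1" using de si by(intro mult_le_one) auto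
 hence "de * si*n <= n" using n de si by(simp add: mult_left_le_one_le)
 ultimately have "(n-de * si*n)^2 <= (norm Y)^2" by(intro power_mono) auto
 moreover have "(n-de * si*n)^2 = n^2-2*(de * si)*n^2+(de * si*n)^2" by(simp add: sq_eq algebra_simps)
 hence "n^2-2*(de * si)*n^2 <= (n-de * si*n)^2" by simp
 ultimately have d2: "n^2-2*(de * si)*n^2 <= Y.*Y" by(simp add: dot_sq)
 have D: "n^2*(4-6*(de * si)) <= 2*(g.*Z)+2*(X.*X)+2*(Y.*Y)" (is "_ <= ?D") using d1 d2 by(simp add: dot_sq n_def[symmetric] algebra_simps)
 have q: "(g.*Y)^2 <= (g.*cmul \<i> X)^2+3*(de * si * s)*n^2" proof -
  have "abs (g.*(Y-cmul \<i> X)) <= si*norm (Y-cmul \<i> X)" unfolding si_def by(rule Cauchy_Schwarz_ineq2)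
  also have "... <= si*(de * si*n)" using Yn si by(intro mono_l) auto
  finally have e: "abs (g.*(Y-cmul \<i> X)) <= de * s*n" by(simp add: s_def sq_eq mult_ac)
  have f: "abs (g.*cmul \<i> X) <= si*n" using Cauchy_Schwarz_ineq2[of g "cmul \<i> X"] by(simp add: norm_cmul si_def n_def)
  let ?a = "g.*cmul \<i> X" and ?b = "g.*(Y-cmul \<i> X)"
  have "(g.*Y)^2 = ?a^2+2*(?a*?b)+?b^2" by(simp add: inner_diff_right sq_eq algebra_simps)
  moreover have "abs (?a*?b) <= (si*n)*(de * s*n)" unfolding abs_mult by(intro mult_mono e f) (use si n in auto)
  moreover have "?b^2 <= (de * s*n)^2" using e by(intro power2_le_iff_abs_le[THEN iffD2]) (use de s n in auto)
  moreover have "(de * s*n)^2 <= de * si * s*n^2" proof -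
   have "de * s <= 1 * si" using de s si by(intro mult_mono) auto
   hence "(de * s)*(de * s*n^2) <= si*(de * s*n^2)" using de s by(intro mono_r) auto
   thus ?thesis by(simp add: sq_eq mult_ac)
  qed
  ultimately show ?thesis by(simp add: abs_le_iff sq_eq algebra_simps)
 qed
 have Q: "(2*(g.*X))^2+(2*(g.*Y))^2 <= n^2*(4 * s+12*(de * si * s))" (is "?Q <= _")
  using q complex_Bessel[of g X] by(simp add: power_mult_distrib s_def si_def n_def algebra_simps)
 \<comment> \<open>The terms of order 1/s cancel in the first identity, which reflects that ln |g|^2
   is harmonic for a holomorphic scalar g. What remains is u/4 from |g| and a bounded term from the
   cut-off.\<close>
 have i1: "lsc1 s+s*lsc2 s = u/4-2*((1-s)*(1+si/2))" and i2: "si*lsc1 s = u+(1-s)^2/2" and i3: "si*(s*lsc2 s) = - (2*((1-s)*(1+si/2) * si)+(u+(1-s)^2/4))"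
  unfolding l1 l2 u_def unfolding s_def using si by(simp_all add: field_simps sq_eq)
 have "(1-s)*(1+si/2) <= 1*(3/2)" using s si by(intro mult_mono) auto
 hence j1: "(1-s)*(1+si/2) <= 3/2" by simp
 have "0 <= (1-s)*(1+si/2)" using s si by(intro mult_nonneg_nonneg) auto
 hence j2: "(1-s)*(1+si/2) * si <= 3/2" using j1 si mult_left_le[of si "(1-s)*(1+si/2)"] by linarith
 have j3: "(1-s)^2 <= 1" using s by(simp add: power_le_one)
 have "de*(6*(si*lsc1 s)-12*(si*(s*lsc2 s))) <= de*(24*u+42)" proof(rule mono_l[OF _ de(1)])
  have "6*(u+w/2)-12*- (2*y+(u+w/4)) <= 24*u+42" if "y <= 3/2" "w <= 1" for y w using that u by(simp add: field_simps)
  from this[OF j2 j3] show "6*(si*lsc1 s)-12*(si*(s*lsc2 s)) <= 24*u+42" unfolding i2 i3 .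
 qed
 also have "... <= (1/36)*(24*u+42)" using de u by(intro mono_r) auto
 finally have k1: "de*(6*(si*lsc1 s)-12*(si*(s*lsc2 s))) <= 2/3*u+7/6" by simp
 have "- 14 <= 4*(lsc1 s+s*lsc2 s)-de*(6*(si*lsc1 s)-12*(si*(s*lsc2 s)))" unfolding i1 using k1 j1 u by argo
 also have "... = lsc1 s*(4-6*(de * si))+lsc2 s*(4 * s+12*(de * si * s))" by(simp add: algebra_simps)
 finally have "n^2*(- 14) <= n^2*(lsc1 s*(4-6*(de * si))+lsc2 s*(4 * s+12*(de * si * s)))" by(rule mono_l) simp
 moreover have "lsc1 s*(n^2*(4-6*(de * si))) <= lsc1 s*?D" by(rule mono_l[OF D l1p])
 moreover have "lsc2 s*(n^2*(4 * s+12*(de * si * s))) <= lsc2 s*?Q" by(rule mult_left_mono_neg[OF Q l2n])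
 ultimately show ?thesis unfolding gs n_def[symmetric] by(simp add: algebra_simps)
qed

lemma lap_real_compose:
 fixes f :: "complex => real"
 assumes S: "open S" "z : S" and f: "Ck_on 2 f S" and T: "!!x. x : S ==> f x : T"
  and h: "!!x. x : T ==> (h has_real_derivative h1 x) (at x)" "!!x. x : T ==> (h1 has_real_derivative h2 x) (at x)"
 shows "lap (%x. h (f x)) z = h1 (f z)*lap f z+h2 (f z)*((pd 1 f z)^2+(pd \<i> f z)^2)"
proof -
 note d = Ck2_dif[OF f]
 have p: "pd v (%x. k (f x)) x = k'*pd v f x" "(%x. k (f x)) differentiable (at x)"
  if "x : S" "(k has_real_derivative k') (at (f x))" for k k' v x proof -
  have "((%x. k (f x)) has_derivative (%v. k'*pd v f x)) (at x)" using deriv_comp[OF hd_pd[OF d(1)[OF that(1)]] that(2)[unfolded hfd_def]] .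
  thus "pd v (%x. k (f x)) x = k'*pd v f x" "(%x. k (f x)) differentiable (at x)" by(auto intro: pd_eq differentiableI)
 qed
 have "pd v (pd v (%x. h (f x))) z = h1 (f z)*pd v (pd v f) z+h2 (f z)*(pd v f z)^2" for v proof -
  have "pd v (pd v (%x. h (f x))) z = pd v (%x. h1 (f x)*pd v f x) z" by(rule pd_cong[OF S(1) p(1)[OF _ h(1)[OF T]] S(2)])
  also have "... = h1 (f z)*pd v (pd v f) z+pd v (%x. h1 (f x)) z*pd v f z" by(rule pd_bilinear[OF bounded_bilinear_mult p(2)[OF S(2) h(2)[OF T[OF S(2)]]] d(2)[OF S(2)]])
  also have "pd v (%x. h1 (f x)) z = h2 (f z)*pd v f z" by(rule p(1)[OF S(2) h(2)[OF T[OF S(2)]]])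
  finally show ?thesis by(simp add: sq_eq)
 qed
 thus ?thesis unfolding lap_def by(simp add: algebra_simps)
qed

text \<open>The sum of the squares of the partial derivatives is zero for holomorphic
  \<open>f\<close>; in general it measures the failure of the Cauchy-Riemann equation.\<close>

lemma lap_Re_poly_compose:
 fixes f :: "complex => complex" and q :: "complex poly"
 assumes S: "open S" "z : S" and f: "sm f S" shows "lap (%x. Re (poly q (f x))) z =
  Re (poly (pderiv (pderiv q)) (f z)*((pd 1 f z)^2+(pd \<i> f z)^2)+poly (pderiv q) (f z)*lap f z)"
proof -
 note d = sm_dif[OF f] sm_dif[OF sm_pd[OF f]]
 have dp: "poly q differentiable (at x)" for q :: "complex poly" and x by(rule sm_dif[OF sm_poly UNIV_I])
 have dc: "(%x. poly q (f x)) differentiable (at x)" if "x : S" for q :: "complex poly" and x by(rule dif_comp[OF dp d(1)[OF that]])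
 have p: "pd v (%x. poly q (f x)) x = poly (pderiv q) (f x)*pd v f x" if "x : S" for q :: "complex poly" and v x unfolding chain_pd[OF d(1)[OF that] dp] by(rule pd_poly)
 have e: "pd v (pd v (%x. Re (poly q (f x)))) z = Re (poly (pderiv (pderiv q)) (f z)*(pd v f z)^2+poly (pderiv q) (f z)*pd v (pd v f) z)" for v proof -
  have "pd v (pd v (%x. Re (poly q (f x)))) z = pd v (%x. Re (poly (pderiv q) (f x)*pd v f x)) z"
   by(rule pd_cong[OF S(1) _ S(2)]) (simp add: pd_lin[OF bounded_linear_Re dc] p)
  also have "... = Re (pd v (%x. poly (pderiv q) (f x)*pd v f x) z)" by(rule pd_lin[OF bounded_linear_Re differentiable_mult[OF dc[OF S(2)] d(2)[OF S(2)]]])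
  also have "pd v (%x. poly (pderiv q) (f x)*pd v f x) z =
    poly (pderiv q) (f z)*pd v (pd v f) z+pd v (%x. poly (pderiv q) (f x)) z*pd v f z" by(rule pd_bilinear[OF bounded_bilinear_mult dc[OF S(2)] d(2)[OF S(2)]])
  finally show ?thesis by(simp add: p[OF S(2)] sq_eq algebra_simps)
 qed
 show ?thesis unfolding lap_def e by(simp add: algebra_simps)
qed

lemma lap_dot:
 fixes f :: "complex => 'b::euclidean_space"
 assumes S: "open S" "z : S" and f: "sm f S" shows "lap (%x. f x.*f x) z = 2*(f z.*lap f z)+2*(pd 1 f z.*pd 1 f z)+2*(pd \<i> f z.*pd \<i> f z)"
  "pd v (%x. f x.*f x) z = 2*(f z.*pd v f z)"
proof -
 note d = sm_dif[OF f] sm_dif[OF sm_pd[OF f]]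
 have p: "pd v (%x. f x.*f x) x = 2*(f x.*pd v f x)" if "x : S" for v x by(simp add: pd_bilinear[OF bounded_bilinear_inner d(1)[OF that] d(1)[OF that]] inner_commute)
 thus "pd v (%x. f x.*f x) z = 2*(f z.*pd v f z)" using S(2) .
 have "pd v (pd v (%x. f x.*f x)) z = 2*(f z.*pd v (pd v f) z)+2*(pd v f z.*pd v f z)" for v proof -
  have di: "(%x. f x.*pd v f x) differentiable (at z)" by(rule differentiable_inner[OF d(1)[OF S(2)] d(2)[OF S(2)]])
  have "pd v (pd v (%x. f x.*f x)) z = pd v (%x. 2*.(f x.*pd v f x)) z" by(rule pd_cong[OF S(1) _ S(2)]) (simp add: p)
  also have "... = 2*.pd v (%x. f x.*pd v f x) z" by(rule pd_scaleR_c[OF di])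
  also have "pd v (%x. f x.*pd v f x) z = f z.*pd v (pd v f) z+pd v f z.*pd v f z" by(rule pd_bilinear[OF bounded_bilinear_inner d(1)[OF S(2)] d(2)[OF S(2)]])
  finally show ?thesis by simp
 qed
 thus "lap (%x. f x.*f x) z = 2*(f z.*lap f z)+2*(pd 1 f z.*pd 1 f z)+2*(pd \<i> f z.*pd \<i> f z)" unfolding lap_def by(simp add: inner_add_right)
qed

subsection \<open>The derivative estimate\<close>

text \<open>The real part of et w2^2 is pluriharmonic for the standard structure and pushes the
  function down where |Im w2| is large; the term with \<open>e\<close> makes it strictly
  plurisubharmonic.\<close>

definition Phi :: "complex poly => real => real => C2 => real" where "Phi p et e w = Re (poly p (fst w))+Re (poly [:0, 1, of_real et:] (snd w))+e*(w.*w)"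

lemma inner_zz: "z ~= 0 ==> lap (%z::complex. z.*z+a*ln (z.*z)) z = 4" "Ck_on 2 (%z::complex. z.*z+a*ln (z.*z)) (- {0})"
proof -
 have o: "open (- {0::complex})" by(simp add: open_Compl)
 have C: "Ck_on 2 (%z::complex. z.*z) S" for S by(rule Ck_normsq)
 have ln: "Ck_on 2 (ln :: real => real) {0<..}" by(rule Ck2_real[where ?h1.0 = inverse and ?h2.0 = "%x. - (inverse x^Suc (Suc 0))"])
    (use DERIV_ln DERIV_inverse[where 'a = real] in \<open>auto intro!: continuous_intros\<close>)
 have l: "Ck_on 2 (%z::complex. ln (z.*z)) (- {0})" by(rule Ck_compose[OF o _ ln C]) auto
 have al: "Ck_on 2 (%z::complex. a*ln (z.*z)) (- {0})" by(rule Ck_mult[OF o Ck_const l])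
 show "Ck_on 2 (%z::complex. z.*z+a*ln (z.*z)) (- {0})" by(rule Ck_add[OF o C al])
 assume z: "z ~= 0"
 hence zm: "z : - {0}" by simp
 have id: "sm (%z::complex. z) UNIV" by(rule sm_bl[OF bounded_linear_ident])
 have p: "pd v (%z::complex. z.*z) z = 2*(z.*v)" for v by(simp add: lap_dot(2)[OF open_UNIV UNIV_I id] pd_eq[OF has_derivative_ident])
 have "lap (%z::complex. ln (z.*z)) z = inverse (z.*z)*lap (%z. z.*z) z
   + - (inverse (z.*z)^Suc (Suc 0))*((pd 1 (%z. z.*z) z)^2+(pd \<i> (%z. z.*z) z)^2)"
  by(rule lap_real_compose[OF o zm C, where T = "{0<..}"]) (use z DERIV_ln DERIV_inverse[where 'a = real] in auto)
 also have "(pd 1 (%z. z.*z) z)^2+(pd \<i> (%z. z.*z) z)^2 = 4*(z.*z)" unfolding p by(simp add: inner_complex_def power_mult_distrib sq_eq)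
 finally have "lap (%z::complex. ln (z.*z)) z = 0" using z by(simp add: lap_normsq)
 thus "lap (%z::complex. z.*z+a*ln (z.*z)) z = 4" by(simp add: lap_add[OF o zm C al] lap_scale[OF o zm l] lap_normsq)
qed

text \<open>\<open>G\<close> is the rescaled disc on the part \<open>O1\<close> of the unit disc
  where it runs in the box \<open>E\<close>. On \<open>O1 \<inter> O2\<close> the function Phi is at
  most \<open>ap\<close>, so the maximum of Phi and \<open>ap\<close> continues to \<open>O2\<close>
  by the constant. The number \<open>ka\<close> bounds the distance from the standard structure and
  the first derivatives; 1/1152 = 1/(32 * 36) serves the logarithm, and the condition with 14 M + 8
  e R serves Phi.\<close>

locale sibony =
 fixes p :: "complex poly" and et e M R N ap si ka :: real and E :: "C2 set" and Jm :: "C2 => C2 => C2"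
  and w0 :: C2 and G :: "complex => C2" and O1 O2 :: "complex set"
 assumes const: "0 < e" "0 < ap" "0 < si" "si <= 1" "0 <= M" "0 <= R" "0 <= N" "0 <= ka" "ka <= 1/1152" "ka*(14*M+8*e*R) <= e"
  and E: "open E" "convex E" "!!w. w : E ==> norm w <= R" "!!w. w : E ==> Phi p et e w <= N" "ap <= N"
  and M: "!!w. w : E ==> norm (poly (pderiv p) (fst w)) <= M" "!!w. w : E ==> norm (poly (pderiv (pderiv p)) (fst w)) <= M"
   "!!w. w : E ==> norm (poly (pderiv [:0, 1, of_real et:]) (snd w)) <= M" "!!w. w : E ==> norm (poly (pderiv (pderiv [:0, 1, of_real et:])) (snd w)) <= M"
  and J: "!!v. sm (%w. Jm w v) E" "!!w. w : E ==> linear (Jm w)" "!!w v. w : E ==> Jm w (Jm w v) = - v" "!!w v. w : E ==> norm (Jm w v-J_st v) <= ka*norm v"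
   "!!w u v. w : E ==> norm (pd u (%w. Jm w v) w) <= ka*norm u*norm v" and w0: "w0 : E" "!!w. w : E ==> norm (w-w0) <= 2 * si ==> Phi p et e w > ap"
  and O: "open O1" "open O2" "O1 Un O2 = DD" "0 : O1" and G: "sm G O1" "!!z. z : O1 ==> G z : E" "!!z. z : O1 ==> pd \<i> G z = Jm (G z) (pd 1 G z)" "G 0 = w0"
   "!!z. z : O1 ==> z : O2 ==> Phi p et e (G z) <= ap"
begin

abbreviation "Fi == Phi p et e"
text \<open>Complex linear from the structure J (w0) to the standard one and close to the identity.
  After this normalisation the defect of \<open>g\<close> in the Cauchy-Riemann equation is O(|g|
  |g_x|), as the logarithm requires.\<close>

definition "AA v = (1/2)*.(v-cmul \<i> (Jm w0 v))"
definition "g z = (1/si)*.AA (G z-w0)"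

lemma linAA: "linear AA" using J(2)[OF w0(1)] by(intro linearI) (simp_all add: AA_def linear_add linear_scale cmul_add_right cmul_scaleR_right algebra_simps)

lemma blA: "bounded_linear (%v. (1/si)*.AA v)" using linear_compose_scale_right[OF linAA, of "1/si"] linear_conv_bounded_linear by blast

lemma A_bounds: "norm v <= 2*norm (AA v)" "norm (AA v) <= 2*norm v"
proof -
 have "cmul \<i> (Jm w0 v-J_st v) = cmul \<i> (Jm w0 v)+v" by(simp add: J_st_cmul cmul_diff_right cmul_minus1)
 hence "AA v-v = - (1/2)*.cmul \<i> (Jm w0 v-J_st v)" by(simp add: AA_def algebra_simps flip: scaleR_add_left)
 hence "norm (AA v-v) = norm (Jm w0 v-J_st v)/2" by(simp add: norm_cmul)
 also have "... <= norm v/2" using J(4)[OF w0(1), of v] const mono_r[of ka 1 "norm v"] by simp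
 finally have "norm (AA v-v) <= norm v/2" .
 thus "norm v <= 2*norm (AA v)" "norm (AA v) <= 2*norm v"
  using norm_triangle_ineq2[of v "AA v"] norm_triangle_ineq2[of "AA v" v] norm_minus_commute[of v "AA v"] by linarith+
qed

lemma A_rotate: "AA (Jm w0 v) = cmul \<i> (AA v)" using J(3)[OF w0(1), of v]
 by(simp add: AA_def cmul_scaleR_right cmul_diff_right cmul_minus1 cmul_minus_right algebra_simps)

lemma J_norm: "w : E ==> norm (Jm w v) <= 2*norm v" using J(4)[of w v] const norm_triangle_ineq2[of "Jm w v" "J_st v"] mono_r[of ka 1 "norm v"]
 by(simp add: J_st_cmul norm_cmul)

lemma J_lipschitz:
 assumes "w : E" shows "norm (Jm w v-Jm w0 v) <= ka*norm v * norm (w-w0)"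
proof(rule differentiable_bound[OF E(2)])
 fix x assume x: "x : E"
 show "((%w. Jm w v) has_derivative (%u. pd u (%w. Jm w v) x)) (at x within E)" by(rule has_derivative_at_withinI[OF hd_pd[OF sm_dif[OF J(1) x]]])
 show "onorm (%u. pd u (%w. Jm w v) x) <= ka*norm v" by(rule onorm_bound) (use J(5)[OF x] const in \<open>auto simp: mult_ac\<close>)
qed (use assms w0 in auto)

lemma G_laplacian: "z : O1 ==> norm (lap G z) <= 4*ka*(norm (pd 1 G z))^2"
proof -
 assume z: "z : O1"
 let ?a = "pd 1 G z" and ?b = "pd \<i> G z" and ?w = "G z"
 have b: "norm ?b <= 2*norm ?a" unfolding G(3)[OF z] by(rule J_norm[OF G(2)[OF z]])
 have "norm (pd ?b (%x. Jm x ?a) ?w) <= ka*norm ?b*norm ?a" by(rule J(5)[OF G(2)[OF z]])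
 also have "... <= ka*(2*norm ?a)*norm ?a" using b const by(intro mono_r mono_l) auto
 finally have 1: "norm (pd ?b (%x. Jm x ?a) ?w) <= 2*ka*(norm ?a)^2" by(simp add: sq_eq mult_ac)
 have 2: "norm (Jm ?w (pd ?a (%x. Jm x ?a) ?w)) <= 2*ka*(norm ?a)^2"
  using J_norm[OF G(2)[OF z], of "pd ?a (%x. Jm x ?a) ?w"] J(5)[OF G(2)[OF z], of ?a ?a] by(simp add: sq_eq mult_ac)
 have "lap G z = pd ?b (%x. Jm x ?a) ?w+Jm ?w (pd ?a (%x. Jm x ?a) ?w)" by(rule lap_disc[OF O(1) z E(1) J(1,2,3) G(1,2,3)])
 thus ?thesis using 1 2 tri_ineq[of "pd ?b (%x. Jm x ?a) ?w" "Jm ?w (pd ?a (%x. Jm x ?a) ?w)"] by simp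
qed

text \<open>The function would be harmonic for the standard structure. The failure of the
  Cauchy-Riemann equation costs 3 M ka, through the factorisation of x^2 + y^2 as (y - ix)(y + ix),
  and the Laplacian of \<open>G\<close> costs 4 M ka.\<close>

lemma lap_Re_part:
 assumes z: "z : O1" and L: "bounded_linear L" "!!v. norm (L v) <= norm v" "!!v. L (cmul \<i> v) = \<i>*L v"
  and q: "norm (poly (pderiv q) (L (G z))) <= M" "norm (poly (pderiv (pderiv q)) (L (G z))) <= M"
 shows "abs (lap (%z. Re (poly q (L (G z)))) z) <= 7*M*ka*(norm (pd 1 G z))^2"
proof -
 let ?n = "norm (pd 1 G z)"
 note dG = sm_dif[OF G(1) z] sm_dif[OF sm_pd[OF G(1)]]
 have s: "sm (%z. L (G z)) O1" by(rule sm_lin[OF L(1) O(1) G(1)])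
 have p1: "pd v (%z. L (G z)) x = L (pd v G x)" if "x : O1" for v x by(rule pd_lin[OF L(1) sm_dif[OF G(1) that]])
 have p2: "pd v (pd v (%z. L (G z))) z = L (pd v (pd v G) z)" for v using pd_cong[OF O(1) p1 z] pd_lin[OF L(1) dG(2)[OF z]] by simp
 have lL: "lap (%z. L (G z)) z = L (lap G z)" unfolding lap_def p2 by(simp add: linear_add[OF bounded_linear.linear[OF L(1)]])
 have "norm (L (lap G z)) <= 4*ka*?n^2" using L(2)[of "lap G z"] G_laplacian[OF z] by linarith
 hence 1: "norm (poly (pderiv q) (L (G z))*lap (%z. L (G z)) z) <= M*(4*ka*?n^2)" unfolding lL norm_mult using q(1) const by(intro mult_mono) auto
 let ?x = "L (pd 1 G z)" and ?y = "L (pd \<i> G z)"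
 have "norm (?y-\<i>*?x) <= norm (pd \<i> G z-J_st (pd 1 G z))"
  using L(2)[of "pd \<i> G z-J_st (pd 1 G z)"] by(simp add: J_st_cmul linear_diff[OF bounded_linear.linear[OF L(1)]] L(3))
 also have "... <= ka*?n" unfolding G(3)[OF z] by(rule J(4)[OF G(2)[OF z]])
 finally have a: "norm (?y-\<i>*?x) <= ka*?n" .
 have "norm ?x <= ?n" by(rule L(2))
 moreover have "norm ?y <= 2*?n" using L(2)[of "pd \<i> G z"] J_norm[OF G(2)[OF z], of "pd 1 G z"] G(3)[OF z] by simp
 ultimately have b: "norm (?y+\<i>*?x) <= 3*?n" using tri_ineq[of ?y "\<i>*?x"] by(simp add: norm_mult)
 have "?x^2+?y^2 = (?y-\<i>*?x)*(?y+\<i>*?x)" by(simp add: algebra_simps sq_eq)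
 hence "norm (?x^2+?y^2) = norm (?y-\<i>*?x)*norm (?y+\<i>*?x)" by(simp only: norm_mult)
 also have "... <= (ka*?n)*(3*?n)" by(rule mult_mono[OF a b]) (use const in auto)
 finally have "norm (?x^2+?y^2) <= (ka*?n)*(3*?n)" .
 hence 2: "norm (poly (pderiv (pderiv q)) (L (G z))*(?x^2+?y^2)) <= M*(3*ka*?n^2)" unfolding norm_mult using q(2) const by(intro mult_mono) (auto simp: sq_eq mult_ac)
 have "abs (lap (%z. Re (poly q (L (G z)))) z) <=
   norm (poly (pderiv (pderiv q)) (L (G z))*(?x^2+?y^2)+poly (pderiv q) (L (G z))*lap (%z. L (G z)) z)"
  unfolding lap_Re_poly_compose[OF O(1) z s] p1[OF z] by(rule abs_Re_le_cmod)
 also have "... <= M*(3*ka*?n^2)+M*(4*ka*?n^2)" by(rule order_trans[OF tri_ineq add_mono[OF 2 1]])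
 finally show ?thesis by(simp add: algebra_simps)
qed

lemma Phi_parts_smooth: "Ck_on 2 (%z. Re (poly p (fst (G z)))) O1" "Ck_on 2 (%z. Re (poly [:0, 1, of_real et:] (snd (G z)))) O1"
 "Ck_on 2 (%z. G z.*G z) O1" "Ck_on 2 (%z. e*(G z.*G z)) O1"
proof -
 have a: "sm (%z. Re (poly q (L (G z)))) O1" if "bounded_linear L" for q and L :: "C2 => complex" by(rule sm_lin[OF bounded_linear_Re O(1)
    sm_comp[OF O(1) open_UNIV sm_poly sm_lin[OF that O(1) G(1)] UNIV_I]])
 show "Ck_on 2 (%z. Re (poly p (fst (G z)))) O1" "Ck_on 2 (%z. Re (poly [:0, 1, of_real et:] (snd (G z)))) O1"
  by(rule sm_Ck[OF a[OF bl_fst]], rule sm_Ck[OF a[OF bl_snd]])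
 show c: "Ck_on 2 (%z. G z.*G z) O1" by(rule sm_Ck[OF sm_bilinear[OF bounded_bilinear_inner O(1) G(1) G(1)]])
 show "Ck_on 2 (%z. e*(G z.*G z)) O1" by(rule Ck_mult[OF O(1) Ck_const c])
qed

lemma Phi_smooth: "Ck_on 2 (%z. Fi (G z)) O1" unfolding Phi_def by(rule Ck_add[OF O(1) Ck_add[OF O(1) Phi_parts_smooth(1,2)] Phi_parts_smooth(4)])

text \<open>The term e |G|^2 contributes 2 e |G_x|^2, and by the smallness of \<open>ka\<close> the
  errors of all three terms together use up at most half of this.\<close>

lemma Phi_subharmonic: "z : O1 ==> e*(norm (pd 1 G z))^2 <= lap (%z. Fi (G z)) z"
proof -
 assume z: "z : O1"
 let ?n = "(norm (pd 1 G z))^2"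
 note P = Phi_parts_smooth
 have q: "lap (%z. Fi (G z)) z = lap (%z. Re (poly p (fst (G z)))) z+lap (%z. Re (poly [:0, 1, of_real et:] (snd (G z)))) z
   + e*lap (%z. G z.*G z) z" unfolding Phi_def by(simp only: lap_add[OF O(1) z Ck_add[OF O(1) P(1,2)] P(4)] lap_add[OF O(1) z P(1,2)] lap_scale[OF O(1) z P(3)])
 have 1: "abs (lap (%z. Re (poly p (fst (G z)))) z) <= 7*M*ka*?n"
  by(rule lap_Re_part[OF z bl_fst]) (use M G(2)[OF z] norm_fst_le in \<open>auto simp: cmul_def simp del: norm_Pair\<close>)
 have 2: "abs (lap (%z. Re (poly [:0, 1, of_real et:] (snd (G z)))) z) <= 7*M*ka*?n"
  by(rule lap_Re_part[OF z bl_snd]) (use M(3,4)[OF G(2)[OF z]] norm_snd_le in \<open>auto simp: cmul_def simp del: norm_Pair\<close>)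
 have "abs (G z.*lap G z) <= norm (G z)*norm (lap G z)" by(rule Cauchy_Schwarz_ineq2)
 also have "... <= R*(4*ka*?n)" using E(3)[OF G(2)[OF z]] G_laplacian[OF z] const by(intro mult_mono) auto
 finally have 3: "- (4*R*ka*?n) <= G z.*lap G z" by(simp add: abs_le_iff mult_ac)
 have 4: "2*?n-8*R*ka*?n <= lap (%z. G z.*G z) z" unfolding lap_dot(1)[OF O(1) z G(1)] dot_sq[of "pd 1 G z"] using 3 inner_ge_zero[of "pd \<i> G z"] by linarith
 hence "e*(2*?n-8*R*ka*?n) <= e*lap (%z. G z.*G z) z" using const by(intro mono_l) auto
 moreover have "ka*(14*M+8*e*R)*?n <= e*?n" using const(10) by(rule mono_r) simp
 ultimately show ?thesis unfolding q using 1 2 by(simp add: abs_le_iff algebra_simps)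
qed

lemma g_smooth: "sm g O1" unfolding g_def[abs_def] by(rule sm_lin[OF blA O(1) sm_diff[OF O(1) G(1) sm_const]])

lemma g_derivatives:
 assumes z: "z : O1" shows "pd v g z = (1/si)*.AA (pd v G z)" "lap g z = (1/si)*.AA (lap G z)"
proof -
 have d: "(%z. G z-w0) differentiable (at x)" if "x : O1" for x by(rule differentiable_diff[OF sm_dif[OF G(1) that] differentiable_const])
 have p: "pd v g x = (1/si)*.AA (pd v G x)" if "x : O1" for v x unfolding g_def[abs_def] pd_lin[OF blA d[OF that]]
  by(simp add: pd_diff[OF sm_dif[OF G(1) that] differentiable_const] pd_eq[OF has_derivative_const])
 thus "pd v g z = (1/si)*.AA (pd v G z)" using z .
 have "pd v (pd v g) z = (1/si)*.AA (pd v (pd v G) z)" for v using pd_cong[OF O(1) p z] pd_lin[OF blA sm_dif[OF sm_pd[OF G(1)] z]] by simp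
 thus "lap g z = (1/si)*.AA (lap G z)" unfolding lap_def by(simp add: linear_add[OF linAA] scaleR_add_right)
qed

lemma g_bounds: "norm (G z-w0) <= 2 * si*norm (g z)" "z : O1 ==> norm (pd 1 G z) <= 2 * si*norm (pd 1 g z)" "z : O1 ==> norm (pd 1 g z) <= 2/si*norm (pd 1 G z)"
proof -
 show "norm (G z-w0) <= 2 * si*norm (g z)" using A_bounds(1)[of "G z-w0"] const by(simp add: g_def)
 assume z: "z : O1"
 show "norm (pd 1 G z) <= 2 * si*norm (pd 1 g z)" using A_bounds(1)[of "pd 1 G z"] const by(simp add: g_derivatives[OF z])
 show "norm (pd 1 g z) <= 2/si*norm (pd 1 G z)" using A_bounds(2)[of "pd 1 G z"] const by(simp add: g_derivatives[OF z] divide_right_mono)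
qed

text \<open>The constant 56/si^2 is 14 (2/si)^2, because |g_x| is at most (2/si) |G_x|. The two
  defects of \<open>g\<close> are bounded with 8 ka si and 32 ka si, both at most 1/36.\<close>

lemma log_term:
 assumes z: "z : O1" and gz: "!!x. x : S ==> g x ~= 0" and S: "open S" "z : S" "S <= O1"
 shows "Ck_on 2 (%z. lsc (g z.*g z)) S" "- (56/si^2)*(norm (pd 1 G z))^2 <= lap (%z. lsc (g z.*g z)) z"
proof -
 let ?a = "norm (pd 1 G z)" and ?X = "pd 1 g z" and ?Y = "pd \<i> g z"
 note gS = sm_subset[OF g_smooth S(3)]
 have c: "Ck_on 2 (%z. g z.*g z) S" by(rule sm_Ck[OF sm_bilinear[OF bounded_bilinear_inner S(1) gS gS]])
 have pos: "g x.*g x : {0<..}" if "x : S" for x using gz[OF that] by simp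
 show "Ck_on 2 (%z. lsc (g z.*g z)) S" by(rule Ck_compose[OF S(1) open_greaterThan Ck2_lsc c pos])
 have Y: "norm (?Y-cmul \<i> ?X) <= 1/36*norm (g z)*norm ?X" proof -
  have "?Y-cmul \<i> ?X = (1/si)*.AA (Jm (G z) (pd 1 G z)-Jm w0 (pd 1 G z))"
   by(simp add: g_derivatives[OF z] G(3)[OF z] cmul_scaleR_right A_rotate[symmetric] linear_diff[OF linAA] scaleR_diff_right)
  hence "norm (?Y-cmul \<i> ?X) <= (1/si)*(2*norm (Jm (G z) (pd 1 G z)-Jm w0 (pd 1 G z)))" using A_bounds(2) const by(simp add: divide_right_mono)
  also have "... <= (1/si)*(2*(ka*?a*norm (G z-w0)))" using J_lipschitz[OF G(2)[OF z], of "pd 1 G z"] const by(intro mono_l) auto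
  also have "... <= (1/si)*(2*(ka*(2 * si*norm ?X)*(2 * si*norm (g z))))" using g_bounds(1)[of z] g_bounds(2)[OF z] const by(intro mono_l mult_mono) auto
  also have "... = (8*ka * si)*(norm (g z)*norm ?X)" using const by simp
  also have "... <= (1/36)*(norm (g z)*norm ?X)" using mult_mono[of ka "1/1152" si 1] const by(intro mono_r) auto
  finally show ?thesis by(simp add: mult.assoc)
 qed
 have Z: "norm (lap g z) <= 1/36*(norm ?X)^2" proof -
  have "norm (lap g z) <= (1/si)*(2*norm (lap G z))" using A_bounds(2) const by(simp add: g_derivatives[OF z] divide_right_mono)
  also have "... <= (1/si)*(2*(4*ka*(2 * si*norm ?X)^2))" proof(intro mono_l order_trans[OF G_laplacian[OF z]] power_mono)
  qed (use g_bounds(2)[OF z] const in auto)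
  also have "... = (32*ka * si)*(norm ?X)^2" using const by(simp add: sq_eq)
  also have "... <= (1/36)*(norm ?X)^2" using mult_mono[of ka "1/1152" si 1] const by(intro mono_r) auto
  finally show ?thesis .
 qed
 have "lap (%z. lsc (g z.*g z)) z = lsc1 (g z.*g z)*lap (%z. g z.*g z) z
   + lsc2 (g z.*g z)*((pd 1 (%z. g z.*g z) z)^2+(pd \<i> (%z. g z.*g z) z)^2)" by(rule lap_real_compose[OF S(1,2) c pos]) (auto intro: DERIV_lsc DERIV_lsc1)
 also have "... >=-14*(norm ?X)^2" unfolding lap_dot[OF S(1,2) gS] using lsc_subharmonic[OF gz[OF S(2)] _ _ Y Z] by simp
 finally have 1: "- 14*(norm ?X)^2 <= lap (%z. lsc (g z.*g z)) z" .
 have "(norm ?X)^2 <= (2/si*?a)^2" by(rule power_mono[OF g_bounds(3)[OF z]]) simp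
 hence "14*(norm ?X)^2 <= 56/si^2*?a^2" by(simp add: power_mult_distrib power_divide)
 thus "- (56/si^2)*?a^2 <= lap (%z. lsc (g z.*g z)) z" using 1 by linarith
qed

text \<open>Chosen so that \<open>La\<close> times the lower bound e |G_x|^2 for the Laplacian of
  Phi balances the loss of the logarithmic term.\<close>

definition "La = 56/(si^2*e)"
text \<open>Both \<open>tt\<close> and \<open>ph\<close> are continued from \<open>O1\<close> to the
  whole disc by the constants they take on the overlap with \<open>O2\<close>.\<close>

definition "tt z = (if z : O1 then tau (g z.*g z) else 1)"
definition "ph z = (if z : O1 then max (Fi (G z)) ap else ap)"
text \<open>The term |z|^2 makes the Laplacian strictly positive. A positive \<open>ep\<close> makes
  \<open>WW\<close> tend to 0 at the centre, where \<open>tt\<close> is O(|z|^2).\<close>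

definition "ll ep z = z.*z+(ep/2-1)*ln (z.*z)"
definition "WW ep z = tt z*exp (La*ph z+ll ep z)" for z :: complex

lemma Lam: "La > 0" "La*e = 56/si^2" using const by(simp_all add: La_def)

text \<open>Within distance 2 si of the centre \<open>w0\<close> Phi exceeds \<open>ap\<close>.
  Where it does not, the disc has left this ball, so \<open>tt\<close> is constant there and nothing
  is lost in the gluing.\<close>

lemma small_Phi: "z : O1 ==> Fi (G z) <= ap ==> norm (g z) > 1"
proof(rule ccontr)
 assume z: "z : O1" "Fi (G z) <= ap" and "~norm (g z) > 1"
 have "2 * si*norm (g z) <= 2 * si*1" by(rule mono_l) (use `~norm (g z) > 1` const in auto)
 hence "norm (G z-w0) <= 2 * si" using g_bounds(1)[of z] by simp
 thus False using w0(2)[OF G(2)[OF z(1)]] z by simp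
qed

lemma on_O2: "z : O2 ==> tt z = 1" "z : O2 ==> ph z = ap" using G(5) small_Phi by(auto simp: tt_def ph_def dot_sq intro!: tau_bounds(4) one_le_power less_imp_le)

lemma ph_bounds: "ap <= ph z" "ph z <= N" and tt_bounds: "0 <= tt z" "tt z <= 1" using E(4)[OF G(2)] E(5) tau_bounds(1,2) by(auto simp: ph_def tt_def)

lemma continuous_WW: "continuous_on (DD - {0}) (WW ep)"
proof -
 have g: "continuous_on O1 (%z. g z.*g z)" using sm_cont[OF g_smooth] by(intro continuous_intros)
 have "continuous_on O1 (%z. tau (g z.*g z))" by(rule cont_comp[OF continuous_tau g]) auto
 hence "continuous_on O1 tt" by(rule continuous_on_eq) (simp add: tt_def)
 moreover have "continuous_on O2 tt" by(rule continuous_on_eq[OF continuous_on_const]) (simp add: on_O2)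
 ultimately have tt: "continuous_on (DD) tt" unfolding O(3)[symmetric] by(rule continuous_on_open_Un[OF O(1,2)])
 have "continuous_on O1 (%z. max (Fi (G z)) ap)" using Ck_cont[OF Phi_smooth] by(intro continuous_intros)
 hence "continuous_on O1 ph" by(rule continuous_on_eq) (simp add: ph_def)
 moreover have "continuous_on O2 ph" by(rule continuous_on_eq[OF continuous_on_const]) (simp add: on_O2)
 ultimately have ph: "continuous_on (DD) ph" unfolding O(3)[symmetric] by(rule continuous_on_open_Un[OF O(1,2)])
 show ?thesis unfolding WW_def[abs_def] ll_def by(intro continuous_intros cont_sub[OF tt] cont_sub[OF ph]) auto
qed

text \<open>Where \<open>ph\<close> equals \<open>ap\<close>, the function \<open>ll\<close> touches \<open>ln WW\<close> from below up to a constant.\<close>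

lemma WW_no_max:
 assumes z: "z : DD" "z ~= 0" and S: "open S" "z : S" and max: "!!x. x : S ==> WW ep x <= WW ep z" and pos: "WW ep z > 0" shows False
proof(cases "z : O1 & Fi (G z) > ap")
 case True
 hence z1: "z : O1" "Fi (G z) > ap" by auto
 have oP: "open ((%z. Fi (G z)) -` {ap<..} Int O1)" using continuous_on_open_vimage[OF O(1), of "%z. Fi (G z)"] Ck_cont[OF Phi_smooth] open_greaterThan by blast
 have og: "open (g -` (- {0}) Int O1)" using continuous_on_open_vimage[OF O(1), of g] sm_cont[OF g_smooth] open_Compl[OF closed_singleton] by blast
 define T where "T = S Int ((%z. Fi (G z)) -` {ap<..} Int O1) Int (g -` (- {0}) Int O1) Int - {0}"
 have "g z ~= 0" using pos z1 by(auto simp: WW_def tt_def tau_def)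
 have T: "open T" "z : T" "T <= O1" "T <= - {0}" using S oP og z z1 `g z ~= 0` by(auto simp: T_def intro!: open_Int)
 have gT: "g x ~= 0" if "x : T" for x using that by(auto simp: T_def)
 note l = log_term[OF z1(1) gT T(1,2,3)]
 have P: "Ck_on 2 (%z. Fi (G z)) T" by(rule Ck_subset[OF Phi_smooth T(3)])
 have LP: "Ck_on 2 (%z. La*Fi (G z)) T" by(rule Ck_mult[OF T(1) Ck_const P])
 have ll: "Ck_on 2 (ll ep) T" unfolding ll_def[abs_def] by(rule Ck_subset[OF inner_zz(2) T(4)])
 let ?f = "%z. lsc (g z.*g z)+La*Fi (G z)+ll ep z"
 have f: "Ck_on 2 ?f T" by(rule Ck_add[OF T(1) Ck_add[OF T(1) l(1) LP] ll])
 have W: "WW ep x = exp (?f x)" if "x : T" for x proof -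
  have "x : O1" "Fi (G x) > ap" "g x ~= 0" using that by(auto simp: T_def)
  moreover hence "~g x.*g x <= 0" by(simp add: not_le)
  ultimately show ?thesis by(simp add: WW_def tt_def ph_def tau_def exp_add[symmetric] algebra_simps)
 qed
 have "lap ?f z <= 0" proof(rule lap_at_max[OF T(1,2) f])
  fix x assume "x : T"
  moreover hence "x : S" by(simp add: T_def)
  ultimately show "?f x <= ?f z" using max[of x] W T(2) by simp
 qed
 moreover have "lap ?f z = lap (%z. lsc (g z.*g z)) z+La*lap (%z. Fi (G z)) z+4" proof -
  have "lap ?f z = lap (%z. lsc (g z.*g z)+La*Fi (G z)) z+lap (ll ep) z" by(rule lap_add[OF T(1,2) Ck_add[OF T(1) l(1) LP] ll])
  moreover have "lap (%z. lsc (g z.*g z)+La*Fi (G z)) z = lap (%z. lsc (g z.*g z)) z+lap (%z. La*Fi (G z)) z" by(rule lap_add[OF T(1,2) l(1) LP])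
  moreover have "lap (%z. La*Fi (G z)) z = La*lap (%z. Fi (G z)) z" by(rule lap_scale[OF T(1,2) P])
  moreover have "lap (ll ep) z = 4" unfolding ll_def[abs_def] by(rule inner_zz(1)[OF z(2)])
  ultimately show ?thesis by linarith
 qed
 moreover have "La*(e*(norm (pd 1 G z))^2) <= La*lap (%z. Fi (G z)) z" using Phi_subharmonic[OF z1(1)] Lam by(intro mono_l) auto
 moreover have "La*(e*(norm (pd 1 G z))^2) = 56/si^2*(norm (pd 1 G z))^2" using Lam(2) by(simp add: mult.assoc[symmetric])
 ultimately show False using l(2) by linarith
next
 case False
 have "? T. open T & z : T & (! x:T. tt x = 1)" proof(cases "z : O2")
  case True thus ?thesis using O(2) on_O2 by blast
 next
  case F: False
  have "z : O1" using z(1) F unfolding O(3)[symmetric] by blast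
  moreover hence "Fi (G z) <= ap" using False by(simp add: not_less)
  ultimately have z1: "z : O1" "Fi (G z) <= ap" .
  have "open (g -` (- cball 0 1) Int O1)" using continuous_on_open_vimage[OF O(1), of g] sm_cont[OF g_smooth] open_Compl[OF closed_cball] by blast
  moreover have "z : g -` (- cball 0 1) Int O1" using small_Phi[OF z1] z1(1) by(simp add: not_le)
  moreover have "tt x = 1" if "x : g -` (- cball 0 1) Int O1" for x using that by(auto simp: tt_def dot_sq intro!: tau_bounds(4) one_le_power)
  ultimately show ?thesis by blast
 qed
 then obtain T where T: "open T" "z : T" "!!x. x : T ==> tt x = 1" by blast
 have phz: "ph z = ap" using False by(auto simp: ph_def)
 let ?T = "T Int S Int - {0}"
 have oT: "open ?T" "z : ?T" using T S z by(auto intro!: open_Int)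
 have "lap (ll ep) z <= 0" proof(rule lap_at_max[OF oT])
  show "Ck_on 2 (ll ep) ?T" unfolding ll_def[abs_def] by(rule Ck_subset[OF inner_zz(2)]) auto
  fix x assume x: "x : ?T"
  hence "exp (La*ph x+ll ep x) <= exp (La*ph z+ll ep z)" using max[of x] T(3)[of x] T(3)[OF T(2)] by(simp add: WW_def)
  moreover have "La*ap <= La*ph x" using ph_bounds(1)[of x] Lam by(intro mono_l) auto
  ultimately show "ll ep x <= ll ep z" by(simp add: phz)
 qed
 thus False using inner_zz(1)[OF z(2), of "ep/2-1"] by(simp add: ll_def[abs_def])
qed

text \<open>The maximum over an annulus x <= |z| <= 1/2 is not attained inside. On a small inner
  circle \<open>WW\<close> is at most a multiple of |z|^ep and tends to 0. On the outer circle the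
  logarithm is at least -2, so that \<open>ll\<close> is at most 1/4 + 2, which is covered by the
  summand 3.\<close>

lemma WW_bound:
 assumes ep: "0 < ep" "ep < 1" and z0: "z0 ~= 0" "norm z0 <= 1/2" shows "WW ep z0 <= exp (La*N+3)"
proof(rule ccontr)
 let ?K = "exp (La*N+3)"
 assume big: "~WW ep z0 <= ?K"
 have "(%z. G z-w0) differentiable (at 0)" by(rule differentiable_diff[OF sm_dif[OF G(1) O(4)] differentiable_const])
 moreover have "G 0-w0 = 0" by(simp add: G(4))
 ultimately obtain C d where C: "C > 0" "d > 0" "!!z. norm z < d ==> norm (G z-w0) <= C*norm z" using dif_bound_at_0[of "%z. G z-w0"] by blast
 obtain d' where d': "d' > 0" "ball 0 d' <= O1" using O(1,4) open_contains_ball by blast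
 define B where "B = exp 3*(2*C/si)^2*exp (La*N+1)"
 have B: "B > 0" using C const by(simp add: B_def)
 have Wle: "WW ep z <= B*exp (ep/2*ln (z.*z))" if z: "z ~= 0" "norm z < d" "norm z < d'" "norm z <= 1" for z proof -
  have z1: "z : O1" using z d' by auto
  have zz: "z.*z > 0" using z by simp
  have "norm (g z) <= 1/si*(2*(C*norm z))" using order_trans[OF A_bounds(2)[of "G z-w0"], of "2*(C*norm z)"] C(3)[OF z(2)] const by(simp add: g_def divide_right_mono)
  hence "(norm (g z))^2 <= (1/si*(2*(C*norm z)))^2" by(intro power_mono) auto
  hence gg: "g z.*g z <= (2*C/si)^2*(z.*z)" by(simp add: dot_sq power_mult_distrib power_divide)
  have "tt z <= exp 3*(g z.*g z)" using tau_bounds(3)[of "g z.*g z"] z1 by(simp add: tt_def)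
  also have "... <= exp 3*((2*C/si)^2*(z.*z))" using gg by simp
  finally have t: "tt z <= exp 3*(2*C/si)^2*exp (ln (z.*z))" using zz by(simp add: mult.assoc)
  have "z.*z <= 1" using z(4) by(simp add: dot_sq power_le_one)
  moreover have "La*ph z <= La*N" using ph_bounds(2) Lam by(intro mono_l) auto
  ultimately have "exp (La*ph z+ll ep z) <= exp (La*N+1+(ep/2-1)*ln (z.*z))" by(simp add: ll_def)
  hence "WW ep z <= (exp 3*(2*C/si)^2*exp (ln (z.*z)))*exp (La*N+1+(ep/2-1)*ln (z.*z))" unfolding WW_def using t tt_bounds(1) by(intro mult_mono) auto
  also have "... = B*exp (ep/2*ln (z.*z))" unfolding B_def by(simp add: exp_add[symmetric] algebra_simps)
  finally show ?thesis .
 qed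
 have "((%x::real. B*exp (ep*ln x)) ---> B*0) (at_right 0)" proof(intro tendsto_mult tendsto_const filterlim_compose[OF exp_at_bot])
  show "filterlim (%x. ep*ln x) at_bot (at_right (0::real))" by(rule filterlim_tendsto_pos_mult_at_bot[OF tendsto_const ep(1) ln_at_0])
 qed
 hence "\<forall>\<^sub>F x in at_right 0. B*exp (ep*ln x) < ?K" by(intro order_tendstoD(2)[where a = ?K]) auto
 moreover have "\<forall>\<^sub>F x in at_right 0. x : {0<..<Min {d, d', 1/2, norm z0}}" using C d' z0 by(intro eventually_at_right_real) auto
 ultimately have "\<forall>\<^sub>F x in at_right 0. B*exp (ep*ln x) < ?K & x : {0<..<Min {d, d', 1/2, norm z0}}" by(rule eventually_conj)
 from eventually_happens[OF this] obtain x where "B*exp (ep*ln x) < ?K" "x : {0<..<Min {d, d', 1/2, norm z0}}" using trivial_limit_at_right_real[of "0::real"] by blast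
 hence x: "x > 0" "x < d" "x < d'" "x < 1/2" "x < norm z0" "B*exp (ep*ln x) < ?K" by simp_all
 define A where "A = (cball 0 (1/2)-ball 0 x :: complex set)"
 have cA: "compact A" unfolding A_def by(rule compact_diff[OF compact_cball open_ball])
 have AB: "A <= DD - {0}" using x by(auto simp: A_def)
 have z0A: "z0 : A" using x z0 by(simp add: A_def)
 obtain z where z: "z : A" "!!y. y : A ==> WW ep y <= WW ep z" using continuous_attains_sup[OF cA _ cont_sub[OF continuous_WW AB]] z0A by blast
 have Wz: "WW ep z > ?K" using big z(2)[OF z0A] by linarith
 consider "norm z = x" | "norm z = 1/2" | "x < norm z" "norm z < 1/2" using z(1) unfolding A_def by fastforce
 thus False proof cases
  case 1
  have "ln (z.*z) = 2*ln x" using x 1 by(simp add: dot_sq ln_realpow)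
  moreover have "z ~= 0" using 1 x by auto
  ultimately show False using Wle[of z] x 1 Wz by simp
 next
  case 2
  have zz: "z.*z = 1/4" unfolding dot_sq 2 by(simp add: sq_eq)
  have l4: "0 <= ln (4 :: real)" "ln (4 :: real) <= 2" "ln (1/4 :: real) = - ln 4" using ln_2_less_1 ln_realpow[of 2 2] by(simp_all add: ln_div)
  have "(1-ep/2)*ln (4 :: real) <= 1*2" by(rule mult_mono) (use l4 ep in auto)
  hence "(ep/2-1)*ln (1/4) <= 2" unfolding l4(3) by(simp add: algebra_simps)
  moreover have "La*ph z <= La*N" using ph_bounds(2) Lam by(intro mono_l) auto
  ultimately have "exp (La*ph z+ll ep z) <= ?K" unfolding ll_def zz exp_le_cancel_iff by linarith
  hence "WW ep z <= 1*?K" unfolding WW_def using tt_bounds by(intro mult_mono) auto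
  thus False using Wz by simp
 next
  case 3
  let ?S = "ball 0 (1/2)-cball 0 x :: complex set"
  show False proof(rule WW_no_max[of z ?S])
   show "open ?S" by(rule open_Diff[OF open_ball closed_cball])
   show "z : DD" "z ~= 0" "z : ?S" using 3 x by auto
   show "WW ep y <= WW ep z" if "y : ?S" for y using that by(intro z(2)) (auto simp: A_def)
   show "WW ep z > 0" using Wz exp_gt_zero[of "La*N+3"] by linarith
  qed
 qed
qed

text \<open>As \<open>ep\<close> tends to 0, tt (z) is at most exp (La N + 3) |z|^2. Since s <= exp
  2 tau (s) for s < 1, this bounds |g| near 0 by exp ((La N + 5)/2) |z|, hence also g_x at 0. The
  factor 2 undoes \<open>AA\<close>.\<close>

theorem derivative_bound: "norm (pd 1 G 0) <= 2*exp ((La*N+5)/2)"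
proof -
 let ?K = "exp (La*N+3)"
 have tb: "tt z <= ?K*(z.*z)" if z: "z ~= 0" "norm z <= 1/2" for z proof -
  have zz: "z.*z > 0" using z by simp
  have "((%ep. tt z*exp ((ep/2-1)*ln (z.*z))) ---> tt z*exp ((0/2-1)*ln (z.*z))) (at_right 0)" by(intro tendsto_intros) simp
  moreover have "\<forall>\<^sub>F ep in at_right 0. tt z*exp ((ep/2-1)*ln (z.*z)) <= ?K" unfolding eventually_at_right_field
  proof(rule exI[of _ 1], intro conjI allI impI)
   fix ep :: real assume e: "0 < ep" "ep < 1"
   have "0 <= La*ph z" using ph_bounds(1)[of z] Lam const by(intro mult_nonneg_nonneg) auto
   hence "(ep/2-1)*ln (z.*z) <= La*ph z+ll ep z" using zz by(simp add: ll_def)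
   hence "tt z*exp ((ep/2-1)*ln (z.*z)) <= WW ep z" unfolding WW_def using tt_bounds(1) by(intro mono_l) auto
   thus "tt z*exp ((ep/2-1)*ln (z.*z)) <= ?K" using WW_bound[OF e z] by linarith
  qed simp
  ultimately have "tt z*exp ((0/2-1)*ln (z.*z)) <= ?K" by(intro tendsto_upperbound[where F = "at_right 0"]) auto
  thus ?thesis using zz by(simp add: exp_minus field_simps)
 qed
 have g0: "g 0 = 0" by(simp add: g_def G(4) linear_0[OF linAA])
 have dg: "g differentiable (at 0)" by(rule sm_dif[OF g_smooth O(4)])
 have "open (g -` ball 0 1 Int O1)" using continuous_on_open_vimage[OF O(1), of g] sm_cont[OF g_smooth] open_ball by blast
 moreover have "0 : g -` ball 0 1 Int O1" using O(4) g0 by simp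
 ultimately obtain d where d: "d > 0" "ball 0 d <= g -` ball 0 1 Int O1" by(rule openE)
 have est: "norm (g z) <= exp ((La*N+5)/2)*norm z" if z: "z ~= 0" "norm z < d" "norm z <= 1/2" for z proof -
  have "z : ball 0 d" using z by simp
  hence z1: "z : O1" "norm (g z) < 1" using d(2) by auto
  hence "g z.*g z <= exp 2*tt z" using tau_bounds(5)[of "g z.*g z"] by(simp add: tt_def dot_sq power_less_one_iff)
  also have "... <= exp 2*(?K*(z.*z))" using tb[OF z(1,3)] by simp
  also have "... = (exp ((La*N+5)/2)*norm z)^2" by(simp add: power_mult_distrib dot_sq exp_double[symmetric] mult.assoc[symmetric] exp_add[symmetric])
  finally have "(norm (g z))^2 <= (exp ((La*N+5)/2)*norm z)^2" by(simp only: dot_sq)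
  thus ?thesis by(rule power2_le_imp_le) simp
 qed
 have "norm (pd 1 g 0) <= exp ((La*N+5)/2)" proof(rule field_le_epsilon)
  fix t :: real assume t: "t > 0"
  from hd_pd[OF dg] obtain d2 where d2: "d2 > 0" "!!y. norm y < d2 ==> norm (g y-pd y g 0) <= t*norm y" unfolding has_derivative_at_alt using t g0 by auto
  define x where "x = min (min d d2) (1/2)/2"
  have x: "0 < x" "x < d" "x < d2" "x <= 1/2" using d d2 by(auto simp: x_def)
  have "pd (of_real x) g 0 = x*.pd 1 g 0" by(simp add: pd_complex[OF dg, of "of_real x"])
  hence "x*norm (pd 1 g 0) = norm (pd (of_real x) g 0)" using x by simp
  also have "... <= norm (g (of_real x))+norm (g (of_real x)-pd (of_real x) g 0)" using norm_triangle_ineq4[of "g (of_real x)" "g (of_real x)-pd (of_real x) g 0"] by simp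
  also have "... <= exp ((La*N+5)/2)*x+t*x" using est[of "of_real x"] d2(2)[of "of_real x"] x by(intro add_mono) auto
  finally have "x*norm (pd 1 g 0) <= x*(exp ((La*N+5)/2)+t)" by(simp add: algebra_simps)
  thus "norm (pd 1 g 0) <= exp ((La*N+5)/2)+t" using x by simp
 qed
 moreover have "norm (pd 1 G 0) <= 2*norm (pd 1 g 0)" using g_bounds(2)[OF O(4)] const mono_r[of si 1 "norm (pd 1 g 0)"] by simp
 ultimately show ?thesis by simp
qed

end

subsection \<open>Anisotropic scaling\<close>

text \<open>The weights 1 and \<open>k\<close> are those for which Re w2 and a form of degree
  \<open>k\<close> in w1 are both multiplied by t^k.\<close>

definition tm :: "real => nat => C2 => C2" where "tm t k w = (t*.fst w, t^k*.snd w)"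
definition tmi :: "real => nat => C2 => C2" where "tmi t k w = ((1/t)*.fst w, (1/t^k)*.snd w)"

lemma bl_tm: "bounded_linear (tm t k)" "bounded_linear (tmi t k)" unfolding tm_def[abs_def] tmi_def[abs_def]
 by(intro bounded_linear_Pair bounded_linear_scaleR_right[THEN bounded_linear_compose] bl_fst bl_snd)+

lemmas lin_tm = bl_tm[THEN bounded_linear.linear]

lemma tm_inverse: "t > 0 ==> tmi t k (tm t k w) = w" "t > 0 ==> tm t k (tmi t k w) = w" by(simp_all add: tm_def tmi_def)

lemma norm_le_sum: "norm (w :: C2) <= norm (fst w)+norm (snd w)" using norm_Pair_le[of "fst w" "snd w"] by(simp del: norm_Pair)

lemma norm_tm:
 assumes "0 < t" "t <= 1" "k >= 1" shows "norm (tm t k w) <= 2*t*norm w" "norm (tmi t k w) <= norm (fst w)/t+norm (snd w)/t^k"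
proof -
 have "t^k <= t^1" by(rule power_decreasing) (use assms in auto)
 hence "t^k*norm (snd w) <= t*norm w" using assms norm_snd_le[of "snd w" "fst w"] by(intro mult_mono) (auto simp del: norm_Pair)
 moreover have "t*norm (fst w) <= t*norm w" using assms norm_fst_le[of "fst w" "snd w"] by(intro mono_l) (auto simp del: norm_Pair)
 moreover have "norm (tm t k w) <= t*norm (fst w)+t^k*norm (snd w)" using norm_le_sum[of "tm t k w"] assms by(simp add: tm_def del: norm_Pair)
 ultimately show "norm (tm t k w) <= 2*t*norm w" by linarith
 show "norm (tmi t k w) <= norm (fst w)/t+norm (snd w)/t^k" using norm_le_sum[of "tmi t k w"] assms by(simp add: tmi_def del: norm_Pair)
qed

lemma Basis_C2: "i : (Basis :: C2 set) ==> snd i = 0 | fst i = 0" by(auto simp: Basis_prod_def)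

lemma smooth_bounded_on_compact:
 fixes f :: "'a::euclidean_space => 'b::real_normed_vector"
 assumes "sm f W" "compact K" "K <= W" shows "? M. ! x:K. norm (f x) <= M"
proof -
 have "compact (f ` K)" by(rule compact_continuous_image[OF cont_sub[OF sm_cont[OF assms(1)] assms(3)] assms(2)])
 thus ?thesis using compact_imp_bounded[of "f ` K"] by(auto simp: bounded_iff)
qed

locale straight_structure =
 fixes Jm :: "C2 => C2 => C2" and W :: "C2 set" and R Rad :: real and k :: nat
 assumes W: "open W" "ball 0 R <= W" "R > 0" and Rad: "Rad > 0" and k: "k >= 1" and smJ: "!!v. sm (%x. Jm x v) W" and lin: "!!x. x : W ==> linear (Jm x)"
  and J2: "!!x v. x : W ==> Jm x (Jm x v) = - v" and J0: "Jm 0 = J_st" and axis: "!!ze h. (ze, 0) : W ==> Jm (ze, 0) (h, 0) = (\<i>*h, 0)"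
begin

definition "Js t w v = tmi t k (Jm (tm t k w) (tm t k v))"

text \<open>The columns of J in tangential directions are constant along the axis. Hence their
  tangential derivatives vanish at w2 = 0 and are O(|w2|) elsewhere.\<close>

lemma derivative_bounds: "EX M>0. ! i:Basis. ! j:Basis. ! x. norm x <= R/2 --> norm (pd i (%x. Jm x j) x) <= M &
   (snd i = 0 --> snd j = 0 --> norm (pd i (%x. Jm x j) x) <= M*norm (snd x))"
proof -
 let ?K = "cball 0 (R/2) :: C2 set" and ?B = "Basis :: C2 set"
 have KW: "?K <= W" using W by auto
 define D where "D = (%i j. pd i (%x. Jm x j))"
 have sD: "sm (D i j) W" for i j unfolding D_def by(rule sm_pd[OF smJ])
 define M1 where "M1 = (%i j. SOME M. ! x:?K. norm (D i j x) <= M)"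
 define M2 where "M2 = (%i j l. SOME M. ! x:?K. norm (pd l (D i j) x) <= M)"
 have M1: "norm (D i j x) <= M1 i j" if "x : ?K" for i j x using someI_ex[OF smooth_bounded_on_compact[OF sD compact_cball KW]] that unfolding M1_def by blast
 have M2: "norm (pd l (D i j) x) <= M2 i j l" if "x : ?K" for i j l x
  using someI_ex[OF smooth_bounded_on_compact[OF sm_pd[OF sD] compact_cball KW]] that unfolding M2_def by blast
 define M where "M = 1+(SUM i:?B. SUM j:?B. abs (M1 i j)+(SUM l:?B. abs (M2 i j l)))"
 have S0: "0 <= (SUM l:?B. abs (M2 i j l))" for i j by(rule sum_nonneg) simp
 have le: "abs (M1 i j)+(SUM l:?B. abs (M2 i j l)) <= M" if "i : ?B" "j : ?B" for i j proof -
  have "abs (M1 i j)+(SUM l:?B. abs (M2 i j l)) <= (SUM j:?B. abs (M1 i j)+(SUM l:?B. abs (M2 i j l)))"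
   by(rule member_le_sum[OF that(2)]) (use S0 in \<open>auto intro: add_nonneg_nonneg\<close>)
  also have "... <= (SUM i:?B. SUM j:?B. abs (M1 i j)+(SUM l:?B. abs (M2 i j l)))"
   by(rule member_le_sum[OF that(1)]) (use S0 in \<open>auto intro!: sum_nonneg add_nonneg_nonneg\<close>)
  finally show ?thesis by(simp add: M_def)
 qed
 have M: "M > 0" unfolding M_def using S0 by(intro add_pos_nonneg sum_nonneg add_nonneg_nonneg) auto
 have z: "D i j (ze, 0) = 0" if "snd i = 0" "snd j = 0" "(ze, 0) : W" for i j ze proof -
  let ?L = "%ze::complex. (ze, 0 :: complex)"
  have bl: "bounded_linear ?L" by(intro bounded_linear_Pair bounded_linear_ident bounded_linear_zero)
  have o: "open (?L -` W)" using continuous_open_vimage[OF W(1), of ?L] linear_continuous_at[OF bl] by blast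
  have "pd (fst i) (%ze. Jm (?L ze) j) ze = pd (pd (fst i) ?L ze) (%x. Jm x j) (?L ze)"
   by(rule chain_pd[OF bounded_linear_imp_differentiable[OF bl] sm_dif[OF smJ that(3)]])
  moreover have "pd (fst i) ?L ze = i" using that(1) by(simp add: pd_eq[OF bounded_linear_imp_has_derivative[OF bl]] prod_eq_iff)
  moreover have "(fst j, 0) = j" using that(2) by(simp add: prod_eq_iff)
  hence "Jm (?L ze) j = (\<i>*fst j, 0)" if "?L ze : W" for ze using axis[OF that, of "fst j"] by simp
  hence "pd (fst i) (%ze. Jm (?L ze) j) ze = pd (fst i) (%ze. (\<i>*fst j, 0)) ze" by(intro pd_cong[OF o]) (use that in auto)
  ultimately show ?thesis by(simp add: D_def pd_eq[OF has_derivative_const])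
 qed
 have lip: "norm (D i j x) <= M*norm (snd x)" if ij: "i : ?B" "j : ?B" "snd i = 0" "snd j = 0" and x: "x : ?K" for i j x proof -
  have y: "(fst x, 0) : ?K" using x norm_fst_le[of "fst x" "snd x"] by(auto simp: norm_Pair simp del: norm_Pair)
  have d: "norm (D i j x-D i j (fst x, 0)) <= M*norm (x-(fst x, 0))" proof(rule differentiable_bound[OF convex_cball _ _ x y])
   fix w assume w: "w : ?K"
   have dw: "D i j differentiable (at w)" using sm_dif[OF sD] KW w by blast
   show "(D i j has_derivative (%v. pd v (D i j) w)) (at w within ?K)" by(rule has_derivative_at_withinI[OF hd_pd[OF dw]])
   show "onorm (%v. pd v (D i j) w) <= M" proof(rule onorm_bound)
    fix v
    have "norm (pd v (D i j) w) <= (SUM l:?B. norm ((v.*l)*.pd l (D i j) w))" unfolding pd_Basis[OF dw, of v] by(rule norm_sum)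
    also have "... <= (SUM l:?B. norm v * abs (M2 i j l))" proof(rule sum_mono)
    fix l assume "l : ?B"
    hence "abs (v.*l) <= norm v" by(rule Basis_le_norm)
    thus "norm ((v.*l)*.pd l (D i j) w) <= norm v * abs (M2 i j l)" unfolding norm_scaleR using M2[OF w, of l i j] by(intro mult_mono) auto
    qed
    also have "... = norm v * (SUM l:?B. abs (M2 i j l))" by(simp add: sum_distrib_left)
    also have "... <= norm v * M" using le[OF ij(1,2)] by(intro mono_l) auto
    finally show "norm (pd v (D i j) w) <= M*norm v" by(simp add: mult.commute)
   qed (use M in simp)
  qed
  have "x-(fst x, 0) = (0, snd x)" by(simp add: prod_eq_iff)
  thus ?thesis using d z[OF ij(3,4) subsetD[OF KW y]] by simp
 qed
 have "norm (D i j x) <= M" if "i : ?B" "j : ?B" "x : ?K" for i j x using M1[OF that(3), of i j] le[OF that(1,2)] S0[of i j] by linarith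
 thus ?thesis using M lip unfolding D_def by(intro exI[of _ M]) auto
qed

text \<open>Dilation multiplies a derivative by the weights of its two directions and divides its
  second component by t^k. If one direction is normal, its weight t^k compensates. If both are
  tangential, the derivative is O(|w2|), which is O(t^k) at the dilated point. So the first
  derivatives of the rescaled structure are O(t), and so is its distance from the standard
  one.\<close>

theorem scaled_structure: "EX C>0. EX t0>0. t0 <= 1 & (! t. 0 < t & t <= t0 --> (! w:ball 0 Rad. norm (tm t k w) < R) & (! v. sm (%w. Js t w v) (ball 0 Rad)) &
   (! w:ball 0 Rad. linear (Js t w) & (! v. Js t w (Js t w v) = - v & norm (Js t w v-J_st v) <= C*t*norm v & (! u. norm (pd u (%w. Js t w v) w) <= C*t*norm u*norm v))))"
proof -
 let ?B = "Basis :: C2 set"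
 obtain M where M: "M > 0" "!!i j x. i : ?B ==> j : ?B ==> norm x <= R/2 ==> norm (pd i (%x. Jm x j) x) <= M"
  "!!i j x. i : ?B ==> j : ?B ==> norm x <= R/2 ==> snd i = 0 ==> snd j = 0 ==> norm (pd i (%x. Jm x j) x) <= M*norm (snd x)" using derivative_bounds by blast
 define C1 where "C1 = M*(2+Rad)"
 define C where "C = 16*C1*(1+Rad)"
 define t0 where "t0 = min 1 (R/(4*Rad))"
 have C1: "C1 > 0" using M Rad by(simp add: C1_def)
 have C: "C > 0" "16*C1 <= C" "16*C1*Rad <= C" using C1 Rad by(simp_all add: C_def)
 have t0: "t0 > 0" "t0 <= 1" using W Rad by(simp_all add: t0_def)
 show ?thesis proof(rule exI[of _ C], rule conjI[OF C(1)], rule exI[of _ t0], intro conjI t0 allI impI)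
  fix t assume "0 < t & t <= t0"
  hence t: "0 < t" "t <= 1" "t*Rad <= R/4" using t0 Rad by(auto simp: t0_def field_simps)
  let ?T = "tm t k" and ?Ti = "tmi t k"
  have Tw: "norm (?T w) <= R/2" "?T w : W" if "w : ball 0 Rad" for w proof -
   have "norm (?T w) <= 2*t*norm w" by(rule norm_tm[OF t(1,2) k])
   also have "... <= 2*t*Rad" using that t by(intro mono_l) auto
   finally show n: "norm (?T w) <= R/2" using t by simp
   thus "?T w : W" using W by(auto simp: subset_eq)
  qed
  show "! w:ball 0 Rad. norm (?T w) < R" using Tw(1) W(3) by fastforce
  have sm: "sm (%w. Js t w v) (ball 0 Rad)" for v unfolding Js_def by(rule sm_lin[OF bl_tm(2) open_ball sm_comp[OF open_ball W(1) smJ sm_bl[OF bl_tm(1)] Tw(2)]])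
  thus "sm (%w. Js t w v) (ball 0 Rad)" for v .
  have lJ: "linear (Js t w)" if "w : ball 0 Rad" for w using lin[OF Tw(2)[OF that]] lin_tm by(intro linearI) (simp_all add: Js_def linear_add linear_scale)
  have jd: "(%w. Js t w v) differentiable (at w)" if "w : ball 0 Rad" for w v by(rule sm_dif[OF sm that])
  have basis: "norm (pd i (%w. Js t w j) w) <= C1*t" if i: "i : ?B" and j: "j : ?B" and w: "w : ball 0 Rad" for i j w proof -
   define ta where "ta = (%i::C2. if snd i = 0 then t else t^k)"
   have Tta: "?T i = ta i*.i" if "i : ?B" for i using Basis_C2[OF that] by(auto simp: tm_def ta_def prod_eq_iff)
   let ?D = "pd i (%x. Jm x j) (?T w)"
   have dJ: "(%x. Jm x v) differentiable (at (?T w))" for v by(rule sm_dif[OF smJ Tw(2)[OF w]])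
   have "pd i (%w. Js t w j) w = ?Ti (pd i (%w. Jm (?T w) (?T j)) w)"
    unfolding Js_def by(rule pd_lin[OF bl_tm(2) dif_comp[OF dJ bounded_linear_imp_differentiable[OF bl_tm(1)]]])
   also have "pd i (%w. Jm (?T w) (?T j)) w = pd (?T i) (%x. Jm x (?T j)) (?T w)"
    by(subst chain_pd[OF bounded_linear_imp_differentiable[OF bl_tm(1)] dJ]) (simp add: pd_eq[OF bounded_linear_imp_has_derivative[OF bl_tm(1)]])
   also have "... = ta i*.pd i (%x. Jm x (?T j)) (?T w)" unfolding Tta[OF i] by(rule linear_scale[OF deriv_lin[OF hd_pd[OF dJ]]])
   also have "pd i (%x. Jm x (?T j)) (?T w) = pd i (%x. ta j*.Jm x j) (?T w)" by(rule pd_cong[OF W(1) _ Tw(2)[OF w]]) (simp add: Tta[OF j] linear_scale[OF lin])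
   also have "... = ta j*.?D" by(rule pd_scaleR_c[OF dJ])
   finally have e: "norm (pd i (%w. Js t w j) w) = ta i*ta j*norm (?Ti ?D)" using t by(simp add: linear_scale[OF lin_tm(2)] ta_def)
   have tk: "t^k <= t" using power_decreasing[OF k, of t] t by simp
   have fs: "norm (fst ?D) <= norm ?D" "norm (snd ?D) <= norm ?D" using norm_fst_le[of "fst ?D" "snd ?D"] norm_snd_le[of "snd ?D" "fst ?D"] by(simp_all del: norm_Pair)
   have Ti: "norm (?Ti ?D) <= M/t+norm ?D/t^k" by(rule order_trans[OF norm_tm(2)[OF t(1,2) k] add_mono[OF divide_right_mono divide_right_mono]])
    (use fs M(2)[OF i j Tw(1)[OF w]] t in auto)
   have "ta i*ta j*norm (?Ti ?D) <= C1*t" proof(cases "snd i = 0 & snd j = 0")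
    case True
    have "norm (snd (?T w)) <= t^k*Rad" using w t norm_snd_le[of "snd w" "fst w"] by(auto simp: tm_def intro!: mono_l simp del: norm_Pair)
    hence "norm ?D <= M*(t^k*Rad)" by(intro order_trans[OF M(3)[OF i j Tw(1)[OF w]] mono_l]) (use True M(1) in auto)
    hence "norm ?D/t^k <= M*Rad" using t by(simp add: divide_le_eq mult_ac)
    hence "t*t*norm (?Ti ?D) <= t*t*(M/t+M*Rad)" using Ti t by(intro mono_l) auto
    also have "... = t*M+t*(t*(M*Rad))" using t by(simp add: algebra_simps)
    also have "... <= t*M+t*(1*(M*Rad))" using t M Rad by(intro add_left_mono mono_l mono_r) auto
    also have "... <= C1*t" using M t by(simp add: C1_def algebra_simps)
    finally show ?thesis using True by(simp add: ta_def)
   next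
    case False
    hence "ta i*ta j <= t*t^k" using t tk by(auto simp: ta_def mult.commute intro: mult_mono)
    moreover have "norm ?D/t^k <= M/t^k" using M(2)[OF i j Tw(1)[OF w]] t by(intro divide_right_mono) auto
    hence "norm (?Ti ?D) <= M/t+M/t^k" using Ti by linarith
    ultimately have "ta i*ta j*norm (?Ti ?D) <= t*t^k*(M/t+M/t^k)" by(rule mult_mono) (use t in auto)
    also have "... = t^k*M+t*M" using t by(simp add: field_simps)
    also have "... <= t*M+t*M" using tk M by(intro add_right_mono mono_r) auto
    also have "... <= C1*t" using M t Rad by(simp add: C1_def algebra_simps)
    finally show ?thesis .
   qed
   thus ?thesis unfolding e .
  qed
  have der: "norm (pd u (%w. Js t w v) w) <= 16*C1*t*norm u*norm v" if w: "w : ball 0 Rad" for u v w proof -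
   have s: "norm (pd i (%w. Js t w v) w) <= 4*(norm v * (C1*t))" if i: "i : ?B" for i proof -
    have "pd i (%w. Js t w v) w = pd i (%w. SUM j:?B. (v.*j)*.Js t w j) w" by(rule pd_cong[OF open_ball lin_Basis[OF lJ] w])
    also have "... = (SUM j:?B. pd i (%w. (v.*j)*.Js t w j) w)" by(rule pd_sum, intro differentiable_scaleR differentiable_const jd[OF w])
    also have "... = (SUM j:?B. (v.*j)*.pd i (%w. Js t w j) w)" by(simp only: pd_scaleR_c[OF jd[OF w]])
    also have "norm ... <= (SUM j:?B. norm v * (C1*t))" proof(rule order_trans[OF norm_sum sum_mono])
    fix j assume j: "j : ?B"
    hence "abs (v.*j) <= norm v" by(rule Basis_le_norm)
    thus "norm ((v.*j)*.pd i (%w. Js t w j) w) <= norm v * (C1*t)" unfolding norm_scaleR using basis[OF i j w] by(intro mult_mono) auto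
    qed
    finally show ?thesis by(simp add: card_Basis_C2)
   qed
   have "norm (pd u (%w. Js t w v) w) <= (SUM i:?B. norm u*(4*(norm v * (C1*t))))" unfolding pd_Basis[OF jd[OF w], of u] proof(rule order_trans[OF norm_sum sum_mono])
    fix i assume i: "i : ?B"
    hence "abs (u.*i) <= norm u" by(rule Basis_le_norm)
    thus "norm ((u.*i)*.pd i (%w. Js t w v) w) <= norm u*(4*(norm v * (C1*t)))" unfolding norm_scaleR using s[OF i] by(intro mult_mono) auto
   qed
   thus ?thesis by(simp add: card_Basis_C2 mult_ac)
  qed
  have Js0: "Js t 0 v = J_st v" for v unfolding Js_def linear_0[OF lin_tm(1)] J0 using t by(simp add: J_st_def tm_def tmi_def)
  show "! w:ball 0 Rad. linear (Js t w) & (! v. Js t w (Js t w v) = - v & norm (Js t w v-J_st v) <= C*t*norm v &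
    (! u. norm (pd u (%w. Js t w v) w) <= C*t*norm u*norm v))" proof(intro ballI conjI allI)
   fix w u v :: C2 assume w: "w : ball 0 Rad"
   show "linear (Js t w)" by(rule lJ[OF w])
   show "Js t w (Js t w v) = - v" using t by(simp add: Js_def tm_inverse J2[OF Tw(2)[OF w]] linear_neg[OF lin_tm(2)])
   have "16*C1*(t*norm u*norm v) <= C*(t*norm u*norm v)" using C t by(intro mono_r) auto
   thus "norm (pd u (%w. Js t w v) w) <= C*t*norm u*norm v" using der[OF w, of u v] by(simp add: mult.assoc)
   have "norm (Js t w v-Js t 0 v) <= 16*C1*t*norm v * norm (w-0)" proof(rule differentiable_bound[OF convex_ball])
    fix x :: C2 assume x: "x : ball 0 Rad"
    show "((%w. Js t w v) has_derivative (%u. pd u (%w. Js t w v) x)) (at x within ball 0 Rad)" by(rule has_derivative_at_withinI[OF hd_pd[OF jd[OF x]]])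
    show "onorm (%u. pd u (%w. Js t w v) x) <= 16*C1*t*norm v" by(rule onorm_bound) (use der[OF x] C1 t in \<open>auto simp: mult_ac\<close>)
   qed (use w Rad in auto)
   also have "... <= 16*C1*t*norm v * Rad" using w C1 t by(intro mono_l) auto
   also have "... = (16*C1*Rad)*(t*norm v)" by simp
   also have "... <= C*(t*norm v)" using C t by(intro mono_r) auto
   finally show "norm (Js t w v-J_st v) <= C*t*norm v" by(simp add: Js0 mult.assoc)
  qed
 qed
qed

end

text \<open>Strict differentiability moves from U zeta to U zeta + (0, t^k w2) and changes
  \<open>r\<close> by about t^k Re w2; the contact of \<open>U\<close> gives r (U zeta) as t^k times
  the form. Each step may be off by half of e t^k.\<close>

lemma (in boundary_point) scaled_defining_function:
 assumes U: "chart_disc U" and k: "k >= 1" and con: "(%ze. r (U ze)-hpoly k a ze) : o[at 0](%ze. norm ze^k)" and Rad: "Rad > 0" and e: "e > 0"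
 shows "EX t1>0. ! t w. 0 < t --> t <= t1 --> norm w <= Rad -->
  abs (r (U (fst (tm t k w))+(0, snd (tm t k w)))-t^k*(Re (snd w)+hpoly k a (fst w))) <= e*t^k"
proof -
 note Uf = chart_discD[OF U]
 define e1 e2 where "e1 = e/(2*(Rad+1))" and "e2 = e/(2*(Rad+1)^k)"
 have e12: "e1 > 0" "e2 > 0" using e Rad by(simp_all add: e1_def e2_def)
 have "e/(2*x)*x = e/2" if "x ~= 0" for x :: real using that by simp
 from this[of "Rad+1"] this[of "(Rad+1)^k"] have e1R: "e1*(Rad+1) = e/2" and e2R: "e2*(Rad+1)^k = e/2" using Rad unfolding e1_def e2_def by simp_all
 obtain R' where R': "R' > 0" "!!x y. norm x < R' ==> norm y < R' ==> abs (r x-r y-Re (snd (x-y))) <= e1*norm (x-y)" using r_strict[OF e12(1)] by blast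
 obtain d where d: "d > 0" "!!ze. ze ~= 0 ==> norm ze < d ==> abs (r (U ze)-hpoly k a ze) <= e2*norm ze^k" using con e12(2) unfolding smallo_at_0 by blast
 have "isCont U 0" using sm_cont[OF Uf(1)] continuous_on_eq_continuous_at[of "DD" U] by simp
 then obtain d' where "d' > 0" "! x'. dist x' 0 < d' --> dist (U x') (U 0) < R'/2" unfolding continuous_at_eps_delta using R'(1) by(meson half_gt_zero)
 hence d': "d' > 0" "!!z. norm z < d' ==> norm (U z) < R'/2" using Uf(2) by auto
 define t1 where "t1 = min 1 (min (min d d'/(2*(Rad+1))) (R'/(4*(Rad+1))))"
 have t1: "t1 > 0" using d d' R' Rad by(simp add: t1_def)
 show ?thesis proof(rule exI[of _ t1], intro conjI t1 allI impI)
  fix t and w :: C2 assume t: "0 < t" "t <= t1" and w: "norm w <= Rad"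
  have tt: "t <= 1" "t*(Rad+1) <= d/2" "t*(Rad+1) <= d'/2" "t*(Rad+1) <= R'/4" using t Rad by(auto simp: t1_def field_simps)
  have fs: "norm (fst w) <= Rad" "norm (snd w) <= Rad" using w norm_fst_le[of "fst w" "snd w"] norm_snd_le[of "snd w" "fst w"] by(simp_all del: norm_Pair)
  have tR: "t*norm x <= t*(Rad+1)" if "norm x <= Rad" for x :: complex using that t by(intro mono_l) auto
  define ze where "ze = t*.fst w"
  have "norm ze = t*norm (fst w)" using t by(simp add: ze_def)
  hence ze: "norm ze < d" "norm ze < d'" using tR[OF fs(1)] tt d d' by linarith+
  let ?y = "U ze" and ?x = "U ze+(0, t^k*.snd w)"
  have "t^k <= t" using power_decreasing[OF k, of t] t tt by simp
  hence "t^k*norm (snd w) <= t*norm (snd w)" by(rule mono_r) simp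
  moreover have "norm (t^k*.snd w) = t^k*norm (snd w)" using t by simp
  ultimately have "norm (t^k*.snd w) < R'/2" using tR[OF fs(2)] tt R' by linarith
  hence x: "norm ?x < R'" "norm ?y < R'" using tri_ineq[of ?y "(0, t^k*.snd w)"] d'(2)[OF ze(2)] R' by(simp_all add: norm_Pair)
  have "abs (r ?x-r ?y-Re (snd (?x-?y))) <= e1*norm (?x-?y)" by(rule R'(2)[OF x])
  also have "norm (?x-?y) = t^k*norm (snd w)" using t by(simp add: norm_Pair)
  also have "e1*(t^k*norm (snd w)) <= e1*(t^k*(Rad+1))" using fs e12 t by(intro mono_l) auto
  also have "... = e1*(Rad+1)*t^k" by(simp only: mult_ac)
  also have "... = e/2*t^k" by(simp only: e1R)
  finally have 1: "abs (r ?x-r ?y-t^k*Re (snd w)) <= e/2*t^k" by simp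
  have 2: "abs (r ?y-t^k*hpoly k a (fst w)) <= e/2*t^k" proof(cases "ze = 0")
   case True
   hence "fst w = 0" using t by(simp add: ze_def)
   thus ?thesis using True e t by(simp add: Uf(2) r_0 hpoly_at_0[OF k])
  next
   case False
   have "abs (r ?y-hpoly k a ze) <= e2*norm ze^k" by(rule d(2)[OF False ze(1)])
   also have "... <= e2*(t*(Rad+1))^k" using tR[OF fs(1)] t e12 by(intro mono_l power_mono) (auto simp: ze_def)
   also have "... = e2*(Rad+1)^k*t^k" by(simp only: power_mult_distrib mult_ac)
   also have "... = e/2*t^k" by(simp only: e2R)
   finally show ?thesis by(simp add: ze_def scaleR_conv_of_real hpoly_scale)
  qed
  have "abs (r ?x-t^k*(Re (snd w)+hpoly k a (fst w))) <= e*t^k" using 1 2 unfolding abs_le_iff distrib_left by linarith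
  thus "abs (r (U (fst (tm t k w))+(0, snd (tm t k w)))-t^k*(Re (snd w)+hpoly k a (fst w))) <= e*t^k" by(simp add: tm_def ze_def)
 qed
qed

subsection \<open>The estimate at the boundary point\<close>

definition obx :: "real => real => C2 set" where "obx L Y = fst -` DD Int (%w. Re (snd w)) -` {- L<..<L} Int (%w. Im (snd w)) -` {- Y<..<Y}"
definition cbx :: "real => real => C2 set" where "cbx L Y = fst -` cball 0 1 Int (%w. Re (snd w)) -` {- L..L} Int (%w. Im (snd w)) -` {- Y..Y}"

lemma box_facts: "open (obx L Y)" "convex (obx L Y)" "compact (cbx L Y)" "obx L Y <= cbx L Y" "w : cbx L Y ==> norm w <= 1+L+Y"
proof -
 have l: "linear (fst :: C2 => complex)" "linear (%w::C2. Re (snd w))" "linear (%w::C2. Im (snd w))" by(intro linearI; simp)+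
 have c: "continuous_on UNIV (fst :: C2 => complex)" "continuous_on UNIV (%w::C2. Re (snd w))" "continuous_on UNIV (%w::C2. Im (snd w))" by(intro continuous_intros)+
 show "open (obx L Y)" unfolding obx_def by(intro open_Int open_vimage open_ball open_greaterThanLessThan c)
 show "convex (obx L Y)" unfolding obx_def by(intro convex_Int convex_linear_vimage l convex_ball convex_real_interval)
 show n: "norm w <= 1+L+Y" if "w : cbx L Y" for w using that norm_le_sum[of w] cmod_le[of "snd w"] by(auto simp: cbx_def simp del: norm_Pair)
 have "closed (cbx L Y)" unfolding cbx_def by(intro closed_Int closed_vimage closed_cball closed_atLeastAtMost c)
 thus "compact (cbx L Y)" unfolding compact_eq_bounded_closed bounded_iff using n by blast
 show "obx L Y <= cbx L Y" by(auto simp: obx_def cbx_def)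
qed

lemma Phi_continuous: "continuous_on S (Phi p et e)" unfolding Phi_def[abs_def] by(intro continuous_intros)

text \<open>On the part of the boundary of the box that meets the rescaled domain \<open>Phi\<close> is small: for
  \<open>\<bar>fst w\<bar> = 1\<close> since there \<open>p\<close> agrees with \<open>hpoly k a\<close>, on the other faces by the choice of \<open>L\<close> and \<open>Y\<close>.\<close>

lemma box_constants:
 assumes circ: "!!og. norm og = 1 ==> hpoly k a og = Re (poly p og)" and pos: "Re (coeff p 0) > 0"
 obtains et e M R N ap si ka' L Y where "0 < e" "0 < ap" "0 < si" "si <= 1" "0 <= M" "0 < R" "0 <= N" "0 < ka'" "ap <= N" "cbx L Y <= ball 0 R"
  "!!w. w : obx L Y ==> Phi p et e w <= N" "!!w. w : obx L Y ==> norm (poly (pderiv p) (fst w)) <= M" "!!w. w : obx L Y ==> norm (poly (pderiv (pderiv p)) (fst w)) <= M"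
  "!!w. w : obx L Y ==> norm (poly (pderiv [:0, 1, of_real et:]) (snd w)) <= M" "!!w. w : obx L Y ==> norm (poly (pderiv (pderiv [:0, 1, of_real et:])) (snd w)) <= M"
  "!!w. norm w <= 3 * si ==> w : obx L Y" "!!w. norm w <= 3 * si ==> Phi p et e w > ap"
  "!!w. w : cbx L Y ==> Re (snd w)+hpoly k a (fst w) <= ka' ==> ap <= Phi p et e w ==> w : obx L Y"
proof -
 define ap0 where "ap0 = Re (coeff p 0)"
 have ap0: "ap0 > 0" using pos by(simp add: ap0_def)
 \<comment> \<open>A common bound for the small errors in Phi and in the rescaled domain; 16 b <=
   ap0 leaves room for several of them.\<close>
 define b where "b = min 1 ap0/16"
 have b: "b > 0" "b <= 1/16" "16*b <= ap0" using ap0 by(auto simp: b_def)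
 have bound: "EX M>=0. ! z. norm z <= 1 --> abs (f z) <= M" if f: "continuous_on (cball 0 1) f" for f :: "complex => real" proof -
  obtain M where M: "! x:cball 0 1. norm (f x) <= M" using compact_imp_bounded[OF compact_continuous_image[OF f compact_cball]] by(auto simp: bounded_iff)
  have "abs (f z) <= abs M" if "norm z <= 1" for z using M[rule_format, of z] that by simp
  thus ?thesis by(intro exI[of _ "abs M"]) simp
 qed
 have "continuous_on (cball 0 1) (%z. Re (poly p z))" by(intro continuous_intros)
 from bound[OF this] obtain P1 where P1: "P1 >= 0" "!!z. norm z <= 1 ==> abs (Re (poly p z)) <= P1" by blast
 from bound[OF continuous_hpoly[of _ k a]] obtain P2 where P2: "P2 >= 0" "!!z. norm z <= 1 ==> abs (hpoly k a z) <= P2" by blast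
 define P where "P = P1+P2"
 have P: "P >= 0" "!!z. norm z <= 1 ==> abs (Re (poly p z)) <= P" "!!z. norm z <= 1 ==> abs (hpoly k a z) <= P"
  using P1(1) P2(1) order_trans[OF P1(2)] order_trans[OF P2(2)] unfolding P_def by auto
 \<comment> \<open>\<open>L\<close> is so large that the rescaled domain misses Re w2 = L and Phi is
   negative at Re w2 = -L; \<open>et\<close> is so small that et (Re w2)^2 <= b on the box. Below,
   \<open>Y\<close> makes -et (Im w2)^2 outweigh the other terms at |Im w2| = Y, and
   \<open>e\<close> is small compared with the size of the box.\<close>
 define L et where "L = 2*P+2" and "et = b/L^2"
 have L: "L >= 2" using P by(simp add: L_def)
 have et: "et > 0" "et*L^2 = b" using b L by(simp_all add: et_def)
 define Y where "Y = sqrt ((L+P+2)/et)"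
 have Y: "Y > 0" "et*Y^2 = L+P+2" using et L P by(simp_all add: Y_def)
 define R e where "R = 2+L+Y" and "e = b/R^2"
 have R: "R > 0" using L Y by(simp add: R_def)
 have e: "e > 0" "e*R^2 = b" using b R by(simp_all add: e_def)
 have wR: "norm w < R" if "w : cbx L Y" for w using box_facts(5)[OF that] by(simp add: R_def)
 have ew: "0 <= e*(w.*w)" "e*(w.*w) <= b" if "w : cbx L Y" for w proof -
  have "(norm w)^2 <= R^2" using wR[OF that] by(intro power_mono) auto
  thus "e*(w.*w) <= b" using e mono_l[of "(norm w)^2" "R^2" e] by(simp add: dot_sq)
 qed (use e in simp)
 have Pe: "Phi p et e w = Re (poly p (fst w))+Re (snd w)+(et*(Re (snd w))^2-et*(Im (snd w))^2)+e*(w.*w)" for w by(simp add: Phi_def sq_eq algebra_simps)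
 have cb: "norm (fst w) <= 1" "abs (Re (snd w)) <= L" "abs (Im (snd w)) <= Y" if "w : cbx L Y" for w using that by(auto simp: cbx_def)
 have re2: "et*(Re (snd w))^2 <= b" if "w : cbx L Y" for w proof -
  have "(Re (snd w))^2 <= L^2" using power_mono[OF cb(2)[OF that], of 2] by simp
  thus ?thesis using et mono_l[of "(Re (snd w))^2" "L^2" et] by simp
 qed
 have im2: "0 <= et*(Im (snd w))^2" for w :: C2 using et by simp
 \<comment> \<open>Half of the value of Phi at 0. At |w1| = 1 the form equals Re p, so that on the
   rescaled domain Phi is at most 3 b there, which is below \<open>ap\<close>.\<close>
 define ap N where "ap = ap0/2" and "N = P+L+1"
 have PhiN: "Phi p et e w <= N" if "w : cbx L Y" for w
  unfolding Pe N_def using ew[OF that] re2[OF that] im2[of w] P(2)[OF cb(1)[OF that]] cb(2)[OF that] b by(simp add: abs_le_iff)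
 have edge: "w : obx L Y" if w: "w : cbx L Y" "Re (snd w)+hpoly k a (fst w) <= b" "ap <= Phi p et e w" for w proof -
  have f: "Re (poly p (fst w)) <= P" "hpoly k a (fst w) >=-P" using P(2,3)[OF cb(1)[OF w(1)]] by(simp_all add: abs_le_iff)
  note w3 = w(3)[unfolded Pe ap_def]
  have "norm (fst w) ~= 1" proof
   assume "norm (fst w) = 1"
   hence "hpoly k a (fst w) = Re (poly p (fst w))" by(rule circ)
   thus False using w(2) w3 ew[OF w(1)] re2[OF w(1)] im2[of w] b by linarith
  qed
  moreover have "Re (snd w) ~= L" using f w(2) b P(1) by(auto simp: L_def)
  moreover have "Re (snd w) ~=-L" proof
   assume r: "Re (snd w) = - L"
   hence "Phi p et e w <= P-L+b+b" using f ew[OF w(1)] re2[OF w(1)] im2[of w] unfolding Pe by linarith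
   thus False using w(3) ap0 b P(1) by(simp add: L_def ap_def)
  qed
  moreover have "abs (Im (snd w)) ~= Y" proof
   assume "abs (Im (snd w)) = Y"
   hence "(Im (snd w))^2 = Y^2" by(metis power2_abs)
   hence "et*(Im (snd w))^2 = L+P+2" using Y by simp
   hence "Phi p et e w <= P+L+b+b-(L+P+2)" using f ew[OF w(1)] re2[OF w(1)] cb(2)[OF w(1)] unfolding Pe by linarith
   thus False using w(3) ap0 b by(simp add: ap_def)
  qed
  ultimately show ?thesis using cb[OF w(1)] by(auto simp: obx_def abs_le_iff abs_if split: if_splits)
 qed
 have P0: "Phi p et e 0 = ap0" by(simp add: Phi_def poly_0_coeff_0 ap0_def)
 have "open (obx L Y Int Phi p et e -` {ap<..})" by(intro open_Int box_facts(1) open_vimage open_greaterThan Phi_continuous)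
 moreover have "0 : obx L Y Int Phi p et e -` {ap<..}" using P0 ap0 L Y by(simp add: obx_def ap_def)
 ultimately obtain s where s: "s > 0" "cball 0 s <= obx L Y Int Phi p et e -` {ap<..}" using open_contains_cball by blast
 define si where "si = min 1 (s/3)"
 have si: "0 < si" "si <= 1" "!!w. norm w <= 3 * si ==> w : cball 0 s" using s by(auto simp: si_def)
 have cq: "continuous_on (cball 0 1) (%z. norm (poly q z))" for q :: "complex poly" by(intro continuous_intros)
 obtain M1 where M1: "M1 >= 0" "!!z. norm z <= 1 ==> norm (poly (pderiv p) z) <= M1" using bound[OF cq[of "pderiv p"]] by auto
 obtain M2 where M2: "M2 >= 0" "!!z. norm z <= 1 ==> norm (poly (pderiv (pderiv p)) z) <= M2" using bound[OF cq[of "pderiv (pderiv p)"]] by auto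
 define M where "M = M1+M2+1+2*et*(R+1)"
 have pd: "pderiv [:0, 1, complex_of_real et:] = [:1, of_real (2*et):]" "pderiv [:1, complex_of_real (2*et):] = [:of_real (2*et):]" by(simp_all add: pderiv_pCons)
 have Mb: "norm (poly (pderiv [:0, 1, of_real et:]) (snd w)) <= M" "norm (poly (pderiv (pderiv [:0, 1, of_real et:])) (snd w)) <= M"
  if "w : cbx L Y" for w proof -
  have "norm (snd w) <= R" using wR[OF that] norm_snd_le[of "snd w" "fst w"] by(simp del: norm_Pair)
  hence "norm (snd w * of_real (2*et)) <= R*(2*et)" using et R unfolding norm_mult by(intro mult_mono) auto
  hence "norm (1+snd w * of_real (2*et)) <= 1+R*(2*et)" using tri_ineq[of 1 "snd w * of_real (2*et)"] by simp
  thus "norm (poly (pderiv [:0, 1, of_real et:]) (snd w)) <= M" unfolding pd using M1 M2 et by(simp add: M_def algebra_simps)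
  have "0 <= et*R" using et R by simp
  thus "norm (poly (pderiv (pderiv [:0, 1, of_real et:])) (snd w)) <= M" unfolding pd using M1 M2 et by(simp add: M_def norm_mult algebra_simps)
 qed
 have M0: "0 <= 2*et*(R+1)" using et R by simp
 have Ma: "norm (poly (pderiv p) (fst w)) <= M" "norm (poly (pderiv (pderiv p)) (fst w)) <= M" if "w : cbx L Y" for w
  using M1(2)[OF cb(1)[OF that]] M2(2)[OF cb(1)[OF that]] M1(1) M2(1) M0 unfolding M_def by linarith+
 have "ap <= N" using P(2)[of 0] L ap0 by(simp add: ap_def N_def ap0_def poly_0_coeff_0 abs_le_iff)
 have M: "0 <= M" using M0 M1(1) M2(1) by(simp add: M_def)
 have N: "0 <= N" using P(1) L by(simp add: N_def)
 have a: "0 < ap" using ap0 by(simp add: ap_def)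
 have sub: "cbx L Y <= ball 0 R" using wR by auto
 have near: "w : obx L Y" "Phi p et e w > ap" if "norm w <= 3 * si" for w using subsetD[OF s(2) si(3)[OF that]] by simp_all
 note bc = subsetD[OF box_facts(4)[of L Y]]
 show thesis by(rule that[OF e(1) a si(1,2) M R N b(1) `ap <= N` sub PhiN[OF bc] Ma(1)[OF bc] Ma(2)[OF bc] Mb(1)[OF bc] Mb(2)[OF bc] near edge])
qed

text \<open>Tangency at 0 makes the normal component of the derivative of \<open>U\<close> vanish
  there, so it is O(|zeta|) by the mean value theorem.\<close>

lemma (in boundary_point) disc_derivative_bounds:
 assumes U: "chart_disc U" shows "EX M>0. ! ze h. norm ze <= 1/2 --> norm (pd h U ze) <= M*norm h & norm (snd (pd h U ze)) <= M*norm ze*norm h"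
proof -
 note Uf = chart_discD[OF U]
 let ?K = "cball 0 (1/2) :: complex set"
 have KB: "?K <= DD" by auto
 have sm: "sm (pd v U) (DD)" "sm (pd u (pd v U)) (DD)" for u v by(rule sm_pd[OF Uf(1)] sm_pd[OF sm_pd[OF Uf(1)]])+
 have bd: "? B. ! x:?K. norm (f x) <= B" if "sm f (DD)" for f :: "complex => C2" by(rule smooth_bounded_on_compact[OF that compact_cball KB])
 obtain B1 where B1: "!!x. x : ?K ==> norm (pd 1 U x) <= B1" using bd[OF sm(1)] by blast
 obtain B2 where B2: "!!x. x : ?K ==> norm (pd \<i> U x) <= B2" using bd[OF sm(1)] by blast
 obtain B3 where B3: "!!x. x : ?K ==> norm (pd 1 (pd 1 U) x) <= B3" using bd[OF sm(2)] by blast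
 obtain B4 where B4: "!!x. x : ?K ==> norm (pd \<i> (pd 1 U) x) <= B4" using bd[OF sm(2)] by blast
 obtain B5 where B5: "!!x. x : ?K ==> norm (pd 1 (pd \<i> U) x) <= B5" using bd[OF sm(2)] by blast
 obtain B6 where B6: "!!x. x : ?K ==> norm (pd \<i> (pd \<i> U) x) <= B6" using bd[OF sm(2)] by blast
 define M where "M = 1+abs B1+abs B2+abs B3+abs B4+abs B5+abs B6"
 have lip: "norm (pd v U ze-pd v U 0) <= (abs B+abs B')*norm (ze-0)"
  if ze: "ze : ?K" and B: "!!x. x : ?K ==> norm (pd 1 (pd v U) x) <= B" "!!x. x : ?K ==> norm (pd \<i> (pd v U) x) <= B'" for v ze B B'
 proof(rule differentiable_bound[OF convex_cball])
  fix x assume x: "x : ?K"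
  have d: "pd v U differentiable (at x)" by(rule sm_dif[OF sm(1) subsetD[OF KB x]])
  show "(pd v U has_derivative (%h. pd h (pd v U) x)) (at x within ?K)" by(rule has_derivative_at_withinI[OF hd_pd[OF d]])
  show "onorm (%h. pd h (pd v U) x) <= abs B+abs B'" proof(rule onorm_bound)
   fix h
   show "norm (pd h (pd v U) x) <= (abs B+abs B')*norm h" by(rule order_trans[OF pd_linear_bound[OF d] mono_r]) (use B[OF x] in auto)
  qed simp
 qed (use ze in auto)
 have s0: "snd (pd 1 U 0) = 0" "snd (pd \<i> U 0) = 0" using Uf(5) chart_disc_pd_i[OF U] by(simp_all add: J_st_def)
 have sn: "norm (snd x) <= norm x" for x :: C2 using norm_snd_le[of "snd x" "fst x"] by(simp del: norm_Pair)
 show ?thesis proof(rule exI[of _ M], intro conjI allI impI)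
  fix ze h :: complex assume "norm ze <= 1/2"
  hence ze: "ze : ?K" by simp
  have d: "U differentiable (at ze)" by(rule sm_dif[OF Uf(1) subsetD[OF KB ze]])
  show "norm (pd h U ze) <= M*norm h" by(rule order_trans[OF pd_linear_bound[OF d] mono_r]) (use B1[OF ze] B2[OF ze] in \<open>auto simp: M_def\<close>)
  have "norm (snd (pd 1 U ze)) <= (abs B3+abs B4)*norm ze" using lip[OF ze B3 B4] sn[of "pd 1 U ze-pd 1 U 0"] s0 by simp
  moreover have "norm (snd (pd \<i> U ze)) <= (abs B5+abs B6)*norm ze" using lip[OF ze B5 B6] sn[of "pd \<i> U ze-pd \<i> U 0"] s0 by simp
  moreover have "0 <= (1+abs B1+abs B2)*norm ze" by simp
  ultimately have s: "norm (snd (pd 1 U ze))+norm (snd (pd \<i> U ze)) <= M*norm ze" unfolding M_def distrib_right by linarith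
  have "norm (snd (pd h U ze)) <= abs (Re h)*norm (snd (pd 1 U ze))+abs (Im h)*norm (snd (pd \<i> U ze))"
   unfolding pd_complex[OF d, of h] using tri_ineq[of "Re h*.snd (pd 1 U ze)" "Im h*.snd (pd \<i> U ze)"] by simp
  also have "... <= norm h*norm (snd (pd 1 U ze))+norm h*norm (snd (pd \<i> U ze))" by(intro add_mono mono_r abs_Re_le_cmod abs_Im_le_cmod) auto
  also have "... <= norm h*(M*norm ze)" unfolding distrib_left[symmetric] by(rule mono_l[OF s]) simp
  finally show "norm (snd (pd h U ze)) <= M*norm ze*norm h" by(simp add: mult_ac)
 qed (simp add: M_def)
qed

text \<open>The box comes first, then the bounds of the rescaled structure on it, and these decide
  how small \<open>t\<close> must be; so the constants depend neither on \<open>t\<close> nor on the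
  disc. The disc may leave the chart, which the cover of the unit disc by \<open>O1\<close> and
  \<open>O2\<close> takes care of.\<close>

lemma (in boundary_point) scaled_disc_estimate:
 assumes U: "chart_disc U" and k: "k >= 1" and circ: "! og. norm og = 1 --> hpoly k a og = Re (poly p og)"
  and pos: "Re (coeff p 0) > 0" and con: "(%ze. r (U ze)-hpoly k a ze) : o[at 0](%ze. norm ze^k)" and st: "straight U c' R Cst"
 shows "EX si>0. EX C>0. EX t0>0. t0 <= 1 & (! t f. 0 < t --> t <= t0 --> J_holomorphic_disc A J f --> f ` DD <= D -->
  f 0 : chart_dom c' --> norm (tmi t k (coord c' (f 0))) <= si --> norm (pd 1 (%ze. tmi t k (coord c' (f ze))) 0) <= C)"
proof -
 note c' = straightD[OF st]
 obtain et e M Rb N ap si ka' L Y where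
  const: "0 < e" "0 < ap" "0 < si" "si <= 1" "0 <= M" "0 < Rb" "0 <= N" "0 < ka'" "ap <= N" and
  cbR: "cbx L Y <= ball 0 Rb" and
  bd: "!!w. w : obx L Y ==> Phi p et e w <= N" "!!w. w : obx L Y ==> norm (poly (pderiv p) (fst w)) <= M"
   "!!w. w : obx L Y ==> norm (poly (pderiv (pderiv p)) (fst w)) <= M" "!!w. w : obx L Y ==> norm (poly (pderiv [:0, 1, of_real et:]) (snd w)) <= M"
   "!!w. w : obx L Y ==> norm (poly (pderiv (pderiv [:0, 1, of_real et:])) (snd w)) <= M" and
  near: "!!w. norm w <= 3 * si ==> w : obx L Y" "!!w. norm w <= 3 * si ==> Phi p et e w > ap" and
  edge: "!!w. w : cbx L Y ==> Re (snd w)+hpoly k a (fst w) <= ka' ==> ap <= Phi p et e w ==> w : obx L Y"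
  by((rule box_constants[OF circ[rule_format] pos], assumption), (rule that; assumption))
 let ?W = "img c'"
 note cf' = chart_facts[OF ac_facts(1)[OF acm c'(1)]]
 note Jf' = ac_facts(2-4)[OF acm c'(1)]
 have RW: "ball 0 R <= ?W" using c'(4) by auto
 interpret straight_structure "J c'" ?W R Rb k by(rule straight_structure.intro[OF cf'(2) RW c'(2) const(6) k Jf'(2,1,3) c'(8,9)])
 obtain Cs t1 where Cs: "Cs > 0" "t1 > 0" "t1 <= 1" and
  sc: "! t. 0 < t & t <= t1 --> (! w:ball 0 Rb. norm (tm t k w) < R) & (! v. sm (%w. Js t w v) (ball 0 Rb)) &
   (! w:ball 0 Rb. linear (Js t w) & (! v. Js t w (Js t w v) = - v & norm (Js t w v-J_st v) <= Cs*t*norm v & (! u. norm (pd u (%w. Js t w v) w) <= Cs*t*norm u*norm v)))"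
  using scaled_structure by(elim exE conjE) (rule that; assumption)
 obtain t2 where t2: "t2 > 0" and df: "!!t w. 0 < t ==> t <= t2 ==> norm w <= Rb ==>
   abs (r (U (fst (tm t k w))+(0, snd (tm t k w)))-t^k*(Re (snd w)+hpoly k a (fst w))) <= ka'*t^k"
  using scaled_defining_function[OF U k con const(6,8)] by(elim exE conjE) (rule that; blast)
 let ?d = "14*M+8*e*Rb"
 have d0: "?d >= 0" using const by simp
 \<comment> \<open>Both smallness conditions of \<open>sibony\<close> on \<open>ka\<close>; the + 1
   keeps the denominator positive.\<close>
 define ka0 where "ka0 = min (1/1152) (e/(?d+1))"
 have ka0: "ka0 > 0" "ka0 <= 1/1152" using divide_pos_pos[of e "?d+1"] d0 const(1) unfolding ka0_def by linarith+
 have kae: "ka*?d <= e" if "0 <= ka" "ka <= ka0" for ka proof -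
  have "ka*?d <= e/(?d+1)*(?d+1)" using that d0 const by(intro mult_mono) (auto simp: ka0_def)
  thus ?thesis using d0 by simp
 qed
 define t0 where "t0 = min (min t1 t2) (ka0/Cs)"
 have t0: "t0 > 0" "t0 <= 1" using Cs t2 ka0 by(auto simp: t0_def)
 have main: "norm (pd 1 (%ze. tmi t k (coord c' (f ze))) 0) <= 2*exp ((56/(si^2*e)*N+5)/2)"
  if t: "0 < t" "t <= t0" and f: "J_holomorphic_disc A J f" "f ` DD <= D" "f 0 : chart_dom c'" and w0: "norm (tmi t k (coord c' (f 0))) <= si" for t f proof -
  have tt: "t <= t1" "t <= t2" "Cs*t <= ka0" "0 <= Cs*t" using t Cs by(auto simp: t0_def field_simps)
  note sct = sc[rule_format (no_asm), OF conjI[OF t(1) tt(1)]]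
  have bR: "w : ball 0 Rb" if "w : obx L Y" for w using that cbR box_facts(4) by blast
  define G where "G ze = tmi t k (coord c' (f ze))" for ze
  define S1 where "S1 = {ze : DD. f ze : chart_dom c'}"
  \<comment> \<open>For small \<open>t\<close> this contains every point of the rescaled domain in
    the closed box with Phi >= ap, and by \<open>edge\<close> it lies in the open box. Its image
    \<open>Q\<close> in the manifold is compact, hence closed, so \<open>O2\<close> is open.\<close>
  define K where "K = cbx L Y Int ({w. ap <= Phi p et e w} Int {w. Re (snd w)+hpoly k a (fst w) <= ka'})"
  define Q where "Q = coord_inv c' ` tm t k ` K"
  define O1 where "O1 = S1 Int G -` obx L Y"
  define O2 where "O2 = DD Int f -` (- Q)"
  note dc = disc_in_chart[OF acm c'(1) f(1), folded S1_def]
  have sG: "sm G S1" using sm_lin[OF bl_tm(2)[of t k] dc(1,2)] by(simp add: G_def[abs_def])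
  have tmG: "tm t k (G ze) = coord c' (f ze)" for ze unfolding G_def by(rule tm_inverse(2)[OF t(1)])
  have K_box: "K <= obx L Y" using edge by(auto simp: K_def)
  have tmK: "tm t k w : ?W" if "w : obx L Y" for w using sct bR[OF that] c'(4) by blast
  have hp: "continuous_on UNIV (%w::C2. hpoly k a (fst w))" by(rule cont_comp[OF continuous_hpoly[of UNIV k a] continuous_on_fst[OF continuous_on_id]]) simp
  have "closed ({w. ap <= Phi p et e w} Int {w. Re (snd w)+hpoly k a (fst w) <= ka'})"
   by(intro closed_Int closed_Collect_le Phi_continuous continuous_on_const continuous_on_add hp continuous_on_Re continuous_on_snd continuous_on_id)
  hence cK: "compact K" unfolding K_def by(rule compact_Int_closed[OF box_facts(3)])
  have "continuous_on K (tm t k)" by(rule linear_continuous_on[OF bl_tm(1)])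
  from compact_continuous_image[OF this cK] have "compact (tm t k ` K)" .
  moreover have "tm t k ` K <= ?W" using tmK K_box by blast
  ultimately have "compact Q" unfolding Q_def by(intro compact_continuous_image[OF cont_sub[OF cf'(4)]])
  hence cQ: "closed Q" by(rule compact_imp_closed)
  have cf: "continuous_on (DD) f" using f(1) by(simp add: J_holomorphic_disc_def)
  have O: "open O1" "open O2" unfolding O1_def O2_def by(rule continuous_open_preimage[OF sm_cont[OF sG] dc(1) box_facts(1)]
    continuous_open_preimage[OF cf open_ball] open_Compl cQ)+
  have O12: "O1 Un O2 = DD" proof(intro equalityI subsetI)
   fix ze :: complex assume z: "ze : DD"
   show "ze : O1 Un O2" proof(cases "f ze : Q")
    case True
    then obtain w where w: "w : K" "f ze = coord_inv c' (tm t k w)" by(auto simp: Q_def)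
    have wW: "tm t k w : ?W" using tmK K_box w(1) by blast
    have "f ze : chart_dom c'" unfolding w(2) by(rule cf'(7)[OF wW])
    moreover have "G ze = w" unfolding G_def w(2) cf'(6)[OF wW] by(rule tm_inverse(1)[OF t(1)])
    ultimately show ?thesis using z w(1) K_box by(auto simp: O1_def S1_def)
   qed (use z in \<open>simp add: O2_def\<close>)
  qed (auto simp: O1_def O2_def S1_def)
  have O1S: "ze : S1" "ze : DD" "f ze : chart_dom c'" "G ze : obx L Y" if "ze : O1" for ze using that by(auto simp: O1_def S1_def)
  have pdG: "pd h G ze = tmi t k (pd h (coord c' o f) ze)" if "ze : O1" for h ze
   using pd_lin[OF bl_tm(2)[of t k] sm_dif[OF dc(2) O1S(1)[OF that]]] by(simp add: G_def[abs_def])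
  have G_J: "pd \<i> G ze = Js t (G ze) (pd 1 G ze)" if "ze : O1" for ze
   unfolding Js_def tmG pdG[OF that] tm_inverse(2)[OF t(1)] using dc(3)[OF O1S(2,3)[OF that], of 1] by simp
  \<comment> \<open>A disc point in the box with Phi > ap would belong to \<open>K\<close>, as
    \<open>r\<close> is negative on the domain, and then its image would lie in \<open>Q\<close>,
    which \<open>O2\<close> excludes.\<close>
  have small: "Phi p et e (G ze) <= ap" if "ze : O1" "ze : O2" for ze proof(rule ccontr)
   assume "~Phi p et e (G ze) <= ap"
   hence big: "ap <= Phi p et e (G ze)" by simp
   note z = O1S[OF that(1)]
   have eq: "coord_inv c' (tm t k (G ze)) = f ze" unfolding tmG by(rule cf'(5)[OF z(3)])
   have cb: "G ze : cbx L Y" using z(4) box_facts(4) by blast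
   have "r (U (fst (tm t k (G ze)))+(0, snd (tm t k (G ze)))) = rh (f ze)" unfolding in_chart_def o_def c'(5)[OF tmK[OF z(4)], symmetric] eq ..
   moreover have "rh (f ze) < 0" using f(2) z(2) D_eq by blast
   moreover have "norm (G ze) <= Rb" using bR[OF z(4)] by simp
   ultimately have "t^k*(Re (snd (G ze))+hpoly k a (fst (G ze))) <= t^k*ka'" using df[OF t(1) tt(2), of "G ze"] by(simp add: abs_le_iff mult.commute)
   hence "Re (snd (G ze))+hpoly k a (fst (G ze)) <= ka'" using t(1) by(simp only: mult_le_cancel_left_pos zero_less_power)
   hence "G ze : K" using cb big by(simp add: K_def)
   hence "f ze : Q" unfolding Q_def using eq by(metis imageI)
   thus False using that(2) by(simp add: O2_def)
  qed
  have nw0: "norm (G 0) <= si" using w0 by(simp add: G_def)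
  have G0: "G 0 : obx L Y" using near(1)[of "G 0"] nw0 const(3) by simp
  have gt: "Phi p et e w > ap" if "norm (w-G 0) <= 2 * si" for w using near(2)[of w] norm_triangle_ineq2[of w "G 0"] nw0 that by linarith
  have "sibony p et e M Rb N ap si (Cs*t) (obx L Y) (Js t) (G 0) G O1 O2" proof(rule sibony.intro)
   show "Cs*t*?d <= e" by(rule kae[OF tt(4,3)])
   show "Cs*t <= 1/1152" using tt ka0 by linarith
   show "norm w <= Rb" if "w : obx L Y" for w using bR[OF that] by simp
   show "sm (%w. Js t w v) (obx L Y)" for v using sct sm_subset bR by(metis subsetI)
   show "linear (Js t w)" if "w : obx L Y" for w using sct bR[OF that] by blast
   show "0 : O1" using f(3) G0 by(simp add: O1_def S1_def)
   show "sm G O1" by(rule sm_subset[OF sG]) (simp add: O1_def)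
   show "open O1" "open O2" "O1 Un O2 = DD" by(fact O O12)+
  qed (use const tt(4) bd sct bR box_facts(1,2) G0 gt O1S(4) G_J small in \<open>auto\<close>)
  from sibony.derivative_bound[OF this] show ?thesis unfolding sibony.La_def[OF `sibony _ _ _ _ _ _ _ _ _ _ _ _ _ _ _`] G_def[abs_def] .
 qed
 show ?thesis by(rule exI[of _ si], rule conjI[OF const(3)], rule exI[of _ "2*exp ((56/(si^2*e)*N+5)/2)"], rule conjI, simp,
    rule exI[of _ t0], intro conjI allI impI t0) (rule main)
qed

text \<open>Back in the original coordinates a tangential velocity of order t also moves the normal
  component, through the derivative of snd U. That derivative is of the order of the distance to the
  origin, which accounts for the first summand of the second bound.\<close>

lemma (in boundary_point) disc_derivative_transfer:
 assumes U: "chart_disc U" and st: "straight U c' R Cst" and M: "!!ze h. norm ze <= 1/2 ==> norm (pd h U ze) <= M*norm h"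
   "!!ze h. norm ze <= 1/2 ==> norm (snd (pd h U ze)) <= M*norm ze*norm h" "0 <= M" and f: "J_holomorphic_disc A J f" "f 0 : chart_dom c'" "norm (coord c' (f 0)) <= 1/2"
  and t: "0 < t" and G: "norm (pd 1 (%ze. tmi t k (coord c' (f ze))) 0) <= C" shows "norm (fst (pd 1 (coord c o f) 0)) <= M*(t*C)"
  "norm (snd (pd 1 (coord c o f) 0)) <= M*norm (coord c' (f 0))*(t*C)+t^k*C"
proof -
 note c' = straightD[OF st]
 define S1 where "S1 = {ze : DD. f ze : chart_dom c'}"
 note dc = disc_in_chart[OF acm c'(1) f(1), folded S1_def]
 let ?F = "coord c' o f"
 have S0: "0 : S1" using f(2) by(simp add: S1_def)
 have dF: "?F differentiable (at 0)" by(rule sm_dif[OF dc(2) S0])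
 have F0: "norm (fst (?F 0)) <= norm (?F 0)" using norm_fst_le[of "fst (?F 0)" "snd (?F 0)"] by(simp del: norm_Pair)
 hence F12: "norm (fst (?F 0)) <= 1/2" using f(3) by simp
 have dU: "U differentiable (at (fst (?F 0)))" by(rule sm_dif[OF chart_discD(1)[OF U]]) (use F12 in auto)
 define g where "g = pd 1 (%ze. tmi t k (coord c' (f ze))) 0"
 have "g = tmi t k (pd 1 ?F 0)" using pd_lin[OF bl_tm(2)[of t k] dF] by(simp add: g_def)
 hence F: "pd 1 ?F 0 = tm t k g" using tm_inverse(2)[OF t] by simp
 have gC: "norm (fst g) <= C" "norm (snd g) <= C"
  using G norm_fst_le[of "fst g" "snd g"] norm_snd_le[of "snd g" "fst g"] unfolding g_def[symmetric] by(simp_all del: norm_Pair)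
 have "pd 1 (coord c o f) 0 = pd 1 (%ze. U (fst (?F ze))+(0, snd (?F ze))) 0" by(rule pd_cong[OF dc(1) _ S0]) (use c'(6) in \<open>simp add: S1_def\<close>)
 also have "... = pd (fst (pd 1 ?F 0)) U (fst (?F 0))+(0, snd (pd 1 ?F 0))"
  by(rule pd_eq[OF has_derivative_add[OF deriv_comp[OF has_derivative_fst[OF hd_pd[OF dF]] hd_pd[OF dU]]
   has_derivative_Pair[OF has_derivative_const has_derivative_snd[OF hd_pd[OF dF]]]]])
 finally have e: "pd 1 (coord c o f) 0 = pd (t*.fst g) U (fst (?F 0))+(0, t^k*.snd g)" unfolding F tm_def by simp
 have tg: "norm (t*.fst g) <= t*C" using gC t by simp
 let ?P = "pd (t*.fst g) U (fst (?F 0))"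
 have "norm (fst ?P) <= norm ?P" using norm_fst_le[of "fst ?P" "snd ?P"] by(simp del: norm_Pair)
 also have "... <= M*norm (t*.fst g)" by(rule M(1)[OF F12])
 also have "... <= M*(t*C)" by(rule mono_l[OF tg M(3)])
 finally show "norm (fst (pd 1 (coord c o f) 0)) <= M*(t*C)" unfolding e by simp
 have "norm (snd ?P) <= M*norm (fst (?F 0))*norm (t*.fst g)" by(rule M(2)[OF F12])
 also have "... <= M*norm (?F 0)*(t*C)" by(intro mult_mono mono_l F0 tg M(3) mult_nonneg_nonneg norm_ge_zero)
 finally have 1: "norm (snd ?P) <= M*norm (?F 0)*(t*C)" .
 have 2: "norm (t^k*.snd g) <= t^k*C" using gC t by simp
 show "norm (snd (pd 1 (coord c o f) 0)) <= M*norm (coord c' (f 0))*(t*C)+t^k*C" unfolding e using tri_ineq[of "snd ?P" "t^k*.snd g"] 1 2 by simp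
qed

text \<open>Passes from the contact order \<open>k\<close> to 2m: for de <= 1 the exponent 1/k gives
  the smaller power, and B >= 1 dominates its own root.\<close>

lemma root_le_powr:
 fixes de B :: real
 assumes "0 < de" "de <= 1" "1 <= B" "1 <= k" "k <= n" shows "root k (B*de) <= B*de powr (1/real n)"
proof -
 have "root k (B*de) = B powr (1/real k)*de powr (1/real k)" using assms by(simp add: root_powr_inverse powr_mult)
 also have "... <= B powr 1*de powr (1/real n)" by(intro mult_mono powr_mono powr_mono') (use assms in \<open>auto simp: frac_le\<close>)
 finally show ?thesis using assms by simp
qed

text \<open>In the cone |z| is comparable to |rho|. With t^k = B |rho| the rescaled point comes
  within \<open>si\<close> of the origin, so every disc in D through p has a bounded rescaled
  derivative. Undoing the dilation gives t for the tangential and t^k for the normal part; the shear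
  adds a term of order |z| t to the normal part, which is harmless because |z| is O(|rho|).\<close>

theorem (in boundary_point) kobayashi_estimate:
 assumes m: "m >= 1" and kc: "0 < kc" shows "? V. open V & q : V & boundary_cone c kc Int V <= D & (EX C>0. ! p : D Int (boundary_cone c kc Int V). ! v.
    kobayashi A J D c p v >= ereal (C*(norm (tangential_part v)/abs (rh p) powr (1/(2*real m))+norm (normal_part v)/abs (rh p))))"
proof -
 from good_disc obtain U k a pl where U: "chart_disc U" and k: "2 <= k" "k <= 2*m" and
  circ: "! og. norm og = 1 --> hpoly k a og = Re (poly pl og)" and pos: "Re (coeff pl 0) > 0" and
  con: "(%ze. r (U ze)-hpoly k a ze) : o[at 0](%ze. norm ze^k)" by(elim exE conjE) (rule that; assumption)
 have k1: "1 <= k" using k by simp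
 from straightened_chart[OF U] obtain c' R C where st: "straight U c' R C" by blast
 note c' = straightD[OF st]
 obtain si C3 t0 where si: "si > 0" "C3 > 0" "t0 > 0" "t0 <= 1" and
  est: "! t f. 0 < t --> t <= t0 --> J_holomorphic_disc A J f --> f ` DD <= D --> f 0 : chart_dom c' -->
   norm (tmi t k (coord c' (f 0))) <= si --> norm (pd 1 (%ze. tmi t k (coord c' (f ze))) 0) <= C3"
  using scaled_disc_estimate[OF U k1 circ pos con st] by(elim exE conjE) (rule that; assumption)
 from disc_derivative_bounds[OF U] obtain Mu where Mu: "Mu > 0" "!!ze h. norm ze <= 1/2 ==> norm (pd h U ze) <= Mu*norm h"
  "!!ze h. norm ze <= 1/2 ==> norm (snd (pd h U ze)) <= Mu*norm ze*norm h" by(elim exE conjE) (rule that; blast)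
 from r_quadratic obtain Cq Rq where Cq: "Cq > 0" "Rq > 0" "!!z. norm z < Rq ==> abs (r z-Re (snd z)) <= Cq*norm z^2" by blast
 \<comment> \<open>Near q the quadratic error of \<open>r\<close> takes away at most half of the
   cone condition, so r < -(kc/2) |z| and hence |z| <= C2 |rho|.\<close>
 define C2 where "C2 = 2/kc"
 have C2: "C2 > 0" using kc by(simp add: C2_def)
 \<comment> \<open>The factor 2 is for the two components of the rescaled point, both divided by t^k
   at worst; the + 1 gives B >= 1, which \<open>root_le_powr\<close> needs.\<close>
 define B where "B = 2*C*C2/si+1"
 have B: "B >= 1" "2*C*C2 <= si*B" using c'(3) C2 si by(simp_all add: B_def field_simps)
 \<comment> \<open>In this order: the straightened chart and the quadratic expansion of
   \<open>r\<close> apply, the quadratic error is at most half of the cone term, the new coordinates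
   are at most 1/2, t <= t0, and |rho| <= 1.\<close>
 define d where "d = min (min R Rq) (min (min (kc/(2*Cq)) (1/(2*C))) (min (t0^k/(B*(1+Cq))) (1/(1+Cq))))"
 have "d > 0" using c'(2,3) Cq kc si B(1) by(simp add: d_def)
 have "d <= kc/(2*Cq)" "d <= 1/(2*C)" "d <= t0^k/(B*(1+Cq))" "d <= 1/(1+Cq)" by(simp_all add: d_def)
 moreover have "0 < 2*Cq" "0 < 2*C" "0 < B*(1+Cq)" "0 < 1+Cq" using c'(3) Cq(1) B(1) by simp_all
 ultimately have d: "d*(2*Cq) <= kc" "d*(2*C) <= 1" "d*(B*(1+Cq)) <= t0^k" "d*(1+Cq) <= 1" by(simp_all only: pos_le_divide_eq)
 have "d <= R" "d <= Rq" by(simp_all add: d_def)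
 with d have d: "d <= R" "d <= Rq" "Cq*d <= kc/2" "C*d <= 1/2" "B*((1+Cq)*d) <= t0^k" "(1+Cq)*d <= 1" by(simp_all only: mult_ac)
 have d1: "d <= 1" using d(6) mult_pos_pos[OF Cq(1) `d > 0`] unfolding distrib_right by linarith
 define V where "V = (chart_dom c Int coord c -` ball 0 d) Int W"
 have "open V" unfolding V_def by(intro open_Int continuous_open_preimage cf(1,3) open_ball W(1))
 moreover have "q : V" using c X(2) `d > 0` q W(2) by(auto simp: V_def frontier_def)
 moreover have cone: "- (kc/2)*norm (coord c p) > r (coord c p)" "p : D" "norm (coord c p) < d" "p : chart_dom c"
  "0 < abs (rh p)" "norm (coord c p) <= C2*abs (rh p)" "abs (rh p) <= (1+Cq)*norm (coord c p)"
  if "p : boundary_cone c kc Int V" for p proof -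
  let ?z = "coord c p"
  have p: "p : chart_dom c" "p : W" "norm ?z < d" "- Re (snd ?z) > kc*norm ?z" using that by(auto simp: boundary_cone_def V_def)
  have rh: "rh p = r ?z" by(simp add: in_chart_def cf(5)[OF p(1)])
  have q1: "abs (r ?z-Re (snd ?z)) <= Cq*norm ?z^2" by(rule Cq(3)) (use p(3) d(2) in simp)
  have "Cq*norm ?z <= Cq*d" using p(3) Cq(1) by simp
  hence "Cq*norm ?z*norm ?z <= kc/2*norm ?z" using d(3) by(intro mono_r) auto
  hence q2: "Cq*norm ?z^2 <= kc/2*norm ?z" by(simp add: sq_eq mult.assoc)
  have z: "0 < norm ?z" using p(4) by(cases "?z = 0") auto
  hence kz: "0 < kc*norm ?z" using kc by simp
  show 1: "- (kc/2)*norm ?z > r ?z" using q1 q2 p(4) by(simp add: abs_le_iff)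
  hence neg: "rh p < 0" using kz rh by simp
  thus "p : D" using D_eq p(2) by simp
  show "norm ?z < d" "p : chart_dom c" "0 < abs (rh p)" using p neg by auto
  have "kc*norm ?z <= 2*abs (rh p)" using 1 neg unfolding rh[symmetric] by simp
  thus "norm ?z <= C2*abs (rh p)" using kc by(simp add: C2_def field_simps)
  have "norm ?z^2 <= norm ?z" using z p(3) d1 by(simp add: sq_eq mult_left_le)
  hence "Cq*norm ?z^2 <= Cq*norm ?z" using Cq(1) by simp
  moreover have "abs (Re (snd ?z)) <= norm ?z" using abs_Re_le_cmod[of "snd ?z"] norm_snd_le[of "snd ?z" "fst ?z"] by(simp del: norm_Pair)
  ultimately show "abs (rh p) <= (1+Cq)*norm ?z" using q1 unfolding rh by(simp add: algebra_simps)
 qed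
 moreover define C6 where "C6 = Mu*C3*B+(Mu*C*C2*C3+B*C3)"
 have C6: "C6 > 0" unfolding C6_def using Mu(1) c'(3) C2 si B(1) by(intro add_pos_pos mult_pos_pos) auto
 have "kobayashi A J D c p v >= ereal (1/C6*(norm (tangential_part v)/abs (rh p) powr (1/(2*real m))+norm (normal_part v)/abs (rh p)))"
  if p: "p : boundary_cone c kc Int V" for p v proof -
  define de where "de = abs (rh p)"
  note cn = cone(3-7)[OF p, folded de_def]
  define z where "z = norm (coord c p)"
  note cz = cn[folded z_def]
  have pc: "p : chart_dom c'" "norm (coord c' p) <= C*z" using c'(7)[OF cn(2)] cn(1) d(1) by(simp_all add: z_def)
  have "(1+Cq)*z <= (1+Cq)*d" using cz(1) Cq(1) by(intro mono_l) auto
  hence de: "0 < de" "de <= (1+Cq)*d" "de <= 1" using cz d(6) by linarith+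
  define t where "t = root k (B*de)"
  have Bde: "0 < B*de" using B de by simp
  have t: "0 < t" "t^k = B*de" using Bde k1 by(simp_all add: t_def)
  have "B*de <= t0^k" by(rule order_trans[OF mono_l[OF de(2)] d(5)]) (use B in simp)
  hence tt0: "t <= t0" using t si k1 power_le_imp_le_base[of t "k-1" t0] by simp
  hence t1: "t <= 1" using si by simp
  have tk: "t^k <= t" using power_decreasing[of 1 k t] k1 t t1 by simp
  have Cz: "C*z <= C*C2*de" using cz(4) c'(3) by(simp add: mult.assoc)
  have "C*z <= C*d" using cz(1) c'(3) by simp
  hence half: "norm (coord c' p) <= 1/2" using pc(2) d(4) by linarith
  have "norm (tmi t k (coord c' p)) <= norm (fst (coord c' p))/t+norm (snd (coord c' p))/t^k" by(rule norm_tm(2)[OF t(1) t1 k1])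
  also have "... <= norm (coord c' p)/t^k+norm (coord c' p)/t^k"
   using norm_fst_le[of "fst (coord c' p)" "snd (coord c' p)"] norm_snd_le[of "snd (coord c' p)" "fst (coord c' p)"] t(1) tk
   by(intro add_mono frac_le) (simp_all del: norm_Pair)
  also have "... = 2*norm (coord c' p)/(B*de)" by(simp add: t(2))
  also have "... <= si*(B*de)/(B*de)" proof(rule divide_right_mono)
   have "2*norm (coord c' p) <= 2*C*C2*de" using pc(2) Cz by linarith
   also have "... <= si*B*de" by(rule mono_r[OF B(2)]) (use de in simp)
   finally show "2*norm (coord c' p) <= si*(B*de)" by simp
  qed (use Bde in simp)
  finally have w0: "norm (tmi t k (coord c' p)) <= si" by(simp only: nonzero_mult_div_cancel_right[OF less_imp_neq[OF Bde, symmetric]])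
  \<comment> \<open>Every competing disc with derivative R0 v satisfies R0 times the bracket <= C6,
    where the first summand of \<open>C6\<close> belongs to the tangential and the second to the
    normal part. The bound passes to the infimum.\<close>
  have "1/C6*(norm (tangential_part v)/de powr (1/(2*real m))+norm (normal_part v)/de) <= 1/R0"
   if R0: "1/R0 > 0" and f: "J_holomorphic_disc A J f" "f ` DD <= D" "f 0 = p" and fv: "frechet_derivative (coord c o f) (at 0) 1 = R0*.v" for R0 f proof -
   have R0: "R0 > 0" using R0 by simp
   have pv: "pd 1 (coord c o f) 0 = R0*.v" using fv by(simp add: pd_def)
   have f0: "f 0 : chart_dom c'" "norm (coord c' (f 0)) <= 1/2" "norm (tmi t k (coord c' (f 0))) <= si" unfolding f(3) by(rule pc(1) half w0)+
   have G: "norm (pd 1 (%ze. tmi t k (coord c' (f ze))) 0) <= C3" by(rule est[rule_format, OF t(1) tt0 f(1,2) f0(1,3)])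
   note tr = disc_derivative_transfer[OF U st Mu(2,3) less_imp_le[OF Mu(1)] f(1) f0(1,2) t(1) G, unfolded pv f(3)]
   define s where "s = de powr (1/(2*real m))"
   have s: "s > 0" "t <= B * s" using de root_le_powr[OF de(1,3) B(1) k1 k(2)] by(simp_all add: s_def t_def)
   have "R0*norm (fst v) <= Mu*(t*C3)" using tr(1) R0 by simp
   also have "... <= Mu*(B * s*C3)" by(intro mono_l mono_r s) (use Mu si in auto)
   finally have a: "R0*norm (fst v)/s <= Mu*C3*B" using s by(simp add: field_simps)
   have "R0*norm (snd v) <= Mu*norm (coord c' p)*(t*C3)+t^k*C3" using tr(2) R0 by simp
   also have "... <= Mu*(C*C2*de)*(1*C3)+B*de*C3"
    unfolding t(2) by(intro add_mono mult_mono mono_l order_refl order_trans[OF pc(2) Cz] t1 mult_nonneg_nonneg norm_ge_zero) (use Mu si t c'(3) C2 de in auto)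
   also have "... = (Mu*C*C2*C3+B*C3)*de" by(simp add: algebra_simps)
   finally have b: "R0*norm (snd v)/de <= Mu*C*C2*C3+B*C3" using de by(simp add: divide_le_eq)
   have "R0*(norm (fst v)/s+norm (snd v)/de) <= C6" using a b by(simp add: C6_def distrib_left)
   thus ?thesis unfolding s_def[symmetric] tangential_part_def normal_part_def using C6 R0 by(simp add: field_simps)
  qed
  thus ?thesis unfolding kobayashi_def de_def by(intro Inf_greatest) (auto simp del: times_divide_eq_left)
 qed
 ultimately show ?thesis using C6 by(intro exI[of _ V] conjI exI[of _ "1/C6"]) auto
qed

theorem theoremC:
  fixes A :: "('a::{t2_space, second_countable_topology}) chart set"
    and J :: "'a tensor11" and D W :: "'a set" and \<rho> :: "'a \<Rightarrow> real"
    and q :: 'a and m :: nat and c :: "'a chart" and k :: real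
  assumes "almost_complex_manifold A J"
    and "open D" and "connected D"
    and "open W" and "closure D \<subseteq> W"
    and "C2_defining_function A W \<rho> D"
    and "J_plurisubharmonic_on A J \<rho> W"
    and "finite_dangelo_type A J \<rho> D"
    and "q \<in> frontier D" and "m \<ge> 1" and "dangelo_type A J \<rho> q = ereal (2 * real m)"
    and "adapted_coordinates A J \<rho> q c"
    and "0 < k" and "k < 1"
  shows "\<exists>V. open V \<and> q \<in> V \<and> boundary_cone c k \<inter> V \<subseteq> D \<and>
    (\<exists>C>0. \<forall>p \<in> D \<inter> (boundary_cone c k \<inter> V). \<forall>v.
       kobayashi A J D c p v \<ge>
         ereal (C * (norm (tangential_part v) / \<bar>\<rho> p\<bar> powr (1 / (2 * real m))
                   + norm (normal_part v) / \<bar>\<rho> p\<bar>)))"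
proof -
 interpret boundary_point A J D W \<rho> q m c by(rule boundary_point.intro) (fact assms)+
 show ?thesis by(rule kobayashi_estimate) (fact assms)+
qed

end
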